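(* For any $s\in\mathbb R$ there exists $\epsilon_0=\epsilon_0(s)>0$ such that for any $(\alpha,\mu,\epsilon)\in\mathbb R\times\mathbb R\times B_{\epsilon_0}(0)$ the fiber Dirichlet–Neumann operator $\mathcal G(\alpha,\mu,\epsilon)$ maps $H^s(\mathbb T)\to H^{s-1}(\mathbb T)$ and decomposes as $$\mathcal G(\alpha,\mu,\epsilon)=|D|_{\alpha,\mu}+\mathcal G^\sharp(\alpha,\mu,\epsilon),$$ where: (1) $|D|_{\alpha,\mu}:=((D+\mu)^2+\alpha^2)^{1/2}:H^s(\mathbb T)\to H^{s-1}(\mathbb T)$; (2) $\mathcal G^\sharp(\alpha,\mu,\epsilon):H^s(\mathbb T)\to H^{s+1}(\mathbb T)$ is $1$-smoothing and satisfies, for any $\mu_0>0$ (with a constant $C_{s,\mu_0}$), $$\sup_{|\mu|\le\mu_0}\|\mathcal G^\sharp(\alpha,\mu,\epsilon)\|_{\mathcal L(H^s,H^{s+1})}\le C_{s,\mu_0}\alpha^2|\epsilon|,\qquad \sup_{|\mu|\le\mu_0}\|\mathcal G^\sharp(\alpha,\mu,\epsilon)\|_{\mathcal L(H^s,H^s)}\le C_{s,\mu_0}|\alpha||\epsilon|;$$ (3) $(\alpha^2\epsilon)^{-1}\mathcal G^\sharp(\alpha,\mu,\epsilon)\in\mathcal A(\mathbb R\times\mathbb R,\epsilon_0;H^s(\mathbb T),H^{s+1}(\mathbb T))$ and $\mathcal G(\alpha,\mu,\epsilon)\in\mathcal A(\mathbb R\times\mathbb R,\epsilon_0;H^s(\mathbb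 T),H^{s-1}(\mathbb T))$; moreover $\mathcal G^\sharp(\alpha,\mu,\epsilon)$ and $\mathcal G(\alpha,\mu,\epsilon)$ belong to $\mathtt F$.
   Context: Notation: $\mathbb T=\mathbb R/2\pi\mathbb Z$, $D=-i\partial_x$, $B_r(\cdot)$ closed balls, $\mathcal L(Y,Z)$ bounded linear operators. Stokes waves. For a $2\pi$-periodic $\eta(x)$ put $G(\eta)\psi:=(\Phi_z-\eta_x\Phi_x)|_{z=\eta(x)}$, where $\Phi$ is harmonic in $\{z<\eta(x)\}$, $\Phi|_{z=\eta(x)}=\psi$, $\Phi_z\to0$ as $z\to-\infty$. For $|\epsilon|$ small, $(\eta_\epsilon(x),\psi_\epsilon(x),c_\epsilon)$ is the unique family, analytic in $\epsilon$, of $2\pi$-periodic solutions ($\eta_\epsilon$ even, $\psi_\epsilon$ odd) of $c\eta_x+G(\eta)\psi=0$, $c\psi_x-\eta-\frac{\psi_x^2}2+\frac{(G(\eta)\psi+\eta_x\psi_x)^2}{2(1+\eta_x^2)}=0$ with $\eta_\epsilon=\epsilon\cos x+\frac{\epsilon^2}2\cos2x+O(\epsilon^3)$, $\psi_\epsilon=\epsilon\sin x+\frac{\epsilon^2}2\sin2x+O(\epsilon^3)$, $c_\epsilon=1+\frac{\epsilon^2}2+O(\epsilon^3)$ (analytic in $\epsilon$ with values in spaces of functions analytic in $x$). Conformal flattening. $\mathfrak p_\epsilon(x)=\sum_k\mathfrak p_ke^{ikx}$ is the small, odd, $2\pi$-periodic function, analytic in $\epsilon$, solving $\mathfrak p=\mathcal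 H[\eta_\epsilon\circ(\mathrm{Id}+\mathfrak p)]$, $\mathcal H=-i\,\mathrm{sgn}(D)$. Let $U(x,z)=x+\sum_{k\ne0}\mathfrak p_ke^{|k|z}e^{ikx}$ and $d_\epsilon(x,z)=U_x^2+U_z^2-1$ for $z\le0$. Fiber Dirichlet–Neumann operator. $\mathcal G(\alpha,\mu,\epsilon)[g](x):=\partial_z\Theta_g(x,z)|_{z=0}$, where $\Theta_g$ is the unique solution on $\mathbb T\times(-\infty,0)$ of $\partial_z^2\Theta+(\partial_x+i\mu)^2\Theta-\alpha^2(1+d_\epsilon(x,z))\Theta=0$, $\Theta|_{z=0}=g$, $\partial_z\Theta\to0$ as $z\to-\infty$. Class $\mathcal A(\Omega,\epsilon_0;X)$ ($X$ Banach, $\Omega\subset\mathbb R^2$): functions $A:\Omega\times B_{\epsilon_0}(0)\to X$ such that (1) for each $(\alpha,\mu)\in\Omega$, $\epsilon\mapsto A(\alpha,\mu,\epsilon)$ is (real) analytic; (2) for each $\epsilon$, $(\alpha,\mu)\mapsto A(\alpha,\mu,\epsilon)$ is analytic on $\Omega\setminus(\{0\}\times\mathbb Z)$, and there is $r>0$ such that for each $j\in\mathbb Z$, $(\alpha,\mu)\in B_r(0,j)\cap\Omega$ and $\epsilon\in B_{\epsilon_0}(0)$, $A=A^{[\mathrm I]}(\alpha^2,\mu,\epsilon)+(\alpha^2+(\mu-j)^2)^{1/2}A^{[\mathrm{II}]}(\alpha^2,\mu,\epsilon)$ with $(\beta,\mu,\epsilon)\mapsto A^{[\mathrm I]},A^{[\mathrm{II}]}(\beta,\mu,\epsilon)$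 analytic on $B_{r^2}(0)\times B_r(j)\times B_{\epsilon_0}(0)$. For $X=\mathcal L(Y,Z)$ one writes $\mathcal A(\Omega,\epsilon_0;Y,Z)$. Class $\mathtt F$. For a linear operator $A$ on functions on $\mathbb T$ with matrix $A^{k_1}_{k_2}=(Ae^{ik_1x},e^{ik_2x})_{L^2}$, its $\kappa$-band $A^{[\kappa]}$ is the operator $A^{[\kappa]}e^{ijx}=A^{j}_{j+\kappa}e^{i(j+\kappa)x}$. $\mathfrak F_\ell$ ($\ell\in\mathbb N_0$) is the set of operators $B$ with $B^{[\kappa]}=0$ if $|\kappa|>\ell$ or $\kappa\not\equiv\ell$ mod $2$. $\mathtt F$ is the set of operators with a power series $A(\epsilon)=\sum_{\ell\ge0}A_\ell\epsilon^\ell$ with $A_\ell\in\mathfrak F_\ell$ for all $\ell$ (here for each fixed $(\alpha,\mu)$).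
   Formalization: The listed conditions fix the Stokes family only up to reparametrisation (ε→ε+ε⁴ keeps them but breaks membership in class F), so the symmetry (η,ψ,c) at −ε, x equals (η,ψ,c) at ε, x+π (c unchanged), which the asserted uniqueness would imply, is added as a hypothesis. *)

theory Defs
  imports "HOL-Analysis.Analysis"
begin

section \<open>Stokes waves\<close>

text \<open>
  Power series at \<open>0\<close> in the amplitude \<open>\<epsilon>\<close>, absolutely convergent for \<open>\<bar>\<epsilon>\<bar> \<le> e1\<close> in the Banach space
  of \<open>2\<pi>\<close>-periodic functions analytic in a strip, with norm \<open>\<Sum>k. \<bar>f\<^sub>k\<bar> exp (\<sigma> \<bar>k\<bar>)\<close>. For a family
  considered for small \<open>\<bar>\<epsilon>\<bar>\<close> only, this is analyticity in \<open>\<epsilon>\<close> with values in functions analytic in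
  \<open>x\<close>. Periodicity in \<open>x\<close> is implied by the Fourier expansion.
\<close>

definition analytic_family :: "real \<Rightarrow> (real \<Rightarrow> real \<Rightarrow> real) \<Rightarrow> bool" where
  "analytic_family e1 f \<longleftrightarrow>
     (\<exists>\<sigma>>0. \<exists>a :: nat \<Rightarrow> int \<Rightarrow> complex.
        (\<lambda>(l, k). cmod (a l k) * e1 ^ l * exp (\<sigma> * of_int \<bar>k\<bar>)) summable_on UNIV \<and>
        (\<forall>\<epsilon>\<in>cball 0 e1. \<forall>x.
           ((\<lambda>(l, k). a l k * of_real (\<epsilon> ^ l) * cis (of_int k * x)) has_sum of_real (f \<epsilon> x)) UNIV))"

text \<open>
  \<open>is_DN \<eta> \<psi> G\<close> says \<open>G = G(\<eta>)\<psi>\<close>. The potential is \<open>C\<^sup>2\<close> inside the fluid and \<open>C\<^sup>1\<close> up to the free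
  surface; \<open>\<Phi>x\<close>, \<open>\<Phi>z\<close> are its first and \<open>\<Phi>xx\<close>, \<open>\<Phi>xz\<close>, \<open>\<Phi>zz\<close> its second partial derivatives.
\<close>

definition is_DN :: "(real \<Rightarrow> real) \<Rightarrow> (real \<Rightarrow> real) \<Rightarrow> (real \<Rightarrow> real) \<Rightarrow> bool" where
  "is_DN \<eta> \<psi> G \<longleftrightarrow>
     (\<exists>(\<Phi> :: real \<times> real \<Rightarrow> real) \<Phi>x \<Phi>z \<Phi>xx \<Phi>xz \<Phi>zz.
        continuous_on {(x, z). z \<le> \<eta> x} \<Phi> \<and>
        continuous_on {(x, z). z \<le> \<eta> x} \<Phi>x \<and>
        continuous_on {(x, z). z \<le> \<eta> x} \<Phi>z \<and>
        continuous_on {(x, z). z < \<eta> x} \<Phi>xx \<and>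
        continuous_on {(x, z). z < \<eta> x} \<Phi>xz \<and>
        continuous_on {(x, z). z < \<eta> x} \<Phi>zz \<and>
        (\<forall>q\<in>{(x, z). z < \<eta> x}.
           (\<Phi> has_derivative (\<lambda>(h, k). \<Phi>x q * h + \<Phi>z q * k)) (at q) \<and>
           (\<Phi>x has_derivative (\<lambda>(h, k). \<Phi>xx q * h + \<Phi>xz q * k)) (at q) \<and>
           (\<Phi>z has_derivative (\<lambda>(h, k). \<Phi>xz q * h + \<Phi>zz q * k)) (at q) \<and>
           \<Phi>xx q + \<Phi>zz q = 0) \<and>
        (\<forall>x z. z \<le> \<eta> x \<longrightarrow> \<Phi> (x + 2 * pi, z) = \<Phi> (x, z)) \<and>
        (\<forall>x. \<Phi> (x, \<eta> x) = \<psi> x) \<and>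
        uniform_limit UNIV (\<lambda>z x. \<Phi>z (x, z)) (\<lambda>_. 0) at_bot \<and>
        (\<forall>x. G x = \<Phi>z (x, \<eta> x) - deriv \<eta> x * \<Phi>x (x, \<eta> x)))"

text \<open>
  The equations and the displayed expansions determine the family only up to a reparametrisation
  \<open>\<epsilon> \<mapsto> \<epsilon> + O(\<epsilon>\<^sup>3)\<close>. The symmetry \<open>\<epsilon> \<mapsto> -\<epsilon>\<close>, \<open>x \<mapsto> x + \<pi>\<close> preserves all of them, hence is shared by a
  family that is unique; it is the part of that uniqueness which singles out the parametrisations whose
  Taylor coefficient of order \<open>l\<close> has only harmonics congruent to \<open>l\<close> modulo \<open>2\<close>.
\<close>

definition stokes_family ::
  "real \<Rightarrow> (real \<Rightarrow> real \<Rightarrow> real) \<Rightarrow> (real \<Rightarrow> real \<Rightarrow> real) \<Rightarrow> (real \<Rightarrow> real) \<Rightarrow> bool" where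
  "stokes_family e1 \<eta> \<psi> c \<longleftrightarrow>
     analytic_family e1 \<eta> \<and> analytic_family e1 \<psi> \<and>
     (\<exists>a. \<forall>\<epsilon>\<in>cball 0 e1. (\<lambda>n. a n * \<epsilon> ^ n) sums c \<epsilon>) \<and>
     (\<forall>\<epsilon>\<in>cball 0 e1. \<forall>x. \<eta> \<epsilon> (- x) = \<eta> \<epsilon> x \<and> \<psi> \<epsilon> (- x) = - \<psi> \<epsilon> x) \<and>
     (\<forall>\<epsilon>\<in>cball 0 e1. \<exists>G. is_DN (\<eta> \<epsilon>) (\<psi> \<epsilon>) G \<and>
        (\<forall>x. c \<epsilon> * deriv (\<eta> \<epsilon>) x + G x = 0 \<and>
             c \<epsilon> * deriv (\<psi> \<epsilon>) x - \<eta> \<epsilon> x - (deriv (\<psi> \<epsilon>) x)\<^sup>2 / 2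
               + (G x + deriv (\<eta> \<epsilon>) x * deriv (\<psi> \<epsilon>) x)\<^sup>2 / (2 * (1 + (deriv (\<eta> \<epsilon>) x)\<^sup>2)) = 0)) \<and>
     (\<exists>C. \<forall>\<epsilon>\<in>cball 0 e1. \<forall>x.
        \<bar>\<eta> \<epsilon> x - (\<epsilon> * cos x + \<epsilon>\<^sup>2 / 2 * cos (2 * x))\<bar> \<le> C * \<bar>\<epsilon>\<bar> ^ 3 \<and>
        \<bar>\<psi> \<epsilon> x - (\<epsilon> * sin x + \<epsilon>\<^sup>2 / 2 * sin (2 * x))\<bar> \<le> C * \<bar>\<epsilon>\<bar> ^ 3 \<and>
        \<bar>c \<epsilon> - (1 + \<epsilon>\<^sup>2 / 2)\<bar> \<le> C * \<bar>\<epsilon>\<bar> ^ 3) \<and>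
     (\<forall>\<epsilon>\<in>cball 0 e1. \<forall>x.
        \<eta> (- \<epsilon>) x = \<eta> \<epsilon> (x + pi) \<and> \<psi> (- \<epsilon>) x = \<psi> \<epsilon> (x + pi) \<and> c (- \<epsilon>) = c \<epsilon>)"

section \<open>Conformal flattening\<close>

definition fcoeff :: "(real \<Rightarrow> real) \<Rightarrow> int \<Rightarrow> complex" where
  "fcoeff f k = integral {0..2 * pi} (\<lambda>x. of_real (f x) * cis (- (of_int k * x))) / of_real (2 * pi)"

text \<open>The equation \<open>p = H[\<eta> \<circ> (Id + p)]\<close> is written on Fourier coefficients, where \<open>H = -i sgn(D)\<close> is diagonal.\<close>

definition conformal_flattening ::
  "real \<Rightarrow> (real \<Rightarrow> real \<Rightarrow> real) \<Rightarrow> (real \<Rightarrow> real \<Rightarrow> real) \<Rightarrow> bool" where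
  "conformal_flattening e1 \<eta> p \<longleftrightarrow>
     analytic_family e1 p \<and> (\<forall>x. p 0 x = 0) \<and>
     (\<forall>\<epsilon>\<in>cball 0 e1. \<forall>x. p \<epsilon> (- x) = - p \<epsilon> x) \<and>
     (\<forall>\<epsilon>\<in>cball 0 e1. \<forall>k.
        fcoeff (p \<epsilon>) k = - \<i> * of_int (sgn k) * fcoeff (\<lambda>x. \<eta> \<epsilon> (x + p \<epsilon> x)) k)"

definition flat_U :: "(real \<Rightarrow> real) \<Rightarrow> real \<Rightarrow> real \<Rightarrow> real" where
  "flat_U q x z =
     x + Re (\<Sum>\<^sub>\<infinity>k\<in>UNIV - {0}. fcoeff q k * of_real (exp (of_int \<bar>k\<bar> * z)) * cis (of_int k * x))"

definition flat_d :: "(real \<Rightarrow> real) \<Rightarrow> real \<Rightarrow> real \<Rightarrow> real" where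
  "flat_d q x z =
     (deriv (\<lambda>y. flat_U q y z) x)\<^sup>2 + (vector_derivative (\<lambda>w. flat_U q x w) (at z within {..0}))\<^sup>2 - 1"

section \<open>Sobolev spaces and operators between them\<close>

text \<open>
  A periodic distribution \<open>u\<close> is identified with its Fourier coefficients, \<open>u = \<Sum>k. u k e\<^sup>i\<^sup>k\<^sup>x\<close>;
  \<open>Hspace s\<close> is \<open>H\<^sup>s(\<T>)\<close> for every real \<open>s\<close>. Operators on \<open>H\<^sup>s\<close> are total functions whose values
  outside \<open>Hspace s\<close> are irrelevant.
\<close>

type_synonym pdist = "int \<Rightarrow> complex"

definition Hspace :: "real \<Rightarrow> pdist set" where
  "Hspace s = {u. (\<lambda>k. (1 + (of_int k)\<^sup>2) powr s * (cmod (u k))\<^sup>2) summable_on UNIV}"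

definition hnorm :: "real \<Rightarrow> pdist \<Rightarrow> real" where
  "hnorm s u = sqrt (\<Sum>\<^sub>\<infinity>k. (1 + (of_int k)\<^sup>2) powr s * (cmod (u k))\<^sup>2)"

definition bounded_op :: "real \<Rightarrow> real \<Rightarrow> (pdist \<Rightarrow> pdist) \<Rightarrow> bool" where
  "bounded_op s t A \<longleftrightarrow>
     (\<forall>u\<in>Hspace s. A u \<in> Hspace t) \<and>
     (\<forall>u\<in>Hspace s. \<forall>v\<in>Hspace s. \<forall>k. A (\<lambda>j. u j + v j) k = A u k + A v k) \<and>
     (\<forall>u\<in>Hspace s. \<forall>b k. A (\<lambda>j. b * u j) k = b * A u k) \<and>
     (\<exists>C. \<forall>u\<in>Hspace s. hnorm t (A u) \<le> C * hnorm s u)"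

definition opnorm :: "real \<Rightarrow> real \<Rightarrow> (pdist \<Rightarrow> pdist) \<Rightarrow> real" where
  "opnorm s t A = (SUP u\<in>{u \<in> Hspace s. hnorm s u \<le> 1}. hnorm t (A u))"

text \<open>Unconditional convergence of \<open>\<Sum>i\<in>I. f i\<close> to \<open>A\<close> in the norm of \<open>\<L>(H\<^sup>s, H\<^sup>t)\<close>.\<close>

definition op_has_sum ::
  "real \<Rightarrow> real \<Rightarrow> ('i \<Rightarrow> pdist \<Rightarrow> pdist) \<Rightarrow> (pdist \<Rightarrow> pdist) \<Rightarrow> 'i set \<Rightarrow> bool" where
  "op_has_sum s t f A I \<longleftrightarrow>
     (\<forall>i\<in>I. bounded_op s t (f i)) \<and> bounded_op s t A \<and>
     ((\<lambda>N. opnorm s t (\<lambda>u k. A u k - (\<Sum>i\<in>N. f i u k))) \<longlongrightarrow> 0) (finite_subsets_at_top I)"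

text \<open>
  Real analyticity of an \<open>\<L>(H\<^sup>s, H\<^sup>t)\<close>-valued map: near each point of \<open>S\<close> it is the sum of a power
  series, with \<open>\<nu>\<close> ranging over the multi-indices. On a closed box the series at a boundary point
  provides the analytic extension beyond the box.
\<close>

definition op_analytic_on ::
  "real \<Rightarrow> real \<Rightarrow> ('e::euclidean_space \<Rightarrow> pdist \<Rightarrow> pdist) \<Rightarrow> 'e set \<Rightarrow> bool" where
  "op_analytic_on s t F S \<longleftrightarrow>
     (\<forall>x0\<in>S. \<exists>r>0. \<exists>a :: ('e \<Rightarrow> nat) \<Rightarrow> pdist \<Rightarrow> pdist.
        (\<forall>\<nu>\<in>Basis \<rightarrow>\<^sub>E UNIV. bounded_op s t (a \<nu>)) \<and>
        (\<forall>x\<in>S \<inter> ball x0 r.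
           op_has_sum s t
             (\<lambda>\<nu> u k. of_real (\<Prod>b\<in>Basis. ((x - x0) \<bullet> b) ^ \<nu> b) * a \<nu> u k)
             (F x) (Basis \<rightarrow>\<^sub>E UNIV)))"

definition classA ::
  "real \<Rightarrow> real \<Rightarrow> (real \<times> real) set \<Rightarrow> real \<Rightarrow> (real \<Rightarrow> real \<Rightarrow> real \<Rightarrow> pdist \<Rightarrow> pdist) \<Rightarrow> bool" where
  "classA s t \<Omega> e0 A \<longleftrightarrow>
     (\<forall>(\<alpha>, \<mu>)\<in>\<Omega>. \<forall>\<epsilon>\<in>cball 0 e0. bounded_op s t (A \<alpha> \<mu> \<epsilon>)) \<and>
     (\<forall>(\<alpha>, \<mu>)\<in>\<Omega>. op_analytic_on s t (A \<alpha> \<mu>) (cball 0 e0)) \<and>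
     (\<forall>\<epsilon>\<in>cball 0 e0. op_analytic_on s t (\<lambda>(\<alpha>, \<mu>). A \<alpha> \<mu> \<epsilon>) (\<Omega> - {0} \<times> \<int>)) \<and>
     (\<exists>r>0. \<forall>j::int. \<exists>A1 A2 :: real \<Rightarrow> real \<Rightarrow> real \<Rightarrow> pdist \<Rightarrow> pdist.
        op_analytic_on s t (\<lambda>(\<beta>, \<mu>, \<epsilon>). A1 \<beta> \<mu> \<epsilon>) (cball 0 (r\<^sup>2) \<times> cball (of_int j) r \<times> cball 0 e0) \<and>
        op_analytic_on s t (\<lambda>(\<beta>, \<mu>, \<epsilon>). A2 \<beta> \<mu> \<epsilon>) (cball 0 (r\<^sup>2) \<times> cball (of_int j) r \<times> cball 0 e0) \<and>
        (\<forall>(\<alpha>, \<mu>)\<in>cball (0, of_int j) r \<inter> \<Omega>. \<forall>\<epsilon>\<in>cball 0 e0. \<forall>u\<in>Hspace s. \<forall>k.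
           A \<alpha> \<mu> \<epsilon> u k =
             A1 (\<alpha>\<^sup>2) \<mu> \<epsilon> u k + of_real (sqrt (\<alpha>\<^sup>2 + (\<mu> - of_int j)\<^sup>2)) * A2 (\<alpha>\<^sup>2) \<mu> \<epsilon> u k))"

definition expi :: "int \<Rightarrow> pdist" where
  "expi j = (\<lambda>k. if k = j then 1 else 0)"

text \<open>With the normalised inner product on \<open>L\<^sup>2(\<T>)\<close>, the matrix entry \<open>(A e\<^sup>i\<^sup>j\<^sup>x, e\<^sup>i\<^sup>n\<^sup>x)\<close> is \<open>A (expi j) n\<close>.\<close>

definition band :: "int \<Rightarrow> (pdist \<Rightarrow> pdist) \<Rightarrow> pdist \<Rightarrow> pdist" where
  "band \<kappa> A u = (\<lambda>n. A (expi (n - \<kappa>)) n * u (n - \<kappa>))"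

definition frakF :: "nat \<Rightarrow> (pdist \<Rightarrow> pdist) set" where
  "frakF l = {B. \<forall>\<kappa>. (\<bar>\<kappa>\<bar> > int l \<or> \<kappa> mod 2 \<noteq> int l mod 2) \<longrightarrow> band \<kappa> B = (\<lambda>u k. 0)}"

definition classF :: "real \<Rightarrow> real \<Rightarrow> real \<Rightarrow> (real \<Rightarrow> pdist \<Rightarrow> pdist) \<Rightarrow> bool" where
  "classF s t e0 A \<longleftrightarrow>
     (\<exists>a. (\<forall>l. a l \<in> frakF l \<and> bounded_op s t (a l)) \<and>
          (\<forall>\<epsilon>\<in>cball 0 e0. op_has_sum s t (\<lambda>l u k. of_real (\<epsilon> ^ l) * a l u k) (A \<epsilon>) UNIV))"

section \<open>The fiber Dirichlet-Neumann operator\<close>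

definition absD :: "real \<Rightarrow> real \<Rightarrow> pdist \<Rightarrow> pdist" where
  "absD \<alpha> \<mu> u = (\<lambda>k. of_real (sqrt ((of_int k + \<mu>)\<^sup>2 + \<alpha>\<^sup>2)) * u k)"

definition mult_fun :: "(real \<Rightarrow> real) \<Rightarrow> pdist \<Rightarrow> pdist" where
  "mult_fun f u = (\<lambda>k. \<Sum>\<^sub>\<infinity>m. fcoeff f (k - m) * u m)"

text \<open>\<open>F'\<close> is the derivative of \<open>F\<close> on \<open>(-\<infinity>, 0]\<close> in the norm of \<open>H\<^sup>r\<close>, one-sided at \<open>0\<close>.\<close>

definition H_deriv :: "real \<Rightarrow> (real \<Rightarrow> pdist) \<Rightarrow> (real \<Rightarrow> pdist) \<Rightarrow> bool" where
  "H_deriv r F F' \<longleftrightarrow>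
     (\<forall>z\<le>0. F z \<in> Hspace r \<and> F' z \<in> Hspace r \<and>
        ((\<lambda>w. hnorm r (\<lambda>k. (F w k - F z k) / of_real (w - z) - F' z k)) \<longlongrightarrow> 0) (at z within {..0}))"

text \<open>
  \<open>fiber_sol d \<alpha> \<mu> g T T'\<close>: \<open>T\<close> solves the fiber problem with Dirichlet datum \<open>g\<close> and \<open>T' = \<partial>\<^sub>z T\<close>.
  For rough \<open>g\<close> the solution takes values in distributions, whence the unspecified exponent \<open>r\<close>
  (for \<open>g\<close> in \<open>H\<^sup>s\<close>, \<open>r = s - 2\<close> will do). On the \<open>k\<close>-th mode \<open>(\<partial>\<^sub>x + i\<mu>)\<^sup>2\<close> is \<open>-(k + \<mu>)\<^sup>2\<close>.
\<close>

definition fiber_sol ::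
  "(real \<Rightarrow> real \<Rightarrow> real) \<Rightarrow> real \<Rightarrow> real \<Rightarrow> pdist \<Rightarrow> (real \<Rightarrow> pdist) \<Rightarrow> (real \<Rightarrow> pdist) \<Rightarrow> bool" where
  "fiber_sol d \<alpha> \<mu> g T T' \<longleftrightarrow>
     (\<exists>r T''. H_deriv r T T' \<and> H_deriv r T' T'' \<and>
        (\<forall>z\<le>0. \<forall>k.
           T'' z k - of_real ((of_int k + \<mu>)\<^sup>2) * T z k
             - of_real (\<alpha>\<^sup>2) * mult_fun (\<lambda>x. 1 + d x z) (T z) k = 0) \<and>
        T 0 = g \<and>
        ((\<lambda>z. hnorm r (T' z)) \<longlongrightarrow> 0) at_bot)"

definition fiber_DN ::
  "(real \<Rightarrow> real \<Rightarrow> real) \<Rightarrow> real \<Rightarrow> real \<Rightarrow> real \<Rightarrow> pdist \<Rightarrow> pdist" where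
  "fiber_DN p \<alpha> \<mu> \<epsilon> g = (THE f. \<exists>T T'. fiber_sol (flat_d (p \<epsilon>)) \<alpha> \<mu> g T T' \<and> f = T' 0)"

end

(*
Over any commutative Banach algebra containing the frequencies, the second order equation for the Fourier
modes is factored into two first order equations and solved by a fixed point among matrices with exponential
decay off the diagonal. Power series algebras in the parameters then give analyticity; near (0, j) the
frequency w of the mode -j is an additional variable, and the parts even and odd in w give A^[I] and A^[II].
Subspaces graded by the order in eps give the class F, once the eps^l-coefficient of d has only harmonics
up to l and of the parity of l. This follows from the Stokes wave equation: as psi(x + p) = c p, Bernoulli's
law is a quadratic recursion for the coefficients of the conformal map.
*)
theory Submission
  imports Defs "HOL-Complex_Analysis.Complex_Analysis"
begin

text \<open>Parameters are formal: a Taylor expansion at a point is one element of an l1 algebra of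
  power series, and values come back through contractive evaluation homomorphisms. As the fixed
  point is unique, homomorphisms commute with it, so analyticity needs no differentiation in the
  parameters. The obstacle is the mode whose frequency vanishes at (0, j): as a free variable of
  norm 1/4 it has no sign, and its exponential may grow like exp(t/4). The factor exp(z) in the
  bound for d compensates: solutions may grow like exp(-z/4), sources then decay like exp(3/4 z),
  and every rate nu >= -1/4 leaves nu + 3/4 >= 1/2. For the class F the obstacle is that no explicit
  formula for the Stokes wave is at hand. Cancelling the antianalytic factor in Bernoulli's law
  leaves a recursion in which the n-th coefficient is multiplied by roughly 1 - 1/n; only n = 1 is
  resonant, and this mode vanishes at eps = 0 because the conformal map does.\<close>

abbreviation ew :: "real => int => real" where "ew c k == exp (c * of_int \<bar>k\<bar>)"

text \<open>Commutativity makes evaluation multiplicative and lets exponentials be combined freely.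
  The class is closed under \<open>ps\<close>, so series in several parameters arise by iterating
  \<open>ps\<close>.\<close>

class banach_ring = comm_ring_1 + real_normed_algebra_1 + banach

instance real :: banach_ring ..
instance complex :: banach_ring ..

section \<open>Absolutely summable power series\<close>

text \<open>The Wiener-type algebra of the closed unit disc: the l1 norm of the coefficients is
  submultiplicative, and evaluation is defined on the whole closed unit ball of the coefficient
  algebra.\<close>

typedef (overloaded) 'a ps = "{f :: ('a::banach_ring) fps. summable (%n. norm (fps_nth f n))}"
  by (rule exI[of _ 0]) simp

setup_lifting type_definition_ps

lemma summable_norm_fps_mult:
  fixes f g :: "'a::banach_ring fps"
  assumes "summable (%n. norm (fps_nth f n))" "summable (%n. norm (fps_nth g n))"
  shows "summable (%n. norm (fps_nth (f * g) n))"
    and "(\<Sum>n. norm (fps_nth (f * g) n)) <= (\<Sum>n. norm (fps_nth f n)) * (\<Sum>n. norm (fps_nth g n))"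
proof -
  let ?c = "%n. \<Sum>i\<le>n. norm (fps_nth f i) * norm (fps_nth g (n - i))"
  have s: "?c sums ((\<Sum>n. norm (fps_nth f n)) * (\<Sum>n. norm (fps_nth g n)))"
    by (rule Cauchy_product_sums) (use assms in simp_all)
  have le: "norm (fps_nth (f * g) n) <= ?c n" for n
    unfolding fps_mult_nth atMost_atLeast0
    by (rule order_trans[OF norm_sum]) (intro sum_mono norm_mult_ineq)
  show "summable (%n. norm (fps_nth (f * g) n))"
    by (rule summable_comparison_test'[OF sums_summable[OF s], of 0]) (use le in simp)
  then show "(\<Sum>n. norm (fps_nth (f * g) n)) <= (\<Sum>n. norm (fps_nth f n)) * (\<Sum>n. norm (fps_nth g n))"
    using suminf_le[OF le _ sums_summable[OF s]] by (simp add: sums_unique[OF s])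
qed

instantiation ps :: (banach_ring) comm_ring_1
begin
lift_definition zero_ps :: "'a ps" is 0 by simp
lift_definition one_ps :: "'a ps" is 1
  by (rule summable_finite[of "{0}"]) auto
lift_definition plus_ps :: "'a ps => 'a ps => 'a ps" is "(+)"
proof -
  fix f g :: "'a fps" assume "summable (%n. norm (fps_nth f n))" "summable (%n. norm (fps_nth g n))"
  from summable_add[OF this] show "summable (%n. norm (fps_nth (f + g) n))"
    by (rule summable_comparison_test'[of _ 0]) (simp add: norm_triangle_ineq)
qed
lift_definition uminus_ps :: "'a ps => 'a ps" is "uminus" by simp
lift_definition minus_ps :: "'a ps => 'a ps => 'a ps" is "(-)"
proof -
  fix f g :: "'a fps" assume "summable (%n. norm (fps_nth f n))" "summable (%n. norm (fps_nth g n))"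
  from summable_add[OF this] show "summable (%n. norm (fps_nth (f - g) n))"
    by (rule summable_comparison_test'[of _ 0]) (simp add: norm_triangle_ineq4)
qed
lift_definition times_ps :: "'a ps => 'a ps => 'a ps" is "(*)"
  by (rule summable_norm_fps_mult)
instance
  by standard (transfer, simp add: algebra_simps)+
end

lift_definition ps_nth :: "'a::banach_ring ps => nat => 'a" is fps_nth .

lemma ps_eqI: "(!!n. ps_nth f n = ps_nth g n) ==> f = g"
  by transfer (simp add: fps_eq_iff)

lemma summable_norm_ps_nth: "summable (%n. norm (ps_nth f n))"
  by transfer

lemma ps_nth_add [simp]: "ps_nth (f + g) n = ps_nth f n + ps_nth g n" by transfer simp
lemma ps_nth_diff [simp]: "ps_nth (f - g) n = ps_nth f n - ps_nth g n" by transfer simp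
lemma ps_nth_zero [simp]: "ps_nth 0 n = 0" by transfer simp
lemma ps_nth_one: "ps_nth 1 n = (if n = 0 then 1 else 0)" by transfer simp
lemma ps_nth_mult: "ps_nth (f * g) n = (\<Sum>i\<le>n. ps_nth f i * ps_nth g (n - i))"
  by transfer (simp add: fps_mult_nth atMost_atLeast0)

instantiation ps :: (banach_ring) real_algebra_1
begin
lift_definition scaleR_ps :: "real => 'a ps => 'a ps" is "%r f. Abs_fps (%n. r *\<^sub>R fps_nth f n)"
  by (simp add: summable_mult)
instance
proof
  fix a b :: real and x y :: "'a ps"
  show "a *\<^sub>R (x + y) = a *\<^sub>R x + a *\<^sub>R y" "(a + b) *\<^sub>R x = a *\<^sub>R x + b *\<^sub>R x"
    "a *\<^sub>R b *\<^sub>R x = (a * b) *\<^sub>R x" "1 *\<^sub>R x = x"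
    by (transfer, simp add: fps_eq_iff scaleR_add_left scaleR_add_right)+
  show "a *\<^sub>R x * y = a *\<^sub>R (x * y)" "x * a *\<^sub>R y = a *\<^sub>R (x * y)"
    by (transfer, simp add: fps_eq_iff fps_mult_nth scaleR_sum_right)+
qed
end

instantiation ps :: (banach_ring) real_normed_algebra_1
begin
lift_definition norm_ps :: "'a ps => real" is "%f. \<Sum>n. norm (fps_nth f n)" .
definition sgn_ps :: "'a ps => 'a ps" where "sgn_ps x = x /\<^sub>R norm x"
definition dist_ps :: "'a ps => 'a ps => real" where "dist_ps x y = norm (x - y)"
definition uniformity_ps :: "('a ps \<times> 'a ps) filter" where
  "uniformity_ps = (INF e\<in>{0 <..}. principal {(x, y). dist x y < e})"
definition open_ps :: "'a ps set => bool" where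
  "open_ps S = (\<forall>x\<in>S. \<forall>\<^sub>F (x', y) in uniformity. x' = x --> y \<in> S)"
instance
proof
  fix a :: real and x y :: "'a ps" and S :: "'a ps set"
  show "dist x y = norm (x - y)" by (rule dist_ps_def)
  show "sgn x = x /\<^sub>R norm x" by (rule sgn_ps_def)
  show "uniformity = (INF e\<in>{0 <..}. principal {(x, y :: 'a ps). dist x y < e})" by (rule uniformity_ps_def)
  show "open S = (\<forall>x\<in>S. \<forall>\<^sub>F (x', y) in uniformity. x' = x --> y \<in> S)" by (rule open_ps_def)
  show "norm (x * y) <= norm x * norm y" by transfer (rule summable_norm_fps_mult)
  show "norm (a *\<^sub>R x) = abs a * norm x" by transfer (simp add: suminf_mult)
  show "norm (1 :: 'a ps) = 1"
  proof transfer
    have "(\<Sum>n. norm (fps_nth (1 :: 'a fps) n)) = (\<Sum>n\<in>{0}. norm (fps_nth (1 :: 'a fps) n))"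
      by (rule suminf_finite) auto
    then show "(\<Sum>n. norm (fps_nth (1 :: 'a fps) n)) = 1" by simp
  qed
  show "norm x = 0 \<longleftrightarrow> x = 0"
    by transfer (auto simp: fps_eq_iff suminf_eq_zero_iff)
  show "norm (x + y) <= norm x + norm y"
  proof transfer
    fix f g :: "'a fps" assume s: "summable (%n. norm (fps_nth f n))" "summable (%n. norm (fps_nth g n))"
    have "summable (%n. norm (fps_nth (f + g) n))"
      by (rule summable_comparison_test'[OF summable_add[OF s], of 0]) (simp add: norm_triangle_ineq)
    then have "(\<Sum>n. norm (fps_nth (f + g) n)) <= (\<Sum>n. norm (fps_nth f n) + norm (fps_nth g n))"
      by (rule suminf_le[rotated]) (use summable_add[OF s] in \<open>auto simp: norm_triangle_ineq\<close>)
    then show "(\<Sum>n. norm (fps_nth (f + g) n)) <= (\<Sum>n. norm (fps_nth f n)) + (\<Sum>n. norm (fps_nth g n))"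
      by (simp add: suminf_add[OF s])
  qed
qed
end

lemma norm_ps: "norm f = (\<Sum>n. norm (ps_nth f n))" by transfer simp
lemma ps_nth_scaleR [simp]: "ps_nth (r *\<^sub>R f) n = r *\<^sub>R ps_nth f n" by transfer simp

lemma norm_ps_nth_le: "norm (ps_nth f n) <= norm f"
  unfolding norm_ps using sum_le_suminf[OF summable_norm_ps_nth[of f], of "{n}"] by simp

lemma bounded_linear_ps_nth: "bounded_linear (%f. ps_nth f n)"
  by (rule bounded_linear_intro[of _ 1]) (auto simp: norm_ps_nth_le)

lift_definition Ps :: "(nat => 'a::banach_ring) => 'a ps"
  is "%a. if summable (%n. norm (a n)) then Abs_fps a else 0" by simp

lemma ps_nth_Ps: "summable (%n. norm (a n)) ==> ps_nth (Ps a) n = a n"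
  by transfer simp

lemma norm_ps_leI:
  assumes "!!N. (\<Sum>n<N. norm (ps_nth f n)) <= C" shows "norm f <= C"
  unfolding norm_ps using suminf_le_const[OF summable_norm_ps_nth] assms by blast

text \<open>Completeness of l1: the coefficients converge one by one, and the Cauchy condition
  bounds all partial sums of the differences by the same e, a bound that passes to the
  limit.\<close>

instance ps :: (banach_ring) banach
proof
  fix X :: "nat => 'a ps" assume C: "Cauchy X"
  have "Cauchy (%i. ps_nth (X i) n)" for n
    by (rule bounded_linear.Cauchy[OF bounded_linear_ps_nth C])
  then have "\<forall>n. \<exists>l. (%i. ps_nth (X i) n) \<longlonglongrightarrow> l"
    using Cauchy_convergent_iff convergent_def by blast
  from choice[OF this] obtain a where a: "!!n. (%i. ps_nth (X i) n) \<longlonglongrightarrow> a n" by blast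
  have part: "\<exists>M. \<forall>i\<ge>M. \<forall>N. (\<Sum>n<N. norm (ps_nth (X i) n - a n)) <= e" if "e > 0" for e
  proof -
    from C that obtain M where M: "!!i j. i >= M ==> j >= M ==> norm (X i - X j) < e"
      unfolding Cauchy_def dist_norm by blast
    have "(\<Sum>n<N. norm (ps_nth (X i) n - a n)) <= e" if "i >= M" for i N
    proof (rule LIMSEQ_le_const2)
      show "(%j. \<Sum>n<N. norm (ps_nth (X i) n - ps_nth (X j) n)) \<longlonglongrightarrow> (\<Sum>n<N. norm (ps_nth (X i) n - a n))"
        by (intro tendsto_intros a)
      have "(\<Sum>n<N. norm (ps_nth (X i) n - ps_nth (X j) n)) <= e" if "j >= M" for j
        using sum_le_suminf[OF summable_norm_ps_nth[of "X i - X j"], of "{..<N}"] M[OF \<open>i >= M\<close> that]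
        by (simp add: norm_ps)
      then show "\<exists>M. \<forall>j\<ge>M. (\<Sum>n<N. norm (ps_nth (X i) n - ps_nth (X j) n)) <= e" by blast
    qed
    then show ?thesis by blast
  qed
  obtain M where M: "!!N. (\<Sum>n<N. norm (ps_nth (X M) n - a n)) <= 1" using part[of 1] by force
  have "summable (%n. norm (ps_nth (X M) n - a n))"
    by (rule bounded_imp_summable[of _ 1]) (use M[of "Suc _"] in \<open>auto simp: lessThan_Suc_atMost\<close>)
  note s = summable_add[OF this summable_norm_ps_nth[of "X M"]]
  have "norm (a n) <= norm (ps_nth (X M) n - a n) + norm (ps_nth (X M) n)" for n
    using norm_triangle_ineq2[of "a n" "ps_nth (X M) n"] by (simp add: norm_minus_commute)
  then have sa: "summable (%n. norm (a n))"
    by (intro summable_comparison_test'[OF s, of 0]) simp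
  have "X \<longlonglongrightarrow> Ps a"
  proof (rule LIMSEQ_I)
    fix e :: real assume "e > 0"
    then obtain M where M: "!!i N. i >= M ==> (\<Sum>n<N. norm (ps_nth (X i) n - a n)) <= e/2" using part[of "e/2"] by auto
    have "norm (X i - Ps a) < e" if "i >= M" for i
      using norm_ps_leI[of "X i - Ps a" "e/2"] M[OF that] \<open>e > 0\<close> by (simp add: ps_nth_Ps[OF sa])
    then show "\<exists>M. \<forall>i\<ge>M. norm (X i - Ps a) < e" by blast
  qed
  then show "convergent X" by (auto simp: convergent_def)
qed

instance ps :: (banach_ring) banach_ring ..

definition ps_const :: "'a::banach_ring => 'a ps" where
  "ps_const c = Ps (%n. if n = 0 then c else 0)"

definition ps_X :: "'a::banach_ring ps" where
  "ps_X = Ps (%n. if n = 1 then 1 else 0)"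

lemma ps_nth_const: "ps_nth (ps_const c) n = (if n = 0 then c else 0)"
  unfolding ps_const_def by (subst ps_nth_Ps) (auto intro!: summable_finite[of "{0}"] split: if_splits)

lemma ps_nth_X: "ps_nth ps_X n = (if n = 1 then 1 else 0)"
  unfolding ps_X_def by (subst ps_nth_Ps) (auto intro!: summable_finite[of "{1}"] split: if_splits)

lemma norm_ps_const [simp]: "norm (ps_const c) = norm c"
  unfolding norm_ps by (subst suminf_finite[of "{0}"]) (auto simp: ps_nth_const)

lemma norm_ps_X [simp]: "norm (ps_X :: 'a::banach_ring ps) = 1"
  unfolding norm_ps by (subst suminf_finite[of "{1}"]) (auto simp: ps_nth_X)

section \<open>Evaluation homomorphisms of the series algebra\<close>

definition ps_eval :: "'a::banach_ring => 'a ps => 'a" where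
  "ps_eval x f = (\<Sum>n. ps_nth f n * x ^ n)"

lemma norm_mult_power_le:
  fixes x :: "'a::real_normed_algebra_1"
  assumes "norm x <= 1" shows "norm (c * x ^ n) <= norm c"
proof -
  have "norm (c * x ^ n) <= norm c * norm x ^ n"
    by (rule order_trans[OF norm_mult_ineq mult_left_mono[OF norm_power_ineq]]) simp
  also have "... <= norm c * 1" by (intro mult_left_mono power_le_one assms) auto
  finally show ?thesis by simp
qed

lemma summable_norm_ps_eval:
  assumes "norm x <= 1" shows "summable (%n. norm (ps_nth f n * x ^ n))"
  by (rule summable_comparison_test'[OF summable_norm_ps_nth[of f], of 0]) (simp add: norm_mult_power_le assms)

lemma ps_eval_sums:
  assumes "norm x <= 1" shows "(%n. ps_nth f n * x ^ n) sums ps_eval x f"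
  unfolding ps_eval_def using summable_norm_cancel[OF summable_norm_ps_eval[OF assms]] by (rule summable_sums)

lemma norm_ps_eval_le: assumes "norm x <= 1" shows "norm (ps_eval x f) <= norm f"
proof -
  have "norm (ps_eval x f) <= (\<Sum>n. norm (ps_nth f n * x ^ n))"
    unfolding ps_eval_def by (rule summable_norm[OF summable_norm_ps_eval[OF assms]])
  also have "... <= norm f" unfolding norm_ps
    by (rule suminf_le[OF norm_mult_power_le[OF assms] summable_norm_ps_eval[OF assms] summable_norm_ps_nth])
  finally show ?thesis .
qed

lemma ps_eval_add: "norm x <= 1 ==> ps_eval x (f + g) = ps_eval x f + ps_eval x g"
  using sums_add[OF ps_eval_sums[of x f] ps_eval_sums[of x g]] ps_eval_sums[of x "f + g"]
  by (simp add: distrib_right sums_unique2)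

lemma ps_eval_scaleR: "norm x <= 1 ==> ps_eval x (r *\<^sub>R f) = r *\<^sub>R ps_eval x f"
  using sums_scaleR_right[OF ps_eval_sums[of x f], of r] ps_eval_sums[of x "r *\<^sub>R f"]
  by (simp add: sums_unique2)

lemma ps_eval_mult: assumes "norm x <= 1" shows "ps_eval x (f * g) = ps_eval x f * ps_eval x g"
proof -
  have *: "ps_nth (f * g) n * x ^ n = (\<Sum>i\<le>n. (ps_nth f i * x ^ i) * (ps_nth g (n - i) * x ^ (n - i)))" for n
    unfolding ps_nth_mult sum_distrib_right
  proof (rule sum.cong[OF refl])
    fix i assume "i \<in> {..n}"
    then have "x ^ n = x ^ i * x ^ (n - i)" by (simp add: power_add[symmetric])
    then show "ps_nth f i * ps_nth g (n - i) * x ^ n = (ps_nth f i * x ^ i) * (ps_nth g (n - i) * x ^ (n - i))"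
      by (simp add: mult_ac)
  qed
  show ?thesis
    unfolding ps_eval_def * by (rule Cauchy_product[symmetric]) (simp_all add: summable_norm_ps_eval assms)
qed

lemma ps_eval_const [simp]: "ps_eval x (ps_const c) = c"
  unfolding ps_eval_def by (subst suminf_finite[of "{0}"]) (auto simp: ps_nth_const)

lemma ps_eval_X [simp]: "ps_eval x ps_X = x"
  unfolding ps_eval_def by (subst suminf_finite[of "{1}"]) (auto simp: ps_nth_X)

lemma ps_eval_one [simp]: "ps_eval x 1 = 1"
  unfolding ps_eval_def by (subst suminf_finite[of "{0}"]) (auto simp: ps_nth_one)

text \<open>The dependence of all objects below on the parameters is expressed by the evaluation homomorphisms of algebras of power series.\<close>

definition contr_hom :: "('a::real_normed_algebra_1 => 'b::real_normed_algebra_1) => bool" where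
  "contr_hom \<phi> \<longleftrightarrow> linear \<phi> & (\<forall>x y. \<phi> (x * y) = \<phi> x * \<phi> y) & \<phi> 1 = 1 & (\<forall>x. norm (\<phi> x) <= norm x)"

lemma contr_hom_ps_eval: "norm x <= 1 ==> contr_hom (ps_eval x)"
  unfolding contr_hom_def
  by (auto intro!: linearI simp: ps_eval_add ps_eval_scaleR ps_eval_mult norm_ps_eval_le)

lemma contr_hom_comp: "contr_hom \<phi> ==> contr_hom th ==> contr_hom (%x. th (\<phi> x))"
  unfolding contr_hom_def by (auto intro: linear_compose[unfolded o_def] order_trans)

lemma contr_hom_bounded_linear: "contr_hom \<phi> ==> bounded_linear \<phi>"
  unfolding contr_hom_def
  by (intro bounded_linear_intro[of _ 1]) (auto simp: linear_add linear_scale)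

lemma contr_hom_simps:
  assumes "contr_hom \<phi>"
  shows "\<phi> (x + y) = \<phi> x + \<phi> y" "\<phi> (x - y) = \<phi> x - \<phi> y" "\<phi> (- x) = - \<phi> x" "\<phi> (x * y) = \<phi> x * \<phi> y"
    "\<phi> (r *\<^sub>R x) = r *\<^sub>R \<phi> x" "\<phi> 1 = 1" "\<phi> 0 = 0" "norm (\<phi> x) <= norm x" "\<phi> (x ^ n) = \<phi> x ^ n" "\<phi> (of_real r) = of_real r"
proof -
  show "\<phi> (x ^ n) = \<phi> x ^ n" using assms by (induct n) (auto simp: contr_hom_def)
qed (use assms in \<open>auto simp: contr_hom_def linear_add linear_diff linear_neg linear_scale linear_0 of_real_def\<close>)

section \<open>Linear equations with coefficients in a normed algebra\<close>

lemma exp_diff_mult: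
  fixes w :: "'a::banach_ring"
  shows "exp ((x - y) *\<^sub>R w) = exp (x *\<^sub>R w) * exp (- (y *\<^sub>R w))"
  by (subst exp_add_commuting[symmetric]) (simp_all add: scaleR_diff_left mult.commute)

lemma contr_hom_exp:
  fixes \<phi> :: "'a::{real_normed_algebra_1,banach} => 'b::{real_normed_algebra_1,banach}"
  assumes "contr_hom \<phi>" shows "\<phi> (exp x) = exp (\<phi> x)"
proof -
  have "\<phi> (exp x) = (\<Sum>n. \<phi> (x ^ n /\<^sub>R fact n))"
    unfolding exp_def by (rule bounded_linear.suminf[OF contr_hom_bounded_linear[OF assms] summable_exp_generic])
  then show ?thesis by (simp add: exp_def contr_hom_simps[OF assms])
qed

text \<open>The scalar part of the exponent gives the decay; the perturbation t enters through the
  crude bound of \<open>norm (exp x)\<close> by \<open>exp (norm x)\<close>. If t has norm at most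
  1/4, three quarters of the decay survive.\<close>

lemma norm_exp_scaled_le:
  fixes t :: "'a::banach_ring"
  assumes "norm t <= th" "x >= 0"
  shows "norm (exp (- (x *\<^sub>R (\<omega> *\<^sub>R (1 + t))))) <= exp (- (\<omega> * x) + abs \<omega> * th * x)"
proof -
  have e: "exp (- (x *\<^sub>R (\<omega> *\<^sub>R (1 + t)))) = exp (of_real (- (\<omega> * x))) * exp (- ((x * \<omega>) *\<^sub>R t))"
    by (subst exp_add_commuting[symmetric]) (simp_all add: of_real_def algebra_simps)
  have "norm (exp (- (x *\<^sub>R (\<omega> *\<^sub>R (1 + t))))) <= norm (exp (of_real (- (\<omega> * x)) :: 'a)) * norm (exp (- ((x * \<omega>) *\<^sub>R t)))"
    unfolding e by (rule norm_mult_ineq)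
  also have "norm (exp (of_real (- (\<omega> * x)) :: 'a)) = exp (- (\<omega> * x))"
    by (metis exp_of_real norm_of_real abs_exp_cancel)
  also have "norm (exp (- ((x * \<omega>) *\<^sub>R t))) <= exp (norm (- ((x * \<omega>) *\<^sub>R t)))" by (rule norm_exp)
  also have "... <= exp (abs \<omega> * th * x)"
    using mult_left_mono[OF assms(1), of "\<bar>x * \<omega>\<bar>"] assms(2) by (simp add: abs_mult mult_ac)
  finally show ?thesis by (simp add: exp_add[symmetric] mult_left_mono)
qed

text \<open>The root is the fixed point of t = (h - t^2)/2. On the ball of radius 1/4 the sum x + y
  has norm at most 1/2, which makes this map a contraction with factor 1/4.\<close>

lemma sqrt_one_plus_exists:
  fixes h :: "'a::banach_ring"
  assumes "norm h <= 1/4"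
  shows "\<exists>t. norm t <= 1/4 & (1 + t) * (1 + t) = 1 + h"
proof -
  let ?f = "%t. (1/2) *\<^sub>R (h - t * t)"
  have "\<exists>!t\<in>cball 0 (1/4). ?f t = t"
  proof (rule Banach_fix[where f="?f" and c="1/4"])
    show "complete (cball 0 (1/4) :: 'a set)" by (simp add: complete_eq_closed)
    show "?f ` cball 0 (1/4) \<subseteq> cball 0 (1/4)"
    proof (rule image_subsetI)
      fix t :: 'a assume t: "t \<in> cball 0 (1/4)"
      have "norm (h - t * t) <= norm h + norm t * norm t"
        by (rule order_trans[OF norm_triangle_ineq4]) (simp add: norm_mult_ineq)
      also have "... <= 1/4 + 1/4 * (1/4)" by (intro add_mono mult_mono) (use assms t in auto)
      finally show "?f t \<in> cball 0 (1/4)" by simp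
    qed
    show "dist (?f x) (?f y) <= (1/4) * dist x y" if "x \<in> cball 0 (1/4)" "y \<in> cball 0 (1/4)" for x y
    proof -
      have "?f x - ?f y = (1/2) *\<^sub>R ((y - x) * (x + y))" by (simp add: algebra_simps)
      then have "dist (?f x) (?f y) = (1/2) * norm ((y - x) * (x + y))" by (simp add: dist_norm)
      also have "... <= (1/2) * (norm (y - x) * (1/4 + 1/4))"
        by (intro mult_left_mono order_trans[OF norm_mult_ineq] order_trans[OF norm_triangle_ineq] add_mono)
          (use that in auto)
      finally show ?thesis by (simp add: dist_norm norm_minus_commute)
    qed
  qed auto
  then obtain t where t: "norm t <= 1/4" "?f t = t" by auto
  have "h - t * t = 2 *\<^sub>R ?f t" by simp
  then have "h - t * t = 2 *\<^sub>R t" using t(2) by simp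
  then have "(1 + t) * (1 + t) = 1 + h" by (simp add: algebra_simps scaleR_2)
  with t show ?thesis by blast
qed

section \<open>First order linear equations on the half-line\<close>

definition solves :: "'a::real_normed_algebra => (real => 'a) => (real => 'a) => bool" where
  "solves w f u \<longleftrightarrow> (\<forall>z\<le>0. (u has_vector_derivative w * u z + f z) (at z within {..0}))"

lemma solves_diff:
  assumes "solves w f u" "solves w g v" shows "solves w (%z. f z - g z) (%z. u z - v z)"
  using assms unfolding solves_def
  by (auto intro!: derivative_eq_intros has_vector_derivative_diff[THEN has_vector_derivative_eq_rhs] simp: algebra_simps)

lemma solves_continuous: "solves w f u ==> continuous_on {..0} u"
  unfolding solves_def continuous_on_eq_continuous_within
  by (auto intro: has_vector_derivative_continuous)

lemma solves_hom:
  assumes "contr_hom \<phi>" "solves w f u" shows "solves (\<phi> w) (%z. \<phi> (f z)) (%z. \<phi> (u z))"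
  using assms(2) bounded_linear.has_vector_derivative[OF contr_hom_bounded_linear[OF assms(1)]]
  unfolding solves_def by (fastforce simp: contr_hom_simps[OF assms(1)])

text \<open>Integrating factor. The free base point z keeps the sign of z - s fixed along the
  interval of integration, so that the one-sided bounds for the exponential of w can be
  applied.\<close>

lemma solves_conj_exp:
  fixes w :: "'a::banach_ring"
  assumes "solves w f u" "s <= 0"
  shows "((%s. exp ((z - s) *\<^sub>R w) * u s) has_vector_derivative exp ((z - s) *\<^sub>R w) * f s) (at s within {..0})"
proof -
  have "((%s. exp (s *\<^sub>R (- w))) has_vector_derivative exp (s *\<^sub>R (- w)) * (- w)) (at s within {..0})"
    by (rule exp_scaleR_has_vector_derivative_right)
  from has_vector_derivative_mult[OF this assms(1)[unfolded solves_def, rule_format, OF assms(2)]]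
  have "((%s. exp (s *\<^sub>R (- w)) * u s) has_vector_derivative exp (s *\<^sub>R (- w)) * f s) (at s within {..0})"
    by (rule has_vector_derivative_eq_rhs) (simp add: algebra_simps)
  from has_vector_derivative_mult_right[OF this, of "exp (z *\<^sub>R w)"]
  show ?thesis by (simp add: exp_diff_mult mult.assoc)
qed

text \<open>Mean value inequality for the conjugated function. \<open>\<phi>\<close> is a primitive
  of the bound for the source, so that no vector-valued integral has to be estimated.\<close>

lemma solves_gronwall:
  fixes w :: "'a::banach_ring"
  assumes u: "solves w f u" and ab: "a <= b" "b <= 0"
    and phi: "!!s. (\<phi> has_vector_derivative \<phi>' s) (at s)"
    and bnd: "!!s. a <= s ==> s <= b ==> norm (exp ((z - s) *\<^sub>R w) * f s) <= \<phi>' s"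
  shows "norm (exp ((z - b) *\<^sub>R w) * u b - exp ((z - a) *\<^sub>R w) * u a) <= \<phi> b - \<phi> a"
proof (cases "a = b")
  case False
  have d: "((%s. exp ((z - s) *\<^sub>R w) * u s) has_vector_derivative exp ((z - s) *\<^sub>R w) * f s) (at s within {..0})" if "s <= b" for s
    using solves_conj_exp[OF u] ab that by auto
  show ?thesis
  proof (rule differentiable_bound_general[where f="%s. exp ((z - s) *\<^sub>R w) * u s" and f'="%s. exp ((z - s) *\<^sub>R w) * f s" and \<phi>'=\<phi>'])
    show "a < b" using False ab by auto
    show "continuous_on {a..b} (%s. exp ((z - s) *\<^sub>R w) * u s)"
      by (rule continuous_on_vector_derivative, rule has_vector_derivative_within_subset[OF d]) (use ab in auto)
    show "continuous_on {a..b} \<phi>"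
      using phi by (meson continuous_at_imp_continuous_on has_vector_derivative_continuous)
    show "((%s. exp ((z - s) *\<^sub>R w) * u s) has_vector_derivative exp ((z - x) *\<^sub>R w) * f x) (at x)" if "a < x" "x < b" for x
      proof -
      have "at x within {..0} = at x" by (rule at_within_nhd[of x "{..<0}" "{..0}" UNIV]) (use that ab in auto)
      then show ?thesis using d[of x] that by simp
    qed
  qed (use phi bnd in auto)
qed simp

lemma exp_scale_neg: "exp ((z - s) *\<^sub>R w) = exp (- ((s - z) *\<^sub>R w))"
  by (simp add: scaleR_diff_left)

lemma norm_mult_le: "norm (x::'a::real_normed_algebra) <= a ==> norm y <= b ==> norm (x * y) <= a * b"
  by (rule order_trans[OF norm_mult_ineq]) (auto intro: mult_mono order_trans[OF norm_ge_zero])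

text \<open>Integrate from a to z and let a tend to minus infinity. The limit hypothesis removes the
  contribution of the homogeneous solution exp(-w z), and nu + 3/4 > 0 makes the source
  integrable.\<close>

lemma decaying_bound:
  fixes w :: "'a::banach_ring"
  assumes w: "!!t. t >= 0 ==> norm (exp (- (t *\<^sub>R w))) <= exp (- nu * t)" and nu: "nu >= -1/4"
    and u: "solves (- w) f u" and f: "!!z. z <= 0 ==> norm (f z) <= F * exp (3/4 * z)"
    and lim: "((%z. exp (nu * z) * norm (u z)) \<longlongrightarrow> 0) at_bot" and z: "z <= 0"
  shows "norm (u z) <= F / (nu + 3/4) * exp (3/4 * z)"
proof -
  have F: "F >= 0" using order_trans[OF norm_ge_zero f[of 0]] by simp
  let ?\<phi> = "%s. F / (nu + 3/4) * exp (- nu * z) * exp ((nu + 3/4) * s)"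
  have b: "norm (u z) <= ?\<phi> z + exp (- nu * z) * (exp (nu * a) * norm (u a))" if "a <= z" for a
  proof -
    have "norm (exp ((z - z) *\<^sub>R (- w)) * u z - exp ((z - a) *\<^sub>R (- w)) * u a) <= ?\<phi> z - ?\<phi> a"
    proof (rule solves_gronwall[OF u that z, where \<phi>'="%s. F * exp (- nu * z) * exp ((nu + 3/4) * s)"])
      show "(?\<phi> has_vector_derivative F * exp (- nu * z) * exp ((nu + 3/4) * s)) (at s)" for s
        using nu by (auto intro!: derivative_eq_intros simp: has_real_derivative_iff_has_vector_derivative[symmetric])
      fix s assume s: "a <= s" "s <= z"
      have "norm (exp ((z - s) *\<^sub>R (- w)) * f s) <= exp (- nu * (z - s)) * (F * exp (3/4 * s))"
        by (rule norm_mult_le) (use w[of "z - s"] f[of s] s z in auto)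
      then show "norm (exp ((z - s) *\<^sub>R (- w)) * f s) <= F * exp (- nu * z) * exp ((nu + 3/4) * s)"
        by (simp add: exp_add[symmetric] algebra_simps)
    qed
    then have "norm (u z - exp ((z - a) *\<^sub>R (- w)) * u a) <= ?\<phi> z - ?\<phi> a" by simp
    moreover have "?\<phi> a >= 0" using F nu by simp
    moreover have "norm (exp ((z - a) *\<^sub>R (- w)) * u a) <= exp (- nu * (z - a)) * norm (u a)"
      by (rule norm_mult_le) (use w[of "z - a"] that in auto)
    moreover have "exp (- nu * (z - a)) * norm (u a) = exp (- nu * z) * (exp (nu * a) * norm (u a))"
      by (simp add: algebra_simps exp_add[symmetric] mult_exp_exp)
    ultimately show ?thesis
      using norm_triangle_ineq2[of "u z" "exp ((z - a) *\<^sub>R (- w)) * u a"] by linarith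
  qed
  have "norm (u z) <= ?\<phi> z + exp (- nu * z) * 0"
  proof (rule tendsto_lowerbound)
    show "((%a. ?\<phi> z + exp (- nu * z) * (exp (nu * a) * norm (u a))) \<longlongrightarrow> ?\<phi> z + exp (- nu * z) * 0) at_bot"
      by (intro tendsto_intros lim)
    show "\<forall>\<^sub>F a in at_bot. norm (u z) <= ?\<phi> z + exp (- nu * z) * (exp (nu * a) * norm (u a))"
      using b eventually_le_at_bot by (rule eventually_mono[rotated])
  qed simp
  then show ?thesis by (simp add: mult.assoc exp_add[symmetric] algebra_simps)
qed

text \<open>Such subspaces pass through limits and integrals; they carry the band structure through the fixed point.\<close>

definition functional_subspace :: "'a::real_normed_vector set => bool" where
  "functional_subspace S \<longleftrightarrow> (\<exists>\<Psi>::('a => real) set. (\<forall>\<psi>\<in>\<Psi>. bounded_linear \<psi>) & S = {x. \<forall>\<psi>\<in>\<Psi>. \<psi> x = 0})"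

lemma functional_subspace_UNIV: "functional_subspace UNIV"
  unfolding functional_subspace_def by (rule exI[of _ "{}"]) simp

lemma functional_subspace_closed: assumes "functional_subspace S" shows "closed S"
proof -
  obtain \<Psi> where P: "\<forall>\<psi>\<in>\<Psi>. bounded_linear \<psi>" and S: "S = {x. \<forall>\<psi>\<in>\<Psi>. \<psi> x = (0::real)}"
    using assms unfolding functional_subspace_def by blast
  have "S = (\<Inter>\<psi>\<in>\<Psi>. {x. \<psi> x = 0})" using S by auto
  moreover have "closed {x. \<psi> x = 0}" if "\<psi> \<in> \<Psi>" for \<psi>
    using P that by (intro closed_Collect_eq) (auto intro: linear_continuous_on)
  ultimately show ?thesis by auto
qed

lemma functional_subspace_subspace: assumes "functional_subspace S" shows "subspace S"
  using assms unfolding functional_subspace_def subspace_def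
  by (auto simp: linear_0 linear_add linear_scale bounded_linear.linear)

lemma functional_subspace_infsum:
  assumes "functional_subspace S" "!!i. f i \<in> S" shows "infsum f A \<in> S"
proof (cases "f summable_on A")
  case True
  then have "(f has_sum infsum f A) A" by simp
  then show ?thesis unfolding has_sum_def
    by (rule Lim_in_closed_set[OF functional_subspace_closed[OF assms(1)], rotated 2])
      (auto intro!: eventually_finite_subsets_at_top_weakI subspace_sum functional_subspace_subspace assms)
qed (simp add: infsum_not_exists subspace_0 functional_subspace_subspace assms)

lemma functional_subspace_integral:
  fixes f :: "real => 'a::banach"
  assumes "functional_subspace S" "!!t. t \<in> A ==> f t \<in> S" "f integrable_on A" shows "integral A f \<in> S"
proof -
  obtain \<Psi> where P: "!!\<psi>. \<psi> \<in> \<Psi> ==> bounded_linear \<psi>" and S: "S = {x. \<forall>\<psi>\<in>\<Psi>. \<psi> x = (0::real)}"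
    using assms(1) unfolding functional_subspace_def by blast
  have "\<psi> (integral A f) = 0" if "\<psi> \<in> \<Psi>" for \<psi>
  proof -
    have "\<psi> (integral A f) = integral A (\<psi> \<circ> f)" by (rule integral_linear[OF assms(3) P[OF that], symmetric])
    also have "... = integral A (%_. 0)" by (rule integral_cong) (use assms(2) S that in auto)
    finally show ?thesis by simp
  qed
  then show ?thesis using S by blast
qed

text \<open>Variation of constants. Membership in \<open>S\<close> passes through the integral
  because \<open>S\<close> is cut out by bounded functionals.\<close>

lemma solves_exists:
  fixes w :: "'a::banach_ring"
  assumes f: "continuous_on {..0} f" and S: "functional_subspace S" "!!z. z <= 0 ==> f z \<in> S" "x0 \<in> S"
    "!!t x. x \<in> S ==> exp (t *\<^sub>R w) * x \<in> S"
  shows "\<exists>u. solves w f u & u 0 = x0 & (\<forall>z\<le>0. u z \<in> S)"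
proof -
  let ?g = "%s. exp (s *\<^sub>R (- w)) * f s"
  have exp_cont: "continuous_on A (%s. exp (s *\<^sub>R (- w)))" for A
    by (rule continuous_on_vector_derivative) (rule exp_scaleR_has_vector_derivative_right)
  have g: "continuous_on {..0} ?g" by (intro continuous_on_mult exp_cont f)
  define J where "J z = integral {z..0} ?g" for z
  have J: "(J has_vector_derivative - ?g z) (at z within {..0})" if z: "z <= 0" for z
  proof -
    have c: "continuous_on {z - 1..0} ?g" by (rule continuous_on_subset[OF g]) auto
    have "(J has_vector_derivative - ?g z) (at z within {z - 1..0})"
      unfolding J_def by (rule integral_has_vector_derivative'[OF c]) (use z in auto)
    moreover have "at z within {z - 1..0} = at z within {..0}"
      by (rule at_within_nhd[of z "{z - 1<..}"]) auto
    ultimately show ?thesis by simp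
  qed
  define u where "u z = exp (z *\<^sub>R w) * (x0 - J z)" for z
  have "solves w f u"
    unfolding solves_def
  proof safe
    fix z :: real assume z: "z <= 0"
    have "(u has_vector_derivative (exp (z *\<^sub>R w) * (0 - - ?g z) + exp (z *\<^sub>R w) * w * (x0 - J z))) (at z within {..0})"
      unfolding u_def
      by (intro has_vector_derivative_mult has_vector_derivative_diff J z has_vector_derivative_const exp_scaleR_has_vector_derivative_right)
    moreover have "exp (z *\<^sub>R w) * ?g z = f z"
      by (simp add: mult.assoc[symmetric] exp_minus_inverse)
    ultimately show "(u has_vector_derivative w * u z + f z) (at z within {..0})"
      by (simp add: u_def mult_ac add.commute)
  qed
  moreover have "u 0 = x0" by (simp add: u_def J_def)
  moreover have "u z \<in> S" if "z <= 0" for z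
  proof -
    have "J z \<in> S" unfolding J_def
    proof (rule functional_subspace_integral[OF S(1)])
      show "?g t \<in> S" if "t \<in> {z..0}" for t using S(2)[of t] S(4)[of "f t" "- t"] that by simp
      show "?g integrable_on {z..0}" by (rule integrable_continuous_interval[OF continuous_on_subset[OF g]]) auto
    qed
    then show ?thesis unfolding u_def
      by (intro S(4) subspace_diff functional_subspace_subspace S)
  qed
  ultimately show ?thesis by blast
qed

text \<open>The solution with value 0 at 0 is corrected by the homogeneous solution that carries its
  growth: q s = exp(s w) u0 s has a limit L at minus infinity, and u0 - exp(-z w) L decays.\<close>

lemma decaying_exists:
  fixes w :: "'a::banach_ring"
  assumes w: "!!t. t >= 0 ==> norm (exp (- (t *\<^sub>R w))) <= exp (- nu * t)" and nu: "nu >= -1/4"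
    and f: "continuous_on {..0} f" and fb: "!!z. z <= 0 ==> norm (f z) <= F * exp (3/4 * z)"
    and S: "functional_subspace S" "!!z. z <= 0 ==> f z \<in> S" "!!t x. x \<in> S ==> exp (t *\<^sub>R w) * x \<in> S"
  shows "\<exists>u. solves (- w) f u & (\<forall>z\<le>0. u z \<in> S) & (\<forall>z\<le>0. norm (u z) <= F / (nu + 3/4) * exp (3/4 * z))"
proof -
  have F: "F >= 0" using order_trans[OF norm_ge_zero fb[of 0]] by simp
  have Sm: "exp (t *\<^sub>R (- w)) * x \<in> S" if "x \<in> S" for t x using S(3)[OF that, of "- t"] by simp
  obtain u0 where u0: "solves (- w) f u0" "u0 0 = 0" "!!z. z <= 0 ==> u0 z \<in> S"
    using solves_exists[OF f S(1,2) subspace_0[OF functional_subspace_subspace[OF S(1)]] Sm] by blast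
  define q where "q s = exp (s *\<^sub>R w) * u0 s" for s
  have gr: "norm (exp (- (z *\<^sub>R w)) * (q b - q a)) <= F / (nu + 3/4) * exp (- nu * z) * exp ((nu + 3/4) * b)"
    if "a <= b" "b <= z" "z <= 0" for a b z
  proof -
    let ?\<phi> = "%s. F / (nu + 3/4) * exp (- nu * z) * exp ((nu + 3/4) * s)"
    have "norm (exp ((z - b) *\<^sub>R (- w)) * u0 b - exp ((z - a) *\<^sub>R (- w)) * u0 a) <= ?\<phi> b - ?\<phi> a"
    proof (rule solves_gronwall[OF u0(1), where \<phi>'="%s. F * exp (- nu * z) * exp ((nu + 3/4) * s)"])
      show "(?\<phi> has_vector_derivative F * exp (- nu * z) * exp ((nu + 3/4) * s)) (at s)" for s
        using nu by (auto intro!: derivative_eq_intros simp: has_real_derivative_iff_has_vector_derivative[symmetric])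
      fix s assume s: "a <= s" "s <= b"
      have "norm (exp ((z - s) *\<^sub>R (- w)) * f s) <= exp (- nu * (z - s)) * (F * exp (3/4 * s))"
        by (rule norm_mult_le) (use w[of "z - s"] fb[of s] s that in auto)
      then show "norm (exp ((z - s) *\<^sub>R (- w)) * f s) <= F * exp (- nu * z) * exp ((nu + 3/4) * s)"
        by (simp add: exp_add[symmetric] algebra_simps)
    qed (use that in auto)
    moreover have "exp ((z - s) *\<^sub>R (- w)) * u0 s = exp (- (z *\<^sub>R w)) * q s" for s
      using exp_diff_mult[of z s "- w"] by (simp add: q_def mult_ac)
    ultimately have "norm (exp (- (z *\<^sub>R w)) * (q b - q a)) <= ?\<phi> b - ?\<phi> a" by (simp add: right_diff_distrib)
    moreover have "?\<phi> a >= 0" using F nu by simp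
    ultimately show ?thesis by linarith
  qed
  \<comment> \<open>At z = 0 the bound \<open>gr\<close> for the increments of q is an exponential
    in the upper end point, with rate nu + 3/4 > 0.\<close>
  have "Cauchy (%n. q (- real n))"
  proof (rule metric_CauchyI)
    fix e :: real assume "e > 0"
    have "(%n. F / (nu + 3/4) * exp ((nu + 3/4) * (- real n))) \<longlonglongrightarrow> F / (nu + 3/4) * 0"
      using nu by (intro tendsto_intros filterlim_compose[OF exp_at_bot] filterlim_tendsto_pos_mult_at_bot[OF tendsto_const])
        (auto simp: filterlim_uminus_at_bot filterlim_real_sequentially)
    then have "\<forall>\<^sub>F n in sequentially. F / (nu + 3/4) * exp ((nu + 3/4) * (- real n)) < e"
      by (rule order_tendstoD) (use \<open>e > 0\<close> in simp)
    then obtain N where N: "!!n. n >= N ==> F / (nu + 3/4) * exp ((nu + 3/4) * (- real n)) < e"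
      unfolding eventually_sequentially by blast
    have "dist (q (- real m)) (q (- real n)) < e" if "m >= N" "n >= N" for m n
    proof -
      have *: "dist (q (- real m)) (q (- real n)) < e" if "m >= N" "n >= m" for m n
        using gr[of "- real n" "- real m" 0] N[OF that(1)] that by (auto simp: dist_norm)
      show ?thesis using *[of m n] *[of n m] that by (cases "n >= m") (auto simp: dist_commute)
    qed
    then show "\<exists>M. \<forall>m\<ge>M. \<forall>n\<ge>M. dist (q (- real m)) (q (- real n)) < e" by blast
  qed
  then obtain L where L: "(%n. q (- real n)) \<longlonglongrightarrow> L" using Cauchy_convergent_iff convergent_def by blast
  have LS: "L \<in> S"
    by (rule closed_sequentially[OF functional_subspace_closed[OF S(1)] _ L]) (simp only: q_def, intro S(3) u0(3), simp)
  define u where "u z = u0 z - exp (z *\<^sub>R (- w)) * L" for z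
  have "solves (- w) (%_. 0) (%z. exp (z *\<^sub>R (- w)) * L)"
    unfolding solves_def
  proof safe
    fix z :: real
    show "((%z. exp (z *\<^sub>R (- w)) * L) has_vector_derivative - w * (exp (z *\<^sub>R (- w)) * L) + 0) (at z within {..0})"
      by (rule has_vector_derivative_eq_rhs[OF has_vector_derivative_mult_left[OF exp_scaleR_has_vector_derivative_right]])
        (simp add: mult_ac)
  qed
  from solves_diff[OF u0(1) this] have "solves (- w) f u" by (simp add: u_def[abs_def])
  moreover have "u z \<in> S" if "z <= 0" for z
    unfolding u_def by (intro subspace_diff functional_subspace_subspace S Sm LS u0(3) that)
  moreover have "norm (u z) <= F / (nu + 3/4) * exp (3/4 * z)" if "z <= 0" for z
  proof -
    have "norm (exp (- (z *\<^sub>R w)) * (q z - L)) <= F / (nu + 3/4) * exp (- nu * z) * exp ((nu + 3/4) * z)"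
    proof (rule tendsto_upperbound)
      show "(%n. norm (exp (- (z *\<^sub>R w)) * (q z - q (- real n)))) \<longlonglongrightarrow> norm (exp (- (z *\<^sub>R w)) * (q z - L))"
        by (intro tendsto_intros L)
      have "\<forall>\<^sub>F n in sequentially. - real n <= z"
        using eventually_ge_at_top[of "nat \<lceil>- z\<rceil>"] by eventually_elim linarith
      then show "\<forall>\<^sub>F n in sequentially. norm (exp (- (z *\<^sub>R w)) * (q z - q (- real n))) <= F / (nu + 3/4) * exp (- nu * z) * exp ((nu + 3/4) * z)"
        by eventually_elim (rule gr; use that in simp)
    qed simp
    moreover have "exp (- (z *\<^sub>R w)) * (q z - L) = u z"
      by (simp add: q_def u_def right_diff_distrib mult.assoc[symmetric] exp_minus_inverse[of "- (z *\<^sub>R w)", simplified])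
    ultimately show ?thesis by (simp add: mult.assoc exp_add[symmetric] algebra_simps)
  qed
  ultimately show ?thesis by blast
qed

text \<open>The two alternatives for \<open>B\<close> reflect that near a vanishing frequency the decay of the right-hand side
  has to be used, while for large frequencies a power of \<open>nu\<close> is gained.\<close>

lemma dirichlet_bound:
  fixes w :: "'a::banach_ring"
  assumes w: "!!t. t >= 0 ==> norm (exp (- (t *\<^sub>R w))) <= exp (- nu * t)" and nu: "nu >= -1/4"
    and u: "solves w g u" "u 0 = 0" and g: "!!z. z <= 0 ==> norm (g z) <= G * exp (3/4 * z)"
    and G: "G <= B \<or> (nu > 0 & G <= nu * B)" and z: "z <= 0"
  shows "norm (u z) <= B * exp (- z / 4)"
proof -
  have G0: "G >= 0" using order_trans[OF norm_ge_zero g[of 0]] by simp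
  have E: "norm (exp ((z - s) *\<^sub>R w) * g s) <= G * exp (- nu * (s - z)) * exp (3/4 * s)" if "z <= s" "s <= 0" for s
    using norm_mult_le[OF w[of "s - z"] g[of s]] that by (simp add: exp_scale_neg mult_ac)
  from G show ?thesis
  proof
    assume B: "G <= B"
    have "norm (exp ((z - 0) *\<^sub>R w) * u 0 - exp ((z - z) *\<^sub>R w) * u z) <= G * exp (- z/4) * exp 0 - G * exp (- z/4) * exp z"
    proof (rule solves_gronwall[OF u(1) z, where \<phi>="%s. G * exp (- z/4) * exp s" and \<phi>'="%s. G * exp (- z/4) * exp s"])
      show "((%s. G * exp (- z/4) * exp s) has_vector_derivative G * exp (- z/4) * exp s) (at s)" for s
        by (auto intro!: derivative_eq_intros simp: has_real_derivative_iff_has_vector_derivative[symmetric])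
      fix s assume s: "z <= s" "s <= 0"
      \<comment> \<open>The unknown rate is replaced by the worst one, -1/4; together with exp(3/4
        s) this leaves exp(s), which is integrable.\<close>
      have "- nu * (s - z) <= 1/4 * (s - z)" using nu s by (intro mult_right_mono) auto
      then have "exp (- nu * (s - z)) * exp (3/4 * s) <= exp (- z/4) * exp s"
        by (simp add: exp_add[symmetric] algebra_simps)
      with E[OF s] G0 show "norm (exp ((z - s) *\<^sub>R w) * g s) <= G * exp (- z/4) * exp s"
        by (smt (verit) mult.assoc mult_left_mono)
    qed simp
    then have "norm (u z) <= G * exp (- z/4) - G * exp (- z/4) * exp z" using u(2) by simp
    moreover have "G * exp (- z/4) * exp z >= 0" using G0 by simp
    moreover have "G * exp (- z/4) <= B * exp (- z/4)" using B by simp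
    ultimately show ?thesis by linarith
  next
    assume B: "nu > 0 & G <= nu * B"
    let ?\<phi> = "%s. - G / nu * exp (- nu * (s - z))"
    have "norm (exp ((z - 0) *\<^sub>R w) * u 0 - exp ((z - z) *\<^sub>R w) * u z) <= ?\<phi> 0 - ?\<phi> z"
    proof (rule solves_gronwall[OF u(1) z, where \<phi>'="%s. G * exp (- nu * (s - z))"])
      show "(?\<phi> has_vector_derivative G * exp (- nu * (s - z))) (at s)" for s
        using B by (auto intro!: derivative_eq_intros simp: has_real_derivative_iff_has_vector_derivative[symmetric])
      fix s assume s: "z <= s" "s <= 0"
      have "G * exp (- nu * (s - z)) * exp (3/4 * s) <= G * exp (- nu * (s - z)) * 1"
        using s G0 by (intro mult_left_mono) auto
      with E[OF s] show "norm (exp ((z - s) *\<^sub>R w) * g s) <= G * exp (- nu * (s - z))" by simp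
    qed simp
    moreover have "?\<phi> 0 <= 0" using G0 B by simp
    ultimately have "norm (u z) <= G / nu" using u(2) by simp
    also have "... <= B" using B by (simp add: field_simps)
    also have "B <= B * exp (- z/4)"
    proof -
      have "0 <= nu * B" using B G0 by linarith
      then have "B >= 0" using B by (simp add: zero_le_mult_iff)
      then show ?thesis using z mult_left_mono[of 1 "exp (- z/4)" B] by simp
    qed
    finally show ?thesis .
  qed
qed

section \<open>The fundamental solution of the fiber problem over a normed algebra\<close>

definition lconv :: "(int => real => 'a::real_normed_algebra) => (int => real => 'a) => int => real => 'a" where
  "lconv d th k z = (\<Sum>\<^sub>\<infinity>kap. d kap z * th (k - kap) z)"

text \<open>The second order equation \<open>th'' = w^2 th + b (d * th)\<close> is factored into \<open>th' = w th + b u\<close>,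
  \<open>u' = -w u + d * th\<close>, so that no division by \<open>w\<close> is needed; \<open>th'(0) = w th(0) + b u(0)\<close>.\<close>

definition fundamental ::
  "(int => 'a) => 'a => (int => real => 'a::real_normed_algebra_1) => real => (int => int => real => 'a) => (int => int => real => 'a) => bool" where
  "fundamental w b d tau Th U \<longleftrightarrow>
     (\<forall>k m. solves (- w k) (lconv d (%j. Th j m) k) (U k m) & solves (w k) (%z. b * U k m z) (Th k m) &
        Th k m 0 = (if k = m then 1 else 0)) &
     (\<exists>C. \<forall>k m. \<forall>z\<le>0. norm (Th k m z) <= C * ew (-tau) (k - m) * exp (- z / 4) &
        norm (U k m z) <= C * ew (-tau) (k - m) * exp (3/4 * z))"

lemma tendsto_exp_mult_at_bot:
  assumes "(c::real) > 0" shows "((%z. exp (c * z)) \<longlongrightarrow> 0) at_bot"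
  by (intro filterlim_compose[OF exp_at_bot] filterlim_tendsto_pos_mult_at_bot[OF tendsto_const assms] filterlim_ident)

lemma tendsto_weighted_at_bot:
  assumes "nu >= -1/4" "!!z. z <= 0 ==> norm (u z) <= C * exp (3/4 * z)"
  shows "((%z. exp (nu * z) * norm (u z)) \<longlongrightarrow> 0) at_bot"
proof (rule tendsto_sandwich[of "%_. 0"])
  have "exp (nu * z) * norm (u z) <= C * exp ((nu + 3/4) * z)" if "z <= 0" for z
    using mult_left_mono[OF assms(2)[OF that], of "exp (nu * z)"] by (simp add: exp_add[symmetric] algebra_simps mult_exp_exp)
  then show "\<forall>\<^sub>F z in at_bot. exp (nu * z) * norm (u z) <= C * exp ((nu + 3/4) * z)"
    by (intro eventually_mono[OF eventually_le_at_bot[of 0]]) auto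
  show "((%z. C * exp ((nu + 3/4) * z)) \<longlongrightarrow> 0) at_bot"
    using tendsto_mult_left[OF tendsto_exp_mult_at_bot[of "nu + 3/4"], of C] assms(1) by simp
qed auto

lemma has_sum_diff:
  fixes f g :: "'i => 'a::real_normed_vector"
  assumes "(f has_sum a) A" "(g has_sum b) A" shows "((%x. f x - g x) has_sum a - b) A"
  using has_sum_add[OF assms(1) has_sum_bounded_linear[OF bounded_linear_minus[OF bounded_linear_ident] assms(2)]] by simp

text \<open>\<open>nu k\<close> stands for the real part of \<open>w k\<close>. Solving for u costs
  1/(nu + 3/4), solving for th costs 1 or 1/nu; \<open>b_bound\<close> says that norm b times the
  product of the two is at most M. N is the norm of convolution with d in weighted spaces, and
  \<open>small\<close> makes the composition a contraction with factor 1/2.\<close>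

locale fiber_system =
  fixes w :: "int => 'a::banach_ring" and b :: 'a and d :: "int => real => 'a"
    and D nu :: "int => real" and tau M :: real
  assumes w_exp: "!!k t. t >= 0 ==> norm (exp (- (t *\<^sub>R w k))) <= exp (- nu k * t)"
    and nu: "!!k. nu k >= -1/4"
    and b_bound: "!!k. norm b <= M * (nu k + 3/4) \<or> (nu k > 0 & norm b <= M * (nu k * (nu k + 3/4)))"
    and d_cont: "!!kap. continuous_on {..0} (d kap)"
    and d_bound: "!!kap z. z <= 0 ==> norm (d kap z) <= D kap * exp z"
    and D_summable: "(%kap. D kap * ew tau kap) summable_on UNIV"
    and tau: "tau >= 0" and M: "M >= 0"
    and small: "M * (\<Sum>\<^sub>\<infinity>kap. D kap * ew tau kap) <= 1/2"
begin

abbreviation "N \<equiv> (\<Sum>\<^sub>\<infinity>kap. D kap * ew tau kap)"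

text \<open>Weights for which convolution with d loses only the factor exp(tau |kap|), which
  \<open>D_summable\<close> pays for. Decaying weights control the columns of the fundamental
  matrix; growing ones admit data of polynomial growth, as uniqueness in Sobolev spaces of arbitrary
  order requires.\<close>

definition weight :: "(int => real) => bool" where
  "weight W \<longleftrightarrow> (\<forall>k. W k >= 0) & (\<forall>k kap. W (k - kap) <= ew tau kap * W k)"

lemma weight_diff: "weight (%k. ew (-tau) (k - m))"
proof -
  have "- tau * real_of_int \<bar>k - kap - m\<bar> <= tau * real_of_int \<bar>kap\<bar> + - tau * real_of_int \<bar>k - m\<bar>" for k kap
  proof -
    have "real_of_int \<bar>k - m\<bar> <= real_of_int \<bar>kap\<bar> + real_of_int \<bar>k - kap - m\<bar>" by linarith
    from mult_left_mono[OF this tau] show ?thesis by (simp add: algebra_simps)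
  qed
  then show ?thesis unfolding weight_def by (simp add: exp_add[symmetric])
qed

lemma weight_growing: "weight (%k. ew tau k)"
proof -
  have "tau * real_of_int \<bar>k - kap\<bar> <= tau * real_of_int \<bar>kap\<bar> + tau * real_of_int \<bar>k\<bar>" for k kap
  proof -
    have "real_of_int \<bar>k - kap\<bar> <= real_of_int \<bar>kap\<bar> + real_of_int \<bar>k\<bar>" by linarith
    from mult_left_mono[OF this tau] show ?thesis by (simp add: algebra_simps)
  qed
  then show ?thesis unfolding weight_def by (simp add: exp_add[symmetric])
qed

lemma D_nonneg: "D kap >= 0"
  using order_trans[OF norm_ge_zero d_bound[of 0 kap]] by simp

lemma N_nonneg: "N >= 0"
  by (intro infsum_nonneg) (simp add: D_nonneg)

lemma lconv_term:
  assumes W: "weight W" and z: "z <= 0" and b: "!!k. norm (th k z) <= C * W k * exp (- z / 4)" and C: "C >= 0"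
  shows "norm (d kap z * th (k - kap) z) <= D kap * ew tau kap * (C * W k * exp (3/4 * z))"
proof -
  have "norm (d kap z * th (k - kap) z) <= (D kap * exp z) * (C * W (k - kap) * exp (- z / 4))"
    by (rule norm_mult_le[OF d_bound[OF z] b])
  also have "... <= (D kap * exp z) * (C * (ew tau kap * W k) * exp (- z / 4))"
    by (intro mult_left_mono mult_right_mono) (use W C D_nonneg in \<open>auto simp: weight_def\<close>)
  also have "... = D kap * ew tau kap * (C * W k * (exp z * exp (- z / 4)))" by (simp add: mult_ac)
  also have "exp z * exp (- z / 4) = exp (3/4 * z)" by (simp add: exp_add[symmetric])
  finally show ?thesis .
qed

lemma lconv_summable:
  assumes W: "weight W" and z: "z <= 0" and b: "!!k. norm (th k z) <= C * W k * exp (- z / 4)" and C: "C >= 0"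
  shows "(%kap. d kap z * th (k - kap) z) summable_on UNIV"
    and "norm (lconv d th k z) <= N * C * W k * exp (3/4 * z)"
proof -
  have s: "(%kap. D kap * ew tau kap * (C * W k * exp (3/4 * z))) summable_on UNIV"
    by (rule summable_on_cmult_left[OF D_summable])
  have "(%kap. norm (d kap z * th (k - kap) z)) summable_on UNIV"
    by (rule summable_on_comparison_test[OF s]) (use lconv_term[where th=th, OF W z b C] in auto)
  then show s': "(%kap. d kap z * th (k - kap) z) summable_on UNIV" by (rule abs_summable_summable)
  have "norm (lconv d th k z) <= (\<Sum>\<^sub>\<infinity>kap. D kap * ew tau kap * (C * W k * exp (3/4 * z)))"
    unfolding lconv_def
    by (rule norm_infsum_le[OF has_sum_infsum[OF s'] has_sum_infsum[OF s]]) (rule lconv_term[where th=th, OF W z b C])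
  also have "... = N * (C * W k * exp (3/4 * z))" by (rule infsum_cmult_left) (rule D_summable)
  finally show "norm (lconv d th k z) <= N * C * W k * exp (3/4 * z)" by (simp add: mult_ac)
qed

lemma lconv_diff:
  assumes W: "weight W" and z: "z <= 0" and C: "C >= 0"
    and b: "!!k. norm (th k z) <= C * W k * exp (- z / 4)" "!!k. norm (th' k z) <= C * W k * exp (- z / 4)"
  shows "lconv d th k z - lconv d th' k z = lconv d (%k z. th k z - th' k z) k z"
proof -
  have "((%kap. d kap z * th (k - kap) z - d kap z * th' (k - kap) z) has_sum lconv d th k z - lconv d th' k z) UNIV"
    unfolding lconv_def
    by (intro has_sum_diff has_sum_infsum) (rule lconv_summable[where th=th, OF W z b(1) C] lconv_summable[where th=th', OF W z b(2) C])+
  then show ?thesis by (simp add: lconv_def right_diff_distrib infsumI)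
qed

lemma lconv_continuous:
  assumes W: "weight W" and b: "!!k z. z <= 0 ==> norm (th k z) <= C * W k * exp (- z / 4)" and C: "C >= 0"
    and c: "!!k. continuous_on {..0} (th k)"
  shows "continuous_on {..0} (lconv d th k)"
proof -
  have "uniform_limit {..0} (%X z. \<Sum>kap\<in>X. d kap z * th (k - kap) z) (%z. \<Sum>\<^sub>\<infinity>kap. d kap z * th (k - kap) z) (finite_subsets_at_top UNIV)"
  proof (rule Weierstrass_m_test_general)
    show "(%kap. D kap * ew tau kap * (C * W k)) summable_on UNIV"
      by (rule summable_on_cmult_left[OF D_summable])
    fix kap and z :: real assume "z \<in> {..0}"
    then have z: "z <= 0" by simp
    have "norm (d kap z * th (k - kap) z) <= D kap * ew tau kap * (C * W k * exp (3/4 * z))"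
      by (rule lconv_term[where th=th, OF W z b[OF z] C])
    also have "... <= D kap * ew tau kap * (C * W k * 1)"
      by (intro mult_left_mono) (use z C W D_nonneg in \<open>auto simp: weight_def\<close>)
    finally show "norm (d kap z * th (k - kap) z) <= D kap * ew tau kap * (C * W k)" by simp
  qed
  moreover have "\<forall>\<^sub>F X in finite_subsets_at_top UNIV. continuous_on {..0} (%z. \<Sum>kap\<in>X. d kap z * th (k - kap) z)"
    by (intro always_eventually allI continuous_on_sum continuous_on_mult d_cont c)
  ultimately have "continuous_on {..0} (%z. \<Sum>\<^sub>\<infinity>kap. d kap z * th (k - kap) z)"
    by (intro uniform_limit_theorem) auto
  then show ?thesis by (simp add: lconv_def[abs_def])
qed

text \<open>The two alternatives of \<open>b_bound\<close> become those of
  \<open>dirichlet_bound\<close>; both lead to the same constant M F.\<close>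

lemma response_bound:
  assumes "solves (w k) u th" "th 0 = 0" and F: "F >= 0"
    and "!!z. z <= 0 ==> norm (u z) <= norm b * (F / (nu k + 3/4)) * exp (3/4 * z)" and z: "z <= 0"
  shows "norm (th z) <= M * F * exp (- z / 4)"
proof (rule dirichlet_bound[OF w_exp nu assms(1,2,4) _ z])
  have p: "nu k + 3/4 > 0" using nu[of k] by simp
  from b_bound[of k]
  show "norm b * (F / (nu k + 3/4)) <= M * F \<or> 0 < nu k & norm b * (F / (nu k + 3/4)) <= nu k * (M * F)"
  proof
    assume "norm b <= M * (nu k + 3/4)"
    from mult_right_mono[OF this F] show ?thesis using p by (simp add: field_simps)
  next
    assume a: "nu k > 0 & norm b <= M * (nu k * (nu k + 3/4))"
    then have "norm b * F <= M * (nu k * (nu k + 3/4)) * F" using F by (intro mult_right_mono) auto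
    then show ?thesis using p a by (simp add: pos_divide_le_eq mult_ac)
  qed
qed

section \<open>The response map and its contraction property\<close>

text \<open>\<open>th'\<close> arises from \<open>th\<close> by solving first for \<open>u\<close> and then for \<open>th'\<close>; a fixed point solves the system.\<close>

definition response :: "(int => real) => real => (int => real => 'a) => (int => real => 'a) => (int => real => 'a) => bool" where
  "response W C th u th' \<longleftrightarrow> (\<forall>k. solves (- w k) (%z. b * lconv d th k z) (u k) & solves (w k) (u k) (th' k) &
     ((%z. exp (nu k * z) * norm (u k z)) \<longlongrightarrow> 0) at_bot & (\<forall>z\<le>0. norm (th k z) <= C * W k * exp (- z / 4)))"

text \<open>The difference of two responses is a response with zero boundary value to the difference
  of the arguments. Decay at minus infinity enters through \<open>decaying_bound\<close>, the
  boundary value through \<open>response_bound\<close>, and the constants multiply to M N <=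
  1/2.\<close>

lemma response_contraction:
  assumes W: "weight W" and 1: "response W C th u th'" and 2: "response W C \<eta> v \<eta>'" and C: "C >= 0" "c >= 0" and 0: "!!k. th' k 0 = \<eta>' k 0"
    and c: "!!k z. z <= 0 ==> norm (th k z - \<eta> k z) <= c * W k * exp (- z / 4)" and z: "z <= 0"
  shows "norm (th' k z - \<eta>' k z) <= c / 2 * W k * exp (- z / 4)"
proof -
  note r1 = 1[unfolded response_def, rule_format] and r2 = 2[unfolded response_def, rule_format]
  have W0: "W k >= 0" using W by (simp add: weight_def)
  have "norm (u k z - v k z) <= norm b * (N * c * W k) / (nu k + 3/4) * exp (3/4 * z)" if "z <= 0" for z
  proof (rule decaying_bound[OF w_exp nu solves_diff _ _ that])
    show "solves (- w k) (%z. b * lconv d th k z) (u k)" "solves (- w k) (%z. b * lconv d \<eta> k z) (v k)" using r1 r2 by auto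
    show "norm (b * lconv d th k z - b * lconv d \<eta> k z) <= norm b * (N * c * W k) * exp (3/4 * z)" if z: "z <= 0" for z
    proof -
      have "lconv d th k z - lconv d \<eta> k z = lconv d (%k z. th k z - \<eta> k z) k z"
        by (rule lconv_diff[where th=th and th'=\<eta>, OF W z C(1)]) (use r1 r2 z in auto)
      moreover have "norm (lconv d (%k z. th k z - \<eta> k z) k z) <= N * c * W k * exp (3/4 * z)"
        by (rule lconv_summable(2)[where th="%k z. th k z - \<eta> k z", OF W z c[OF z] C(2)])
      ultimately show ?thesis using norm_mult_le[OF order_refl, of _ _ b] unfolding right_diff_distrib[symmetric] by (simp add: mult.assoc)
    qed
    have "((%z. exp (nu k * z) * norm (u k z) + exp (nu k * z) * norm (v k z)) \<longlongrightarrow> 0) at_bot"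
      using tendsto_add[of _ 0 _ _ 0] r1 r2 by fastforce
    then show "((%z. exp (nu k * z) * norm (u k z - v k z)) \<longlongrightarrow> 0) at_bot"
      by (rule Lim_null_comparison[rotated]) (simp add: norm_triangle_ineq4 flip: distrib_left)
  qed
  then have "norm (th' k z - \<eta>' k z) <= M * (N * c * W k) * exp (- z / 4)"
    by (intro response_bound[OF solves_diff _ _ _ z]) (use r1 r2 0 C W0 N_nonneg in auto)
  also have "... = M * N * (c * W k * exp (- z / 4))" by (simp add: mult_ac)
  also have "... <= 1/2 * (c * W k * exp (- z / 4))" by (intro mult_right_mono small) (use C W0 in auto)
  finally show ?thesis by simp
qed

text \<open>Both fixed points are bounded by C, so their difference is bounded by 2C, and after n
  applications of the contraction by 2C / 2^n.\<close>

lemma response_unique: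
  assumes W: "weight W" and 1: "response W C th u th" and 2: "response W C \<eta> v \<eta>" and C: "C >= 0" and 0: "!!k. th k 0 = \<eta> k 0" and z: "z <= 0"
  shows "th k z = \<eta> k z"
proof -
  have "norm (th k z - \<eta> k z) <= 2 * C / 2 ^ n * W k * exp (- z / 4)" if "z <= 0" for n k z
    using that
  proof (induction n arbitrary: k z)
    case 0
    then have "norm (th k z) <= C * W k * exp (- z / 4)" "norm (\<eta> k z) <= C * W k * exp (- z / 4)"
      using 1 2 by (auto simp: response_def)
    with norm_triangle_ineq4[of "th k z" "\<eta> k z"] show ?case by simp
  next
    case (Suc n)
    from response_contraction[OF W 1 2 C _ 0 Suc.IH Suc.prems] show ?case using C by (simp add: mult.commute)
  qed
  from this[OF z] have "norm (th k z - \<eta> k z) <= 0 * W k * exp (- z / 4)"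
    by (intro LIMSEQ_le_const[of "%n. 2 * C / 2 ^ n * W k * exp (- z / 4)"] tendsto_intros LIMSEQ_divide_realpow_zero) auto
  then show ?thesis by simp
qed

text \<open>Translates between the two systems: \<open>response\<close> has the factor b inside its
  u, \<open>fundamental\<close> outside, so u is b * U.\<close>

lemma fundamental_response:
  assumes "solves (- w k) (lconv d th k) (U k)" "solves (w k) (%z. b * U k z) (th' k)"
    and "!!z. z <= 0 ==> norm (U k z) <= C * exp (3/4 * z)"
  shows "solves (- w k) (%z. b * lconv d th k z) (%z. b * U k z)" "((%z. exp (nu k * z) * norm (b * U k z)) \<longlongrightarrow> 0) at_bot"
proof -
  show "solves (- w k) (%z. b * lconv d th k z) (%z. b * U k z)"
    unfolding solves_def
  proof safe
    fix z :: real assume "z <= 0"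
    from has_vector_derivative_mult_right[OF assms(1)[unfolded solves_def, rule_format, OF this], of b]
    show "((%z. b * U k z) has_vector_derivative - w k * (b * U k z) + b * lconv d th k z) (at z within {..0})"
      by (simp add: algebra_simps)
  qed
  show "((%z. exp (nu k * z) * norm (b * U k z)) \<longlongrightarrow> 0) at_bot"
    by (rule tendsto_weighted_at_bot[OF nu, where C="norm b * C"]) (use norm_mult_le[OF order_refl assms(3), of _ b] in \<open>simp add: mult.assoc\<close>)
qed

lemma response_mono: "weight W ==> C <= C' ==> response W C th u th' ==> response W C' th u th'"
  unfolding response_def weight_def by (meson exp_ge_zero mult_right_mono order_trans)

text \<open>Uniqueness of Th comes from the contraction. It does not give U by cancelling b, which
  may vanish or be a zero divisor; instead the difference of the two U solves the homogeneous
  equation and decays, so \<open>decaying_bound\<close> applies with F = 0.\<close>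

lemma fundamental_unique:
  assumes "fundamental w b d tau Th1 U1" "fundamental w b d tau Th2 U2" "z <= 0"
  shows "U1 k m z = U2 k m z"
proof -
  let ?W = "%k. ew (-tau) (k - m)"
  have ex: "\<exists>C\<ge>0. response ?W C (%j. Th j m) (%k z. b * U k m z) (%j. Th j m) & (\<forall>k. \<forall>z\<le>0. norm (U k m z) <= C * ?W k * exp (3/4 * z))"
    if f: "fundamental w b d tau Th U" for Th U
  proof -
    obtain C where C: "!!k z. z <= 0 ==> norm (Th k m z) <= C * ?W k * exp (- z / 4)" "!!k z. z <= 0 ==> norm (U k m z) <= C * ?W k * exp (3/4 * z)"
      using f unfolding fundamental_def by blast
    note s = f[unfolded fundamental_def, THEN conjunct1, rule_format, of _ m]
    have "C >= 0" using order_trans[OF norm_ge_zero C(1)[of 0 m]] by simp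
    moreover note fundamental_response[where th="%j. Th j m" and th'="%j. Th j m" and U="%j. U j m", OF _ _ C(2)]
    ultimately show ?thesis using C s by (intro exI[of _ C]) (simp add: response_def)
  qed
  obtain C1 C2 where "C1 >= 0" "C2 >= 0"
    and r: "response ?W C1 (%j. Th1 j m) (%k z. b * U1 k m z) (%j. Th1 j m)" "response ?W C2 (%j. Th2 j m) (%k z. b * U2 k m z) (%j. Th2 j m)"
    and bU: "!!k z. z <= 0 ==> norm (U1 k m z) <= C1 * ?W k * exp (3/4 * z)" "!!k z. z <= 0 ==> norm (U2 k m z) <= C2 * ?W k * exp (3/4 * z)"
    using ex[OF assms(1)] ex[OF assms(2)] by (elim exE conjE) blast
  then have C: "C1 + C2 >= 0" "C1 <= C1 + C2" "C2 <= C1 + C2" by auto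
  note s = assms(1)[unfolded fundamental_def, THEN conjunct1, rule_format] assms(2)[unfolded fundamental_def, THEN conjunct1, rule_format]
  have t: "Th1 k m z = Th2 k m z" if "z <= 0" for k z
    using response_unique[OF weight_diff response_mono[OF weight_diff C(2) r(1)] response_mono[OF weight_diff C(3) r(2)] C(1) _ that] s by auto
  have "norm (U1 k m z - U2 k m z) <= 0 / (nu k + 3/4) * exp (3/4 * z)"
  proof (rule decaying_bound[OF w_exp nu solves_diff _ tendsto_weighted_at_bot[OF nu] assms(3)])
    show "solves (- w k) (lconv d (%j. Th1 j m) k) (U1 k m)" "solves (- w k) (lconv d (%j. Th2 j m) k) (U2 k m)" using s by auto
    show "norm (lconv d (%j. Th1 j m) k z - lconv d (%j. Th2 j m) k z) <= 0 * exp (3/4 * z)" if "z <= 0" for z using t[OF that] by (simp add: lconv_def)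
    show "norm (U1 k m z - U2 k m z) <= (C1 * ?W k + C2 * ?W k) * exp (3/4 * z)" if "z <= 0" for z
      using norm_triangle_ineq4[of "U1 k m z" "U2 k m z"] bU(1)[OF that, of k] bU(2)[OF that, of k] unfolding distrib_right by linarith
  qed
  then show ?thesis by simp
qed

text \<open>A contractive homomorphism preserves the equations and all bounds. Together with
  uniqueness in the target algebra this says that inserting values for the parameters and solving
  commute.\<close>

lemma fundamental_hom:
  assumes h: "contr_hom \<phi>" and f: "fundamental w b d tau Th U"
  shows "fundamental (%k. \<phi> (w k)) (\<phi> b) (%kap z. \<phi> (d kap z)) tau (%k m z. \<phi> (Th k m z)) (%k m z. \<phi> (U k m z))"
proof -
  obtain C where C: "!!k m z. z <= 0 ==> norm (Th k m z) <= C * ew (-tau) (k - m) * exp (- z / 4) &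
        norm (U k m z) <= C * ew (-tau) (k - m) * exp (3/4 * z)" using f unfolding fundamental_def by blast
  have C0: "C >= 0" using order_trans[OF norm_ge_zero C[of 0 0 0, THEN conjunct1]] by simp
  note s = f[unfolded fundamental_def, THEN conjunct1, rule_format]
  have eq: "\<phi> (lconv d (%j. Th j m) k z) = lconv (%kap z. \<phi> (d kap z)) (%j z. \<phi> (Th j m z)) k z" if "z <= 0" for k m z
  proof -
    have "(%kap. d kap z * Th (k - kap) m z) summable_on UNIV"
      using lconv_summable(1)[OF weight_diff[of m] that, of "%j. Th j m" C] C[OF that] C0 by auto
    from has_sum_bounded_linear[OF contr_hom_bounded_linear[OF h] has_sum_infsum[OF this]]
    show ?thesis by (simp add: lconv_def infsumI contr_hom_simps[OF h])
  qed
  show ?thesis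
    unfolding fundamental_def
  proof (intro conjI allI)
    fix k m
    show "solves (- \<phi> (w k)) (lconv (%kap z. \<phi> (d kap z)) (%j z. \<phi> (Th j m z)) k) (%z. \<phi> (U k m z))"
      using solves_hom[OF h, of "- w k" "lconv d (%j. Th j m) k" "U k m"] s eq
      unfolding solves_def by (simp add: contr_hom_simps[OF h])
    show "solves (\<phi> (w k)) (%z. \<phi> b * \<phi> (U k m z)) (%z. \<phi> (Th k m z))"
      using solves_hom[OF h, of "w k" "%z. b * U k m z" "Th k m"] s by (simp add: contr_hom_simps[OF h])
    show "\<phi> (Th k m 0) = (if k = m then 1 else 0)" using s by (simp add: contr_hom_simps[OF h])
  next
    show "\<exists>C. \<forall>k m. \<forall>z\<le>0. norm (\<phi> (Th k m z)) <= C * ew (-tau) (k - m) * exp (- z / 4) &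
        norm (\<phi> (U k m z)) <= C * ew (-tau) (k - m) * exp (3/4 * z)"
      using C contr_hom_simps(8)[OF h] by (intro exI[of _ C]) (meson order_trans)
  qed
qed

text \<open>\<open>S kap\<close> and \<open>S' kap\<close> constrain the entries of Th and U on the
  band k - m = kap. The hypotheses keep the iteration inside them: multiplication by b leads from S'
  to S and by d from S to S'. With UNIV in both places the lemma is plain existence.\<close>

lemma fundamental_exists:
  assumes S: "!!kap. functional_subspace (S kap)" and S': "!!kap. functional_subspace (S' kap)"
    and one: "1 \<in> S 0"
    and bS: "!!kap x. x \<in> S' kap ==> b * x \<in> S kap"
    and dS: "!!kap kap' z x. z <= 0 ==> x \<in> S kap' ==> d kap z * x \<in> S' (kap + kap')"
    and eS: "!!kap k t x. x \<in> S kap ==> exp (t *\<^sub>R w k) * x \<in> S kap"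
    and eS': "!!kap k t x. x \<in> S' kap ==> exp (t *\<^sub>R w k) * x \<in> S' kap"
  shows "\<exists>Th U. fundamental w b d tau Th U &
    (\<forall>k m. \<forall>z\<le>0. norm (Th k m z) <= 2 * ew (-tau) (k - m) * exp (- z / 4) &
        norm (U k m z) <= 2 * N / (nu k + 3/4) * ew (-tau) (k - m) * exp (3/4 * z) &
        Th k m z \<in> S (k - m) & U k m z \<in> S' (k - m))"
proof -
  let ?W = "%m k::int. ew (-tau) (k - m) :: real"
  note S0 = functional_subspace_subspace[OF S]
  define A where "A m th \<longleftrightarrow> (\<forall>k. continuous_on {..0} (th k) & (\<forall>z\<le>0. th k z \<in> S (k - m) & norm (th k z) <= 2 * ?W m k * exp (- z / 4)))"
    for m and th :: "int => real => 'a"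
  \<comment> \<open>One step of the iteration is a relation and not a map, since the intermediate
    solutions are only known to exist.\<close>
  define P where "P m th u th' \<longleftrightarrow> A m th' & (\<forall>k. solves (- w k) (lconv d th k) (u k) & solves (w k) (%z. b * u k z) (th' k) & th' k 0 = (if k = m then 1 else 0) &
      (\<forall>z\<le>0. u k z \<in> S' (k - m) & norm (u k z) <= 2 * N / (nu k + 3/4) * ?W m k * exp (3/4 * z)))" for m th u th'
  have Aresp: "response (?W m) 2 th (%k z. b * u k z) th'" if A: "A m th" and P: "P m th u th'" for m th u th'
  proof -
    have "norm (u k z) <= 2 * N / (nu k + 3/4) * ?W m k * exp (3/4 * z)" if "z <= 0" for k z using P that unfolding P_def by blast
    note fr = fundamental_response[where th=th and U=u and th'=th', OF _ _ this]
    show ?thesis unfolding response_def using A P fr unfolding A_def P_def by blast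
  qed
  have ex: "\<exists>u th'. P m th u th'" if A: "A m th" for m th
  proof -
    have A': "!!k. continuous_on {..0} (th k)" "!!k z. z <= 0 ==> th k z \<in> S (k - m)" "!!k z. z <= 0 ==> norm (th k z) <= 2 * ?W m k * exp (- z / 4)"
      using A by (auto simp: A_def)
    have "\<forall>k. \<exists>u. solves (- w k) (lconv d th k) u & (\<forall>z\<le>0. u z \<in> S' (k - m)) & (\<forall>z\<le>0. norm (u z) <= N * 2 * ?W m k / (nu k + 3/4) * exp (3/4 * z))"
    proof (rule allI, rule decaying_exists[OF w_exp nu _ _ S'])
      fix k
      show "continuous_on {..0} (lconv d th k)" by (rule lconv_continuous[where th=th, OF weight_diff A'(3) _ A'(1)]) auto
      show "norm (lconv d th k z) <= N * 2 * ?W m k * exp (3/4 * z)" if "z <= 0" for z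
        by (rule lconv_summable(2)[where th=th, OF weight_diff that A'(3)[OF that]]) simp
      show "lconv d th k z \<in> S' (k - m)" if z: "z <= 0" for z
        unfolding lconv_def
      proof (rule functional_subspace_infsum[OF S'])
        show "d kap z * th (k - kap) z \<in> S' (k - m)" for kap using dS[OF z A'(2)[OF z], of kap "k - kap"] by simp
      qed
    qed (auto intro: eS')
    from choice[OF this] obtain u where u: "!!k. solves (- w k) (lconv d th k) (u k)" "!!k z. z <= 0 ==> u k z \<in> S' (k - m)"
        "!!k z. z <= 0 ==> norm (u k z) <= N * 2 * ?W m k / (nu k + 3/4) * exp (3/4 * z)"
      by blast
    have "\<forall>k. \<exists>v. solves (w k) (%z. b * u k z) v & v 0 = (if k = m then 1 else 0) & (\<forall>z\<le>0. v z \<in> S (k - m))"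
      by (rule allI, rule solves_exists) (use one in \<open>auto intro!: continuous_on_mult continuous_on_const solves_continuous[OF u(1)] S bS u(2) eS subspace_0 S0\<close>)
    from choice[OF this] obtain v where v: "!!k. solves (w k) (%z. b * u k z) (v k)" "!!k. v k 0 = (if k = m then 1 else 0)" "!!k z. z <= 0 ==> v k z \<in> S (k - m)"
      by blast
    \<comment> \<open>Half of the radius 2 is used by the homogeneous solution through the boundary
      value, the other half by the response, of size M N 2 <= 1.\<close>
    have "norm (v k z) <= 2 * (?W m k * exp (- z / 4))" if z: "z <= 0" for k z
    proof -
      let ?e = "%z. exp (z *\<^sub>R w k) * (if k = m then 1 else 0)"
      have "solves (w k) (%_. 0) ?e"
        unfolding solves_def by (auto intro!: has_vector_derivative_at_within[OF exp_scaleR_has_vector_derivative_left])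
      from solves_diff[OF v(1)[of k] this] have sv: "solves (w k) (%z. b * u k z) (%z. v k z - ?e z)" by simp
      have "norm (v k z - ?e z) <= M * (N * 2 * ?W m k) * exp (- z / 4)"
      proof (rule response_bound[OF sv _ _ _ z])
        show "norm (b * u k z) <= norm b * (N * 2 * ?W m k / (nu k + 3/4)) * exp (3/4 * z)" if "z <= 0" for z
          using norm_mult_le[OF order_refl u(3)[OF that], of b k] by (simp add: mult_ac)
      qed (use v(2) N_nonneg in auto)
      moreover have "M * (N * 2 * ?W m k) * exp (- z / 4) <= 1 * (?W m k * exp (- z / 4))"
        using mult_right_mono[OF small, of "2 * (?W m k * exp (- z / 4))"] by (simp add: mult_ac)
      moreover have "norm (?e z) <= 1 * (?W m k * exp (- z / 4))"
      proof (cases "k = m")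
        case True
        have "norm (?e z) <= exp (- nu k * (- z))" using w_exp[of "- z" k] z True by simp
        also have "... <= exp (- z / 4)" using mult_right_mono[of "- nu k" "1/4" "- z"] nu[of k] z by simp
        finally show ?thesis using True by simp
      qed simp
      ultimately show ?thesis using norm_triangle_ineq[of "v k z - ?e z" "?e z"] unfolding diff_add_cancel by linarith
    qed
    then have "P m th u v" unfolding P_def A_def using u v solves_continuous[OF v(1)] by (auto simp: mult_ac)
    then show ?thesis by blast
  qed
  have "\<forall>m. \<exists>th u th'. P m th u th' & (\<forall>k. \<forall>z\<le>0. th k z = th' k z)"
  proof
    fix m
    let ?W = "%k::int. ew (-tau) (k - m) :: real"
    have "A m (%_ _. 0)" by (simp add: A_def subspace_0 S0)
    then have "\<exists>x. \<forall>n. A m (x n) & (\<exists>u. P m (x n) u (x (Suc n)))"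
      by (intro dependent_nat_choice) (use ex P_def in blast)+
    then obtain x where x: "!!n. A m (x n) & (\<exists>u. P m (x n) u (x (Suc n)))" by blast
    have contr: "norm (th' k z - \<eta>' k z) <= c / 2 * ?W k * exp (- z / 4)"
      if "A m th" "P m th u th'" "A m \<eta>" "P m \<eta> v \<eta>'" "c >= 0" "!!k z. z <= 0 ==> norm (th k z - \<eta> k z) <= c * ?W k * exp (- z / 4)" "z <= 0"
      for th u th' \<eta> v \<eta>' k z c
      by (rule response_contraction[OF weight_diff Aresp[OF that(1,2)] Aresp[OF that(3,4)] _ that(5) _ that(6,7)]) (use that in \<open>auto simp: P_def\<close>)
    have geo: "norm (x (Suc n) k z - x n k z) <= 4 / 2 ^ n * ?W k * exp (- z / 4)" if "z <= 0" for n k z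
      using that
    proof (induction n arbitrary: k z)
      case 0
      then have "norm (x 1 k z) <= 2 * ?W k * exp (- z / 4)" "norm (x 0 k z) <= 2 * ?W k * exp (- z / 4)" using x by (auto simp: A_def)
      with norm_triangle_ineq4[of "x 1 k z" "x 0 k z"] show ?case by simp
    next
      case (Suc n)
      from x[of n] x[of "Suc n"] obtain u v where "P m (x n) u (x (Suc n))" "P m (x (Suc n)) v (x (Suc (Suc n)))" by blast
      from contr[OF _ this(2) _ this(1) _ Suc.IH Suc.prems] x show ?case by (simp add: mult.commute)
    qed
    \<comment> \<open>Dividing by the weight and by exp(-z/4) makes the increments geometric
      uniformly in (k, z), so that one Weierstrass test covers all modes and depths.\<close>
    let ?r = "%k z. exp (z / 4) / ?W k"
    let ?y = "%i (k, z). ?r k z *\<^sub>R (x (Suc i) k z - x i k z)"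
    let ?D = "UNIV \<times> {..0} :: (int \<times> real) set"
    have r1: "?W k * exp (- z / 4) * ?r k z = 1" for k z by (simp flip: exp_add)
    have ul: "uniform_limit ?D (%n q. \<Sum>i<n. ?y i q) (%q. \<Sum>i. ?y i q) sequentially"
    proof (rule Weierstrass_m_test)
      show "summable (%i. 4 / 2 ^ i :: real)" using summable_mult[OF summable_geometric[of "1/2 :: real"], of 4] by (simp add: power_divide)
      fix i and q :: "int \<times> real" assume q: "q \<in> ?D"
      obtain k z where kz: "q = (k, z)" by fastforce
      have "norm (?y i q) = ?r k z * norm (x (Suc i) k z - x i k z)" by (simp add: kz)
      also have "... <= ?r k z * (4 / 2 ^ i * ?W k * exp (- z / 4))" using q by (intro mult_left_mono geo) (auto simp: kz)
      also have "... = 4 / 2 ^ i * (?W k * exp (- z / 4) * ?r k z)" by (simp only: mult_ac)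
      finally show "norm (?y i q) <= 4 / 2 ^ i" unfolding r1 by simp
    qed
    define th where "th k z = x 0 k z + (?W k * exp (- z / 4)) *\<^sub>R (\<Sum>i. ?y i (k, z))" for k z
    have tel: "(?W k * exp (- z / 4)) *\<^sub>R (\<Sum>i<n. ?y i (k, z)) = x n k z - x 0 k z" for n k z
      by (simp only: split scaleR_sum_right scaleR_scaleR r1 scaleR_one sum_lessThan_telescope[of "%n. x n k z"])
    have close: "\<forall>\<^sub>F n in sequentially. \<forall>k. \<forall>z\<le>0. norm (x n k z - th k z) <= e * ?W k * exp (- z / 4)" if "e > 0" for e
      using uniform_limitD[OF ul that]
    proof eventually_elim
      case (elim n)
      have "norm (x n k z - th k z) <= (?W k * exp (- z / 4)) * e" if "z <= 0" for k z
      proof -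
        have "x n k z - th k z = (?W k * exp (- z / 4)) *\<^sub>R ((\<Sum>i<n. ?y i (k, z)) - (\<Sum>i. ?y i (k, z)))"
          using tel[of k z n] by (simp add: th_def scaleR_diff_right)
        then show ?thesis using elim[rule_format, of "(k, z)"] that by (simp add: dist_norm mult_left_mono less_imp_le)
      qed
      then show ?case by (simp add: mult_ac)
    qed
    have Ath: "A m th"
      unfolding A_def
    proof (intro conjI allI impI)
      fix k and z :: real assume z: "z <= 0"
      have "(%n. \<Sum>i<n. ?y i (k, z)) \<longlonglongrightarrow> (\<Sum>i. ?y i (k, z))" using tendsto_uniform_limitI[OF ul, of "(k, z)"] z by simp
      then have "(%n. x 0 k z + (?W k * exp (- z / 4)) *\<^sub>R (\<Sum>i<n. ?y i (k, z))) \<longlonglongrightarrow> th k z"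
        unfolding th_def by (intro tendsto_add tendsto_scaleR tendsto_const)
      then have lim: "(%n. x n k z) \<longlonglongrightarrow> th k z" unfolding tel by simp
      show "th k z \<in> S (k - m)" by (rule closed_sequentially[OF functional_subspace_closed[OF S] _ lim]) (use x z in \<open>auto simp: A_def\<close>)
      show "norm (th k z) <= 2 * ?W k * exp (- z / 4)" by (rule tendsto_upperbound[OF tendsto_norm[OF lim]]) (use x z in \<open>auto simp: A_def\<close>)
    next
      fix k
      have "uniform_limit {..0} (%n z. \<Sum>i<n. ?y i (k, z)) (%z. \<Sum>i. ?y i (k, z)) sequentially"
        using ul unfolding uniform_limit_iff by (fastforce elim: eventually_mono)
      then have "continuous_on {..0} (%z. \<Sum>i. ?y i (k, z))"
        by (rule uniform_limit_theorem[rotated]) (use x in \<open>auto intro!: always_eventually continuous_intros simp: A_def\<close>)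
      then show "continuous_on {..0} (th k)" unfolding th_def[abs_def] using x by (auto intro!: continuous_intros simp: A_def)
    qed
    \<comment> \<open>The limit th is compared with its own response th': the iterate x (Suc n) is
      close to th by convergence and close to th' by contraction.\<close>
    obtain u th' where P: "P m th u th'" using ex[OF Ath] by blast
    have "th k z = th' k z" if z: "z <= 0" for k z
    proof -
      have "norm (th k z - th' k z) <= e" if e: "e > 0" for e
      proof -
        let ?e = "e / 2 * ?r k z"
        have "?e > 0" using e by simp
        from close[OF this] obtain n where n: "!!n' k z. n' >= n ==> z <= 0 ==> norm (x n' k z - th k z) <= ?e * ?W k * exp (- z / 4)"
          unfolding eventually_sequentially by blast
        from x[of n] obtain v where v: "P m (x n) v (x (Suc n))" by blast
        have eq: "?e * ?W k * exp (- z / 4) = e / 2" "?e / 2 * ?W k * exp (- z / 4) = e / 4" using r1[of k z] by (simp_all add: field_simps)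
        have "norm (x (Suc n) k z - th' k z) <= e / 4"
          by (rule order_trans[OF contr[OF _ v Ath P _ n[OF order_refl] z] eq_refl[OF eq(2)]]) (use x e in auto)
        moreover have "norm (x (Suc n) k z - th k z) <= e / 2" by (rule order_trans[OF n[OF _ z] eq_refl[OF eq(1)]]) simp
        ultimately show ?thesis using e norm_triangle_ineq4[of "x (Suc n) k z - th' k z" "x (Suc n) k z - th k z"] by simp
      qed
      then have "norm (th k z - th' k z) <= 0" by (rule field_le_epsilon[of _ 0, simplified])
      then show ?thesis by simp
    qed
    then show "\<exists>th u th'. P m th u th' & (\<forall>k. \<forall>z\<le>0. th k z = th' k z)" using P by blast
  qed
  from choice[OF this] obtain th where "\<forall>m. \<exists>u th'. P m (th m) u th' & (\<forall>k. \<forall>z\<le>0. th m k z = th' k z)" by blast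
  from choice[OF this] obtain U where "\<forall>m. \<exists>th'. P m (th m) (U m) th' & (\<forall>k. \<forall>z\<le>0. th m k z = th' k z)" by blast
  from choice[OF this] obtain Th where P: "!!m. P m (th m) (U m) (Th m)" and eq: "!!m k z. z <= 0 ==> th m k z = Th m k z" by blast
  have sol: "solves (- w k) (lconv d (%j. Th m j) k) (U m k)" for k m
    using P[of m] eq by (auto simp: P_def solves_def lconv_def)
  have b1: "norm (Th m k z) <= 2 * ?W m k * exp (- z / 4)" and b2: "norm (U m k z) <= 2 * N / (nu k + 3/4) * ?W m k * exp (3/4 * z)"
    and m1: "Th m k z \<in> S (k - m)" "U m k z \<in> S' (k - m)" if "z <= 0" for k m z using P[of m] that by (auto simp: P_def A_def)
  have "norm (U m k z) <= (2 + 4 * N) * ?W m k * exp (3/4 * z)" if "z <= 0" for k m z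
  proof -
    have "2 * N / (nu k + 3/4) <= 2 * N / (1/2)" using nu[of k] N_nonneg by (intro divide_left_mono) auto
    also have "... <= 2 + 4 * N" by simp
    finally show ?thesis using b2[OF that, of m k] by (meson exp_ge_zero mult_right_mono order_trans)
  qed
  moreover have "norm (Th m k z) <= (2 + 4 * N) * ?W m k * exp (- z / 4)" if "z <= 0" for k m z
    by (rule order_trans[OF b1[OF that]]) (use N_nonneg in \<open>auto intro!: mult_right_mono\<close>)
  ultimately have "fundamental w b d tau (%k m. Th m k) (%k m. U m k)"
    unfolding fundamental_def using P sol by (auto simp: P_def intro!: exI[of _ "2 + 4 * N"])
  then show ?thesis using b1 b2 m1 by (intro exI[of _ "%k m. Th m k"] exI[of _ "%k m. U m k"]) auto
qed

end

section \<open>Matrices with exponential off-diagonal decay\<close>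

lemma summable_on_int_of_nat:
  fixes f :: "int => real"
  assumes "summable (%n. f (int n))" "summable (%n. f (- int n))" "!!k. f k >= 0"
  shows "f summable_on UNIV"
proof -
  have "f summable_on (range int)"
    by (subst summable_on_reindex) (auto simp: o_def intro!: summable_nonneg_imp_summable_on assms)
  moreover have "f summable_on (range (%n. - int n))"
    by (subst summable_on_reindex) (auto simp: o_def inj_on_def intro!: summable_nonneg_imp_summable_on assms)
  moreover have "range int \<union> range (%n. - int n) = UNIV"
  proof -
    have "x \<in> range int \<union> range (%n. - int n)" for x by (cases x rule: int_cases2) auto
    then show ?thesis by blast
  qed
  ultimately show ?thesis by (metis summable_on_union)
qed

lemma exp_decay_summable:
  fixes tau s :: real assumes "tau > 0"
  shows "(%j::int. ew (-tau) j * (2 * (1 + (of_int j)^2)) powr s) summable_on UNIV"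
proof -
  have "summable (%n. exp (- tau * real n) * (2 * (1 + (real n)^2)) powr s)"
  proof (rule summable_comparison_test_bigo)
    show "summable (%n. norm (exp (- tau / 2) ^ n))" using assms by simp
    have "(%n. exp (- tau * real n) * (2 * (1 + (real n)^2)) powr s) \<in> O(%n. exp (- tau / 2 * real n))"
      using assms by real_asymp
    then show "(%n. exp (- tau * real n) * (2 * (1 + (real n)^2)) powr s) \<in> O(%n. exp (- tau / 2) ^ n)"
      by (simp add: exp_of_nat_mult[symmetric] mult.commute)
  qed
  then show ?thesis by (intro summable_on_int_of_nat) simp_all
qed

text \<open>Peetre's inequality. Negative s is reduced to positive s by exchanging k and m.\<close>

lemma peetre:
  fixes k m :: int and s :: real
  shows "((1 + (of_int k)^2) / (1 + (of_int m)^2)) powr s <= (2 * (1 + (of_int (k - m))^2)) powr \<bar>s\<bar>"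
proof -
  have P: "1 + (x::real)^2 <= (2 * (1 + (x - y)^2)) * (1 + y^2)" for x y
  proof -
    have "(2 * (1 + (x - y)^2)) * (1 + y^2) - (1 + x^2) = 1 + (2 * y - x)^2 + 2 * ((x - y) * y)^2"
      by (simp add: power2_eq_square algebra_simps)
    then show ?thesis by (smt (verit) zero_le_power2)
  qed
  have pos: "1 + (x::real)^2 > 0" for x by (simp add: add_pos_nonneg)
  show ?thesis
  proof (cases "s >= 0")
    case True
    have "(1 + (real_of_int k)^2) / (1 + (of_int m)^2) <= 2 * (1 + (of_int (k - m))^2)"
      using P[of "of_int k" "of_int m"] pos[of "of_int m"] by (simp add: pos_divide_le_eq)
    then show ?thesis using True by (auto intro!: powr_mono2)
  next
    case False
    have "(1 + (real_of_int m)^2) / (1 + (of_int k)^2) <= 2 * (1 + (of_int (k - m))^2)"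
      using P[of "of_int m" "of_int k"] pos[of "of_int k"] by (simp add: pos_divide_le_eq power2_commute)
    then have "((1 + (real_of_int m)^2) / (1 + (of_int k)^2)) powr \<bar>s\<bar> <= (2 * (1 + (of_int (k - m))^2)) powr \<bar>s\<bar>"
      by (auto intro!: powr_mono2)
    moreover have "((1 + (real_of_int k)^2) / (1 + (of_int m)^2)) powr s = ((1 + (real_of_int m)^2) / (1 + (of_int k)^2)) powr \<bar>s\<bar>"
      using False by (simp add: powr_divide powr_minus field_simps)
    ultimately show ?thesis by simp
  qed
qed

text \<open>Young's inequality for the convolution of l1 with l2: weighted Cauchy-Schwarz in each
  row, then summation over the rows.\<close>

lemma young_l2:
  fixes E :: "int => real" and v :: "int => real"
  assumes E: "E summable_on UNIV" "!!j. E j >= 0" and v: "(%m. (v m)^2) summable_on UNIV" "!!m. v m >= 0"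
  shows "(%m. E (k - m) * v m) summable_on UNIV"
    and "(%k. (\<Sum>\<^sub>\<infinity>m. E (k - m) * v m)^2) summable_on UNIV"
    and "(\<Sum>\<^sub>\<infinity>k. (\<Sum>\<^sub>\<infinity>m. E (k - m) * v m)^2) <= (\<Sum>\<^sub>\<infinity>j. E j)^2 * (\<Sum>\<^sub>\<infinity>m. (v m)^2)"
proof -
  let ?S = "\<Sum>\<^sub>\<infinity>j. E j"
  have Ek: "((%m. E (k - m)) has_sum ?S) UNIV" for k
  proof -
    have "bij_betw (%m. k - m) UNIV UNIV" by (rule bij_betw_byWitness[of _ "%m. k - m"]) auto
    from has_sum_reindex_bij_betw[OF this, of E ?S] show ?thesis using E(1) by simp
  qed
  have prod: "(%(j, m). E j * (v m)^2) summable_on UNIV \<times> UNIV"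
  proof -
    have "(%(j, m). E j * (v m)^2) summable_on (SIGMA j:UNIV. UNIV)"
      by (rule summable_on_SigmaI[where g="%j. E j * (\<Sum>\<^sub>\<infinity>m. (v m)^2)"])
        (use E v in \<open>auto intro!: has_sum_cmult_right summable_on_cmult_left has_sum_infsum\<close>)
    then show ?thesis by simp
  qed
  have km: "(%(k, m). E (k - m) * (v m)^2) summable_on UNIV \<times> UNIV"
    using summable_on_reindex_bij_witness[of "UNIV \<times> UNIV" "%(j, m). (j + m, m)" "%(k, m). (k - m, m)" "UNIV \<times> UNIV" "%(j, m). E j * (v m)^2" "%(k, m). E (k - m) * (v m)^2"] prod
    by (auto simp: case_prod_unfold)
  have Q: "(%m. E (k - m) * (v m)^2) summable_on UNIV" for k
    using summable_on_SigmaD1[of "%k m. E (k - m) * (v m)^2" UNIV "%_. UNIV"] km by auto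
  have le: "E (k - m) * v m <= E (k - m) + E (k - m) * (v m)^2" for k m
  proof -
    have "v m <= 1 + (v m)^2"
      using zero_le_power2[of "v m - 1/2"] by (simp add: power2_eq_square algebra_simps)
    from mult_left_mono[OF this E(2)[of "k - m"]] show ?thesis by (simp add: algebra_simps)
  qed
  show P: "(%m. E (k - m) * v m) summable_on UNIV" for k
    by (rule summable_on_comparison_test[OF summable_on_add[OF has_sum_imp_summable[OF Ek[of k]] Q[of k]]]) (use le E v in auto)
  have S0: "?S >= 0" by (intro infsum_nonneg E)
  have cs: "(\<Sum>\<^sub>\<infinity>m. E (k - m) * v m)^2 <= ?S * (\<Sum>\<^sub>\<infinity>m. E (k - m) * (v m)^2)" for k
  proof (cases "?S = 0")
    case True
    have "E j = 0" for j using nonneg_infsum_le_0D[of E UNIV j] True E by auto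
    then show ?thesis by simp
  next
    case False
    then have S: "?S > 0" using S0 by simp
    let ?P = "\<Sum>\<^sub>\<infinity>m. E (k - m) * v m" and ?Q = "\<Sum>\<^sub>\<infinity>m. E (k - m) * (v m)^2"
    \<comment> \<open>Cauchy-Schwarz is read off from the nonnegative sum of E (v - c)^2 at its
      minimiser c.\<close>
    define c where "c = ?P / ?S"
    have "((%m. E (k - m) * (v m)^2 + (- 2 * c) * (E (k - m) * v m) + c^2 * E (k - m)) has_sum (?Q + (- 2 * c) * ?P + c^2 * ?S)) UNIV"
      by (intro has_sum_add has_sum_cmult_right has_sum_infsum P Q Ek)
    moreover have "E (k - m) * (v m)^2 + (- 2 * c) * (E (k - m) * v m) + c^2 * E (k - m) = E (k - m) * (v m - c)^2" for m
      by (simp add: power2_eq_square algebra_simps)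
    ultimately have "((%m. E (k - m) * (v m - c)^2) has_sum (?Q + (- 2 * c) * ?P + c^2 * ?S)) UNIV" by simp
    then have "?Q + (- 2 * c) * ?P + c^2 * ?S >= 0" by (rule has_sum_nonneg) (use E in auto)
    then have "?P^2 / ?S <= ?Q" using S by (simp add: c_def power2_eq_square field_simps)
    then show ?thesis using S by (simp add: pos_divide_le_eq mult.commute)
  qed
  have Qs: "(%k. \<Sum>\<^sub>\<infinity>m. E (k - m) * (v m)^2) summable_on UNIV"
    using summable_on_Sigma_banach[of "%k m. E (k - m) * (v m)^2" UNIV "%_. UNIV"] km by auto
  have Qv: "(\<Sum>\<^sub>\<infinity>k. \<Sum>\<^sub>\<infinity>m. E (k - m) * (v m)^2) = ?S * (\<Sum>\<^sub>\<infinity>m. (v m)^2)"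
  proof -
    have "(\<Sum>\<^sub>\<infinity>k. \<Sum>\<^sub>\<infinity>m. E (k - m) * (v m)^2) = (\<Sum>\<^sub>\<infinity>(k, m)\<in>UNIV \<times> UNIV. E (k - m) * (v m)^2)"
      using infsum_Sigma'_banach[of "%k m. E (k - m) * (v m)^2" UNIV "%_. UNIV"] km by auto
    also have "... = (\<Sum>\<^sub>\<infinity>(j, m)\<in>UNIV \<times> UNIV. E j * (v m)^2)"
      by (rule infsum_reindex_bij_witness[of _ "%(j, m). (j + m, m)" "%(k, m). (k - m, m)"]) auto
    also have "... = (\<Sum>\<^sub>\<infinity>j. \<Sum>\<^sub>\<infinity>m. E j * (v m)^2)"
      using infsum_Sigma'_banach[of "%j m. E j * (v m)^2" UNIV "%_. UNIV"] prod by auto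
    also have "... = (\<Sum>\<^sub>\<infinity>j. E j * (\<Sum>\<^sub>\<infinity>m. (v m)^2))" by (simp add: infsum_cmult_right')
    also have "... = ?S * (\<Sum>\<^sub>\<infinity>m. (v m)^2)" by (simp add: infsum_cmult_left')
    finally show ?thesis .
  qed
  show s: "(%k. (\<Sum>\<^sub>\<infinity>m. E (k - m) * v m)^2) summable_on UNIV"
    by (rule summable_on_comparison_test[OF summable_on_cmult_right[OF Qs, of ?S]]) (use cs in auto)
  have "(\<Sum>\<^sub>\<infinity>k. (\<Sum>\<^sub>\<infinity>m. E (k - m) * v m)^2) <= (\<Sum>\<^sub>\<infinity>k. ?S * (\<Sum>\<^sub>\<infinity>m. E (k - m) * (v m)^2))"
    by (rule infsum_mono[OF s summable_on_cmult_right[OF Qs]]) (use cs in auto)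
  also have "... = ?S * (?S * (\<Sum>\<^sub>\<infinity>m. (v m)^2))" by (simp add: infsum_cmult_right' Qv)
  finally show "(\<Sum>\<^sub>\<infinity>k. (\<Sum>\<^sub>\<infinity>m. E (k - m) * v m)^2) <= ?S^2 * (\<Sum>\<^sub>\<infinity>m. (v m)^2)" by (simp add: power2_eq_square mult_ac)
qed

section \<open>Matrix operators between Sobolev spaces\<close>

definition jap :: "int => real" where "jap k = 1 + (of_int k)^2"

lemma jap_pos: "jap k > 0" by (simp add: jap_def add_pos_nonneg)

lemma jap_ge1: "jap k >= 1" by (simp add: jap_def)

definition matop :: "(int => int => real) => pdist => pdist" where
  "matop A u = (%k. \<Sum>\<^sub>\<infinity>m. of_real (A k m) * u m)"

text \<open>Entries of an operator of order p. As \<open>jap\<close> is the square of the Japanese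
  bracket, the order appears as the power p/2. Growth is measured in the row index only; the decay
  off the diagonal absorbs the exchange of k and m.\<close>

definition mat_decay :: "real => real => real => (int => int => 'a::real_normed_vector) => bool" where
  "mat_decay tau p C A \<longleftrightarrow> C >= 0 & (\<forall>k m. norm (A k m) <= C * ew (-tau) (k - m) * jap k powr (p / 2))"

text \<open>The l1 norm of the exponential kernel times the Peetre factor that belongs to the
  exponent s.\<close>

definition sobconst :: "real => real => real" where
  "sobconst tau s = (\<Sum>\<^sub>\<infinity>j::int. ew (-tau) j * (2 * (1 + (of_int j)^2)) powr (abs s / 2))"

lemma sobconst_nonneg: "sobconst tau s >= 0"
  unfolding sobconst_def by (intro infsum_nonneg) simp

lemma powr_half_sq: "x > 0 ==> (x powr (s / 2))^2 = x powr s" for x s :: real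
  by (simp add: power2_eq_square powr_add[symmetric])

lemma Hspace_iff: "u \<in> Hspace s \<longleftrightarrow> (%k. (jap k powr (s/2) * cmod (u k))^2) summable_on UNIV"
  by (simp add: Hspace_def jap_def[symmetric] power_mult_distrib powr_half_sq jap_pos)

lemma hnorm_eq: "hnorm s u = sqrt (\<Sum>\<^sub>\<infinity>k. (jap k powr (s/2) * cmod (u k))^2)"
  by (simp add: hnorm_def jap_def[symmetric] power_mult_distrib powr_half_sq jap_pos)

lemma hnorm_nonneg: "hnorm s u >= 0"
  unfolding hnorm_eq by (intro real_sqrt_ge_zero infsum_nonneg) simp

text \<open>Peetre's inequality moves the Sobolev weight from the column to the row index at the
  price of a kernel in k - m. The exponential decay makes this kernel summable, and
  \<open>young_l2\<close> applies.\<close>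

lemma matop_estimate:
  assumes tau: "tau > 0" and A: "mat_decay tau p C A" and u: "u \<in> Hspace s"
  shows "(%m. of_real (A k m) * u m) summable_on UNIV"
    and "matop A u \<in> Hspace (s - p)"
    and "hnorm (s - p) (matop A u) <= sobconst tau s * C * hnorm s u"
proof -
  define v where "v m = jap m powr (s/2) * cmod (u m)" for m
  define E where "E j = ew (-tau) j * (2 * (1 + (of_int j)^2)) powr (abs s / 2)" for j :: int
  have C: "C >= 0" using A by (simp add: mat_decay_def)
  have E: "E summable_on UNIV" "!!j. E j >= 0" unfolding E_def by (rule exp_decay_summable[OF tau]) simp
  have v: "(%m. (v m)^2) summable_on UNIV" "!!m. v m >= 0" using u by (auto simp: Hspace_iff v_def)
  note Y = young_l2[OF E v]
  have trm: "cmod (of_real (A k m) * u m) <= C * jap k powr ((p - s)/2) * (E (k - m) * v m)" for k m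
  proof -
    have "1 = jap k powr (- s/2) * jap k powr (s/2)" using jap_pos[of k] by (simp add: powr_add[symmetric])
    also have "jap k powr (s/2) = (jap k / jap m) powr (s/2) * jap m powr (s/2)"
      using jap_pos[of k] jap_pos[of m] by (simp add: powr_divide)
    also have "(jap k / jap m) powr (s/2) <= (2 * (1 + (of_int (k - m))^2)) powr (abs s / 2)"
      using peetre[of k m "s/2"] by (simp add: jap_def)
    finally have 1: "1 <= jap k powr (- s/2) * ((2 * (1 + (of_int (k - m))^2)) powr (abs s / 2) * jap m powr (s/2))"
      by (simp add: mult_left_mono mult_right_mono)
    have "cmod (of_real (A k m) * u m) = \<bar>A k m\<bar> * cmod (u m)" by (simp add: norm_mult)
    also have "... <= (C * ew (-tau) (k - m) * jap k powr (p / 2)) * cmod (u m)"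
      using A by (intro mult_right_mono) (auto simp: mat_decay_def)
    also have "... <= (C * ew (-tau) (k - m) * jap k powr (p / 2)) * cmod (u m) * (jap k powr (- s/2) * ((2 * (1 + (of_int (k - m))^2)) powr (abs s / 2) * jap m powr (s/2)))"
      using mult_left_mono[OF 1, of "(C * ew (-tau) (k - m) * jap k powr (p / 2)) * cmod (u m)"] C by simp
    also have "... = C * (jap k powr (p / 2) * jap k powr (- s/2)) * (E (k - m) * v m)"
      by (simp only: E_def v_def mult_ac)
    also have "jap k powr (p / 2) * jap k powr (- s/2) = jap k powr ((p - s)/2)"
      by (simp add: powr_add[symmetric] diff_divide_distrib)
    finally show ?thesis .
  qed
  have s1: "(%m. C * jap k powr ((p - s)/2) * (E (k - m) * v m)) summable_on UNIV" for k
    by (rule summable_on_cmult_right[OF Y(1)])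
  have "(%m. cmod (of_real (A k m) * u m)) summable_on UNIV" for k
    by (rule summable_on_comparison_test[OF s1]) (use trm in auto)
  then show sA: "(%m. of_real (A k m) * u m) summable_on UNIV" for k by (rule abs_summable_summable)
  have ptw: "jap k powr ((s - p)/2) * cmod (matop A u k) <= C * (\<Sum>\<^sub>\<infinity>m. E (k - m) * v m)" for k
  proof -
    have "cmod (matop A u k) <= (\<Sum>\<^sub>\<infinity>m. C * jap k powr ((p - s)/2) * (E (k - m) * v m))"
      unfolding matop_def by (rule norm_infsum_le[OF has_sum_infsum[OF sA] has_sum_infsum[OF s1]]) (rule trm)
    also have "... = C * jap k powr ((p - s)/2) * (\<Sum>\<^sub>\<infinity>m. E (k - m) * v m)" by (rule infsum_cmult_right')
    finally have "jap k powr ((s - p)/2) * cmod (matop A u k) <= (jap k powr ((s - p)/2) * jap k powr ((p - s)/2)) * (C * (\<Sum>\<^sub>\<infinity>m. E (k - m) * v m))"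
      using mult_left_mono[of "cmod (matop A u k)" "C * jap k powr ((p - s)/2) * (\<Sum>\<^sub>\<infinity>m. E (k - m) * v m)" "jap k powr ((s - p)/2)"] by (simp add: mult_ac)
    also have "jap k powr ((s - p)/2) * jap k powr ((p - s)/2) = 1"
      using jap_pos[of k] by (simp add: powr_add[symmetric] diff_divide_distrib)
    finally show ?thesis by simp
  qed
  have sq: "(jap k powr ((s - p)/2) * cmod (matop A u k))^2 <= C^2 * (\<Sum>\<^sub>\<infinity>m. E (k - m) * v m)^2" for k
    using power_mono[OF ptw[of k], of 2] by (simp add: power_mult_distrib)
  show H: "matop A u \<in> Hspace (s - p)"
    unfolding Hspace_iff by (rule summable_on_comparison_test[OF summable_on_cmult_right[OF Y(2), of "C^2"]]) (use sq in auto)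
  have "(\<Sum>\<^sub>\<infinity>k. (jap k powr ((s - p)/2) * cmod (matop A u k))^2) <= (\<Sum>\<^sub>\<infinity>k. C^2 * (\<Sum>\<^sub>\<infinity>m. E (k - m) * v m)^2)"
    by (rule infsum_mono[OF H[unfolded Hspace_iff] summable_on_cmult_right[OF Y(2)]]) (use sq in auto)
  also have "... = C^2 * (\<Sum>\<^sub>\<infinity>k. (\<Sum>\<^sub>\<infinity>m. E (k - m) * v m)^2)" by (rule infsum_cmult_right')
  also have "... <= C^2 * ((\<Sum>\<^sub>\<infinity>j. E j)^2 * (\<Sum>\<^sub>\<infinity>m. (v m)^2))" by (intro mult_left_mono Y) simp
  finally have "hnorm (s - p) (matop A u) <= sqrt (C^2 * ((\<Sum>\<^sub>\<infinity>j. E j)^2 * (\<Sum>\<^sub>\<infinity>m. (v m)^2)))"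
    unfolding hnorm_eq by (rule real_sqrt_le_mono)
  also have "... = sobconst tau s * C * hnorm s u"
  proof -
    have "sobconst tau s = (\<Sum>\<^sub>\<infinity>j. E j)" unfolding sobconst_def E_def ..
    then show ?thesis
      using C sobconst_nonneg[of tau s] by (simp add: real_sqrt_mult hnorm_eq v_def[symmetric])
  qed
  finally show "hnorm (s - p) (matop A u) <= sobconst tau s * C * hnorm s u" .
qed

lemma Hspace_0: "(%_. 0) \<in> Hspace s"
  by (simp add: Hspace_iff)

lemma hnorm_0: "hnorm s (%_. 0) = 0"
  by (simp add: hnorm_eq)

lemma matop_add:
  assumes "tau > 0" "mat_decay tau p C A" "u \<in> Hspace s" "v \<in> Hspace s"
  shows "matop A (%j. u j + v j) k = matop A u k + matop A v k"
  unfolding matop_def using matop_estimate(1)[OF assms(1,2,3)] matop_estimate(1)[OF assms(1,2,4)]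
  by (simp add: distrib_left infsum_add)

lemma matop_scale: "matop A (%j. c * u j) k = c * matop A u k"
  unfolding matop_def by (subst infsum_cmult_right'[symmetric]) (simp add: mult_ac)

lemma bounded_op_matop:
  assumes "tau > 0" "mat_decay tau p C A" shows "bounded_op s (s - p) (matop A)"
  unfolding bounded_op_def
  using matop_estimate[OF assms] matop_add[OF assms] matop_scale by blast

lemma opnorm_leI:
  assumes "!!u. u \<in> Hspace s ==> hnorm t (A u) <= C * hnorm s u" "C >= 0" shows "opnorm s t A <= C"
  unfolding opnorm_def
proof (rule cSUP_least)
  show "{u \<in> Hspace s. hnorm s u <= 1} ~= {}" using Hspace_0[of s] hnorm_0[of s] by force
  fix u assume "u \<in> {u \<in> Hspace s. hnorm s u <= 1}"
  then show "hnorm t (A u) <= C" using assms(1)[of u] mult_left_mono[of "hnorm s u" 1 C] assms(2) by auto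
qed

lemma opnorm_cong: "(!!u. u \<in> Hspace s ==> A u = B u) ==> opnorm s t A = opnorm s t B"
  unfolding opnorm_def by (intro SUP_cong) auto

lemma Hspace_add:
  assumes "u \<in> Hspace s" "v \<in> Hspace s" shows "(%j. u j + v j) \<in> Hspace s"
proof -
  have sq: "(cmod (u k + v k))^2 <= 2 * (cmod (u k))^2 + 2 * (cmod (v k))^2" for k
  proof -
    have "(cmod (u k + v k))^2 <= (cmod (u k) + cmod (v k))^2" by (intro power_mono norm_triangle_ineq) simp
    also have "... <= 2 * (cmod (u k))^2 + 2 * (cmod (v k))^2"
      using zero_le_power2[of "cmod (u k) - cmod (v k)"] by (simp add: power2_eq_square algebra_simps)
    finally show ?thesis .
  qed
  have le: "(jap k powr (s/2) * cmod (u k + v k))^2 <= 2 * (jap k powr (s/2) * cmod (u k))^2 + 2 * (jap k powr (s/2) * cmod (v k))^2" for k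
    using mult_left_mono[OF sq[of k], of "(jap k powr (s/2))^2"]
    by (simp add: power_mult_distrib algebra_simps)
  note s = summable_on_add[OF summable_on_cmult_right[OF assms(1)[unfolded Hspace_iff], of 2] summable_on_cmult_right[OF assms(2)[unfolded Hspace_iff], of 2]]
  show ?thesis unfolding Hspace_iff
    by (rule summable_on_comparison_test[OF s]) (use le in auto)
qed

lemma Hspace_scale: "u \<in> Hspace s ==> (%j. b * u j) \<in> Hspace s"
  unfolding Hspace_iff using summable_on_cmult_right[of "%k. (jap k powr (s / 2) * cmod (u k))^2" UNIV "(cmod b)^2"]
  by (simp add: norm_mult power_mult_distrib mult_ac)

text \<open>Operators are prescribed on \<open>Hspace s\<close> only; linearity is transported
  because \<open>Hspace s\<close> is closed under sums and multiples.\<close>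

lemma bounded_op_cong:
  assumes eq: "!!u. u \<in> Hspace s ==> A u = B u" and B: "bounded_op s t B" shows "bounded_op s t A"
proof -
  show ?thesis using B unfolding bounded_op_def by (simp add: eq Hspace_add Hspace_scale)
qed

lemma matop_expi: "matop A (expi j) k = of_real (A k j)"
proof -
  have "(\<Sum>\<^sub>\<infinity>m. of_real (A k m) * expi j m) = (\<Sum>\<^sub>\<infinity>m\<in>{j}. of_real (A k m) * expi j m)"
    by (rule infsum_cong_neutral) (auto simp: expi_def)
  then show ?thesis by (simp add: matop_def expi_def)
qed

lemma has_sum_sum:
  fixes f :: "'i => 'j => 'a::real_normed_vector"
  assumes "finite N" "!!i. i \<in> N ==> (f i has_sum S i) A"
  shows "((%x. \<Sum>i\<in>N. f i x) has_sum (\<Sum>i\<in>N. S i)) A"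
  using assms by (induction N) (auto intro!: has_sum_add)

text \<open>Entrywise absolute convergence does not make the tails uniform in (k, m). The scalars
  \<open>c i\<close>, which tend to 0 along I, repair this: once all i with |c i| > e are in the
  partial sum, the remainder is at most e times the common bound B. For this reason series are
  summed strictly inside their polydisc.\<close>

lemma op_has_sum_matop:
  assumes tau: "tau > 0"
    and summ: "!!k m. (%i. \<bar>a i k m\<bar>) summable_on I" and B: "!!k m. (\<Sum>\<^sub>\<infinity>i\<in>I. \<bar>a i k m\<bar>) <= B * ew (-tau) (k - m) * jap k powr (p / 2)"
    and B0: "B >= 0"
    and c: "!!i. i \<in> I ==> \<bar>c i\<bar> <= 1" "!!e. e > 0 ==> finite {i \<in> I. \<bar>c i\<bar> > e}"
    and A: "!!k m. ((%i. c i * a i k m) has_sum A k m) I"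
    and F: "!!u. u \<in> Hspace s ==> F u = matop A u"
    and f: "!!i u k. i \<in> I ==> f i u k = of_real (c i) * matop (a i) u k"
  shows "op_has_sum s (s - p) f F I"
proof -
  have dec_a: "mat_decay tau p B (a i)" if "i \<in> I" for i
    unfolding mat_decay_def real_norm_def
  proof (intro conjI allI B0)
    fix k m
    have "\<bar>a i k m\<bar> = (\<Sum>\<^sub>\<infinity>i\<in>{i}. \<bar>a i k m\<bar>)" by simp
    also have "... <= (\<Sum>\<^sub>\<infinity>i\<in>I. \<bar>a i k m\<bar>)" by (rule infsum_mono_neutral) (use that summ in auto)
    finally show "\<bar>a i k m\<bar> <= B * ew (-tau) (k - m) * jap k powr (p / 2)" using B[of k m] by linarith
  qed
  have tail: "mat_decay tau p (e * B) (%k m. A k m - (\<Sum>i\<in>N. c i * a i k m))"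
    if N: "finite N" "N \<subseteq> I" and e: "!!i. i \<in> I - N ==> \<bar>c i\<bar> <= e" "e >= 0" for N e
    unfolding mat_decay_def real_norm_def
  proof (intro conjI allI)
    fix k m
    have "((%i. c i * a i k m) has_sum A k m - (\<Sum>i\<in>N. c i * a i k m)) (I - N)"
      by (rule has_sum_Diff[OF A has_sum_finite[OF N(1)] N(2)])
    moreover have s: "(%i. e * \<bar>a i k m\<bar>) summable_on (I - N)"
      by (intro summable_on_cmult_right summable_on_subset_banach[OF summ]) auto
    ultimately have "norm (A k m - (\<Sum>i\<in>N. c i * a i k m)) <= (\<Sum>\<^sub>\<infinity>i\<in>I - N. e * \<bar>a i k m\<bar>)"
      by (rule norm_infsum_le[OF _ has_sum_infsum]) (use e in \<open>auto simp: abs_mult intro!: mult_right_mono\<close>)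
    also have "... = e * (\<Sum>\<^sub>\<infinity>i\<in>I - N. \<bar>a i k m\<bar>)" by (rule infsum_cmult_right')
    also have "... <= e * (\<Sum>\<^sub>\<infinity>i\<in>I. \<bar>a i k m\<bar>)"
      by (intro mult_left_mono infsum_mono_neutral e) (auto intro: summable_on_subset_banach[OF summ] summ)
    also have "... <= e * (B * ew (-tau) (k - m) * jap k powr (p / 2))" by (intro mult_left_mono B e)
    finally show "\<bar>A k m - (\<Sum>i\<in>N. c i * a i k m)\<bar> <= e * B * ew (-tau) (k - m) * jap k powr (p / 2)"
      by (simp add: mult_ac)
  qed (use e B0 in auto)
  have decA: "mat_decay tau p B A" using tail[of "{}" 1] c by simp
  have diff: "F u k - (\<Sum>i\<in>N. f i u k) = matop (%k m. A k m - (\<Sum>i\<in>N. c i * a i k m)) u k"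
    if N: "finite N" "N \<subseteq> I" and u: "u \<in> Hspace s" for N u k
  proof -
    have "((%m. of_real (A k m) * u m - (\<Sum>i\<in>N. of_real (c i) * (of_real (a i k m) * u m))) has_sum
        matop A u k - (\<Sum>i\<in>N. of_real (c i) * matop (a i) u k)) UNIV"
    proof -
      have "((%m. of_real (A k m) * u m + - 1 * (\<Sum>i\<in>N. of_real (c i) * (of_real (a i k m) * u m))) has_sum
        matop A u k + - 1 * (\<Sum>i\<in>N. of_real (c i) * matop (a i) u k)) UNIV"
        unfolding matop_def
        by (intro has_sum_add has_sum_cmult_right has_sum_sum has_sum_infsum matop_estimate(1)[OF tau decA u])
          (use N in \<open>auto intro!: matop_estimate(1)[OF tau dec_a u]\<close>)
      then show ?thesis by simp
    qed
    then have "matop A u k - (\<Sum>i\<in>N. of_real (c i) * matop (a i) u k) =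
       (\<Sum>\<^sub>\<infinity>m. of_real (A k m) * u m - (\<Sum>i\<in>N. of_real (c i) * (of_real (a i k m) * u m)))"
      by (simp add: infsumI)
    also have "... = matop (%k m. A k m - (\<Sum>i\<in>N. c i * a i k m)) u k"
      unfolding matop_def by (intro infsum_cong) (simp add: algebra_simps sum_distrib_left)
    moreover have "(\<Sum>i\<in>N. f i u k) = (\<Sum>i\<in>N. of_real (c i) * matop (a i) u k)"
      using N f by (intro sum.cong) auto
    ultimately show ?thesis using F[OF u] by simp
  qed
  have lim: "((%N. opnorm s (s - p) (%u k. F u k - (\<Sum>i\<in>N. f i u k))) \<longlongrightarrow> 0) (finite_subsets_at_top I)"
  proof (rule tendstoI)
    fix eps :: real assume eps: "eps > 0"
    define K where "K = sobconst tau s * B + 1"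
    have K: "K > 0" unfolding K_def using sobconst_nonneg[of tau s] B0 by (simp add: add_nonneg_pos)
    define e where "e = eps / (2 * K)"
    have e: "e > 0" using eps K by (simp add: e_def)
    have "\<forall>\<^sub>F N in finite_subsets_at_top I. {i \<in> I. \<bar>c i\<bar> > e} \<subseteq> N & finite N & N \<subseteq> I"
      unfolding eventually_finite_subsets_at_top
      by (rule exI[of _ "{i \<in> I. \<bar>c i\<bar> > e}"]) (use c(2)[OF e] in auto)
    then show "\<forall>\<^sub>F N in finite_subsets_at_top I. dist (opnorm s (s - p) (%u k. F u k - (\<Sum>i\<in>N. f i u k))) 0 < eps"
    proof eventually_elim
      case (elim N)
      then have N: "finite N" "N \<subseteq> I" by auto
      have t: "mat_decay tau p (e * B) (%k m. A k m - (\<Sum>i\<in>N. c i * a i k m))"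
        by (rule tail[OF N]) (use elim e in force)+
      have eq: "opnorm s (s - p) (%u k. F u k - (\<Sum>i\<in>N. f i u k)) = opnorm s (s - p) (matop (%k m. A k m - (\<Sum>i\<in>N. c i * a i k m)))"
        by (rule opnorm_cong) (use diff[OF N] in auto)
      have "opnorm s (s - p) (matop (%k m. A k m - (\<Sum>i\<in>N. c i * a i k m))) <= sobconst tau s * (e * B)"
        by (rule opnorm_leI[OF matop_estimate(3)[OF tau t]]) (use sobconst_nonneg[of tau s] e B0 in auto)
      also have "... = e * (sobconst tau s * B)" by simp
      also have "... <= e * K" using e by (intro mult_left_mono) (auto simp: K_def)
      also have "... < eps" using K eps by (simp add: e_def)
      finally have "opnorm s (s - p) (%u k. F u k - (\<Sum>i\<in>N. f i u k)) < eps" unfolding eq .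
      moreover have "opnorm s (s - p) (%u k. F u k - (\<Sum>i\<in>N. f i u k)) >= 0"
        unfolding eq unfolding opnorm_def
      proof (rule cSUP_upper2[where x="%_. 0"])
        show "bdd_above ((%u. hnorm (s - p) (matop (%k m. A k m - (\<Sum>i\<in>N. c i * a i k m)) u)) ` {u \<in> Hspace s. hnorm s u <= 1})"
        proof (rule bdd_aboveI2)
          fix u assume u: "u \<in> {u \<in> Hspace s. hnorm s u <= 1}"
          show "hnorm (s - p) (matop (%k m. A k m - (\<Sum>i\<in>N. c i * a i k m)) u) <= sobconst tau s * (e * B)"
            using matop_estimate(3)[OF tau t, of u s] u mult_left_mono[of "hnorm s u" 1 "sobconst tau s * (e * B)"] sobconst_nonneg[of tau s] e B0 by auto
        qed
      qed (use Hspace_0 hnorm_0 in \<open>auto simp: hnorm_nonneg\<close>)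
      ultimately show ?case by simp
    qed
  qed
  have "bounded_op s (s - p) (f i)" if "i \<in> I" for i
  proof (rule bounded_op_cong)
    have "mat_decay tau p B (%k m. c i * a i k m)"
      unfolding mat_decay_def real_norm_def
    proof (intro conjI B0 allI)
      fix k m
      have "\<bar>c i * a i k m\<bar> <= 1 * \<bar>a i k m\<bar>" unfolding abs_mult by (intro mult_right_mono c that) simp
      then show "\<bar>c i * a i k m\<bar> <= B * ew (-tau) (k - m) * jap k powr (p / 2)"
        using dec_a[OF that, unfolded mat_decay_def real_norm_def, THEN conjunct2, rule_format, of k m] by linarith
    qed
    then show "bounded_op s (s - p) (matop (%k m. c i * a i k m))" by (rule bounded_op_matop[OF tau])
    show "f i u = matop (%k m. c i * a i k m) u" for u
      by (rule ext) (simp add: f[OF that] matop_def infsum_cmult_right'[symmetric] mult_ac)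
  qed
  moreover have "bounded_op s (s - p) F"
    by (rule bounded_op_cong[OF F bounded_op_matop[OF tau decA]])
  ultimately show ?thesis unfolding op_has_sum_def using lim by blast
qed

section \<open>Analyticity from coefficients in algebras of power series\<close>

text \<open>\<open>c f i\<close> are the Taylor coefficients of \<open>f\<close>, \<open>mon i\<close> the values of the monomials at some point and \<open>\<phi> f\<close> is
  the value of \<open>f\<close> there.\<close>

definition coef_system :: "('a::real_normed_vector => 'i => real) => ('i => real) => ('a => real) => bool" where
  "coef_system c mon \<phi> \<longleftrightarrow> (\<forall>i. \<bar>mon i\<bar> <= 1) &
     (\<forall>f. (%i. \<bar>c f i\<bar>) summable_on UNIV & (\<Sum>\<^sub>\<infinity>i. \<bar>c f i\<bar>) <= norm f & ((%i. mon i * c f i) has_sum \<phi> f) UNIV)"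

lemma coef_system_real: "coef_system (%f (u::unit). f) (%_. 1) (%f. f)"
  unfolding coef_system_def by (auto simp: UNIV_unit intro!: has_sum_finiteI)

text \<open>Adds one variable. The new exponent is paired with the old index, and the new variable,
  being outermost in the series type, is evaluated before the others.\<close>

lemma coef_system_ps:
  fixes c :: "'a::banach_ring => 'i => real"
  assumes c: "coef_system c mon \<phi>" and h: "contr_hom \<phi>" and y: "abs y <= 1"
  shows "coef_system (%f (n, i). c (ps_nth f n) i) (%(n, i). y ^ n * mon i) (%f. \<phi> (ps_eval (of_real y) f))"
proof -
  have c1: "!!i. \<bar>mon i\<bar> <= 1" and c2: "!!f. (%i. \<bar>c f i\<bar>) summable_on UNIV" and c3: "!!f. (\<Sum>\<^sub>\<infinity>i. \<bar>c f i\<bar>) <= norm f"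
    and c4: "!!f. ((%i. mon i * c f i) has_sum \<phi> f) UNIV" using c by (auto simp: coef_system_def)
  have m: "\<bar>y ^ n * mon i\<bar> <= 1" for n i
    using mult_mono[of "abs y ^ n" 1 "\<bar>mon i\<bar>" 1] power_le_one[of "abs y" n] y c1[of i] by (simp add: abs_mult power_abs)
  show ?thesis
    unfolding coef_system_def
  proof (intro conjI allI)
    show "\<bar>case q of (n, i) => y ^ n * mon i\<bar> <= 1" for q using m by (cases q) simp
    fix f :: "'a ps"
    have g: "(%n. \<Sum>\<^sub>\<infinity>i. \<bar>c (ps_nth f n) i\<bar>) summable_on UNIV"
      by (rule summable_on_comparison_test[of "%n. norm (ps_nth f n)"])
        (use c3 in \<open>auto intro!: infsum_nonneg summable_nonneg_imp_summable_on summable_norm_ps_nth\<close>)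
    have s: "(%q. \<bar>case q of (n, i) => c (ps_nth f n) i\<bar>) summable_on (SIGMA n:UNIV. UNIV)"
      by (rule summable_on_SigmaI[OF _ g]) (use c2 in \<open>auto intro: has_sum_infsum\<close>)
    then show s': "(%q. \<bar>case q of (n, i) => c (ps_nth f n) i\<bar>) summable_on UNIV" by simp
    have "(\<Sum>\<^sub>\<infinity>q\<in>(SIGMA n:UNIV. UNIV). \<bar>case q of (n, i) => c (ps_nth f n) i\<bar>) = (\<Sum>\<^sub>\<infinity>n. \<Sum>\<^sub>\<infinity>i. \<bar>c (ps_nth f n) i\<bar>)"
      using infsum_Sigma_banach[OF s] by simp
    also have "... <= (\<Sum>\<^sub>\<infinity>n. norm (ps_nth f n))"
      by (rule infsum_mono[OF g]) (use c3 in \<open>auto intro!: summable_nonneg_imp_summable_on summable_norm_ps_nth\<close>)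
    also have "... = norm f"
      unfolding norm_ps
      by (rule infsumI) (intro sums_nonneg_imp_has_sum summable_sums summable_norm_ps_nth norm_ge_zero)
    finally show "(\<Sum>\<^sub>\<infinity>q. \<bar>case q of (n, i) => c (ps_nth f n) i\<bar>) <= norm f" by simp
    have yn: "norm (of_real y :: 'a) <= 1" using y by simp
    have "(%q. (case q of (n, i) => y ^ n * mon i) * (case q of (n, i) => c (ps_nth f n) i)) summable_on (SIGMA n:UNIV. UNIV)"
    proof (rule abs_summable_summable, rule summable_on_comparison_test[OF s])
      fix q
      show "norm ((case q of (n, i) => y ^ n * mon i) * (case q of (n, i) => c (ps_nth f n) i)) <= \<bar>case q of (n, i) => c (ps_nth f n) i\<bar>"
        using m mult_right_mono[of _ 1 "\<bar>case q of (n, i) => c (ps_nth f n) i\<bar>"] by (cases q) (simp add: abs_mult)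
    qed simp
    moreover have "((%i. (y ^ n * mon i) * c (ps_nth f n) i) has_sum y ^ n * \<phi> (ps_nth f n)) UNIV" for n
      using has_sum_cmult_right[OF c4, of "y ^ n" "ps_nth f n"] by (simp add: mult.assoc)
    moreover have "((%n. y ^ n * \<phi> (ps_nth f n)) has_sum \<phi> (ps_eval (of_real y) f)) UNIV"
    proof (rule norm_summable_imp_has_sum)
      have "(%n. \<phi> (ps_nth f n * of_real y ^ n)) sums \<phi> (ps_eval (of_real y) f)"
        by (rule bounded_linear.sums[OF contr_hom_bounded_linear[OF h] ps_eval_sums[OF yn]])
      then show "(%n. y ^ n * \<phi> (ps_nth f n)) sums \<phi> (ps_eval (of_real y) f)"
        by (simp add: contr_hom_simps[OF h] mult.commute)
      show "summable (%n. norm (y ^ n * \<phi> (ps_nth f n)))"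
      proof (rule summable_comparison_test'[OF summable_norm_ps_nth[of f], of 0])
        fix n
        have "norm (y ^ n * \<phi> (ps_nth f n)) <= 1 * norm (ps_nth f n)"
          using mult_mono[of "abs y ^ n" 1 "\<bar>\<phi> (ps_nth f n)\<bar>"] power_le_one[of "abs y" n] y contr_hom_simps(8)[OF h, of "ps_nth f n"]
          by (simp add: abs_mult power_abs)
        then show "norm (norm (y ^ n * \<phi> (ps_nth f n))) <= norm (ps_nth f n)" by simp
      qed
    qed
    ultimately have "((%q. (case q of (n, i) => y ^ n * mon i) * (case q of (n, i) => c (ps_nth f n) i)) has_sum \<phi> (ps_eval (of_real y) f)) (SIGMA n:UNIV. UNIV)"
      by (intro has_sum_SigmaI) auto
    then show "((%q. (case q of (n, i) => y ^ n * mon i) * (case q of (n, i) => c (ps_nth f n) i)) has_sum \<phi> (ps_eval (of_real y) f)) UNIV" by simp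
  qed
qed

text \<open>Each factor is at most (1/2)^(nu b) and the others at most 1, so a monomial above e has
  all exponents below a common bound.\<close>

lemma finite_large_monomials:
  fixes y :: "'e::euclidean_space => real"
  assumes y: "!!b. b \<in> Basis ==> \<bar>y b\<bar> <= 1/2" and e: "e > 0"
  shows "finite {nu \<in> Basis \<rightarrow>\<^sub>E UNIV. \<bar>\<Prod>b\<in>Basis. y b ^ nu b\<bar> > e}"
proof -
  obtain n where n: "(1/2::real) ^ n < e" using e real_arch_pow_inv[of e "1/2"] by auto
  have "{nu \<in> Basis \<rightarrow>\<^sub>E UNIV. \<bar>\<Prod>b\<in>Basis. y b ^ nu b\<bar> > e} \<subseteq> Basis \<rightarrow>\<^sub>E {..<n}"
  proof safe
    fix nu :: "'e => nat" and b :: 'e assume nu: "\<bar>\<Prod>b\<in>Basis. y b ^ nu b\<bar> > e" and b: "b \<in> Basis"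
    have "\<bar>\<Prod>b\<in>Basis. y b ^ nu b\<bar> = \<bar>y b\<bar> ^ nu b * (\<Prod>b\<in>Basis - {b}. \<bar>y b\<bar> ^ nu b)"
      by (subst prod.remove[OF finite_Basis b]) (simp add: abs_mult abs_prod power_abs)
    also have "... <= (1/2) ^ nu b * 1"
      by (intro mult_mono power_mono prod_le_1 prod_nonneg) (use y b in \<open>auto intro!: power_le_one order_trans[OF y]\<close>)
    finally have "(1/2::real) ^ n < (1/2) ^ nu b" using nu n by linarith
    then show "nu b < n" by (subst (asm) power_strict_decreasing_iff) auto
  qed auto
  then show ?thesis by (rule finite_subset) (intro finite_PiE finite_Basis finite_lessThan)
qed

lemma matop_mat_scale: "matop (%k m. r * A k m) u k = of_real r * matop A u k"
  unfolding matop_def by (subst infsum_cmult_right'[symmetric]) (simp add: mult.assoc)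

lemma mat_decay_scale: "mat_decay tau p C A ==> mat_decay tau p (abs r * C) (%k m. r * A k m :: real)"
  by (auto simp: mat_decay_def abs_mult mult.assoc intro!: mult_left_mono)

lemma mat_decay_coef:
  assumes "coef_system c mon \<phi>" "mat_decay tau p B f" shows "mat_decay tau p B (%k m. c (f k m) i)"
  unfolding mat_decay_def real_norm_def
proof (intro conjI allI)
  fix k m
  have "\<bar>c (f k m) i\<bar> = (\<Sum>\<^sub>\<infinity>i\<in>{i}. \<bar>c (f k m) i\<bar>)" by simp
  also have "... <= (\<Sum>\<^sub>\<infinity>i. \<bar>c (f k m) i\<bar>)" by (rule infsum_mono_neutral) (use assms(1) in \<open>auto simp: coef_system_def\<close>)
  also have "... <= norm (f k m)" using assms(1) by (simp add: coef_system_def)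
  also have "... <= B * ew (-tau) (k - m) * jap k powr (p / 2)" using assms(2) by (simp add: mat_decay_def)
  finally show "\<bar>c (f k m) i\<bar> <= B * ew (-tau) (k - m) * jap k powr (p / 2)" .
qed (use assms(2) in \<open>simp add: mat_decay_def\<close>)

lemma op_has_sum_coef:
  fixes c :: "'a::real_normed_vector => 'i => real"
  assumes tau: "tau > 0" and c: "coef_system c mon \<phi>" and f: "mat_decay tau p B f" and idx: "bij_betw idx I UNIV"
    and fin: "!!e. e > 0 ==> finite {i \<in> I. \<bar>mon (idx i)\<bar> > e}" and F: "!!u. u \<in> Hspace s ==> F u = matop (%k m. \<phi> (f k m)) u"
    and g: "!!i u k. i \<in> I ==> g i u k = of_real (mon (idx i)) * matop (%k m. c (f k m) (idx i)) u k"
  shows "op_has_sum s (s - p) g F I"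
proof (rule op_has_sum_matop[OF tau _ _ _ _ fin _ F g])
  show "(%i. \<bar>c (f k m) (idx i)\<bar>) summable_on I" for k m
    using summable_on_reindex_bij_betw[OF idx, of "%i. \<bar>c (f k m) i\<bar>"] c by (simp add: coef_system_def)
  show "(\<Sum>\<^sub>\<infinity>i\<in>I. \<bar>c (f k m) (idx i)\<bar>) <= B * ew (-tau) (k - m) * jap k powr (p / 2)" for k m
    using infsum_reindex_bij_betw[OF idx, of "%i. \<bar>c (f k m) i\<bar>"] c f order_trans by (simp add: coef_system_def mat_decay_def) blast
  show "((%i. mon (idx i) * c (f k m) (idx i)) has_sum \<phi> (f k m)) I" for k m
    using has_sum_reindex_bij_betw[OF idx, of "%i. mon i * c (f k m) i"] c by (simp add: coef_system_def)
qed (use c f in \<open>auto simp: coef_system_def mat_decay_def\<close>)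

text \<open>One algebra-valued matrix f encodes the whole Taylor series: \<open>mat_decay\<close> of
  f bounds the l1 sum of all coefficients of an entry at once, which gives summation in operator
  norm. \<open>idx\<close> translates multi-indices on the basis into the nested indices of iterated
  series.\<close>

lemma op_analytic_on_coef:
  fixes F :: "'e::euclidean_space => pdist => pdist" and \<phi> :: "'e => 'a::real_normed_vector => real"
    and c :: "'a => 'i => real" and idx :: "('e => nat) => 'i"
  assumes tau: "tau > 0" and bij: "bij_betw idx (Basis \<rightarrow>\<^sub>E UNIV) UNIV"
    and c: "!!y. (!!b. b \<in> Basis ==> \<bar>y \<bullet> b\<bar> <= 1) ==> coef_system c (mon y) (\<phi> y)"
    and mon: "!!y nu. nu \<in> Basis \<rightarrow>\<^sub>E UNIV ==> mon y (idx nu) = (\<Prod>b\<in>Basis. (y \<bullet> b) ^ nu b)"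
    and loc: "!!x0. x0 \<in> S ==> \<exists>dl>0. \<exists>B f. mat_decay tau p B f &
       (\<forall>y. (\<forall>b\<in>Basis. \<bar>y \<bullet> b\<bar> <= 1) --> x0 + dl *\<^sub>R y \<in> S --> (\<forall>k m. A (x0 + dl *\<^sub>R y) k m = \<phi> y (f k m)))"
    and F: "!!x u. x \<in> S ==> u \<in> Hspace s ==> F x u = matop (A x) u"
  shows "op_analytic_on s (s - p) F S"
  unfolding op_analytic_on_def
proof (rule ballI)
  fix x0 assume "x0 \<in> S"
  from loc[OF this] obtain dl B f where d: "dl > 0" and f: "mat_decay tau p B f"
    and A: "!!y k m. (!!b. b \<in> Basis ==> \<bar>y \<bullet> b\<bar> <= 1) ==> x0 + dl *\<^sub>R y \<in> S ==> A (x0 + dl *\<^sub>R y) k m = \<phi> y (f k m)"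
    by blast
  \<comment> \<open>The series f lives on the box rescaled to radius 1; the powers of dl return to
    the variable x - x0.\<close>
  define a where "a nu = matop (%k m. 1 / dl ^ (\<Sum>b\<in>Basis. nu b) * c (f k m) (idx nu))" for nu :: "'e => nat"
  have bo: "bounded_op s (s - p) (a nu)" for nu
    unfolding a_def by (rule bounded_op_matop[OF tau mat_decay_scale[OF mat_decay_coef[OF c[of 0] f]]]) simp
  \<comment> \<open>Half of the radius keeps the coordinates of y at most 1/2, so that the monomials
    tend to 0 over the multi-indices.\<close>
  have "op_has_sum s (s - p) (%nu u k. of_real (\<Prod>b\<in>Basis. ((x - x0) \<bullet> b) ^ nu b) * a nu u k) (F x) (Basis \<rightarrow>\<^sub>E UNIV)"
    if x: "x \<in> S \<inter> ball x0 (dl/2)" for x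
  proof -
    define y where "y = (x - x0) /\<^sub>R dl"
    have yb: "y \<bullet> b = ((x - x0) \<bullet> b) / dl" for b by (simp add: y_def inner_scaleR_left divide_inverse mult.commute)
    have half: "\<bar>y \<bullet> b\<bar> <= 1/2" if "b \<in> Basis" for b
      using Basis_le_norm[OF that, of "x - x0"] x d by (simp add: yb dist_norm norm_minus_commute field_simps)
    then have y1: "\<bar>y \<bullet> b\<bar> <= 1" if "b \<in> Basis" for b using that by force
    have xy: "x0 + dl *\<^sub>R y = x" using d by (simp add: y_def)
    show ?thesis
    proof (rule op_has_sum_coef[OF tau c[OF y1] f bij])
      have "{nu \<in> Basis \<rightarrow>\<^sub>E UNIV. e < \<bar>mon y (idx nu)\<bar>} = {nu \<in> Basis \<rightarrow>\<^sub>E UNIV. e < \<bar>\<Prod>b\<in>Basis. (y \<bullet> b) ^ nu b\<bar>}" for e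
        using mon by auto
      then show "finite {nu \<in> Basis \<rightarrow>\<^sub>E UNIV. e < \<bar>mon y (idx nu)\<bar>}" if "e > 0" for e
        using finite_large_monomials[OF half that] by simp
      show "F x u = matop (%k m. \<phi> y (f k m)) u" if "u \<in> Hspace s" for u
      proof -
        have "A x = (%k m. \<phi> y (f k m))" using A[OF y1] x by (intro ext) (simp add: xy)
        then show ?thesis using F[OF _ that, of x] x by simp
      qed
      fix nu :: "'e => nat" and u k assume "nu \<in> Basis \<rightarrow>\<^sub>E UNIV"
      then have "mon y (idx nu) = (\<Prod>b\<in>Basis. ((x - x0) \<bullet> b) ^ nu b) * (1 / dl ^ (\<Sum>b\<in>Basis. nu b))"
        by (simp add: mon yb power_sum prod_dividef power_divide)
      then show "of_real (\<Prod>b\<in>Basis. ((x - x0) \<bullet> b) ^ nu b) * a nu u k = of_real (mon y (idx nu)) * matop (%k m. c (f k m) (idx nu)) u k"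
        by (simp only: a_def matop_mat_scale of_real_mult mult.assoc)
    qed
  qed
  then show "\<exists>r>0. \<exists>a. (\<forall>nu\<in>Basis \<rightarrow>\<^sub>E UNIV. bounded_op s (s - p) (a nu)) &
      (\<forall>x\<in>S \<inter> ball x0 r. op_has_sum s (s - p) (%nu u k. of_real (\<Prod>b\<in>Basis. ((x - x0) \<bullet> b) ^ nu b) * a nu u k) (F x) (Basis \<rightarrow>\<^sub>E UNIV))"
    using d bo by (intro exI[of _ "dl/2"] conjI exI[of _ a]) auto
qed

lemma coef_system_ps_nth:
  assumes "abs y <= 1" shows "coef_system (%f (n, u::unit). ps_nth f n) (%(n, i). y ^ n * 1) (ps_eval y)"
  using coef_system_ps[OF coef_system_real _ assms] by (simp add: contr_hom_def linear_id[unfolded id_def])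

lemma op_analytic_on_real:
  fixes F :: "real => pdist => pdist"
  assumes tau: "tau > 0"
    and loc: "!!x0. x0 \<in> S ==> \<exists>dl>0. \<exists>B f. mat_decay tau p B f &
       (\<forall>y. abs y <= 1 --> x0 + dl * y \<in> S --> (\<forall>k m. A (x0 + dl * y) k m = ps_eval y (f k m)))"
    and F: "!!x u. x \<in> S ==> u \<in> Hspace s ==> F x u = matop (A x) u"
  shows "op_analytic_on s (s - p) F S"
proof (rule op_analytic_on_coef[OF tau, where idx="%nu. (nu 1, ())" and mon="%y (n, i). y ^ n * 1"
    and c="%f (n, u). ps_nth f n" and \<phi>=ps_eval and A=A])
  show "bij_betw (%nu. (nu 1, ())) (Basis \<rightarrow>\<^sub>E UNIV :: (real => nat) set) (UNIV :: (nat \<times> unit) set)"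
    by (rule bij_betw_byWitness[where f'="%(n, u). \<lambda>b\<in>Basis. n"]) (auto simp: PiE_def extensional_def fun_eq_iff Basis_real_def)
  show "coef_system (%f (n, u::unit). ps_nth f n) (%(n, i). y ^ n * 1) (ps_eval y)" if "!!b. b \<in> Basis ==> \<bar>y \<bullet> b\<bar> <= 1" for y :: real
    by (rule coef_system_ps_nth) (use that[of 1] in simp)
qed (use loc F in auto)

lemma Basis_real2: "(Basis :: (real \<times> real) set) = {(1, 0), (0, 1)}"
  by (auto simp: Basis_prod_def zero_prod_def)

lemma Basis_real3: "(Basis :: (real \<times> real \<times> real) set) = {(1, 0, 0), (0, 1, 0), (0, 0, 1)}"
  by (auto simp: Basis_prod_def zero_prod_def)

text \<open>The outermost series variable carries the last coordinate because it is evaluated first;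
  index and monomials are nested accordingly.\<close>

lemma op_analytic_on_real2:
  fixes F :: "real \<times> real => pdist => pdist"
  assumes tau: "tau > 0"
    and loc: "!!x1 x2. (x1, x2) \<in> S ==> \<exists>dl>0. \<exists>B f. mat_decay tau p B f &
       (\<forall>y1 y2. \<bar>y1\<bar> <= 1 --> \<bar>y2\<bar> <= 1 --> (x1 + dl * y1, x2 + dl * y2) \<in> S -->
          (\<forall>k m. A (x1 + dl * y1) (x2 + dl * y2) k m = ps_eval y1 (ps_eval (of_real y2) (f k m))))"
    and F: "!!x1 x2 u. (x1, x2) \<in> S ==> u \<in> Hspace s ==> F (x1, x2) u = matop (A x1 x2) u"
  shows "op_analytic_on s (s - p) F S"
proof (rule op_analytic_on_coef[OF tau, where idx="%nu. (nu (0, 1), nu (1, 0), ())" and mon="%y (n, q). snd y ^ n * (case q of (n, i) => fst y ^ n * 1)"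
    and c="%f (n, q). (case q of (n', u) => ps_nth (ps_nth f n) n')" and \<phi>="%y f. ps_eval (fst y) (ps_eval (of_real (snd y)) f)" and A="%x. A (fst x) (snd x)"])
  show "bij_betw (%nu. (nu (0, 1), nu (1, 0), ())) (Basis \<rightarrow>\<^sub>E UNIV :: (real \<times> real => nat) set) (UNIV :: (nat \<times> nat \<times> unit) set)"
    by (rule bij_betw_byWitness[where f'="%(n2, n1, u). \<lambda>b\<in>Basis. if b = (1, 0) then n1 else n2"])
      (auto simp: PiE_def extensional_def fun_eq_iff Basis_real2)
  fix y :: "real \<times> real" assume b: "!!b. b \<in> Basis ==> \<bar>y \<bullet> b\<bar> <= 1"
  have y: "\<bar>fst y\<bar> <= 1" "\<bar>snd y\<bar> <= 1" using b[of "(1, 0)"] b[of "(0, 1)"] by (auto simp: Basis_real2 inner_prod_def)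
  note 1 = coef_system_ps_nth[OF y(1)]
  show "coef_system (%f (n, q). (case q of (n', u) => ps_nth (ps_nth f n) n')) (%(n, q). snd y ^ n * (case q of (n, i::unit) => fst y ^ n * 1))
     (%f. ps_eval (fst y) (ps_eval (of_real (snd y)) f))"
    using coef_system_ps[OF 1 contr_hom_ps_eval y(2)] y by simp
next
  fix x0 :: "real \<times> real" assume x0: "x0 \<in> S"
  show "\<exists>dl>0. \<exists>B f. mat_decay tau p B f &
       (\<forall>y. (\<forall>b\<in>Basis. \<bar>y \<bullet> b\<bar> <= 1) --> x0 + dl *\<^sub>R y \<in> S -->
          (\<forall>k m. A (fst (x0 + dl *\<^sub>R y)) (snd (x0 + dl *\<^sub>R y)) k m = ps_eval (fst y) (ps_eval (of_real (snd y)) (f k m))))"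
    using loc[of "fst x0" "snd x0"] x0 by (cases x0) (simp add: Basis_real2 inner_prod_def, blast)
qed (use F in \<open>auto simp: Basis_real2 inner_prod_def\<close>)

lemma op_analytic_on_real3:
  fixes F :: "real \<times> real \<times> real => pdist => pdist"
  assumes tau: "tau > 0"
    and loc: "!!x1 x2 x3. (x1, x2, x3) \<in> S ==> \<exists>dl>0. \<exists>B f. mat_decay tau p B f &
       (\<forall>y1 y2 y3. \<bar>y1\<bar> <= 1 --> \<bar>y2\<bar> <= 1 --> \<bar>y3\<bar> <= 1 --> (x1 + dl * y1, x2 + dl * y2, x3 + dl * y3) \<in> S -->
          (\<forall>k m. A (x1 + dl * y1) (x2 + dl * y2) (x3 + dl * y3) k m = ps_eval y1 (ps_eval (of_real y2) (ps_eval (of_real y3) (f k m)))))"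
    and F: "!!x1 x2 x3 u. (x1, x2, x3) \<in> S ==> u \<in> Hspace s ==> F (x1, x2, x3) u = matop (A x1 x2 x3) u"
  shows "op_analytic_on s (s - p) F S"
proof (rule op_analytic_on_coef[OF tau, where idx="%nu. (nu (0, 0, 1), nu (0, 1, 0), nu (1, 0, 0), ())"
    and mon="%y (n, q). snd (snd y) ^ n * (case q of (n, q) => fst (snd y) ^ n * (case q of (n, i) => fst y ^ n * 1))"
    and c="%f (n, q). (case q of (n', q) => (case q of (n'', u) => ps_nth (ps_nth (ps_nth f n) n') n''))"
    and \<phi>="%y f. ps_eval (fst y) (ps_eval (of_real (fst (snd y))) (ps_eval (of_real (snd (snd y))) f))" and A="%x. A (fst x) (fst (snd x)) (snd (snd x))"])
  show "bij_betw (%nu. (nu (0, 0, 1), nu (0, 1, 0), nu (1, 0, 0), ())) (Basis \<rightarrow>\<^sub>E UNIV :: (real \<times> real \<times> real => nat) set) (UNIV :: (nat \<times> nat \<times> nat \<times> unit) set)"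
    by (rule bij_betw_byWitness[where f'="%(n3, n2, n1, u). \<lambda>b\<in>Basis. if b = (1, 0, 0) then n1 else if b = (0, 1, 0) then n2 else n3"])
      (auto simp: PiE_def extensional_def fun_eq_iff Basis_real3)
  fix y :: "real \<times> real \<times> real" assume b: "!!b. b \<in> Basis ==> \<bar>y \<bullet> b\<bar> <= 1"
  have y: "\<bar>fst y\<bar> <= 1" "\<bar>fst (snd y)\<bar> <= 1" "\<bar>snd (snd y)\<bar> <= 1"
    using b[of "(1, 0, 0)"] b[of "(0, 1, 0)"] b[of "(0, 0, 1)"] by (auto simp: Basis_real3 inner_prod_def)
  note 1 = coef_system_ps_nth[OF y(1)]
  have h1: "contr_hom (ps_eval (fst y))" using y by (intro contr_hom_ps_eval) simp
  have h2: "contr_hom (%f. ps_eval (fst y) (ps_eval (of_real (fst (snd y))) f))"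
    by (rule contr_hom_comp[OF contr_hom_ps_eval h1]) (use y in simp)
  show "coef_system (%f (n, q). (case q of (n', q) => (case q of (n'', u) => ps_nth (ps_nth (ps_nth f n) n') n'')))
     (%(n, q). snd (snd y) ^ n * (case q of (n, q) => fst (snd y) ^ n * (case q of (n, i::unit) => fst y ^ n * 1)))
     (%f. ps_eval (fst y) (ps_eval (of_real (fst (snd y))) (ps_eval (of_real (snd (snd y))) f)))"
    using coef_system_ps[OF coef_system_ps[OF 1 h1 y(2)] h2 y(3)] by simp
next
  fix x0 :: "real \<times> real \<times> real" assume x0: "x0 \<in> S"
  show "\<exists>dl>0. \<exists>B f. mat_decay tau p B f &
       (\<forall>y. (\<forall>b\<in>Basis. \<bar>y \<bullet> b\<bar> <= 1) --> x0 + dl *\<^sub>R y \<in> S -->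
          (\<forall>k m. A (fst (x0 + dl *\<^sub>R y)) (fst (snd (x0 + dl *\<^sub>R y))) (snd (snd (x0 + dl *\<^sub>R y))) k m =
            ps_eval (fst y) (ps_eval (of_real (fst (snd y))) (ps_eval (of_real (snd (snd y))) (f k m)))))"
    using loc[of "fst x0" "fst (snd x0)" "snd (snd x0)"] x0 by (cases x0) (simp add: Basis_real3 inner_prod_def, blast)
qed (use F in \<open>auto simp: Basis_real3 inner_prod_def\<close>)

section \<open>Dependence of the fundamental solution on the parameters\<close>

lemma ps_of_real: "(of_real r :: 'a::banach_ring ps) = ps_const (of_real r)"
  by (rule ps_eqI) (simp add: of_real_def ps_nth_const ps_nth_one)

lemma ps_eval_of_real [simp]: "ps_eval x (of_real r) = of_real r"
  by (simp add: ps_of_real)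

text \<open>Lifts a homomorphism of the coefficients to series in a further variable. It evaluates
  the regular parameters while the singular frequency stays formal.\<close>

definition ps_map :: "('a::banach_ring => 'b::banach_ring) => 'a ps => 'b ps" where
  "ps_map \<phi> f = Ps (%n. \<phi> (ps_nth f n))"

lemma summable_norm_hom:
  assumes "contr_hom \<phi>" shows "summable (%n. norm (\<phi> (ps_nth f n)))"
  by (rule summable_comparison_test'[OF summable_norm_ps_nth[of f], of 0]) (simp add: contr_hom_simps[OF assms])

lemma ps_nth_map: "contr_hom \<phi> ==> ps_nth (ps_map \<phi> f) n = \<phi> (ps_nth f n)"
  unfolding ps_map_def by (rule ps_nth_Ps) (rule summable_norm_hom)

lemma contr_hom_ps_map:
  assumes h: "contr_hom \<phi>" shows "contr_hom (ps_map \<phi>)"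
  unfolding contr_hom_def
proof (intro conjI allI linearI)
  have s: "\<phi> (sum g A) = (\<Sum>i\<in>A. \<phi> (g i))" for g and A :: "nat set"
    using linear_sum[of \<phi>] h by (auto simp: contr_hom_def)
  show "ps_map \<phi> (f * g) = ps_map \<phi> f * ps_map \<phi> g" for f g
    by (rule ps_eqI) (simp add: ps_nth_map[OF h] ps_nth_mult s contr_hom_simps[OF h])
  show "norm (ps_map \<phi> f) <= norm f" for f
    unfolding norm_ps ps_nth_map[OF h]
    by (rule suminf_le) (simp_all add: contr_hom_simps[OF h] summable_norm_hom[OF h] summable_norm_ps_nth)
qed (rule ps_eqI, simp add: ps_nth_map[OF h] contr_hom_simps[OF h] ps_nth_one)+

lemma ps_map_const: "contr_hom \<phi> ==> ps_map \<phi> (ps_const c) = ps_const (\<phi> c)"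
  by (rule ps_eqI) (simp add: ps_nth_map ps_nth_const contr_hom_simps)

lemma ps_map_X: "contr_hom \<phi> ==> ps_map \<phi> ps_X = ps_X"
  by (rule ps_eqI) (simp add: ps_nth_map ps_nth_X contr_hom_simps)

lemma contr_hom_ps_const: "contr_hom ps_const"
  unfolding contr_hom_def
proof (intro conjI allI linearI)
  show "ps_const (x * y) = ps_const x * ps_const y" for x y :: 'a
  proof (rule ps_eqI)
    fix n
    have "(\<Sum>i\<le>n. ps_nth (ps_const x) i * ps_nth (ps_const y) (n - i)) = (\<Sum>i\<in>{0}. ps_nth (ps_const x) i * ps_nth (ps_const y) (n - i))"
      by (rule sum.mono_neutral_right) (auto simp: ps_nth_const)
    then show "ps_nth (ps_const (x * y)) n = ps_nth (ps_const x * ps_const y) n" by (simp add: ps_nth_mult ps_nth_const)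
  qed
qed (rule ps_eqI, simp add: ps_nth_const ps_nth_one | simp)+

text \<open>\<open>f(x) = ps_even (x^2) f + x * ps_odd (x^2) f\<close> separates the square root of the singular frequency.\<close>

definition ps_even :: "'a::banach_ring => 'a ps => 'a" where
  "ps_even q f = (\<Sum>n. ps_nth f (2 * n) * q ^ n)"

definition ps_odd :: "'a::banach_ring => 'a ps => 'a" where
  "ps_odd q f = (\<Sum>n. ps_nth f (2 * n + 1) * q ^ n)"

lemma ps_even_odd_sums:
  assumes "norm q <= 1" "i <= 1"
  shows "summable (%n. norm (ps_nth f (2 * n + i) * q ^ n))" "(\<Sum>n. norm (ps_nth f (2 * n + i) * q ^ n)) <= norm f"
proof -
  have "inj (%n::nat. 2 * n + i)" by (rule injI) simp
  from summable_reindex[OF summable_norm_ps_nth[of f] this] suminf_reindex_mono[OF summable_norm_ps_nth[of f] this]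
  have s: "summable (%n. norm (ps_nth f (2 * n + i)))" "(\<Sum>n. norm (ps_nth f (2 * n + i))) <= norm f"
    by (auto simp: o_def norm_ps)
  show 1: "summable (%n. norm (ps_nth f (2 * n + i) * q ^ n))"
    by (rule summable_comparison_test'[OF s(1), of 0]) (simp add: norm_mult_power_le assms)
  have "(\<Sum>n. norm (ps_nth f (2 * n + i) * q ^ n)) <= (\<Sum>n. norm (ps_nth f (2 * n + i)))"
    by (rule suminf_le[OF norm_mult_power_le[OF assms(1)] 1 s(1)])
  with s(2) show "(\<Sum>n. norm (ps_nth f (2 * n + i) * q ^ n)) <= norm f" by linarith
qed

lemma norm_ps_even: "norm q <= 1 ==> norm (ps_even q f) <= norm f"
  using ps_even_odd_sums[of q 0 f] summable_norm[of "%n. ps_nth f (2 * n) * q ^ n"] unfolding ps_even_def by auto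

lemma norm_ps_odd: "norm q <= 1 ==> norm (ps_odd q f) <= norm f"
  using ps_even_odd_sums[of q 1 f] summable_norm[of "%n. ps_nth f (2 * n + 1) * q ^ n"] unfolding ps_odd_def by auto

lemma hom_ps_even:
  assumes "contr_hom \<phi>" "norm q <= 1" shows "\<phi> (ps_even q f) = ps_even (\<phi> q) (ps_map \<phi> f)"
  using bounded_linear.suminf[OF contr_hom_bounded_linear[OF assms(1)] summable_norm_cancel[OF ps_even_odd_sums(1)[OF assms(2), of 0 f]]]
  by (simp add: ps_even_def ps_nth_map[OF assms(1)] contr_hom_simps[OF assms(1)])

lemma hom_ps_odd:
  assumes "contr_hom \<phi>" "norm q <= 1" shows "\<phi> (ps_odd q f) = ps_odd (\<phi> q) (ps_map \<phi> f)"
  using bounded_linear.suminf[OF contr_hom_bounded_linear[OF assms(1)] summable_norm_cancel[OF ps_even_odd_sums(1)[OF assms(2), of 1 f]]]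
  by (simp add: ps_odd_def ps_nth_map[OF assms(1)] contr_hom_simps[OF assms(1)])

lemma ps_eval_even_odd:
  assumes "norm x <= 1" shows "ps_eval x f = ps_even (x^2) f + x * ps_odd (x^2) f"
proof -
  have q: "norm (x^2) <= 1"
    using norm_mult_power_le[OF assms, of 1 2] by simp
  have "(%n. ps_nth f (2 * n) * (x^2) ^ n) sums ps_even (x^2) f"
    using summable_sums[OF summable_norm_cancel[OF ps_even_odd_sums(1)[OF q, of 0 f]]] by (simp add: ps_even_def)
  moreover have "(%n. x * (ps_nth f (2 * n + 1) * (x^2) ^ n)) sums (x * ps_odd (x^2) f)"
    using sums_mult[OF summable_sums[OF summable_norm_cancel[OF ps_even_odd_sums(1)[OF q, of 1 f]]]] by (simp add: ps_odd_def)
  ultimately have "(%n. ps_nth f (2 * n) * (x^2) ^ n + x * (ps_nth f (2 * n + 1) * (x^2) ^ n)) sums (ps_even (x^2) f + x * ps_odd (x^2) f)"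
    by (rule sums_add)
  moreover have "(%n. \<Sum>i\<in>{n * 2..<n * 2 + 2}. ps_nth f i * x ^ i) sums ps_eval x f"
    by (rule sums_group[OF ps_eval_sums[OF assms]]) simp
  moreover have "(\<Sum>i\<in>{n * 2..<n * 2 + 2}. ps_nth f i * x ^ i) = ps_nth f (2 * n) * (x^2) ^ n + x * (ps_nth f (2 * n + 1) * (x^2) ^ n)" for n
    by (simp add: numeral_2_eq_2 power_add power_mult_distrib mult_ac)
  ultimately show ?thesis by (simp add: sums_unique2)
qed

text \<open>The modes of d are eps times \<open>dt eps\<close>: one factor of the amplitude is split
  off because d vanishes with it. Hence \<open>dc l\<close> belongs to the order l + 1, which is the
  shift visible in \<open>support\<close>. The Lipschitz bound, with the same majorant, yields
  continuity of the sum in z.\<close>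

locale dcoef =
  fixes dc :: "nat => int => real => real" and Dc :: "nat => int => real" and E tau :: real
  assumes E: "E > 0" and tau: "tau > 0"
    and dc_bound: "!!l kap z. z <= 0 ==> \<bar>dc l kap z\<bar> <= Dc l kap * exp z"
    and dc_lip: "!!l kap z z'. z <= 0 ==> z' <= 0 ==> \<bar>dc l kap z - dc l kap z'\<bar> <= Dc l kap * \<bar>z - z'\<bar>"
    and Dc_summable: "(%(l, kap). Dc l kap * E ^ l * ew tau kap) summable_on UNIV"
    and support: "!!l kap z. z <= 0 ==> dc l kap z ~= 0 ==> \<bar>kap\<bar> <= int l + 1 & even (kap - (int l + 1))"
begin

definition dt :: "'a::banach_ring => int => real => 'a" where
  "dt e kap z = (\<Sum>l. dc l kap z *\<^sub>R e ^ l)"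

definition DD :: "int => real" where "DD kap = (\<Sum>l. Dc l kap * E ^ l)"

definition NN :: real where "NN = (\<Sum>\<^sub>\<infinity>kap. DD kap * ew tau kap)"

text \<open>Expansions about points of the ball of radius e0 use elements of norm up to 2 e0, whence
  E / 2; the number 64 leaves room for the smallness 16 e0 NN <= 1/2 of the contraction.\<close>

definition e0 :: real where "e0 = min (E / 2) (1 / (64 * (NN + 1)))"

lemma Dc_nonneg: "Dc l kap >= 0"
  using order_trans[OF abs_ge_zero dc_bound[of 0 l kap]] by simp

lemma Dc_E_summable: "summable (%l. Dc l kap * E ^ l)"
proof -
  have "(%(kap, l). Dc l kap * E ^ l * ew tau kap) summable_on (SIGMA kap:UNIV. UNIV)"
    using summable_on_swap[of "%(l, kap). Dc l kap * E ^ l * ew tau kap" UNIV UNIV] Dc_summable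
    by (simp add: case_prod_unfold)
  from summable_on_SigmaD1[OF this, of kap]
  have "(%l. Dc l kap * E ^ l * ew tau kap) summable_on UNIV" by simp
  from summable_on_cmult_left[OF this, of "ew (-tau) kap"]
  have "(%l. Dc l kap * E ^ l) summable_on UNIV" by (simp add: mult.assoc mult_exp_exp)
  then show ?thesis by (rule summable_on_imp_summable)
qed

lemma DD_summable: "(%kap. DD kap * ew tau kap) summable_on UNIV"
proof -
  have "(%(kap, l). Dc l kap * E ^ l * ew tau kap) summable_on (SIGMA kap:UNIV. UNIV)"
    using summable_on_swap[of "%(l, kap). Dc l kap * E ^ l * ew tau kap" UNIV UNIV] Dc_summable
    by (simp add: case_prod_unfold)
  from summable_on_Sigma_banach[OF this]
  have "(%kap. \<Sum>\<^sub>\<infinity>l. Dc l kap * E ^ l * ew tau kap) summable_on UNIV" by simp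
  moreover have "(\<Sum>\<^sub>\<infinity>l. Dc l kap * E ^ l * ew tau kap) = DD kap * ew tau kap" for kap
  proof -
    have "((%l. Dc l kap * E ^ l) has_sum DD kap) UNIV"
      unfolding DD_def by (rule sums_nonneg_imp_has_sum) (use Dc_nonneg E Dc_E_summable in \<open>auto intro: summable_sums\<close>)
    from has_sum_cmult_left[OF this] show ?thesis by (rule infsumI)
  qed
  ultimately show ?thesis by simp
qed

lemma DD_nonneg: "DD kap >= 0"
  unfolding DD_def by (intro suminf_nonneg Dc_E_summable mult_nonneg_nonneg Dc_nonneg) (use E in simp)

lemma NN_nonneg: "NN >= 0"
  unfolding NN_def by (intro infsum_nonneg mult_nonneg_nonneg DD_nonneg) simp

lemma e0: "e0 > 0" "2 * e0 <= E" "16 * e0 * NN <= 1/2"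
proof -
  show p: "e0 > 0" unfolding e0_def using E NN_nonneg by simp
  show "2 * e0 <= E" unfolding e0_def by simp
  have "16 * e0 * NN <= 16 * (1 / (64 * (NN + 1))) * NN" by (intro mult_right_mono mult_left_mono NN_nonneg) (auto simp: e0_def)
  also have "... <= 1/2" using NN_nonneg by (simp add: field_simps)
  finally show "16 * e0 * NN <= 1/2" .
qed

lemma dt_term:
  fixes e :: "'a::banach_ring"
  assumes "norm e <= E" "abs x <= Dc l kap * y" shows "norm (x *\<^sub>R e ^ l) <= Dc l kap * E ^ l * y"
proof -
  have "norm (x *\<^sub>R e ^ l) <= (Dc l kap * y) * E ^ l"
    unfolding norm_scaleR using assms order_trans[OF norm_power_ineq power_mono[OF assms(1)]]
    by (intro mult_mono) (auto intro: order_trans[OF abs_ge_zero])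
  then show ?thesis by (simp add: mult_ac)
qed

lemma dt_summable:
  fixes e :: "'a::banach_ring"
  assumes e: "norm e <= E" and z: "z <= 0"
  shows "summable (%l. norm (dc l kap z *\<^sub>R e ^ l))"
  by (rule summable_comparison_test'[OF summable_mult2[OF Dc_E_summable[of kap], of "exp z"], of 0])
    (use dt_term[OF e dc_bound[OF z]] in simp)

lemma dt_bound:
  fixes e :: "'a::banach_ring"
  assumes e: "norm e <= E" and z: "z <= 0"
  shows "norm (dt e kap z) <= DD kap * exp z"
proof -
  have "norm (dt e kap z) <= (\<Sum>l. norm (dc l kap z *\<^sub>R e ^ l))"
    unfolding dt_def by (rule summable_norm[OF dt_summable[OF e z]])
  also have "... <= (\<Sum>l. Dc l kap * E ^ l * exp z)"
    by (rule suminf_le[OF _ dt_summable[OF e z] summable_mult2[OF Dc_E_summable]]) (rule dt_term[OF e dc_bound[OF z]])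
  also have "... = DD kap * exp z" unfolding DD_def by (rule suminf_mult2[OF Dc_E_summable, symmetric])
  finally show ?thesis .
qed

lemma dt_lip:
  fixes e :: "'a::banach_ring"
  assumes e: "norm e <= E" and z: "z <= 0" "z' <= 0"
  shows "norm (dt e kap z - dt e kap z') <= DD kap * \<bar>z - z'\<bar>"
proof -
  have eq: "dt e kap z - dt e kap z' = (\<Sum>l. (dc l kap z - dc l kap z') *\<^sub>R e ^ l)"
    unfolding dt_def by (subst suminf_diff) (use dt_summable[OF e] z in \<open>auto intro: summable_norm_cancel simp: scaleR_diff_left\<close>)
  have s: "summable (%l. norm ((dc l kap z - dc l kap z') *\<^sub>R e ^ l))"
    by (rule summable_comparison_test'[OF summable_mult2[OF Dc_E_summable[of kap], of "\<bar>z - z'\<bar>"], of 0])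
      (use dt_term[OF e dc_lip[OF z]] in simp)
  have "norm (dt e kap z - dt e kap z') <= (\<Sum>l. norm ((dc l kap z - dc l kap z') *\<^sub>R e ^ l))"
    unfolding eq by (rule summable_norm[OF s])
  also have "... <= (\<Sum>l. Dc l kap * E ^ l * \<bar>z - z'\<bar>)"
    by (rule suminf_le[OF _ s summable_mult2[OF Dc_E_summable]]) (rule dt_term[OF e dc_lip[OF z]])
  also have "... = DD kap * \<bar>z - z'\<bar>" unfolding DD_def by (rule suminf_mult2[OF Dc_E_summable, symmetric])
  finally show ?thesis .
qed

lemma dt_continuous:
  fixes e :: "'a::banach_ring"
  assumes e: "norm e <= E" shows "continuous_on {..0} (dt e kap)"
proof (rule lipschitz_on_continuous_on)
  show "(DD kap)-lipschitz_on {..0} (dt e kap)"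
    by (rule lipschitz_onI) (use dt_lip[OF e] DD_nonneg in \<open>auto simp: dist_norm\<close>)
qed

lemma dt_hom:
  fixes e :: "'a::banach_ring" and \<phi> :: "'a => 'b::banach_ring"
  assumes h: "contr_hom \<phi>" and e: "norm e <= E" and z: "z <= 0"
  shows "\<phi> (dt e kap z) = dt (\<phi> e) kap z"
  using bounded_linear.suminf[OF contr_hom_bounded_linear[OF h] summable_norm_cancel[OF dt_summable[OF e z]]]
  by (simp add: dt_def contr_hom_simps[OF h])

text \<open>The constant 8 leaves room for perturbed parameters, where only 3/4 of the frequency is
  a guaranteed rate and b may exceed the square of the unperturbed frequency. With norm e <= 2 e0 it
  becomes M = 16 e0 in the fixed point.\<close>

definition admissible :: "(int => real) => (int => 'a::banach_ring) => 'a => 'a => bool" where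
  "admissible nu w b e \<longleftrightarrow> norm e <= 2 * e0 &
     (\<forall>k. (\<forall>t\<ge>0. norm (exp (- (t *\<^sub>R w k))) <= exp (- nu k * t)) & nu k >= -1/4 &
        (norm b <= 8 * (nu k + 3/4) \<or> (nu k > 0 & norm b <= 8 * (nu k * (nu k + 3/4)))))"

lemma admissible_system:
  assumes a: "admissible nu w b e" shows "fiber_system w (b * e) (dt e) DD nu tau (16 * e0)"
proof
  have e: "norm e <= 2 * e0" and eE: "norm e <= E" using a e0 by (auto simp: admissible_def)
  show "norm (exp (- (t *\<^sub>R w k))) <= exp (- nu k * t)" if "0 <= t" for k t using a that by (simp add: admissible_def)
  show nu: "- 1/4 <= nu k" for k using a by (simp add: admissible_def)
  have be: "norm (b * e) <= 16 * e0 * y" if "norm b <= 8 * y" for y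
  proof -
    have "norm (b * e) <= (8 * y) * (2 * e0)" by (rule norm_mult_le[OF that e])
    then show ?thesis by (simp add: mult_ac)
  qed
  have "norm b <= 8 * (nu k + 3/4) \<or> (nu k > 0 & norm b <= 8 * (nu k * (nu k + 3/4)))" for k
    using a by (simp add: admissible_def)
  then show "norm (b * e) <= 16 * e0 * (nu k + 3/4) \<or> 0 < nu k & norm (b * e) <= 16 * e0 * (nu k * (nu k + 3/4))" for k
    using be by blast
  show "continuous_on {..0} (dt e kap)" for kap by (rule dt_continuous[OF eE])
  show "norm (dt e kap z) <= DD kap * exp z" if "z <= 0" for kap z by (rule dt_bound[OF eE that])
  show "16 * e0 * (\<Sum>\<^sub>\<infinity>kap. DD kap * ew tau kap) <= 1/2" using e0(3) by (simp add: NN_def)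
qed (use tau e0 DD_summable in auto)

text \<open>What remains of the Dirichlet-Neumann matrix after the diagonal w and the factor b e are
  removed: th'(0) = w th(0) + b e U(0). Uniqueness makes the choice immaterial, so that values over
  different algebras can be compared.\<close>

definition RR :: "(int => 'a::banach_ring) => 'a => 'a => int => int => 'a" where
  "RR w b e k m = (SOME x. \<exists>Th U. fundamental w (b * e) (dt e) tau Th U & x = U k m 0)"

lemma RR_eq:
  assumes "admissible nu w b e" "fundamental w (b * e) (dt e) tau Th U" shows "RR w b e k m = U k m 0"
proof -
  interpret fiber_system w "b * e" "dt e" DD nu tau "16 * e0" by (rule admissible_system[OF assms(1)])
  have "\<exists>Th U. fundamental w (b * e) (dt e) tau Th U & RR w b e k m = U k m 0"
    unfolding RR_def by (rule someI_ex) (use assms(2) in blast)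
  then show ?thesis using fundamental_unique[OF _ assms(2), of _ _ 0] by auto
qed

lemma fundamental_ex:
  fixes w :: "int => 'a::banach_ring"
  assumes "admissible nu w b e"
  shows "\<exists>Th U. fundamental w (b * e) (dt e) tau Th U &
    (\<forall>k m. \<forall>z\<le>0. norm (Th k m z) <= 2 * ew (-tau) (k - m) * exp (- z / 4) &
        norm (U k m z) <= 2 * NN / (nu k + 3/4) * ew (-tau) (k - m) * exp (3/4 * z))"
proof -
  interpret fiber_system w "b * e" "dt e" DD nu tau "16 * e0" by (rule admissible_system[OF assms])
  show ?thesis
    using fundamental_exists[of "%_. UNIV" "%_. UNIV"] by (auto simp: functional_subspace_UNIV NN_def)
qed

text \<open>The factor 1/(nu + 3/4), kept in the bound for U, is the smoothing by one order.\<close>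

lemma RR_bound:
  assumes "admissible nu w b e"
  shows "norm (RR w b e k m) <= 2 * NN / (nu k + 3/4) * ew (-tau) (k - m)"
proof -
  obtain Th U where f: "fundamental w (b * e) (dt e) tau Th U"
    and b: "!!k m z. z <= 0 ==> norm (U k m z) <= 2 * NN / (nu k + 3/4) * ew (-tau) (k - m) * exp (3/4 * z)"
    using fundamental_ex[OF assms] by blast
  show ?thesis using b[of 0 k m] by (simp add: RR_eq[OF assms f])
qed

lemma fundamental_cong:
  "(!!kap z. z <= 0 ==> d kap z = d' kap z) ==> fundamental w b d tau Th U \<longleftrightarrow> fundamental w b d' tau Th U"
  by (simp add: fundamental_def solves_def lconv_def)

text \<open>Both sides are boundary values of fundamental solutions over the target algebra, where
  these are unique. The rates nu and nu' may differ, since the bounds in \<open>fundamental\<close>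
  do not mention them.\<close>

lemma RR_hom:
  fixes w :: "int => 'a::banach_ring" and \<phi> :: "'a => 'b::banach_ring"
  assumes a: "admissible nu w b e" and h: "contr_hom \<phi>" and a': "admissible nu' w' b' e'"
    and eq: "!!k. \<phi> (w k) = w' k" "\<phi> b = b'" "\<phi> e = e'"
  shows "\<phi> (RR w b e k m) = RR w' b' e' k m"
proof -
  interpret fiber_system w "b * e" "dt e" DD nu tau "16 * e0" by (rule admissible_system[OF a])
  obtain Th U where f: "fundamental w (b * e) (dt e) tau Th U" using fundamental_ex[OF a] by blast
  have eE: "norm e <= E" using a e0 by (auto simp: admissible_def)
  from fundamental_hom[OF h f]
  have "fundamental w' (b' * e') (%kap z. \<phi> (dt e kap z)) tau (%k m z. \<phi> (Th k m z)) (%k m z. \<phi> (U k m z))"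
    by (simp add: eq contr_hom_simps[OF h])
  then have "fundamental w' (b' * e') (dt e') tau (%k m z. \<phi> (Th k m z)) (%k m z. \<phi> (U k m z))"
    by (subst fundamental_cong[where d'="%kap z. \<phi> (dt e kap z)"]) (auto simp: dt_hom[OF h eE] eq)
  from RR_eq[OF a' this] show ?thesis by (simp add: RR_eq[OF a f])
qed

text \<open>Written as a function of be, in place of the square of \<alpha>, because the class of
  analytic families asks for analyticity in that variable near the singular points; be may then be
  negative.\<close>

definition freq :: "real => real => int => real" where "freq be mu k = sqrt ((of_int k + mu)^2 + be)"

lemma norm_exp_of_real: "norm (exp (- (t *\<^sub>R (of_real x :: 'a::banach_ring)))) = exp (- x * t)"
proof -
  have "- (t *\<^sub>R (of_real x :: 'a)) = of_real (- x * t)"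
    by (simp add: of_real_def mult.commute)
  then show ?thesis by (simp only: exp_of_real norm_of_real abs_exp_cancel)
qed

text \<open>A vanishing frequency forces \<alpha> = 0, so that b = 0 satisfies the first
  alternative; otherwise b is at most the square of the frequency, which gives the second.\<close>

lemma admissible_const:
  fixes e :: "'a::banach_ring"
  assumes "norm e <= 2 * e0"
  shows "admissible (freq (al^2) mu) (%k. of_real (freq (al^2) mu k) :: 'a) (of_real (al^2)) e"
  unfolding admissible_def
proof (intro conjI allI impI assms)
  fix k
  show "norm (exp (- (t *\<^sub>R (of_real (freq (al^2) mu k) :: 'a)))) <= exp (- freq (al^2) mu k * t)" for t
    by (simp add: norm_exp_of_real)
  have p: "freq (al^2) mu k >= 0" by (simp add: freq_def)
  then show "- 1/4 <= freq (al^2) mu k" by linarith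
  have a2: "al^2 <= freq (al^2) mu k * freq (al^2) mu k" by (simp add: freq_def)
  have n: "norm (of_real (al^2) :: 'a) = al^2" unfolding norm_of_real by simp
  show "norm (of_real (al^2) :: 'a) <= 8 * (freq (al^2) mu k + 3/4) \<or>
       0 < freq (al^2) mu k & norm (of_real (al^2) :: 'a) <= 8 * (freq (al^2) mu k * (freq (al^2) mu k + 3/4))"
  proof (cases "freq (al^2) mu k = 0")
    case False
    have "freq (al^2) mu k * freq (al^2) mu k <= freq (al^2) mu k * (freq (al^2) mu k + 3/4)" using p by (intro mult_left_mono) auto
    also have "... <= 8 * (freq (al^2) mu k * (freq (al^2) mu k + 3/4))" using p by simp
    finally have "al^2 <= 8 * (freq (al^2) mu k * (freq (al^2) mu k + 3/4))" using a2 by linarith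
    moreover have "freq (al^2) mu k > 0" using False p by linarith
    ultimately show ?thesis unfolding n by blast
  next
    case True
    then show ?thesis unfolding n using a2 by simp
  qed
qed

definition Rmat :: "real => real => real => int => int => real" where
  "Rmat al mu eps = RR (freq (al^2) mu) (al^2) eps"

lemma admissible_real: "abs eps <= 2 * e0 ==> admissible (freq (al^2) mu) (freq (al^2) mu) (al^2) eps"
  using admissible_const[of eps al mu] by simp

text \<open>A perturbed frequency: \<open>\<Omega> (1 + t)\<close> with \<open>(1 + t)^2 = 1 + h\<close>.\<close>

lemma perturbed_frequency:
  fixes h :: "'a::banach_ring"
  assumes h: "norm h <= 1/4" and Om: "\<Omega> > 0"
  shows "\<exists>W. (\<forall>t\<ge>0. norm (exp (- (t *\<^sub>R W))) <= exp (- (3/4 * \<Omega>) * t)) & norm W <= 5/4 * \<Omega> &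
     (\<forall>\<phi>. contr_hom \<phi> --> (\<phi> W :: real) = sqrt (\<Omega>^2 * (1 + \<phi> h)))"
proof -
  obtain t where t: "norm t <= 1/4" "(1 + t) * (1 + t) = 1 + h" using sqrt_one_plus_exists[OF h] by blast
  have 1: "norm (exp (- (x *\<^sub>R (\<Omega> *\<^sub>R (1 + t))))) <= exp (- (3/4 * \<Omega>) * x)" if "x >= 0" for x
    using norm_exp_scaled_le[OF t(1) that, of \<Omega>] Om by (simp add: algebra_simps)
  have "norm (1 + t) <= 5/4" using norm_triangle_ineq[of 1 t] t by simp
  then have 2: "norm (\<Omega> *\<^sub>R (1 + t)) <= 5/4 * \<Omega>" using Om by simp
  have 3: "\<phi> (\<Omega> *\<^sub>R (1 + t)) = sqrt (\<Omega>^2 * (1 + \<phi> h))" if p: "contr_hom \<phi>" for \<phi> :: "'a => real"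
  proof -
    have "\<bar>\<phi> t\<bar> <= 1/4" using contr_hom_simps(8)[OF p, of t] t by simp
    then have pos: "1 + \<phi> t > 0" by linarith
    have "(1 + \<phi> t) * (1 + \<phi> t) = 1 + \<phi> h" using arg_cong[OF t(2), of \<phi>] by (simp add: contr_hom_simps[OF p])
    then have "\<Omega>^2 * (1 + \<phi> h) = (\<Omega> * (1 + \<phi> t))^2" by (simp add: power2_eq_square mult_ac)
    then have "sqrt (\<Omega>^2 * (1 + \<phi> h)) = \<Omega> * (1 + \<phi> t)" using Om pos by (simp add: real_sqrt_unique)
    then show ?thesis by (simp add: contr_hom_simps[OF p])
  qed
  show ?thesis using 1 2 3 by blast
qed

end

section \<open>The class of analytic families\<close>

lemma jap_half_le: "jap k powr (1/2) <= 1 + \<bar>of_int k\<bar>"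
proof -
  have "jap k <= (1 + \<bar>of_int k\<bar>)^2" by (simp add: jap_def power2_eq_square algebra_simps)
  then have "sqrt (jap k) <= 1 + \<bar>of_int k\<bar>" by (intro real_le_lsqrt) auto
  then show ?thesis using jap_pos[of k] by (simp add: powr_half_sqrt)
qed

lemma jap_half_ge: "\<bar>of_int k\<bar> <= jap k powr (1/2)"
proof -
  have "sqrt ((of_int k)^2) <= sqrt (jap k)" unfolding jap_def by (intro real_sqrt_le_mono) simp
  then show ?thesis using jap_pos[of k] by (simp add: powr_half_sqrt)
qed

lemma div_le_jap:
  assumes "jap k powr (1/2) <= C * y" "y > 0" "a >= 0" shows "a / y <= a * C * jap k powr (- 1/2)"
proof -
  have p: "jap k powr (1/2) > 0" "jap k powr (1/2) * jap k powr (-1/2) = 1"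
    using jap_pos[of k] by (auto simp: powr_add[symmetric])
  have "a * jap k powr (1/2) <= a * (C * y)" by (intro mult_left_mono assms)
  then have "a * (jap k powr (1/2) * jap k powr (-1/2)) <= a * (C * y) * jap k powr (-1/2)"
    using mult_right_mono[of "a * jap k powr (1/2)" "a * (C * y)" "jap k powr (-1/2)"] by (simp add: mult.assoc)
  then show ?thesis using assms(2) p by (simp add: pos_divide_le_eq mult_ac)
qed

text \<open>\<open>q\<close> chooses between the full operator, of order 1, and the quotient by \<open>al^2 * eps\<close>, of order -1.\<close>

definition asm :: "bool => int => int => 'a::comm_ring_1 => 'a => 'a => 'a" where
  "asm q k m w c f = (if q then (if k = m then w else 0) + c * f else f)"

lemma asm_hom: "contr_hom \<phi> ==> \<phi> (asm q k m w c f) = asm q k m (\<phi> w) (\<phi> c) (\<phi> f)"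
  by (simp add: asm_def contr_hom_simps)

definition ordr :: "bool => real" where "ordr q = (if q then 1 else -1)"

lemma asm_decay:
  fixes w :: "int => 'a::{comm_ring_1,real_normed_algebra_1}"
  assumes w: "!!k. norm (w k) <= C1 * jap k powr (1/2)"
    and f: "!!k m. norm (f k m) <= C2 * ew (-tau) (k - m) * jap k powr (- 1/2)"
  shows "\<exists>B. mat_decay tau (ordr q) B (%k m. asm q k m (w k) c (f k m))"
proof -
  let ?B = "C1 + C2 + norm c * C2"
  have pos: "C1 >= 0" "C2 >= 0"
    using order_trans[OF norm_ge_zero w[of 0]] order_trans[OF norm_ge_zero f[of 0 0]] by (simp_all add: jap_def)
  have "norm (asm q k m (w k) c (f k m)) <= ?B * ew (-tau) (k - m) * jap k powr (ordr q / 2)" for k m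
  proof (cases q)
    case False
    have "C2 * (ew (-tau) (k - m) * jap k powr (- 1/2)) <= ?B * (ew (-tau) (k - m) * jap k powr (- 1/2))"
      by (intro mult_right_mono) (use pos in auto)
    from order_trans[OF f[of k m, unfolded mult.assoc] this] show ?thesis using False by (simp add: asm_def ordr_def mult.assoc)
  next
    case True
    let ?e = "ew (-tau) (k - m)" and ?j = "jap k powr (1/2)"
    have "jap k powr (- 1/2) <= ?j" using jap_ge1[of k] by (intro powr_mono) auto
    then have f': "norm (f k m) <= C2 * ?e * ?j" using f[of k m] pos by (meson exp_ge_zero mult_left_mono mult_nonneg_nonneg order_trans)
    have "norm (c * f k m) <= norm c * (C2 * ?e * ?j)" by (rule norm_mult_le[OF order_refl f'])
    moreover have "norm (if k = m then w k else 0) <= C1 * ?e * ?j" using w[of k] pos by auto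
    moreover have "C2 * ?e * ?j >= 0" using pos by simp
    ultimately have "norm ((if k = m then w k else 0) + c * f k m) <= C1 * ?e * ?j + C2 * ?e * ?j + norm c * (C2 * ?e * ?j)"
      using norm_triangle_ineq[of "if k = m then w k else 0" "c * f k m"] by linarith
    then show ?thesis using True by (simp add: asm_def ordr_def algebra_simps)
  qed
  then show ?thesis unfolding mat_decay_def using pos by (intro exI[of _ ?B]) auto
qed

lemma mat_decay_hom:
  assumes "mat_decay tau p B f" "contr_hom \<phi>" shows "mat_decay tau p B (%k m. \<phi> (f k m))"
  using assms(1) order_trans[OF contr_hom_simps(8)[OF assms(2)]] unfolding mat_decay_def by blast

context dcoef
begin

definition Gmat :: "bool => real => real => real => int => int => real" where
  "Gmat q al mu eps k m = asm q k m (freq (al^2) mu k) (al^2 * eps) (Rmat al mu eps k m)"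

lemma freq_nonneg: "freq (al^2) mu k >= 0"
  by (simp add: freq_def)

lemma freq_ge: "\<bar>of_int k + mu\<bar> <= freq (al^2) mu k" "abs al <= freq (al^2) mu k"
proof -
  have "sqrt ((of_int k + mu)^2) <= freq (al^2) mu k" "sqrt (al^2) <= freq (al^2) mu k"
    unfolding freq_def by (intro real_sqrt_le_mono, simp)+
  then show "\<bar>of_int k + mu\<bar> <= freq (al^2) mu k" "abs al <= freq (al^2) mu k" by simp_all
qed

lemma freq_sq: "freq (al^2) mu k * freq (al^2) mu k = (of_int k + mu)^2 + al^2"
  by (simp add: freq_def)

text \<open>Comparing k with k + mu costs a multiple of 1 + mu0; from here the bound on mu enters
  the constants of the smoothing estimates.\<close>

lemma jap_le_freq: assumes "abs mu <= mu0" shows "jap k powr (1/2) <= (2 + 2 * mu0) * (freq (al^2) mu k + 3/4)"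
proof -
  have "\<bar>real_of_int k\<bar> <= \<bar>of_int k + mu\<bar> + mu0" using assms by linarith
  then have "jap k powr (1/2) <= freq (al^2) mu k + (1 + mu0)" using jap_half_le[of k] freq_ge(1)[of k mu al] by linarith
  moreover have "2 * mu0 * freq (al^2) mu k >= 0" using assms freq_nonneg[of al mu k] by simp
  moreover have "(2 + 2 * mu0) * (freq (al^2) mu k + 3/4) = 2 * freq (al^2) mu k + 2 * mu0 * freq (al^2) mu k + 3/2 + 3/2 * mu0"
    by (simp add: algebra_simps)
  ultimately show ?thesis using assms freq_nonneg[of al mu k] by linarith
qed

lemma freq_le_jap: "freq (al^2) mu k <= (1 + abs mu + abs al) * jap k powr (1/2)"
proof -
  have "freq (al^2) mu k <= \<bar>of_int k + mu\<bar> + abs al"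
    unfolding freq_def by (rule real_le_lsqrt) (auto simp: power2_sum)
  also have "... <= \<bar>of_int k\<bar> + (abs mu + abs al) * 1" by simp
  also have "... <= jap k powr (1/2) + (abs mu + abs al) * jap k powr (1/2)"
    using jap_half_ge[of k] jap_ge1[of k] by (intro add_mono mult_left_mono ge_one_powr_ge_zero) auto
  finally show ?thesis by (simp add: algebra_simps)
qed

lemma RR_bound_jap:
  assumes a: "admissible nu w b e" and C: "jap k powr (1/2) <= C * (nu k + 3/4)"
  shows "norm (RR w b e k m) <= 2 * NN * C * ew (-tau) (k - m) * jap k powr (- 1/2)"
proof -
  have "nu k >= -1/4" using a by (simp add: admissible_def)
  then have "nu k + 3/4 > 0" by simp
  from div_le_jap[OF C this, of "2 * NN"] NN_nonneg
  have "2 * NN / (nu k + 3/4) * ew (-tau) (k - m) <= 2 * NN * C * jap k powr (- 1/2) * ew (-tau) (k - m)"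
    by (intro mult_right_mono) auto
  with RR_bound[OF a, of k m] show ?thesis by (simp add: mult_ac)
qed

lemma Rmat_bound:
  assumes "abs eps <= 2 * e0" "abs mu <= mu0"
  shows "\<bar>Rmat al mu eps k m\<bar> <= 2 * NN * (2 + 2 * mu0) * ew (-tau) (k - m) * jap k powr (- 1/2)"
  using RR_bound_jap[OF admissible_real[OF assms(1), of al mu] jap_le_freq[OF assms(2), of k al], of m] by (simp add: Rmat_def)

text \<open>The amplitude becomes x0 + e0 X, of norm at most 2 e0, while the frequencies stay
  scalars. One radius serves all \<alpha> and \<mu>, the singular points included.\<close>

lemma Gmat_eps_local:
  assumes x0: "x0 \<in> cball 0 e0"
  shows "\<exists>dl>0. \<exists>B f. mat_decay tau (ordr q) B f &
       (\<forall>y. abs y <= 1 --> x0 + dl * y \<in> cball 0 e0 --> (\<forall>k m. Gmat q al mu (x0 + dl * y) k m = ps_eval y (f k m)))"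
proof -
  define e where "e = of_real x0 + e0 *\<^sub>R (ps_X :: real ps)"
  have en: "norm e <= 2 * e0"
    unfolding e_def using x0 e0(1) by (intro order_trans[OF norm_triangle_ineq]) simp
  let ?w = "%k. of_real (freq (al^2) mu k) :: real ps" and ?b = "of_real (al^2) :: real ps"
  note ad = admissible_const[OF en, of al mu]
  define f where "f k m = asm q k m (?w k) (?b * e) (RR ?w ?b e k m)" for k m
  have fb: "\<exists>B. mat_decay tau (ordr q) B f"
    unfolding f_def[abs_def]
  proof (rule asm_decay[OF _ RR_bound_jap[OF ad jap_le_freq[OF order_refl]]])
    show "norm (?w k) <= (1 + abs mu + abs al) * jap k powr (1/2)" for k using freq_le_jap[of al mu k] freq_nonneg[of al mu k] by simp
  qed
  have ev: "Gmat q al mu (x0 + e0 * y) k m = ps_eval y (f k m)" if y: "abs y <= 1" and S: "x0 + e0 * y \<in> cball 0 e0" for y k m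
  proof -
    have h: "contr_hom (ps_eval y)" using y by (intro contr_hom_ps_eval) simp
    have ee: "ps_eval y e = x0 + e0 * y" by (simp add: e_def contr_hom_simps[OF h])
    have "ps_eval y (RR ?w ?b e k m) = RR (freq (al^2) mu) (al^2) (x0 + e0 * y) k m"
      by (rule RR_hom[OF ad h admissible_real]) (use S e0(1) in \<open>auto simp: ee simp del: of_real_power\<close>)
    then show ?thesis
      by (simp add: f_def asm_hom[OF h] Gmat_def Rmat_def contr_hom_simps(4)[OF h] ee del: of_real_power)
  qed
  show ?thesis using fb e0(1) ev by (intro exI[of _ e0]) blast
qed

lemma freq_lower:
  assumes "(al, mu) \<notin> {0} \<times> \<int>"
  shows "\<exists>\<omega>>0. \<forall>k. freq (al^2) mu k >= \<omega>"
proof (cases "al = 0")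
  case False
  then show ?thesis using freq_ge(2) by (intro exI[of _ "abs al"]) auto
next
  case True
  then have mu: "mu \<notin> \<int>" using assms by auto
  have "\<bar>of_int k + mu\<bar> >= min (frac mu) (1 - frac mu)" for k
  proof -
    have eq: "of_int k + mu = of_int (k + \<lfloor>mu\<rfloor>) + frac mu" by (simp add: frac_def)
    have "min (frac mu) (1 - frac mu) <= frac mu" "min (frac mu) (1 - frac mu) <= 1 - frac mu" by auto
    moreover have "real_of_int (k + \<lfloor>mu\<rfloor>) >= 0 \<or> real_of_int (k + \<lfloor>mu\<rfloor>) <= -1"
      by (cases "k + \<lfloor>mu\<rfloor> >= 0") linarith+
    ultimately show ?thesis unfolding eq by linarith
  qed
  moreover have "min (frac mu) (1 - frac mu) > 0"
    using mu frac_lt_1[of mu] frac_eq_0_iff[of mu] frac_ge_0[of mu] by linarith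
  ultimately show ?thesis using freq_ge(1) by (intro exI[of _ "min (frac mu) (1 - frac mu)"]) (meson order_trans)
qed

lemma norm_sq_plus:
  fixes X :: "'a::{comm_ring_1,real_normed_algebra_1}"
  assumes "norm X <= 1" "dl >= 0"
  shows "norm ((of_real a + dl *\<^sub>R X)^2 - of_real (a^2)) <= 2 * abs a * dl + dl^2"
proof -
  have "(of_real a + dl *\<^sub>R X)^2 - of_real (a^2) = (a * dl) *\<^sub>R X + (a * dl) *\<^sub>R X + dl^2 *\<^sub>R (X * X)"
    by (simp add: power2_eq_square algebra_simps of_real_def)
  also have "norm ... <= \<bar>a * dl\<bar> * norm X + \<bar>a * dl\<bar> * norm X + dl^2 * (norm X * norm X)"
    by (intro order_trans[OF norm_triangle_ineq] add_mono) (auto intro!: mult_left_mono norm_mult_ineq)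
  also have "... <= \<bar>a * dl\<bar> * 1 + \<bar>a * dl\<bar> * 1 + dl^2 * (1 * 1)"
    by (intro add_mono mult_left_mono mult_mono) (use assms in auto)
  finally show ?thesis using assms by (simp add: abs_mult mult_ac)
qed

text \<open>X1 and X2 are the formal increments of \<alpha> and \<mu>. The lower bound \<omega> for
  all frequencies and dl <= \<omega> / 32 keep the relative perturbation h of their squares below
  1/4 uniformly in k. The last clause recognises W under every real evaluation, whatever the
  variables of the algebra are.\<close>

lemma regular_parameters:
  fixes X1 X2 e :: "'a::banach_ring"
  assumes om: "\<omega> > 0" "!!k. freq (al^2) mu k >= \<omega>" and X: "norm X1 <= 1" "norm X2 <= 1" and e: "norm e <= 2 * e0"
    and d: "0 < dl" "dl <= \<omega> / 32"
  shows "\<exists>W. admissible (%k. 3/4 * freq (al^2) mu k) W ((of_real al + dl *\<^sub>R X1)^2) e &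
     (\<forall>k. norm (W k) <= 5/4 * freq (al^2) mu k) &
     (\<forall>\<phi> k. contr_hom \<phi> --> (\<phi> (W k) :: real) = freq ((al + dl * \<phi> X1)^2) (mu + dl * \<phi> X2) k)"
proof -
  let ?O = "freq (al^2) mu" and ?b = "(of_real al + dl *\<^sub>R X1)^2"
  define h where "h k = (1 / (?O k)^2) *\<^sub>R ((of_real (of_int k + mu) + dl *\<^sub>R X2)^2 - of_real ((of_int k + mu)^2) + (?b - of_real (al^2)))" for k
  have Op: "?O k > 0" for k using om(1) om(2)[of k] by linarith
  have dO: "dl <= ?O k / 32" for k using d om(2)[of k] by linarith
  have hn: "norm (h k) <= 1/4" for k
  proof -
    let ?Z = "(of_real (of_int k + mu) + dl *\<^sub>R X2)^2 - of_real ((of_int k + mu)^2) + (?b - of_real (al^2))"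
    have "norm ?Z <= (2 * \<bar>of_int k + mu\<bar> * dl + dl^2) + (2 * abs al * dl + dl^2)"
      by (rule order_trans[OF norm_triangle_ineq add_mono]) (use X d in \<open>auto intro: norm_sq_plus simp del: of_real_power of_real_add\<close>)
    also have "... <= (2 * ?O k * (?O k / 32) + (?O k / 32)^2) + (2 * ?O k * (?O k / 32) + (?O k / 32)^2)"
      using freq_ge[where k=k and mu=mu and al=al] dO[of k] d Op[of k] by (intro add_mono mult_mono power_mono) auto
    also have "... <= 1/4 * (?O k)^2" by (simp add: power2_eq_square field_simps)
    finally have "norm ?Z / (?O k)^2 <= 1/4" using Op[of k] by (simp only: pos_divide_le_eq zero_less_power)
    moreover have "norm (h k) = norm ?Z / (?O k)^2" unfolding h_def norm_scaleR by (simp only: abs_divide abs_one abs_power2 times_divide_eq_left mult_1)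
    ultimately show ?thesis by simp
  qed
  define P where "P k W \<longleftrightarrow> (\<forall>t\<ge>0. norm (exp (- (t *\<^sub>R W))) <= exp (- (3/4 * ?O k) * t)) & norm W <= 5/4 * ?O k &
     (\<forall>\<phi>. contr_hom \<phi> --> (\<phi> W :: real) = sqrt ((?O k)^2 * (1 + \<phi> (h k))))" for k W
  have ex: "\<exists>W. P k W" for k unfolding P_def by (rule perturbed_frequency[OF hn Op])
  define W where "W k = (SOME W. P k W)" for k
  have W: "P k (W k)" for k unfolding W_def by (rule someI_ex[OF ex])
  have bn: "norm ?b <= 8 * (3/4 * ?O k * (3/4 * ?O k + 3/4))" for k
  proof -
    have "norm ?b <= norm (of_real al + dl *\<^sub>R X1 :: 'a) ^ 2" by (rule norm_power_ineq)
    also have "... <= (abs al + dl * 1)^2"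
      using d X by (intro power_mono order_trans[OF norm_triangle_ineq] add_mono) (auto intro: mult_left_mono)
    also have "... <= (?O k + ?O k / 32)^2" using freq_ge(2)[of al mu k] dO[of k] d by (intro power_mono add_mono) auto
    also have "... <= 8 * (3/4 * ?O k * (3/4 * ?O k))" by (simp add: power2_eq_square field_simps)
    also have "... <= 8 * (3/4 * ?O k * (3/4 * ?O k + 3/4))" using Op[of k] by (intro mult_left_mono) auto
    finally show ?thesis .
  qed
  have "admissible (%k. 3/4 * ?O k) W ?b e"
    unfolding admissible_def
  proof (intro conjI allI impI e disjI2 bn)
    show "norm (exp (- (t *\<^sub>R W k))) <= exp (- (3/4 * ?O k) * t)" if "0 <= t" for k t using W[of k] that by (simp add: P_def)
    show "- 1/4 <= 3/4 * ?O k" "0 < 3/4 * ?O k" for k using Op[of k] by auto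
  qed
  moreover have "\<phi> (W k) = freq ((al + dl * \<phi> X1)^2) (mu + dl * \<phi> X2) k" if p: "contr_hom \<phi>" for \<phi> :: "'a => real" and k
  proof -
    have "(?O k)^2 * (1 + \<phi> (h k)) = (of_int k + mu + dl * \<phi> X2)^2 + (al + dl * \<phi> X1)^2"
    proof -
      have "(?O k)^2 * \<phi> (h k) = (of_int k + mu + dl * \<phi> X2)^2 - (of_int k + mu)^2 + ((al + dl * \<phi> X1)^2 - al^2)"
        unfolding h_def using Op[of k] by (simp add: contr_hom_simps[OF p] del: of_real_add of_real_power)
      then show ?thesis using freq_sq[of al mu k] by (simp add: power2_eq_square[of "?O k"] algebra_simps)
    qed
    moreover have "\<phi> (W k) = sqrt ((?O k)^2 * (1 + \<phi> (h k)))" using W[of k] p unfolding P_def by blast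
    ultimately have "\<phi> (W k) = sqrt ((of_int k + mu + dl * \<phi> X2)^2 + (al + dl * \<phi> X1)^2)" by (simp only:)
    then show ?thesis by (simp add: freq_def add.assoc)
  qed
  ultimately show ?thesis using W unfolding P_def by blast
qed

lemma Gmat_regular_analytic:
  assumes eps: "eps \<in> cball 0 e0"
    and F: "!!al mu u. (al, mu) \<in> UNIV - {0} \<times> \<int> ==> u \<in> Hspace s ==> F (al, mu) u = matop (Gmat q al mu eps) u"
  shows "op_analytic_on s (s - ordr q) F (UNIV - {0} \<times> \<int>)"
proof (rule op_analytic_on_real2[where A="%al mu. Gmat q al mu eps", OF tau _ F])
  fix al mu :: real assume "(al, mu) \<in> UNIV - {0} \<times> \<int>"
  then obtain \<omega> where om: "\<omega> > 0" "!!k. freq (al^2) mu k >= \<omega>" using freq_lower[of al mu] by blast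
  define dl where "dl = \<omega> / 32"
  have d: "0 < dl" "dl <= \<omega> / 32" using om by (auto simp: dl_def)
  let ?X1 = "ps_const ps_X :: real ps ps" and ?X2 = "ps_X :: real ps ps" and ?e = "of_real eps :: real ps ps"
  have en: "norm ?e <= 2 * e0" using eps e0(1) by simp
  obtain W where ad: "admissible (%k. 3/4 * freq (al^2) mu k) W ((of_real al + dl *\<^sub>R ?X1)^2) ?e"
    and Wn: "!!k. norm (W k) <= 5/4 * freq (al^2) mu k"
    and Wh: "!!\<phi> k. contr_hom \<phi> ==> (\<phi> (W k) :: real) = freq ((al + dl * \<phi> ?X1)^2) (mu + dl * \<phi> ?X2) k"
    using regular_parameters[OF om, of ?X1 ?X2 ?e dl] en d by auto
  let ?b = "(of_real al + dl *\<^sub>R ?X1)^2"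
  define f where "f k m = asm q k m (W k) (?b * ?e) (RR W ?b ?e k m)" for k m
  have fb: "\<exists>B. mat_decay tau (ordr q) B f"
    unfolding f_def[abs_def]
  proof (rule asm_decay)
    fix k m
    have "norm (W k) <= 5/4 * ((1 + abs mu + abs al) * jap k powr (1/2))" using Wn[of k] freq_le_jap[of al mu k] by linarith
    then show "norm (W k) <= 5/4 * (1 + abs mu + abs al) * jap k powr (1/2)" by (simp only: mult.assoc)
    have "jap k powr (1/2) <= (2 + 2 * abs mu) * (freq (al^2) mu k + 3/4)" by (rule jap_le_freq) simp
    also have "... <= (2 + 2 * abs mu) * (4/3 * (3/4 * freq (al^2) mu k + 3/4))" by (intro mult_left_mono) auto
    finally have "jap k powr (1/2) <= 4/3 * (2 + 2 * abs mu) * (3/4 * freq (al^2) mu k + 3/4)" by (simp only: mult_ac)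
    then show "norm (RR W ?b ?e k m) <= 2 * NN * (4/3 * (2 + 2 * abs mu)) * ew (-tau) (k - m) * jap k powr (- 1/2)"
      by (rule RR_bound_jap[OF ad])
  qed
  have ev: "Gmat q (al + dl * y1) (mu + dl * y2) eps k m = ps_eval y1 (ps_eval (of_real y2) (f k m))" if y: "\<bar>y1\<bar> <= 1" "\<bar>y2\<bar> <= 1" for y1 y2 k m
  proof -
    have h: "contr_hom (%f. ps_eval y1 (ps_eval (of_real y2) f))"
      by (rule contr_hom_comp) (use y in \<open>auto intro!: contr_hom_ps_eval\<close>)
    let ?p = "%f. ps_eval y1 (ps_eval (of_real y2) f)"
    have b: "?p ?b = (al + dl * y1)^2" by (simp only: contr_hom_simps[OF h]) simp
    have w: "?p (W k) = freq ((al + dl * y1)^2) (mu + dl * y2) k" for k using Wh[OF h, of k] by simp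
    have e: "?p ?e = eps" by simp
    have "?p (RR W ?b ?e k m) = RR (freq ((al + dl * y1)^2) (mu + dl * y2)) ((al + dl * y1)^2) eps k m"
      by (rule RR_hom[OF ad h admissible_real w b e]) (use eps e0(1) in auto)
    then show ?thesis
      by (simp add: f_def asm_hom[OF h] Gmat_def Rmat_def contr_hom_simps(4)[OF h] b w e)
  qed
  show "\<exists>dl>0. \<exists>B f. mat_decay tau (ordr q) B f &
       (\<forall>y1 y2. \<bar>y1\<bar> <= 1 --> \<bar>y2\<bar> <= 1 --> (al + dl * y1, mu + dl * y2) \<in> UNIV - {0} \<times> \<int> -->
          (\<forall>k m. Gmat q (al + dl * y1) (mu + dl * y2) eps k m = ps_eval y1 (ps_eval (of_real y2) (f k m))))"
    using d fb ev by (intro exI[of _ dl]) blast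
qed

end

section \<open>Parameters near the singular points (0, j)\<close>

definition srad :: real where "srad = 1/32"

context dcoef
begin

text \<open>The expansion is about the integer |k + j|, which is at least 1 for k other than -j, so
  that one radius works for all these modes. The choice 1/32 of \<open>srad\<close> makes the
  relative perturbation h at most 1/4.\<close>

lemma singular_parameters:
  fixes X1 X2 :: "'a::banach_ring"
  assumes X: "norm X1 <= 1" "norm X2 <= 1" and d: "0 < dl" "dl <= srad^2" and bm: "abs be <= srad^2" "\<bar>mu - of_int j\<bar> <= srad"
    and k: "k ~= - j"
  shows "\<exists>W. (\<forall>t\<ge>0. norm (exp (- (t *\<^sub>R W))) <= exp (- (3/4 * of_int \<bar>k + j\<bar>) * t)) & norm W <= 5/4 * of_int \<bar>k + j\<bar> &
     (\<forall>\<phi>. contr_hom \<phi> --> (\<phi> W :: real) = freq (be + dl * \<phi> X1) (mu + dl * \<phi> X2) k)"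
proof -
  define \<Omega> where "\<Omega> = real_of_int \<bar>k + j\<bar>"
  have O1: "\<Omega> >= 1" using k unfolding \<Omega>_def by linarith
  define m where "m = of_real (mu - of_int j) + dl *\<^sub>R X2"
  define c where "c = real_of_int (k + j)"
  have c2: "c^2 = \<Omega>^2" by (simp add: c_def \<Omega>_def power2_eq_square)
  have cO: "abs c = \<Omega>" by (simp add: c_def \<Omega>_def)
  have mn: "norm m <= 1/16"
  proof -
    have "norm m <= \<bar>mu - of_int j\<bar> + dl * 1"
      unfolding m_def using X d by (intro order_trans[OF norm_triangle_ineq] add_mono) (simp_all add: mult_left_mono del: of_real_diff)
    also have "... <= srad + srad^2" using bm d by simp
    also have "... <= 1/16" by (simp add: srad_def power2_eq_square)
    finally show ?thesis .
  qed
  have bn: "norm (of_real be + dl *\<^sub>R X1 :: 'a) <= 1/512"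
  proof -
    have "norm (of_real be + dl *\<^sub>R X1 :: 'a) <= abs be + dl * 1"
      using X d by (intro order_trans[OF norm_triangle_ineq] add_mono) (simp_all add: mult_left_mono)
    also have "... <= 1/512" using bm d by (simp add: srad_def power2_eq_square)
    finally show ?thesis .
  qed
  define h where "h = (1 / \<Omega>^2) *\<^sub>R ((2 * c) *\<^sub>R m + m * m + (of_real be + dl *\<^sub>R X1))"
  have "norm ((2 * c) *\<^sub>R m + m * m + (of_real be + dl *\<^sub>R X1)) <= (2 * \<Omega>) * (1/16) + 1/16 * (1/16) + 1/512"
    by (intro order_trans[OF norm_triangle_ineq] add_mono bn norm_mult_le mn)
      (use mn cO O1 in \<open>simp add: abs_mult\<close>)
  also have "... <= 1/4 * \<Omega>" using O1 by simp
  also have "... <= 1/4 * \<Omega>^2" using O1 by (simp add: power2_eq_square)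
  finally have hn: "norm h <= 1/4" using O1 unfolding h_def norm_scaleR by (simp add: field_simps)
  from perturbed_frequency[OF hn, of \<Omega>] O1 obtain W where W: "\<forall>t\<ge>0. norm (exp (- (t *\<^sub>R W))) <= exp (- (3/4 * \<Omega>) * t)"
    "norm W <= 5/4 * \<Omega>" "\<forall>\<phi>. contr_hom \<phi> --> (\<phi> W :: real) = sqrt (\<Omega>^2 * (1 + \<phi> h))" by auto
  have "\<Omega>^2 * (1 + \<phi> h) = (of_int k + (mu + dl * \<phi> X2))^2 + (be + dl * \<phi> X1)" if p: "contr_hom \<phi>" for \<phi> :: "'a => real"
  proof -
    have pm: "\<phi> m = mu - of_int j + dl * \<phi> X2" unfolding m_def by (simp only: contr_hom_simps[OF p]) simp
    have "\<Omega>^2 * \<phi> h = 2 * c * \<phi> m + \<phi> m * \<phi> m + (be + dl * \<phi> X1)"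
      unfolding h_def using O1 by (simp add: contr_hom_simps[OF p])
    then have "\<Omega>^2 * (1 + \<phi> h) = c^2 + (2 * c * \<phi> m + \<phi> m * \<phi> m + (be + dl * \<phi> X1))" by (simp add: distrib_left c2)
    also have "... = (c + \<phi> m)^2 + (be + dl * \<phi> X1)" by (simp add: power2_eq_square algebra_simps)
    also have "c + \<phi> m = of_int k + (mu + dl * \<phi> X2)" by (simp add: pm c_def)
    finally show ?thesis .
  qed
  then show ?thesis using W by (intro exI[of _ W]) (auto simp: \<Omega>_def freq_def)
qed

text \<open>The value -1/4 is the worst rate that \<open>admissible\<close> tolerates; it belongs to
  the singular frequency, a variable of norm 1/4 without a sign.\<close>

definition sing_nu :: "int => int => real" where
  "sing_nu j k = (if k = - j then -1/4 else 3/4 * of_int \<bar>k + j\<bar>)"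

lemma sing_nu_ge: "k ~= - j ==> sing_nu j k >= 3/4"
proof -
  assume k: "k ~= - j"
  then have "real_of_int \<bar>k + j\<bar> >= 1" by linarith
  then show ?thesis using k by (simp add: sing_nu_def)
qed

lemma jap_le_sing: "jap k powr (1/2) <= (2 + 2 * \<bar>of_int j\<bar>) * (sing_nu j k + 3/4)"
proof (cases "k = - j")
  case True
  then show ?thesis using jap_half_le[of k] by (simp add: sing_nu_def algebra_simps)
next
  case False
  have "\<bar>real_of_int k\<bar> <= \<bar>of_int (k + j)\<bar> + \<bar>of_int j\<bar>" by linarith
  then have "jap k powr (1/2) <= 1 + \<bar>of_int (k + j)\<bar> + \<bar>of_int j\<bar>" using jap_half_le[of k] by linarith
  also have "... <= (2 + 2 * \<bar>of_int j\<bar>) * (3/4 * \<bar>of_int (k + j)\<bar> + 3/4)"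
  proof -
    have "1 + c + a <= (2 + 2 * a) * (3/4 * c + 3/4)" if "a >= 0" "c >= 0" for a c :: real
    proof -
      have "(2 + 2 * a) * (3/4 * c + 3/4) = 3/2 * c + 3/2 * (a * c) + 3/2 + 3/2 * a" by (simp add: algebra_simps)
      moreover have "a * c >= 0" using that by simp
      ultimately show ?thesis using that by linarith
    qed
    then show ?thesis by simp
  qed
  finally show ?thesis using False by (simp add: sing_nu_def)
qed

text \<open>The frequency of the mode -j is a quarter of the outermost variable. Nothing ties it to
  be and mu until the value 4 sqrt(be + (mu - j)^2) is inserted.\<close>

definition sing_w :: "int => (int => 'a::banach_ring) => int => 'a ps" where
  "sing_w j W k = (if k = - j then (1/4) *\<^sub>R ps_X else ps_const (W k))"

lemma sing_admissible:
  fixes W :: "int => 'a::banach_ring"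
  assumes W: "!!k t. k ~= - j ==> t >= 0 ==> norm (exp (- (t *\<^sub>R W k))) <= exp (- nu k * t)" and nu: "!!k. k ~= - j ==> nu k >= 0" "nu (- j) = -1/4"
    and b: "norm b <= 1" and e: "norm e <= 2 * e0"
  shows "admissible nu (sing_w j W) (ps_const b) (ps_const e)"
  unfolding admissible_def
proof (intro conjI allI impI)
  show "norm (ps_const e) <= 2 * e0" using e by simp
  fix k
  show "norm (exp (- (t *\<^sub>R sing_w j W k))) <= exp (- nu k * t)" if "0 <= t" for t
  proof (cases "k = - j")
    case True
    have "norm (exp (- (t *\<^sub>R sing_w j W k))) <= exp (norm (- (t *\<^sub>R ((1/4) *\<^sub>R (ps_X :: 'a ps)))))"
      using norm_exp[of "- (t *\<^sub>R ((1/4) *\<^sub>R (ps_X :: 'a ps)))"] True by (simp add: sing_w_def)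
    then show ?thesis using True nu(2) that by simp
  next
    case False
    have "exp (- (t *\<^sub>R ps_const (W k))) = ps_const (exp (- (t *\<^sub>R W k)))"
      by (simp add: contr_hom_exp[OF contr_hom_ps_const] contr_hom_simps[OF contr_hom_ps_const])
    then show ?thesis using W[OF False that] False by (simp add: sing_w_def)
  qed
  show "- 1/4 <= nu k" using nu by (cases "k = - j") (auto intro: order_trans[of _ 0])
  \<comment> \<open>As nu + 3/4 >= 1/2, the first alternative holds even for the singular mode: 8 /
    2 exceeds the bound 1 for b.\<close>
  then show "norm (ps_const b) <= 8 * (nu k + 3/4) \<or> 0 < nu k & norm (ps_const b) <= 8 * (nu k * (nu k + 3/4))"
    using b by simp
qed

definition R4 :: "int => real => real => real => int => int => real ps" where
  "R4 j be mu eps = RR (sing_w j (freq be mu)) (ps_const be) (ps_const eps)"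

definition sing_box :: "int => (real \<times> real \<times> real) set" where
  "sing_box j = cball 0 (srad^2) \<times> cball (of_int j) srad \<times> cball 0 e0"

lemma sing_box_iff: "(be, mu, eps) \<in> sing_box j \<longleftrightarrow> \<bar>be\<bar> <= srad^2 & \<bar>mu - of_int j\<bar> <= srad & abs eps <= e0"
  by (auto simp: sing_box_def dist_real_def)

lemma freq_real_sing:
  assumes "(be, mu, eps) \<in> sing_box j" "k ~= - j"
  shows "freq be mu k >= 3/4 * of_int \<bar>k + j\<bar>"
proof -
  let ?O = "real_of_int \<bar>k + j\<bar>"
  have O1: "?O >= 1" using assms(2) by linarith
  have b: "abs be <= srad^2" and m: "\<bar>mu - of_int j\<bar> <= srad" using assms(1) by (auto simp: sing_box_iff)
  have "\<bar>of_int k + mu\<bar> >= ?O - srad" using m by linarith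
  then have "(?O - srad)^2 <= (of_int k + mu)^2" using O1 by (simp add: srad_def abs_le_square_iff[symmetric])
  moreover have "(3/4 * ?O)^2 <= (?O - srad)^2 - srad^2"
  proof -
    have "(3/4 * x)^2 <= (x - srad)^2 - srad^2" if "x >= 1" for x :: real
    proof -
      have "x * 1 <= x * x" using that by (intro mult_left_mono) auto
      moreover have "(3/4 * x)^2 = 9/16 * (x * x)" by (simp add: power2_eq_square)
      moreover have "(x - srad)^2 - srad^2 = x * x - x / 16" by (simp add: srad_def power2_eq_square algebra_simps)
      ultimately show ?thesis using that by linarith
    qed
    then show ?thesis using O1 .
  qed
  ultimately have "(3/4 * ?O)^2 <= (of_int k + mu)^2 + be" using b by linarith
  then show ?thesis unfolding freq_def by (rule real_le_rsqrt)
qed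

lemma R4_admissible:
  assumes "(be, mu, eps) \<in> sing_box j"
  shows "admissible (sing_nu j) (sing_w j (freq be mu)) (ps_const be) (ps_const eps)"
proof (rule sing_admissible)
  show "norm (exp (- (t *\<^sub>R freq be mu k))) <= exp (- sing_nu j k * t)" if "k ~= - j" "t >= 0" for k t
    using mult_right_mono[OF freq_real_sing[OF assms that(1)] that(2)] that by (simp add: sing_nu_def mult_ac)
  show "sing_nu j k >= 0" if "k ~= - j" for k using sing_nu_ge[OF that] by simp
  show "norm be <= 1" using assms by (simp add: sing_box_iff srad_def power2_eq_square)
  show "norm eps <= 2 * e0" using assms e0(1) by (simp add: sing_box_iff)
qed (simp add: sing_nu_def)

text \<open>Even and odd parts in x = 4 sqrt(be + (mu - j)^2). They depend on the square of x only,
  which is polynomial in the parameters; the factor 4 of the odd part turns x into the square root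
  of the class definition.\<close>

definition sing_part :: "bool => int => real => real => real => int => int => real" where
  "sing_part od j be mu eps k m = (if od then 4 * ps_odd (16 * (be + (mu - of_int j)^2)) (R4 j be mu eps k m)
     else ps_even (16 * (be + (mu - of_int j)^2)) (R4 j be mu eps k m))"

definition sing_diag :: "bool => int => real => real => int => real" where
  "sing_diag od j be mu k = (if k = - j then (if od then 1 else 0) else (if od then 0 else freq be mu k))"

definition Gsing :: "bool => bool => int => real => real => real => int => int => real" where
  "Gsing q od j be mu eps k m = asm q k m (sing_diag od j be mu k) (be * eps) (sing_part od j be mu eps k m)"

text \<open>There are four formal variables: three increments and the singular frequency. The last
  is eliminated by inserting qq, a polynomial in the increments of norm at most 1, into the even and
  odd parts. Both parts commute with homomorphisms, so evaluating the increments gives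
  \<open>Gsing\<close>.\<close>

lemma Gsing_local:
  assumes box: "(be, mu, eps) \<in> sing_box j"
  shows "\<exists>dl>0. \<exists>B f. mat_decay tau (ordr q) B f &
       (\<forall>y1 y2 y3. \<bar>y1\<bar> <= 1 --> \<bar>y2\<bar> <= 1 --> \<bar>y3\<bar> <= 1 --> (be + dl * y1, mu + dl * y2, eps + dl * y3) \<in> sing_box j -->
          (\<forall>k m. Gsing q od j (be + dl * y1) (mu + dl * y2) (eps + dl * y3) k m = ps_eval y1 (ps_eval (of_real y2) (ps_eval (of_real y3) (f k m)))))"
proof -
  have bm: "abs be <= srad^2" "\<bar>mu - of_int j\<bar> <= srad" and eps: "abs eps <= e0" using box by (auto simp: sing_box_iff)
  define dl where "dl = min (srad^2) e0"
  have d: "0 < dl" "dl <= srad^2" "dl <= e0" using e0(1) by (auto simp: dl_def srad_def)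
  define X1 where "X1 = (ps_const (ps_const ps_X) :: real ps ps ps)"
  define X2 where "X2 = (ps_const ps_X :: real ps ps ps)"
  define X3 where "X3 = (ps_X :: real ps ps ps)"
  have X: "norm X1 <= 1" "norm X2 <= 1" "norm X3 <= 1" by (simp_all add: X1_def X2_def X3_def)
  define P where "P k W \<longleftrightarrow> (\<forall>t\<ge>0. norm (exp (- (t *\<^sub>R W))) <= exp (- (3/4 * of_int \<bar>k + j\<bar>) * t)) & norm W <= 5/4 * of_int \<bar>k + j\<bar> &
     (\<forall>\<phi>. contr_hom \<phi> --> (\<phi> W :: real) = freq (be + dl * \<phi> X1) (mu + dl * \<phi> X2) k)" for k W
  have ex: "\<exists>W. P k W" if "k ~= - j" for k unfolding P_def by (rule singular_parameters[OF X(1,2) d(1,2) bm that])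
  define W where "W k = (SOME W. P k W)" for k
  have W: "P k (W k)" if "k ~= - j" for k unfolding W_def by (rule someI_ex[OF ex[OF that]])
  define b where "b = of_real be + dl *\<^sub>R X1"
  define e where "e = of_real eps + dl *\<^sub>R X3"
  define qq where "qq = 16 *\<^sub>R (b + (of_real (mu - of_int j) + dl *\<^sub>R X2)^2)"
  have bn: "norm b <= 1/512"
  proof -
    have "norm b <= abs be + dl * 1"
      unfolding b_def using X d by (intro order_trans[OF norm_triangle_ineq] add_mono) (simp_all add: mult_left_mono)
    also have "... <= 1/512" using bm d by (simp add: srad_def power2_eq_square)
    finally show ?thesis .
  qed
  have en: "norm e <= 2 * e0"
  proof -
    have "norm e <= abs eps + dl * 1"
      unfolding e_def using X d by (intro order_trans[OF norm_triangle_ineq] add_mono) (simp_all add: mult_left_mono)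
    then show ?thesis using eps d by simp
  qed
  have qn: "norm qq <= 1"
  proof -
    have "norm (of_real (mu - of_int j) + dl *\<^sub>R X2) <= \<bar>mu - of_int j\<bar> + dl * 1"
      using X d by (intro order_trans[OF norm_triangle_ineq] add_mono) (simp_all add: mult_left_mono del: of_real_diff)
    also have "... <= 1/16" using bm d by (simp add: srad_def power2_eq_square)
    finally have n1: "norm (of_real (mu - of_int j) + dl *\<^sub>R X2) <= 1/16" .
    have "norm ((of_real (mu - of_int j) + dl *\<^sub>R X2)^2) <= 1/16 * (1/16)"
      unfolding power2_eq_square by (rule norm_mult_le[OF n1 n1])
    then have "norm (b + (of_real (mu - of_int j) + dl *\<^sub>R X2)^2) <= 1/512 + 1/16 * (1/16)"
      by (intro order_trans[OF norm_triangle_ineq] add_mono bn)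
    then show ?thesis by (simp add: qq_def)
  qed
  have ad: "admissible (sing_nu j) (sing_w j W) (ps_const b) (ps_const e)"
  proof (rule sing_admissible[OF _ _ _ _ en])
    show "norm (exp (- (t *\<^sub>R W k))) <= exp (- sing_nu j k * t)" if "k ~= - j" "0 <= t" for k t
      using W[OF that(1)] that by (simp add: P_def sing_nu_def)
    show "0 <= sing_nu j k" if "k ~= - j" for k using sing_nu_ge[OF that] by simp
  qed (use bn in \<open>auto simp: sing_nu_def\<close>)
  define r where "r k m = RR (sing_w j W) (ps_const b) (ps_const e) k m" for k m
  define g where "g k m = (if od then 4 *\<^sub>R ps_odd qq (r k m) else ps_even qq (r k m))" for k m
  define D where "D k = (if k = - j then (if od then 1 else 0) else (if od then 0 else W k))" for k
  define f where "f k m = asm q k m (D k) (b * e) (g k m)" for k m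
  have fb: "\<exists>B. mat_decay tau (ordr q) B f"
    unfolding f_def[abs_def]
  proof (rule asm_decay)
    fix k m
    have j1: "1 <= jap k powr (1/2)" using jap_ge1[of k] by (intro ge_one_powr_ge_zero) auto
    have "norm (D k) <= 1 + 5/4 * \<bar>of_int (k + j)\<bar>" using W[of k] by (auto simp: D_def P_def)
    also have "... <= 5/4 * (\<bar>of_int k\<bar> + (1 + \<bar>of_int j\<bar>) * 1)"
      using abs_triangle_ineq[of "real_of_int k" "real_of_int j"] by simp
    also have "... <= 5/4 * (jap k powr (1/2) + (1 + \<bar>of_int j\<bar>) * jap k powr (1/2))"
      using j1 jap_half_ge[of k] by (intro mult_left_mono add_mono) auto
    finally show "norm (D k) <= (5/2 + 5/4 * \<bar>real_of_int j\<bar>) * jap k powr (1/2)" by (simp add: algebra_simps)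
    have "norm (g k m) <= 4 * norm (r k m)"
    proof (cases od)
      case False
      have "norm (ps_even qq (r k m)) <= norm (r k m)" by (rule norm_ps_even[OF qn])
      also have "... <= 4 * norm (r k m)" by simp
      finally show ?thesis using False by (simp add: g_def)
    qed (use norm_ps_odd[OF qn, of "r k m"] in \<open>simp add: g_def\<close>)
    also have "... <= 4 * (2 * NN * (2 + 2 * \<bar>of_int j\<bar>) * ew (-tau) (k - m) * jap k powr (- 1/2))"
      unfolding r_def by (intro mult_left_mono RR_bound_jap[OF ad jap_le_sing]) simp
    finally show "norm (g k m) <= 4 * (2 * NN * (2 + 2 * \<bar>of_int j\<bar>)) * ew (-tau) (k - m) * jap k powr (- 1/2)" by (simp only: mult.assoc)
  qed
  have ev: "Gsing q od j (be + dl * y1) (mu + dl * y2) (eps + dl * y3) k m = ps_eval y1 (ps_eval (of_real y2) (ps_eval (of_real y3) (f k m)))"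
    if y: "\<bar>y1\<bar> <= 1" "\<bar>y2\<bar> <= 1" "\<bar>y3\<bar> <= 1" and S: "(be + dl * y1, mu + dl * y2, eps + dl * y3) \<in> sing_box j" for y1 y2 y3 k m
  proof -
    define p where "p f = ps_eval y1 (ps_eval (of_real y2) (ps_eval (of_real y3) f))" for f :: "real ps ps ps"
    have h1: "contr_hom (ps_eval y1)" using y by (intro contr_hom_ps_eval) simp
    have h2: "contr_hom (%f. ps_eval y1 (ps_eval (of_real y2) f))"
      by (rule contr_hom_comp[OF contr_hom_ps_eval h1]) (use y in simp)
    have "contr_hom (%f. ps_eval y1 (ps_eval (of_real y2) (ps_eval (of_real y3) f)))"
      by (rule contr_hom_comp[OF contr_hom_ps_eval h2]) (use y in simp)
    then have h: "contr_hom p" by (simp add: p_def[abs_def])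
    have pX: "p X1 = y1" "p X2 = y2" "p X3 = y3" by (simp_all add: p_def X1_def X2_def X3_def)
    let ?be = "be + dl * y1" and ?mu = "mu + dl * y2" and ?eps = "eps + dl * y3"
    have pb: "p b = ?be" and pe: "p e = ?eps"
      unfolding b_def e_def by (simp_all add: contr_hom_simps[OF h] pX)
    have pq: "p qq = 16 * (?be + (?mu - of_int j)^2)"
      unfolding qq_def by (simp add: contr_hom_simps[OF h] pX pb algebra_simps del: of_real_diff)
    have pw: "p (W k) = freq ?be ?mu k" if "k ~= - j" for k
    proof -
      have "p (W k) = freq (be + dl * p X1) (mu + dl * p X2) k" using W[OF that] h unfolding P_def by blast
      then show ?thesis by (simp only: pX)
    qed
    have hm: "contr_hom (ps_map p)" by (rule contr_hom_ps_map[OF h])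
    have r: "ps_map p (r k m) = R4 j ?be ?mu ?eps k m"
      unfolding r_def R4_def
    proof (rule RR_hom[OF ad hm R4_admissible[OF S]])
      show "ps_map p (sing_w j W k) = sing_w j (freq ?be ?mu) k" for k
        by (simp add: sing_w_def contr_hom_simps[OF hm] ps_map_X[OF h] ps_map_const[OF h] pw)
    qed (simp_all add: ps_map_const[OF h] pb pe)
    have g: "p (g k m) = sing_part od j ?be ?mu ?eps k m"
      by (simp add: g_def sing_part_def contr_hom_simps[OF h] hom_ps_odd[OF h qn] hom_ps_even[OF h qn] r pq)
    have D: "p (D k) = sing_diag od j ?be ?mu k" by (simp add: D_def sing_diag_def contr_hom_simps[OF h] pw)
    show ?thesis unfolding p_def[symmetric] f_def
      by (simp add: asm_hom[OF h] Gsing_def g D contr_hom_simps(4)[OF h] pb pe)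
  qed
  show ?thesis using fb d ev by (intro exI[of _ dl]) blast
qed

lemma Gsing_decay:
  assumes "(be, mu, eps) \<in> sing_box j"
  shows "\<exists>B. mat_decay tau (ordr q) B (Gsing q od j be mu eps)"
proof -
  obtain dl B f where f: "mat_decay tau (ordr q) B f" and
    "\<forall>y1 y2 y3. \<bar>y1\<bar> <= 1 --> \<bar>y2\<bar> <= 1 --> \<bar>y3\<bar> <= 1 --> (be + dl * y1, mu + dl * y2, eps + dl * y3) \<in> sing_box j -->
          (\<forall>k m. Gsing q od j (be + dl * y1) (mu + dl * y2) (eps + dl * y3) k m = ps_eval y1 (ps_eval (of_real y2) (ps_eval (of_real y3) (f k m))))"
    using Gsing_local[OF assms] by blast
  from this(2)[rule_format, of 0 0 0] have eq: "Gsing q od j be mu eps = (%k m. ps_eval 0 (ps_eval 0 (ps_eval 0 (f k m))))"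
    using assms by (simp add: fun_eq_iff)
  show ?thesis unfolding eq by (intro exI[of _ B] mat_decay_hom[OF mat_decay_hom[OF mat_decay_hom[OF f]]] contr_hom_ps_eval) auto
qed

text \<open>On the box the singular frequency is at most 1/4, so four times its value may be
  inserted into the outermost variable. This turns the formal frequencies into \<open>freq\<close>,
  and \<open>RR_hom\<close> identifies the result with R; it remains to separate even and odd
  powers.\<close>

lemma Rmat_sing:
  assumes "(al^2, mu, eps) \<in> sing_box j"
  shows "Rmat al mu eps k m = sing_part False j (al^2) mu eps k m + sqrt (al^2 + (mu - of_int j)^2) * sing_part True j (al^2) mu eps k m"
proof -
  let ?\<omega> = "sqrt (al^2 + (mu - of_int j)^2)"
  have bm: "\<bar>al^2\<bar> <= srad^2" "\<bar>mu - of_int j\<bar> <= srad" and eps: "abs eps <= e0" using assms by (auto simp: sing_box_iff)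
  have "(mu - of_int j)^2 <= srad^2" using bm(2) by (simp add: abs_le_square_iff[symmetric] srad_def)
  then have "al^2 + (mu - of_int j)^2 <= (1/4)^2" using bm(1) unfolding srad_def power2_eq_square by simp
  then have "?\<omega> <= 1/4" by (rule real_le_lsqrt[rotated]) simp
  then have om: "?\<omega> <= 1/4" "?\<omega> >= 0" by simp_all
  have x: "norm (4 * ?\<omega>) <= 1" using om by simp
  note h = contr_hom_ps_eval[OF x]
  have "ps_eval (4 * ?\<omega>) (R4 j (al^2) mu eps k m) = Rmat al mu eps k m"
    unfolding R4_def Rmat_def
  proof (rule RR_hom[OF R4_admissible[OF assms] h admissible_real])
    show "ps_eval (4 * ?\<omega>) (sing_w j (freq (al^2) mu) k) = freq (al^2) mu k" for k
      by (auto simp: sing_w_def contr_hom_simps[OF h] freq_def add.commute algebra_simps)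
  qed (use eps e0(1) in auto)
  moreover have "(4 * ?\<omega>)^2 = 16 * (al^2 + (mu - of_int j)^2)" by (simp add: power_mult_distrib)
  ultimately show ?thesis using ps_eval_even_odd[OF x, of "R4 j (al^2) mu eps k m"] by (simp add: sing_part_def)
qed

lemma Gmat_sing:
  assumes "(al^2, mu, eps) \<in> sing_box j"
  shows "Gmat q al mu eps k m = Gsing q False j (al^2) mu eps k m + sqrt (al^2 + (mu - of_int j)^2) * Gsing q True j (al^2) mu eps k m"
proof -
  have "freq (al^2) mu k = sing_diag False j (al^2) mu k + sqrt (al^2 + (mu - of_int j)^2) * sing_diag True j (al^2) mu k"
    by (auto simp: sing_diag_def freq_def add.commute)
  then show ?thesis
    using Rmat_sing[OF assms, of k m] by (simp add: Gmat_def Gsing_def asm_def algebra_simps)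
qed

lemma Gmat_decay:
  assumes "eps \<in> cball 0 e0" shows "\<exists>B. mat_decay tau (ordr q) B (Gmat q al mu eps)"
proof -
  obtain dl B f where f: "mat_decay tau (ordr q) B f" and
    "\<forall>y. abs y <= 1 --> eps + dl * y \<in> cball 0 e0 --> (\<forall>k m. Gmat q al mu (eps + dl * y) k m = ps_eval y (f k m))"
    using Gmat_eps_local[OF assms] by blast
  from this(2)[rule_format, of 0] have eq: "Gmat q al mu eps = (%k m. ps_eval 0 (f k m))" using assms by (simp add: fun_eq_iff)
  show ?thesis unfolding eq by (intro exI[of _ B] mat_decay_hom[OF f] contr_hom_ps_eval) simp
qed

theorem classA_Gmat:
  assumes F: "!!al mu eps u. eps \<in> cball 0 e0 ==> u \<in> Hspace s ==> F al mu eps u = matop (Gmat q al mu eps) u"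
  shows "classA s (s - ordr q) UNIV e0 F"
  unfolding classA_def
proof (intro conjI ballI)
  have bo: "bounded_op s (s - ordr q) (F al mu eps)" if eps: "eps \<in> cball 0 e0" for al mu eps
  proof -
    obtain C where "mat_decay tau (ordr q) C (Gmat q al mu eps)" using Gmat_decay[OF eps] by blast
    then show ?thesis by (intro bounded_op_cong[OF F[OF eps]] bounded_op_matop[OF tau])
  qed
  then show "case x of (al, mu) => \<forall>eps\<in>cball 0 e0. bounded_op s (s - ordr q) (F al mu eps)" for x by (cases x) auto
  show "case x of (al, mu) => op_analytic_on s (s - ordr q) (F al mu) (cball 0 e0)" for x
    using op_analytic_on_real[OF tau Gmat_eps_local F[of _ _ "fst x" "snd x"]] by (cases x) auto
  show "op_analytic_on s (s - ordr q) (%(al, mu). F al mu eps) (UNIV - {0} \<times> \<int>)" if "eps \<in> cball 0 e0" for eps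
    by (rule Gmat_regular_analytic[OF that]) (use F that in auto)
  show "\<exists>r>0. \<forall>j. \<exists>A1 A2.
       op_analytic_on s (s - ordr q) (%(be, mu, eps). A1 be mu eps) (cball 0 (r^2) \<times> cball (real_of_int j) r \<times> cball 0 e0) &
       op_analytic_on s (s - ordr q) (%(be, mu, eps). A2 be mu eps) (cball 0 (r^2) \<times> cball (real_of_int j) r \<times> cball 0 e0) &
       (\<forall>(al, mu)\<in>cball (0, real_of_int j) r \<inter> UNIV. \<forall>eps\<in>cball 0 e0. \<forall>u\<in>Hspace s. \<forall>k.
           F al mu eps u k = A1 (al^2) mu eps u k + of_real (sqrt (al^2 + (mu - real_of_int j)^2)) * A2 (al^2) mu eps u k)"
  proof (intro exI[of _ srad] conjI allI)
    show "srad > 0" by (simp add: srad_def)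
    fix j :: int
    let ?A1 = "%be mu eps. matop (Gsing q False j be mu eps)" and ?A2 = "%be mu eps. matop (Gsing q True j be mu eps)"
    have dec: "F al mu eps u k = ?A1 (al^2) mu eps u k + of_real (sqrt (al^2 + (mu - real_of_int j)^2)) * ?A2 (al^2) mu eps u k"
      if am: "(al, mu) \<in> cball (0, real_of_int j) srad" and eps: "eps \<in> cball 0 e0" and u: "u \<in> Hspace s" for al mu eps u k
    proof -
      have "abs al <= srad" "\<bar>mu - of_int j\<bar> <= srad"
        using am dist_fst_le[of "(0, real_of_int j)" "(al, mu)"] dist_snd_le[of "(0, real_of_int j)" "(al, mu)"] by (auto simp: dist_real_def)
      then have box: "(al^2, mu, eps) \<in> sing_box j"
        using eps by (simp add: sing_box_iff abs_le_square_iff[symmetric] srad_def)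
      let ?s = "sqrt (al^2 + (mu - real_of_int j)^2)"
      obtain C1 C2 where C: "mat_decay tau (ordr q) C1 (Gsing q False j (al^2) mu eps)" "mat_decay tau (ordr q) C2 (Gsing q True j (al^2) mu eps)"
        using Gsing_decay[OF box] by metis
      have "F al mu eps u k = matop (Gmat q al mu eps) u k" using F[OF eps u] by simp
      also have "... = (\<Sum>\<^sub>\<infinity>m. of_real (Gsing q False j (al^2) mu eps k m) * u m + of_real ?s * (of_real (Gsing q True j (al^2) mu eps k m) * u m))"
        unfolding matop_def by (intro infsum_cong) (simp only: Gmat_sing[OF box] of_real_add of_real_mult distrib_right mult.assoc)
      also have "... = ?A1 (al^2) mu eps u k + of_real ?s * ?A2 (al^2) mu eps u k"
        unfolding matop_def
        by (rule infsumI) (intro has_sum_add has_sum_cmult_right has_sum_infsum matop_estimate(1)[OF tau C(1) u] matop_estimate(1)[OF tau C(2) u])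
      finally show ?thesis .
    qed
    have an: "op_analytic_on s (s - ordr q) (%(be, mu, eps). matop (Gsing q od j be mu eps)) (cball 0 (srad^2) \<times> cball (real_of_int j) srad \<times> cball 0 e0)" for od
      unfolding sing_box_def[symmetric] by (rule op_analytic_on_real3[OF tau Gsing_local]) auto
    show "\<exists>A1 A2.
       op_analytic_on s (s - ordr q) (%(be, mu, eps). A1 be mu eps) (cball 0 (srad^2) \<times> cball (real_of_int j) srad \<times> cball 0 e0) &
       op_analytic_on s (s - ordr q) (%(be, mu, eps). A2 be mu eps) (cball 0 (srad^2) \<times> cball (real_of_int j) srad \<times> cball 0 e0) &
       (\<forall>(al, mu)\<in>cball (0, real_of_int j) srad \<inter> UNIV. \<forall>eps\<in>cball 0 e0. \<forall>u\<in>Hspace s. \<forall>k.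
           F al mu eps u k = A1 (al^2) mu eps u k + of_real (sqrt (al^2 + (mu - real_of_int j)^2)) * A2 (al^2) mu eps u k)"
      using an[of False] an[of True] dec by (intro exI[of _ ?A1] exI[of _ ?A2]) auto
  qed
qed

section \<open>Grading by the order in the amplitude: the class F\<close>

definition Fmat :: "bool => real => real => real => int => int => real" where
  "Fmat q al mu eps k m = (if q & k = m then freq (al^2) mu k else 0) + al^2 * eps * Rmat al mu eps k m"

text \<open>Series in eps whose coefficient of order l may contribute to the band kap only as the
  class F permits for the order l + a. The shift a = 1 belongs to U and to R, because d has given
  away one power of eps; this is why \<open>Fmat\<close> keeps the factor eps in front of R while
  \<open>Gmat False\<close> drops it.\<close>

definition graded :: "nat => int => real ps set" where
  "graded a kap = {f. \<forall>l. ps_nth f l ~= 0 --> \<bar>kap\<bar> <= int (l + a) & even (kap - int (l + a))}"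

lemma functional_subspace_graded: "functional_subspace (graded a kap)"
proof -
  define P where "P = {(%f::real ps. ps_nth f l) | l. \<not> (abs kap <= int (l + a) & even (kap - int (l + a)))}"
  have "x \<in> graded a kap \<longleftrightarrow> (\<forall>\<psi>\<in>P. \<psi> x = 0)" for x by (auto simp: graded_def P_def)
  then have "graded a kap = {x. \<forall>\<psi>\<in>P. \<psi> x = 0}" by blast
  moreover have "bounded_linear \<psi>" if "\<psi> \<in> P" for \<psi> using that bounded_linear_ps_nth by (auto simp: P_def)
  ultimately show ?thesis unfolding functional_subspace_def by blast
qed

lemma graded_mult:
  assumes "f \<in> graded a kap" "g \<in> graded b kap'" shows "f * g \<in> graded (a + b) (kap + kap')"
  unfolding graded_def mem_Collect_eq
proof (intro allI impI)
  fix l assume "ps_nth (f * g) l ~= 0"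
  then obtain i where i: "i <= l" "ps_nth f i * ps_nth g (l - i) ~= 0"
    unfolding ps_nth_mult by (meson atMost_iff sum.neutral)
  then have 1: "abs kap <= int (i + a)" "even (kap - int (i + a))" "abs kap' <= int (l - i + b)" "even (kap' - int (l - i + b))"
    using assms by (auto simp: graded_def)
  have 2: "(kap - int (i + a)) + (kap' - int (l - i + b)) = kap + kap' - int (l + (a + b))" using i(1) by simp
  have "even (kap + kap' - int (l + (a + b)))" unfolding 2[symmetric] by (rule dvd_add[OF 1(2,4)])
  moreover have "\<bar>kap + kap'\<bar> <= int (l + (a + b))" using 1(1,3) i(1) by linarith
  ultimately show "\<bar>kap + kap'\<bar> <= int (l + (a + b)) & even (kap + kap' - int (l + (a + b)))" by blast
qed

lemma graded_of_real: "of_real r \<in> graded 0 0"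
  by (auto simp: graded_def ps_of_real ps_nth_const)

text \<open>The factor eps in b e restores the lost order: the shift 1 becomes 0.\<close>

lemma scaled_X_mult_graded:
  assumes "f \<in> graded 1 kap" shows "(r *\<^sub>R ps_X) * f \<in> graded 0 kap"
  unfolding graded_def mem_Collect_eq
proof (intro allI impI)
  fix l assume "ps_nth ((r *\<^sub>R ps_X) * f) l ~= 0"
  then obtain i where i: "i <= l" "ps_nth (r *\<^sub>R ps_X) i * ps_nth f (l - i) ~= 0"
    unfolding ps_nth_mult by (meson atMost_iff sum.neutral)
  then have i1: "i = 1" by (auto simp: ps_nth_X split: if_splits)
  then have "abs kap <= int (l - 1 + 1) & even (kap - int (l - 1 + 1))" using assms i by (auto simp: graded_def)
  then show "abs kap <= int (l + 0) & even (kap - int (l + 0))" using i(1) i1 by simp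
qed

lemma dt_graded:
  assumes "z <= 0" shows "dt ((2 * e0) *\<^sub>R ps_X :: real ps) kap z \<in> graded 1 kap"
proof -
  let ?e = "(2 * e0) *\<^sub>R ps_X :: real ps"
  have nth: "ps_nth (ps_X ^ l :: real ps) n = (if n = l then 1 else 0)" for l n
  proof (induction l arbitrary: n)
    case (Suc l)
    have "ps_nth (ps_X * ps_X ^ l :: real ps) n = (\<Sum>i\<in>{i. i <= n & i = 1}. ps_nth (ps_X ^ l :: real ps) (n - i))"
      unfolding ps_nth_mult by (rule sum.mono_neutral_cong_right) (auto simp: ps_nth_X)
    also have "{i. i <= n & i = 1} = (if n >= 1 then {1} else {})" by auto
    finally show ?case using Suc by auto
  qed (simp add: ps_nth_one)
  have en: "norm ?e <= E" using e0 by simp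
  have p: "?e ^ l = (2 * e0) ^ l *\<^sub>R ps_X ^ l" for l by (induction l) (auto simp: mult_ac)
  have "ps_nth (dt ?e kap z) n = (\<Sum>l. ps_nth (dc l kap z *\<^sub>R ?e ^ l) n)" for n
    unfolding dt_def by (rule bounded_linear.suminf[OF bounded_linear_ps_nth]) (rule summable_norm_cancel[OF dt_summable[OF en assms]])
  also have "(\<Sum>l. ps_nth (dc l kap z *\<^sub>R ?e ^ l) n) = (\<Sum>l\<in>{n}. ps_nth (dc l kap z *\<^sub>R ?e ^ l) n)" for n
    by (rule suminf_finite) (auto simp: p nth)
  finally have nd: "ps_nth (dt ?e kap z) n = dc n kap z * (2 * e0) ^ n" for n by (simp add: p nth)
  show ?thesis unfolding graded_def mem_Collect_eq
  proof (intro allI impI)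
    fix l assume "ps_nth (dt ?e kap z) l ~= 0"
    then have "dc l kap z ~= 0" using nd[of l] by auto
    from support[OF assms this] show "abs kap <= int (l + 1) & even (kap - int (l + 1))" by (simp add: add.commute)
  qed
qed

lemma matop_frakF:
  assumes "!!k m. A k m ~= 0 ==> \<bar>k - m\<bar> <= int l & even (k - m - int l)" shows "matop A \<in> frakF l"
  unfolding frakF_def mem_Collect_eq
proof (intro allI impI)
  fix kap assume k: "int l < abs kap \<or> kap mod 2 ~= int l mod 2"
  have "A n (n - kap) = 0" for n
  proof (rule ccontr)
    assume "A n (n - kap) ~= 0"
    from assms[OF this] have "abs kap <= int l" "even (kap - int l)" by auto
    then show False using k by (auto simp: mod_eq_dvd_iff)
  qed
  then show "band kap (matop A) = (%u k. 0)" by (simp add: band_def matop_expi fun_eq_iff)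
qed

text \<open>The band structure is a closed linear condition on the entries, stable under every
  operation of the iteration, so \<open>fundamental_exists\<close> with the subspaces
  \<open>graded 0\<close> and \<open>graded 1\<close> carries it to the solution.\<close>

theorem classF_Fmat:
  assumes F: "!!eps u. eps \<in> cball 0 e0 ==> u \<in> Hspace s ==> F eps u = matop (Fmat q al mu eps) u"
  shows "classF s (s - ordr q) e0 F"
proof -
  let ?e = "(2 * e0) *\<^sub>R ps_X :: real ps" and ?w = "%k. of_real (freq (al^2) mu k) :: real ps" and ?b = "of_real (al^2) :: real ps"
  have en: "norm ?e <= 2 * e0" using e0 by simp
  note ad = admissible_const[OF en, of al mu]
  note tau0 = tau
  interpret fiber_system ?w "?b * ?e" "dt ?e" DD "freq (al^2) mu" tau "16 * e0" by (rule admissible_system[OF ad])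
  have "\<exists>Th U. fundamental ?w (?b * ?e) (dt ?e) tau Th U &
    (\<forall>k m. \<forall>z\<le>0. norm (Th k m z) <= 2 * ew (-tau) (k - m) * exp (- z / 4) &
        norm (U k m z) <= 2 * N / (freq (al^2) mu k + 3/4) * ew (-tau) (k - m) * exp (3/4 * z) &
        Th k m z \<in> graded 0 (k - m) & U k m z \<in> graded 1 (k - m))"
  proof (rule fundamental_exists[OF functional_subspace_graded functional_subspace_graded])
    show "1 \<in> graded 0 0" using graded_of_real[of 1] by simp
    show "?b * ?e * x \<in> graded 0 kap" if "x \<in> graded 1 kap" for kap x
      using graded_mult[OF graded_of_real[of "al^2"] scaled_X_mult_graded[OF that, of "2 * e0"]] by (simp add: mult.assoc del: of_real_power)
    show "dt ?e kap z * x \<in> graded 1 (kap + kap')" if "z <= 0" "x \<in> graded 0 kap'" for kap kap' z x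
      using graded_mult[OF dt_graded[OF that(1)] that(2)] by simp
    have "exp (t *\<^sub>R ?w k) = of_real (exp (t * freq (al^2) mu k))" for t k
      by (subst exp_of_real[symmetric]) (simp add: scaleR_conv_of_real)
    then show "exp (t *\<^sub>R ?w k) * x \<in> graded 0 kap" if "x \<in> graded 0 kap" for kap k t x
      using graded_mult[OF graded_of_real that] by simp
    show "exp (t *\<^sub>R ?w k) * x \<in> graded 1 kap" if "x \<in> graded 1 kap" for kap k t x
      using graded_mult[OF graded_of_real that] \<open>!!t k. exp (t *\<^sub>R ?w k) = _ t k\<close> by simp
  qed
  then obtain Th U where f: "fundamental ?w (?b * ?e) (dt ?e) tau Th U" and gU: "!!k m z. z <= 0 ==> U k m z \<in> graded 1 (k - m)" by blast
  have RG: "RR ?w ?b ?e k m \<in> graded 1 (k - m)" for k m unfolding RR_eq[OF ad f] by (rule gU) simp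
  define g where "g k m = (if q & k = m then ?w k else 0) + ?b * ?e * RR ?w ?b ?e k m" for k m
  have gG: "g k m \<in> graded 0 (k - m)" for k m
  proof -
    have "?b * ?e * RR ?w ?b ?e k m \<in> graded 0 (k - m)"
      using graded_mult[OF graded_of_real[of "al^2"] scaled_X_mult_graded[OF RG, of "2 * e0"]] by (simp add: mult.assoc del: of_real_power)
    moreover have "(if q & k = m then ?w k else 0) \<in> graded 0 (k - m)"
      using graded_of_real[of "freq (al^2) mu k"] by (auto simp: graded_def)
    ultimately show ?thesis unfolding g_def by (intro subspace_add functional_subspace_subspace functional_subspace_graded)
  qed
  have Rb: "norm (RR ?w ?b ?e k m) <= 2 * NN * (2 + 2 * abs mu) * ew (-tau) (k - m) * jap k powr (- 1/2)" for k m
    by (rule RR_bound_jap[OF ad jap_le_freq]) simp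
  have "\<exists>B. mat_decay tau (ordr q) B g"
  proof (cases q)
    case True
    have "\<exists>B. mat_decay tau (ordr True) B (%k m. asm True k m (?w k) (?b * ?e) (RR ?w ?b ?e k m))"
    proof (rule asm_decay[OF _ Rb])
      show "norm (?w k) <= (1 + abs mu + abs al) * jap k powr (1/2)" for k using freq_le_jap[of al mu k] freq_nonneg[of al mu k] by simp
    qed
    then show ?thesis using True by (simp add: g_def[abs_def] asm_def)
  next
    case False
    have "norm (g k m) <= norm (?b * ?e) * (2 * NN * (2 + 2 * abs mu)) * ew (-tau) (k - m) * jap k powr (- 1/2)" for k m
      using norm_mult_le[OF order_refl Rb, of "?b * ?e"] False by (simp only: g_def simp_thms if_False add_0 mult.assoc)
    then show ?thesis unfolding mat_decay_def using False NN_nonneg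
      by (intro exI[of _ "norm (?b * ?e) * (2 * NN * (2 + 2 * abs mu))"]) (simp add: ordr_def)
  qed
  then obtain B where gB: "mat_decay tau (ordr q) B g" by blast
  define a where "a l = matop (%k m. 1 / (2 * e0) ^ l * ps_nth (g k m) l)" for l
  have aF: "a l \<in> frakF l" for l
    unfolding a_def by (rule matop_frakF) (use gG in \<open>auto simp: graded_def\<close>)
  have abo: "bounded_op s (s - ordr q) (a l)" for l
    unfolding a_def
    using bounded_op_matop[OF tau0 mat_decay_scale[OF mat_decay_coef[OF coef_system_ps_nth[of 0] gB, of "(l, ())"], of "1 / (2 * e0) ^ l"]] by (simp del: times_divide_eq_left)
  have "op_has_sum s (s - ordr q) (%l u k. of_real (eps ^ l) * a l u k) (F eps) UNIV" if eps: "eps \<in> cball 0 e0" for eps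
  proof -
    \<comment> \<open>The formal amplitude 2 e0 X makes |y| at most 1/2 on the ball of radius e0, as
      convergence in operator norm demands.\<close>
    define y where "y = eps / (2 * e0)"
    have y: "abs y <= 1/2" using eps e0(1) by (simp add: y_def field_simps)
    have h: "contr_hom (ps_eval y)" using y by (intro contr_hom_ps_eval) simp
    have ee: "ps_eval y ?e = eps" using e0(1) by (simp only: contr_hom_simps(5)[OF h] ps_eval_X) (simp add: y_def)
    have gF: "ps_eval y (g k m) = Fmat q al mu eps k m" for k m
    proof -
      have "ps_eval y (RR ?w ?b ?e k m) = RR (freq (al^2) mu) (al^2) eps k m"
        by (rule RR_hom[OF ad h admissible_real _ _ ee]) (use eps e0 in \<open>auto simp del: of_real_power\<close>)
      moreover have "ps_eval y (if q & k = m then ?w k else 0) = (if q & k = m then freq (al^2) mu k else 0)"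
        by (simp add: contr_hom_simps(7)[OF h])
      moreover have "ps_eval y ?b = al^2" by (simp del: of_real_power)
      ultimately show ?thesis by (simp only: g_def Fmat_def Rmat_def contr_hom_simps(1,4)[OF h] ee)
    qed
    show ?thesis
    proof (rule op_has_sum_coef[OF tau0 coef_system_ps_nth[of y] gB, where idx="%l. (l, ())"])
      show "finite {l \<in> UNIV. r < \<bar>case (l, ()) of (n, i) => y ^ n * 1\<bar>}" if "r > 0" for r :: real
      proof -
        have "\<forall>\<^sub>F l in sequentially. norm (y ^ l) < r"
          by (rule order_tendstoD(2)[OF tendsto_norm_zero[OF LIMSEQ_power_zero] that]) (use y in simp)
        then show ?thesis by (simp add: cofinite_eq_sequentially[symmetric] eventually_cofinite) (rule finite_subset[rotated], auto)
      qed
      show "F eps u = matop (%k m. ps_eval y (g k m)) u" if "u \<in> Hspace s" for u using F[OF eps that] by (simp add: gF)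
      show "of_real (eps ^ l) * a l u k = of_real (case (l, ()) of (n, i) => y ^ n * 1) * matop (%k m. case (l, ()) of (n, u) => ps_nth (g k m) n) u k" for l u k
        unfolding a_def matop_mat_scale by (simp add: y_def power_divide)
      show "bij_betw (%l. (l, ())) UNIV (UNIV :: (nat \<times> unit) set)" by (rule bij_betw_byWitness[where f'=fst]) auto
    qed (use y in simp)
  qed
  then show ?thesis unfolding classF_def using aF abo by blast
qed

end

section \<open>The fiber Dirichlet-Neumann operator\<close>

lemma jap_weight_le_hnorm: assumes "u \<in> Hspace s" shows "jap k powr (s/2) * cmod (u k) <= hnorm s u"
proof -
  have "(jap k powr (s/2) * cmod (u k))^2 = (\<Sum>\<^sub>\<infinity>j\<in>{k}. (jap j powr (s/2) * cmod (u j))^2)" by simp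
  also have "... <= (\<Sum>\<^sub>\<infinity>j. (jap j powr (s/2) * cmod (u j))^2)"
    by (rule infsum_mono_neutral) (use assms in \<open>auto simp: Hspace_iff\<close>)
  finally show ?thesis unfolding hnorm_eq by (intro real_le_rsqrt)
qed

lemma mult_jap_weight: "jap k powr (- r/2) * (jap k powr (r/2) * x) = x"
  using jap_pos[of k] by (simp add: mult.assoc[symmetric] powr_add[symmetric])

lemma cmod_le_hnorm:
  assumes "jap k powr (r/2) * cmod x <= B" shows "cmod x <= jap k powr (- r/2) * B"
  using mult_left_mono[OF assms, of "jap k powr (- r/2)"] unfolding mult_jap_weight by simp

text \<open>Each mode is controlled by the norm up to a fixed weight, so norm limits descend to
  modes, where the equations of the algebraic part live.\<close>

lemma H_deriv_component:
  assumes "H_deriv r F F'" "z <= 0"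
  shows "((%w. F w k) has_vector_derivative F' z k) (at z within {..0})"
proof -
  have F: "F w \<in> Hspace r" "F' w \<in> Hspace r" if "w <= 0" for w using assms(1) that by (auto simp: H_deriv_def)
  let ?q = "%w k. (F w k - F z k) / of_real (w - z) - F' z k"
  have q: "?q w \<in> Hspace r" if "w <= 0" for w
  proof -
    have "(%k. (1 / of_real (w - z)) * (F w k + (- 1) * F z k) + (- 1) * F' z k) \<in> Hspace r"
      by (intro Hspace_add Hspace_scale F that assms(2))
    then show ?thesis by (simp add: divide_inverse mult.commute)
  qed
  have lim: "((%w. hnorm r (?q w)) \<longlongrightarrow> 0) (at z within {..0})" using assms by (auto simp: H_deriv_def)
  have "((%w. ?q w k) \<longlongrightarrow> 0) (at z within {..0})"
  proof (rule Lim_null_comparison)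
    show "\<forall>\<^sub>F w in at z within {..0}. norm (?q w k) <= jap k powr (- r/2) * hnorm r (?q w)"
      unfolding eventually_at_filter
      by (intro always_eventually allI impI cmod_le_hnorm jap_weight_le_hnorm q) auto
    show "((%w. jap k powr (- r/2) * hnorm r (?q w)) \<longlongrightarrow> 0) (at z within {..0})"
      using tendsto_mult_left[OF lim] by simp
  qed
  then have "((%w. (F w k - F z k) / of_real (w - z)) \<longlongrightarrow> F' z k) (at z within {..0})"
    by (rule LIM_zero_cancel)
  then have "((%w. norm ((F w k - F z k) / of_real (w - z) - F' z k)) \<longlongrightarrow> 0) (at z within {..0})"
    by (intro tendsto_norm_zero LIM_zero)
  then have "((%w. norm (F w k - F z k - (w - z) *\<^sub>R F' z k) / norm (w - z)) \<longlongrightarrow> 0) (at z within {..0})"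
  proof (rule Lim_transform_eventually)
    show "\<forall>\<^sub>F w in at z within {..0}. norm ((F w k - F z k) / of_real (w - z) - F' z k) = norm (F w k - F z k - (w - z) *\<^sub>R F' z k) / norm (w - z)"
      unfolding eventually_at_filter
    proof (rule always_eventually, intro allI impI)
      fix w assume "w ~= z"
      then have "(F w k - F z k) / of_real (w - z) - F' z k = (F w k - F z k - (w - z) *\<^sub>R F' z k) / of_real (w - z)"
        by (simp add: divide_simps scaleR_conv_of_real)
      then show "norm ((F w k - F z k) / of_real (w - z) - F' z k) = norm (F w k - F z k - (w - z) *\<^sub>R F' z k) / norm (w - z)"
        by (simp only: norm_divide norm_of_real real_norm_def)
    qed
  qed
  then show ?thesis unfolding has_vector_derivative_def has_derivative_iff_norm
    by (simp add: bounded_linear_scaleR_left)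
qed

text \<open>Differentiability bounds F near each point and compactness gives one bound on the
  interval. The bound is stated mode by mode, so that only the triangle inequality for complex
  numbers is involved.\<close>

lemma H_deriv_locally_bounded:
  assumes "H_deriv r F F'" "z0 <= 0"
  shows "\<exists>B. \<forall>z\<in>{z0..0}. \<forall>k. jap k powr (r/2) * cmod (F z k) <= B"
proof -
  have F: "F w \<in> Hspace r" "F' w \<in> Hspace r" if "w <= 0" for w using assms(1) that by (auto simp: H_deriv_def)
  have loc: "\<exists>e>0. \<exists>B. \<forall>w\<in>{z0..0}. dist w z < e --> (\<forall>k. jap k powr (r/2) * cmod (F w k) <= B)" if z: "z \<in> {z0..0}" for z
  proof -
    let ?q = "%w k. (F w k - F z k) / of_real (w - z) - F' z k"
    have q: "?q w \<in> Hspace r" if "w <= 0" for w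
    proof -
      have "(%k. (1 / of_real (w - z)) * (F w k + (- 1) * F z k) + (- 1) * F' z k) \<in> Hspace r"
        by (intro Hspace_add Hspace_scale F that) (use z in auto)
      then show ?thesis by (simp add: divide_inverse mult.commute)
    qed
    have "((%w. hnorm r (?q w)) \<longlongrightarrow> 0) (at z within {..0})" using assms z by (auto simp: H_deriv_def)
    then have "\<forall>\<^sub>F w in at z within {..0}. hnorm r (?q w) < 1" by (rule order_tendstoD) simp
    then obtain e where e: "e > 0" "!!w. w <= 0 ==> w ~= z ==> dist w z < e ==> hnorm r (?q w) < 1"
      unfolding eventually_at by auto
    have "jap k powr (r/2) * cmod (F w k) <= hnorm r (F z) + e * (1 + hnorm r (F' z))" if w: "w \<in> {z0..0}" "dist w z < e" for w k
    proof (cases "w = z")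
      case True
      have "0 <= e * (1 + hnorm r (F' z))" using e(1) hnorm_nonneg[of r "F' z"] by simp
      then show ?thesis using jap_weight_le_hnorm[OF F(1), of z k] z True by simp
    next
      case False
      have tri: "cmod (x + of_real a * (y + y')) <= cmod x + abs a * (cmod y + cmod y')" for x y y' a
        using norm_triangle_ineq[of x "of_real a * (y + y')"] mult_left_mono[OF norm_triangle_ineq[of y y'], of "abs a"]
        by (simp add: norm_mult)
      have "F w k = F z k + of_real (w - z) * (?q w k + F' z k)" using False by simp
      then have "cmod (F w k) <= cmod (F z k) + \<bar>w - z\<bar> * (cmod (?q w k) + cmod (F' z k))"
        using tri[of "F z k" "w - z" "?q w k" "F' z k"] by simp
      then have "jap k powr (r/2) * cmod (F w k) <= jap k powr (r/2) * (cmod (F z k) + \<bar>w - z\<bar> * (cmod (?q w k) + cmod (F' z k)))"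
        by (intro mult_left_mono) auto
      also have "... = jap k powr (r/2) * cmod (F z k) + \<bar>w - z\<bar> * (jap k powr (r/2) * cmod (?q w k) + jap k powr (r/2) * cmod (F' z k))"
        by (simp add: algebra_simps)
      also have "... <= hnorm r (F z) + e * (1 + hnorm r (F' z))"
      proof (intro add_mono mult_mono)
        show "jap k powr (r/2) * cmod (?q w k) <= 1"
          using jap_weight_le_hnorm[OF q, of w k] e(2)[of w] w False by force
      qed (use w z e(1) in \<open>auto intro!: jap_weight_le_hnorm F simp: dist_real_def\<close>)
      finally show ?thesis .
    qed
    then show ?thesis using e(1) by blast
  qed
  show ?thesis
  proof (rule ccontr)
    assume "\<not> ?thesis"
    then have "\<forall>n. \<exists>z\<in>{z0..0}. \<exists>k. real n < jap k powr (r/2) * cmod (F z k)" by (meson not_le)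
    then obtain x where x: "!!n. x n \<in> {z0..0}" "!!n. \<exists>k. real n < jap k powr (r/2) * cmod (F (x n) k)" by metis
    obtain z \<phi> where z: "z \<in> {z0..0}" "strict_mono \<phi>" "(x \<circ> \<phi>) \<longlonglongrightarrow> z"
      using compact_Icc[of z0 "0::real"] x(1) unfolding compact_def by blast
    obtain e B where "e > 0" and B: "!!w k. w \<in> {z0..0} ==> dist w z < e ==> jap k powr (r/2) * cmod (F w k) <= B" using loc[OF z(1)] by blast
    have "\<forall>\<^sub>F n in sequentially. dist ((x \<circ> \<phi>) n) z < e & B <= real (\<phi> n)"
      using tendstoD[OF z(3) \<open>e > 0\<close>] filterlim_at_top[THEN iffD1, OF filterlim_compose[OF filterlim_real_sequentially filterlim_subseq[OF z(2)]]]
      by (auto intro: eventually_conj)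
    then obtain n where n: "dist (x (\<phi> n)) z < e" "B <= real (\<phi> n)" using eventually_happens' sequentially_bot by fastforce
    obtain k where "real (\<phi> n) < jap k powr (r/2) * cmod (F (x (\<phi> n)) k)" using x(2) by blast
    with n B[OF x(1) n(1), of k] show False by linarith
  qed
qed

lemma fiber_derivative_bounded:
  assumes "H_deriv r T' T''" and lim: "((%z. hnorm r (T' z)) \<longlongrightarrow> 0) at_bot"
  shows "\<exists>B. \<forall>z\<le>0. \<forall>k. jap k powr (r/2) * cmod (T' z k) <= B"
proof -
  have F: "T' w \<in> Hspace r" if "w <= 0" for w using assms(1) that by (auto simp: H_deriv_def)
  have "\<forall>\<^sub>F z in at_bot. hnorm r (T' z) < 1" using lim by (rule order_tendstoD) simp
  then obtain a where a: "!!z. z <= a ==> hnorm r (T' z) < 1" unfolding eventually_at_bot_linorder by blast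
  obtain B where B: "!!z k. z \<in> {min a 0..0} ==> jap k powr (r/2) * cmod (T' z k) <= B"
    using H_deriv_locally_bounded[OF assms(1), of "min a 0"] min.cobounded2 by blast
  have "jap k powr (r/2) * cmod (T' z k) <= max 1 B" if "z <= 0" for z k
  proof (cases "z <= a")
    case True
    then show ?thesis using jap_weight_le_hnorm[OF F[OF that], of k] a[OF True] by linarith
  next
    case False
    then show ?thesis using B[of z k] that by auto
  qed
  then show ?thesis by blast
qed

text \<open>Each term of a convergent series with nonnegative terms is at most its sum. The growing
  weight thereby absorbs the unspecified exponent of a solution of the fiber problem.\<close>

lemma jap_powr_le_exp:
  assumes "tau > 0" shows "\<exists>C. \<forall>k. jap k powr r <= C * ew tau k"
proof -
  have s: "(%j::int. ew (-tau) j * (2 * (1 + (of_int j)^2)) powr \<bar>r\<bar>) summable_on UNIV"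
    by (rule exp_decay_summable[OF assms])
  define K where "K = (\<Sum>\<^sub>\<infinity>j::int. ew (-tau) j * (2 * (1 + (of_int j)^2)) powr \<bar>r\<bar>)"
  have "ew (-tau) k * jap k powr r <= K" for k
  proof -
    have "jap k powr r <= jap k powr \<bar>r\<bar>" using jap_ge1[of k] by (intro powr_mono) auto
    also have "... <= (2 * (1 + (of_int k)^2)) powr \<bar>r\<bar>" using jap_pos[of k] by (intro powr_mono2) (auto simp: jap_def)
    finally have "ew (-tau) k * jap k powr r <= ew (-tau) k * (2 * (1 + (of_int k)^2)) powr \<bar>r\<bar>"
      by (intro mult_left_mono) auto
    also have "... = (\<Sum>\<^sub>\<infinity>j\<in>{k}. ew (-tau) j * (2 * (1 + (of_int j)^2)) powr \<bar>r\<bar>)" by simp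
    also have "... <= K"
      unfolding K_def by (rule infsum_mono_neutral) (use s in auto)
    finally show ?thesis .
  qed
  then have "jap k powr r <= K * ew tau k" for k by (simp add: exp_minus field_simps)
  then show ?thesis by blast
qed

section \<open>Uniqueness for the fiber problem\<close>

definition d_symbol :: "(real => real => real) => (int => real => real) => bool" where
  "d_symbol d dl \<longleftrightarrow> (\<forall>z\<le>0. \<forall>kap. fcoeff (%x. 1 + d x z) kap = of_real ((if kap = 0 then 1 else 0) + dl kap z))"

context dcoef
begin

lemma mult_fun_symbol:
  assumes sym: "d_symbol d (%kap z. eps * dt eps kap z)" and z: "z <= 0"
    and s: "(%kap. of_real (dt eps kap z) * T (k - kap)) summable_on UNIV"
  shows "mult_fun (%x. 1 + d x z) T k = T k + of_real eps * (\<Sum>\<^sub>\<infinity>kap. of_real (dt eps kap z) * T (k - kap))"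
proof -
  let ?S = "T k + of_real eps * (\<Sum>\<^sub>\<infinity>kap. of_real (dt eps kap z) * T (k - kap))"
  have "((%kap. (if kap = 0 then T k else 0) + of_real eps * (of_real (dt eps kap z) * T (k - kap))) has_sum ?S) UNIV"
  proof (rule has_sum_add)
    show "((%kap. if kap = 0 then T k else 0) has_sum T k) UNIV"
      by (rule has_sum_finite_neutralI[of "{0}"]) auto
  qed (intro has_sum_cmult_right has_sum_infsum s)
  moreover have "(if kap = 0 then T k else 0) + of_real eps * (of_real (dt eps kap z) * T (k - kap)) = fcoeff (%x. 1 + d x z) kap * T (k - kap)" for kap
    using sym z by (auto simp: d_symbol_def algebra_simps)
  ultimately have "((%kap. fcoeff (%x. 1 + d x z) kap * T (k - kap)) has_sum ?S) UNIV" by simp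
  moreover have "bij_betw (%m. k - m) UNIV UNIV" by (rule bij_betw_byWitness[of _ "%m. k - m"]) auto
  ultimately have "((%m. fcoeff (%x. 1 + d x z) (k - m) * T m) has_sum ?S) UNIV"
    using has_sum_reindex_bij_betw[of "%m. k - m" UNIV UNIV "%kap. fcoeff (%x. 1 + d x z) kap * T (k - kap)"] by simp
  then show ?thesis unfolding mult_fun_def by (rule infsumI)
qed

text \<open>Decay is assumed for T' only, in a space of unspecified exponent. Thus T grows at most
  linearly in z and polynomially in k, which exp(-z/4) and the growing weight dominate. With u = T'
  - w T the solution is a fixed point of \<open>response\<close>, hence determined by its boundary
  value.\<close>

lemma fiber_sol_unique:
  assumes sym: "d_symbol d (%kap z. eps * dt eps kap z)" and eps: "abs eps <= 2 * e0"
    and S1: "fiber_sol d al mu g T1 T1'" and S2: "fiber_sol d al mu g T2 T2'"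
  shows "T1' 0 = T2' 0"
proof -
  let ?w = "%k. of_real (freq (al^2) mu k) :: complex" and ?b = "of_real (al^2) :: complex" and ?e = "of_real eps :: complex"
  have en: "norm ?e <= 2 * e0" and eE: "norm ?e <= E" using eps e0 by auto
  note tau0 = tau
  interpret fiber_system ?w "?b * ?e" "dt ?e" DD "freq (al^2) mu" tau "16 * e0" by (rule admissible_system[OF admissible_const[OF en]])
  have dtc: "dt ?e kap z = of_real (dt eps kap z)" if "z <= 0" for kap z
    using dt_hom[of "of_real :: real => complex" eps z kap] eE that
    by (simp add: contr_hom_def linear_iff scaleR_conv_of_real)
  let ?W = "%k. ew tau k"
  have main: "\<exists>C\<ge>0. response ?W C (%k z. T z k) (%k z. T' z k - ?w k * T z k) (%k z. T z k) & T 0 = g &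
      (\<forall>k. ((%w. T w k) has_vector_derivative T' 0 k) (at 0 within {..0}))"
    if S: "fiber_sol d al mu g T T'" for T T'
  proof -
    obtain r T'' where D1: "H_deriv r T T'" and D2: "H_deriv r T' T''" and T0: "T 0 = g" and lim: "((%z. hnorm r (T' z)) \<longlongrightarrow> 0) at_bot"
      and eq: "!!z k. z <= 0 ==> T'' z k - of_real ((of_int k + mu)^2) * T z k - of_real (al^2) * mult_fun (%x. 1 + d x z) (T z) k = 0"
      using S unfolding fiber_sol_def by blast
    have H: "T z \<in> Hspace r" "T' z \<in> Hspace r" if "z <= 0" for z using D1 that by (auto simp: H_deriv_def)
    obtain B where B: "!!z k. z <= 0 ==> jap k powr (r/2) * cmod (T' z k) <= B" using fiber_derivative_bounded[OF D2 lim] by blast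
    obtain K where K: "!!k. jap k powr (- r/2) <= K * ?W k" using jap_powr_le_exp[OF tau0, of "- r/2"] by auto
    define C where "C = 4 * K * (B + hnorm r (T 0))"
    have "B >= 0" using order_trans[OF _ B[of 0 0]] by simp
    then have BH: "B + hnorm r (T 0) >= 0" using hnorm_nonneg[of r "T 0"] by simp
    have C0: "C >= 0" unfolding C_def using BH order_trans[OF powr_ge_zero K[of 0]] by simp
    note d1 = H_deriv_component[OF D1]
    have b2: "cmod (T z k) <= jap k powr (- r/2) * (B + hnorm r (T 0)) * (1 + abs z)" if z: "z <= 0" for z k
    proof -
      have T'1: "cmod (T' z k) <= jap k powr (- r/2) * B" if "z <= 0" for z by (rule cmod_le_hnorm[OF B[OF that]])
      have "cmod (T z k - T 0 k) <= (jap k powr (- r/2) * B) * norm (z - 0)"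
      proof (rule differentiable_bound[of "{..0}" "%w. T w k" "%z h. h *\<^sub>R T' z k"])
        show "((%w. T w k) has_derivative (%h. h *\<^sub>R T' x k)) (at x within {..0})" if "x \<in> {..0}" for x
          using d1[of x k] that by (simp add: has_vector_derivative_def)
        show "onorm (%h. h *\<^sub>R T' x k) <= jap k powr (- r/2) * B" if "x \<in> {..0}" for x
          using T'1[of x] that by (subst onorm_scaleR_left) (auto simp: onorm_id)
      qed (use z in auto)
      moreover have "cmod (T 0 k) <= jap k powr (- r/2) * hnorm r (T 0)" by (rule cmod_le_hnorm[OF jap_weight_le_hnorm[OF H(1)]]) simp
      moreover have "0 <= jap k powr (- r/2) * (B + hnorm r (T 0) * abs z)" using hnorm_nonneg[of r "T 0"] \<open>B >= 0\<close> by simp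
      ultimately show ?thesis using norm_triangle_ineq2[of "T z k" "T 0 k"] by (simp add: algebra_simps)
    qed
    have tb: "cmod (T z k) <= C * ?W k * exp (- z / 4)" if z: "z <= 0" for z k
    proof -
      have "1 + abs z <= 4 * exp (- z / 4)" using exp_ge_add_one_self[of "- z / 4"] z by simp
      then have "jap k powr (- r/2) * (B + hnorm r (T 0)) * (1 + abs z) <= K * ?W k * (B + hnorm r (T 0)) * (4 * exp (- z / 4))"
        using K[of k] BH order_trans[OF powr_ge_zero K[of k]] by (intro mult_mono) auto
      from order_trans[OF b2[OF z] this] show ?thesis by (simp only: C_def mult_ac)
    qed
    have l1: "((%z. norm (T' z k)) \<longlongrightarrow> 0) at_bot" for k
    proof (rule Lim_null_comparison)
      show "\<forall>\<^sub>F z in at_bot. norm (norm (T' z k)) <= jap k powr (- r/2) * hnorm r (T' z)"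
        by (rule eventually_mono[OF eventually_le_at_bot[of 0]]) (use cmod_le_hnorm jap_weight_le_hnorm H in auto)
      show "((%z. jap k powr (- r/2) * hnorm r (T' z)) \<longlongrightarrow> 0) at_bot" using tendsto_mult_left[OF lim] by simp
    qed
    have d2: "((%w. T' w k) has_vector_derivative ?w k * ?w k * T z k + ?b * ?e * lconv (dt ?e) (%k z. T z k) k z) (at z within {..0})" if z: "z <= 0" for z k
    proof -
      note ls = lconv_summable(1)[where th="%k z. T z k" and k=k, OF weight_growing z tb[OF z] C0]
      have mf: "mult_fun (%x. 1 + d x z) (T z) k = T z k + ?e * lconv (dt ?e) (%k z. T z k) k z"
        using mult_fun_symbol[OF sym z, of "T z" k] ls by (simp add: dtc[OF z] lconv_def)
      have "?w k * ?w k = of_real ((of_int k + mu)^2) + ?b" using freq_sq[of al mu k] by (simp flip: of_real_mult)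
      then have "T'' z k = ?w k * ?w k * T z k + ?b * ?e * lconv (dt ?e) (%k z. T z k) k z"
        using eq[OF z, of k] unfolding mf by (simp add: algebra_simps)
      then show ?thesis using H_deriv_component[OF D2 z, of k] by simp
    qed
    have "response ?W C (%k z. T z k) (%k z. T' z k - ?w k * T z k) (%k z. T z k)"
      unfolding response_def
    proof (intro allI conjI impI tb)
      fix k
      show "solves (- ?w k) (%z. ?b * ?e * lconv (dt ?e) (%k z. T z k) k z) (%z. T' z k - ?w k * T z k)"
        unfolding solves_def
      proof safe
        fix z :: real assume z: "z <= 0"
        from has_vector_derivative_diff[OF d2[OF z] has_vector_derivative_mult_right[OF d1[OF z]], of k "?w k" k]
        show "((%z. T' z k - ?w k * T z k) has_vector_derivative - ?w k * (T' z k - ?w k * T z k) + ?b * ?e * lconv (dt ?e) (%k z. T z k) k z) (at z within {..0})"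
          by (simp add: algebra_simps)
      qed
      show "solves (?w k) (%z. T' z k - ?w k * T z k) (%z. T z k)" unfolding solves_def using d1 by simp
      define \<omega> where "\<omega> = freq (al^2) mu k"
      have om: "\<omega> >= 0" using freq_nonneg[of al mu k] by (simp add: \<omega>_def)
      let ?K = "jap k powr (- r/2) * (B + hnorm r (T 0))"
      \<comment> \<open>For a vanishing frequency the expression is T' itself, which decays;
        otherwise the exponential beats the linear growth of T.\<close>
      show "((%z. exp (freq (al^2) mu k * z) * norm (T' z k - ?w k * T z k)) \<longlongrightarrow> 0) at_bot"
        unfolding \<omega>_def[symmetric]
      proof (rule Lim_null_comparison)
        show "\<forall>\<^sub>F z in at_bot. norm (exp (\<omega> * z) * norm (T' z k - \<omega> * T z k)) <= norm (T' z k) + ?K * (\<omega> * exp (\<omega> * z) * (1 - z))"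
        proof (rule eventually_mono[OF eventually_le_at_bot[of 0]])
          fix z :: real assume z: "z <= 0"
          have "norm (T' z k - \<omega> * T z k) <= norm (T' z k) + \<omega> * (?K * (1 - z))"
            using norm_triangle_ineq4[of "T' z k" "\<omega> * T z k"] mult_left_mono[OF b2[OF z, of k] om] om z by (simp add: norm_mult)
          from mult_left_mono[OF this, of "exp (\<omega> * z)"] mult_right_mono[of "exp (\<omega> * z)" 1 "norm (T' z k)"] om z
          show "norm (exp (\<omega> * z) * norm (T' z k - \<omega> * T z k)) <= norm (T' z k) + ?K * (\<omega> * exp (\<omega> * z) * (1 - z))"
            by (simp add: distrib_left mult_nonneg_nonpos mult_ac)
        qed
        have "((%z. \<omega> * exp (\<omega> * z) * (1 - z)) \<longlongrightarrow> 0) at_bot"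
        proof (cases "\<omega> = 0")
          case False
          then have "\<omega> > 0" using om by simp
          then show ?thesis by real_asymp
        qed simp
        from tendsto_add[OF l1 tendsto_mult_left[OF this, of ?K]]
        show "((%z. norm (T' z k) + ?K * (\<omega> * exp (\<omega> * z) * (1 - z))) \<longlongrightarrow> 0) at_bot" by simp
      qed
    qed
    then show ?thesis using C0 T0 d1[of 0] by blast
  qed
  from main[OF S1] main[OF S2] obtain C1 C2 where C: "C1 >= 0" "C2 >= 0"
    and r: "response ?W C1 (%k z. T1 z k) (%k z. T1' z k - ?w k * T1 z k) (%k z. T1 z k)" "response ?W C2 (%k z. T2 z k) (%k z. T2' z k - ?w k * T2 z k) (%k z. T2 z k)"
    and T0: "T1 0 = T2 0" and d: "!!k. ((%w. T1 w k) has_vector_derivative T1' 0 k) (at 0 within {..0})" "!!k. ((%w. T2 w k) has_vector_derivative T2' 0 k) (at 0 within {..0})"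
    by (elim exE conjE) simp
  have "T1' 0 k = T2' 0 k" for k
  proof (rule vector_derivative_unique_within[OF _ d(1)])
    have "T1 z k = T2 z k" if "z <= 0" for z
      using response_unique[OF weight_growing response_mono[OF weight_growing _ r(1)] response_mono[OF weight_growing _ r(2)], of "C1 + C2" z k] C T0 that by simp
    then show "((%w. T1 w k) has_vector_derivative T2' 0 k) (at 0 within {..0})"
      by (intro has_vector_derivative_transform[OF _ _ d(2)]) auto
  qed (simp add: at_within_Iic_at_left trivial_limit_at_left_real)
  then show ?thesis by (rule ext)
qed

end

section \<open>Existence for the fiber problem\<close>

lemma dominated_infsum_tendsto_0:
  fixes f :: "'i => 'x => real"
  assumes M: "M summable_on UNIV" and lim: "!!k. (f k \<longlongrightarrow> 0) F"
    and bnd: "\<forall>\<^sub>F x in F. \<forall>k. 0 <= f k x & f k x <= M k"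
  shows "((%x. \<Sum>\<^sub>\<infinity>k. f k x) \<longlongrightarrow> 0) F"
proof (rule tendstoI)
  fix e :: real assume e: "e > 0"
  have "(sum M \<longlongrightarrow> infsum M UNIV) (finite_subsets_at_top UNIV)"
    using has_sum_infsum[OF M] by (simp add: has_sum_def)
  then have "\<forall>\<^sub>F X in finite_subsets_at_top UNIV. dist (sum M X) (infsum M UNIV) < e / 2"
    using e by (intro tendstoD) auto
  then obtain X where X: "finite X" "dist (sum M X) (infsum M UNIV) < e / 2"
    unfolding eventually_finite_subsets_at_top by blast
  have MX: "M summable_on - X" by (rule summable_on_subset_banach[OF M]) simp
  have "infsum M UNIV = infsum M X + infsum M (- X)"
    using infsum_Un_disjoint[of M X "- X"] MX X(1) by (simp add: summable_on_finite)
  then have tail: "infsum M (- X) < e / 2" using X by (simp add: dist_real_def)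
  have "((%x. \<Sum>k\<in>X. f k x) \<longlongrightarrow> (\<Sum>k\<in>X. 0)) F" by (intro tendsto_sum lim)
  then have "\<forall>\<^sub>F x in F. dist (\<Sum>k\<in>X. f k x) 0 < e / 2" using e by (intro tendstoD) auto
  with bnd show "\<forall>\<^sub>F x in F. dist (\<Sum>\<^sub>\<infinity>k. f k x) 0 < e"
  proof eventually_elim
    case (elim x)
    have s: "(%k. f k x) summable_on UNIV" by (rule summable_on_comparison_test[OF M]) (use elim in auto)
    have sX: "(%k. f k x) summable_on - X" by (rule summable_on_subset_banach[OF s]) simp
    have "(\<Sum>\<^sub>\<infinity>k. f k x) = (\<Sum>k\<in>X. f k x) + infsum (%k. f k x) (- X)"
      using infsum_Un_disjoint[of "%k. f k x" X "- X"] sX X(1) by (simp add: summable_on_finite)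
    moreover have "infsum (%k. f k x) (- X) <= infsum M (- X)" by (rule infsum_mono[OF sX MX]) (use elim in auto)
    moreover have "0 <= (\<Sum>\<^sub>\<infinity>k. f k x)" by (rule infsum_nonneg) (use elim in auto)
    ultimately show ?case using elim tail by (simp add: dist_real_def)
  qed
qed

lemma summable_on_product_nonneg:
  fixes f :: "'i => real" and g :: "'j => real"
  assumes "f summable_on A" "g summable_on B" "!!i. f i >= 0" "!!j. g j >= 0"
  shows "(%(i, j). f i * g j) summable_on A \<times> B"
proof (rule summable_on_SigmaI[where g="%i. f i * infsum g B"])
  show "((%j. case (i, j) of (i, j) => f i * g j) has_sum f i * infsum g B) B" for i
    using has_sum_cmult_right[OF has_sum_infsum[OF assms(2)]] by simp
qed (use assms in \<open>auto intro: summable_on_cmult_left\<close>)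

text \<open>Convergence is strong and not in operator norm: for fixed u the common decay of the
  matrices supplies a majorant for the sum over columns and then for the sum over rows, and
  dominated convergence is applied twice.\<close>

lemma matop_tendsto_0:
  assumes tau: "tau > 0" and u: "u \<in> Hspace s" and C: "C >= 0"
    and bnd: "\<forall>\<^sub>F x in F. mat_decay tau p C (M x)" and lim: "!!k m. ((%x. M x k m) \<longlongrightarrow> 0) F"
  shows "((%x. hnorm (s - p) (matop (M x) u)) \<longlongrightarrow> 0) F"
proof -
  define B where "B k m = C * ew (-tau) (k - m) * jap k powr (p / 2)" for k m
  define v where "v m = complex_of_real (cmod (u m))" for m
  define S where "S k = (\<Sum>\<^sub>\<infinity>m. B k m * cmod (u m))" for k
  define g where "g k x = (\<Sum>\<^sub>\<infinity>m. \<bar>M x k m\<bar> * cmod (u m))" for k x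
  have B: "mat_decay tau p C B" using C by (simp add: mat_decay_def B_def)
  have v: "v \<in> Hspace s" using u by (simp add: Hspace_def v_def)
  have sB: "(%m. B k m * cmod (u m)) summable_on UNIV" for k
    using summable_on_bounded_linear[OF bounded_linear_Re matop_estimate(1)[OF tau B v, of k]] by (simp add: v_def)
  have V: "matop B v k = of_real (S k)" for k
    using infsumI[OF has_sum_of_real[OF has_sum_infsum[OF sB[of k]], where 'a=complex]] by (simp add: matop_def S_def v_def)
  have S0: "S k >= 0" for k unfolding S_def B_def using C by (intro infsum_nonneg) simp
  have sS: "(%k. (jap k powr ((s - p)/2) * S k)^2) summable_on UNIV"
    using matop_estimate(2)[OF tau B v] S0 by (simp add: Hspace_iff V)
  have ev: "\<forall>\<^sub>F x in F. \<forall>k m. \<bar>M x k m\<bar> <= B k m" using bnd by eventually_elim (auto simp: mat_decay_def B_def)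
  have lg: "(g k \<longlongrightarrow> 0) F" for k
    unfolding g_def
  proof (rule dominated_infsum_tendsto_0[OF sB[of k]])
    show "((%x. \<bar>M x k m\<bar> * cmod (u m)) \<longlongrightarrow> 0) F" for m
      using tendsto_mult_right[OF tendsto_rabs_zero[OF lim[of k m]], of "cmod (u m)"] by simp
    show "\<forall>\<^sub>F x in F. \<forall>m. 0 <= \<bar>M x k m\<bar> * cmod (u m) & \<bar>M x k m\<bar> * cmod (u m) <= B k m * cmod (u m)"
      using ev by eventually_elim (auto intro: mult_right_mono)
  qed
  have bg: "\<forall>\<^sub>F x in F. \<forall>k. 0 <= g k x & g k x <= S k & cmod (matop (M x) u k) <= g k x"
    using ev
  proof eventually_elim
    case (elim x)
    show ?case
    proof
      fix k
      have s: "(%m. \<bar>M x k m\<bar> * cmod (u m)) summable_on UNIV"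
        by (rule summable_on_comparison_test[OF sB[of k]]) (use elim in \<open>auto intro: mult_right_mono\<close>)
      have "cmod (matop (M x) u k) <= (\<Sum>\<^sub>\<infinity>m. cmod (of_real (M x k m) * u m))"
        unfolding matop_def by (rule norm_infsum_bound) (use s in \<open>simp add: norm_mult\<close>)
      moreover have "g k x <= S k" unfolding g_def S_def by (rule infsum_mono[OF s sB]) (use elim in \<open>auto intro: mult_right_mono\<close>)
      moreover have "0 <= g k x" unfolding g_def by (intro infsum_nonneg) simp
      ultimately show "0 <= g k x & g k x <= S k & cmod (matop (M x) u k) <= g k x" by (simp add: g_def norm_mult)
    qed
  qed
  have lim2: "((%x. \<Sum>\<^sub>\<infinity>k. (jap k powr ((s - p)/2) * g k x)^2) \<longlongrightarrow> 0) F"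
  proof (rule dominated_infsum_tendsto_0[OF sS])
    show "((%x. (jap k powr ((s - p)/2) * g k x)^2) \<longlongrightarrow> 0) F" for k
      using tendsto_power[OF tendsto_mult_left[OF lg[of k], of "jap k powr ((s - p)/2)"], of 2] by simp
    show "\<forall>\<^sub>F x in F. \<forall>k. 0 <= (jap k powr ((s - p)/2) * g k x)^2 & (jap k powr ((s - p)/2) * g k x)^2 <= (jap k powr ((s - p)/2) * S k)^2"
      using bg by eventually_elim (auto intro!: power_mono mult_left_mono)
  qed
  show ?thesis
  proof (rule tendsto_sandwich[OF _ _ tendsto_const])
    show "\<forall>\<^sub>F x in F. 0 <= hnorm (s - p) (matop (M x) u)" by (simp add: hnorm_nonneg)
    show "\<forall>\<^sub>F x in F. hnorm (s - p) (matop (M x) u) <= sqrt (\<Sum>\<^sub>\<infinity>k. (jap k powr ((s - p)/2) * g k x)^2)"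
      using bg bnd
    proof eventually_elim
      case (elim x)
      have s: "(%k. (jap k powr ((s - p)/2) * g k x)^2) summable_on UNIV"
        by (rule summable_on_comparison_test[OF sS]) (use elim in \<open>auto intro!: power_mono mult_left_mono\<close>)
      show ?case unfolding hnorm_eq
        by (intro real_sqrt_le_mono infsum_mono s matop_estimate(2)[OF tau elim(2) u, unfolded Hspace_iff])
          (use elim(1) in \<open>auto intro!: power_mono mult_left_mono\<close>)
    qed
    show "((%x. sqrt (\<Sum>\<^sub>\<infinity>k. (jap k powr ((s - p)/2) * g k x)^2)) \<longlongrightarrow> 0) F"
      using tendsto_real_sqrt[OF lim2] by simp
  qed
qed

text \<open>By the mean value inequality the difference quotients of the entries obey the decay
  bound of A', so \<open>matop_tendsto_0\<close> applies to their deviation from A'.\<close>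

lemma H_deriv_matop:
  assumes tau: "tau > 0" and u: "u \<in> Hspace s"
    and der: "!!k m z. z <= 0 ==> ((%z. A z k m) has_vector_derivative A' z k m) (at z within {..0})"
    and bnd: "!!z0. z0 <= 0 ==> \<exists>C. \<forall>z\<in>{z0..0}. mat_decay tau p C (A z) & mat_decay tau p C (A' z)"
  shows "H_deriv (s - p) (%z. matop (A z) u) (%z. matop (A' z) u)"
  unfolding H_deriv_def
proof (intro allI impI conjI)
  fix z :: real assume z: "z <= 0"
  have "z - 1 <= 0" using z by simp
  from bnd[OF this] obtain C where "\<forall>w\<in>{z - 1..0}. mat_decay tau p C (A w) & mat_decay tau p C (A' w)" by blast
  then have C: "mat_decay tau p C (A w) & mat_decay tau p C (A' w)" if "w \<in> {z - 1..0}" for w using that by blast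
  have Cz: "mat_decay tau p C (A z)" "mat_decay tau p C (A' z)" using C[of z] z by auto
  have C0: "C >= 0" using Cz by (simp add: mat_decay_def)
  show "matop (A z) u \<in> Hspace (s - p)" "matop (A' z) u \<in> Hspace (s - p)" by (rule matop_estimate(2)[OF tau Cz(1) u] matop_estimate(2)[OF tau Cz(2) u])+
  define M where "M w k m = (A w k m - A z k m) / (w - z) - A' z k m" for w k m
  have nb: "\<forall>\<^sub>F w in at z within {..0}. w \<in> {z - 1..0}"
    unfolding eventually_at by (intro exI[of _ 1]) (auto simp: dist_real_def)
  have M: "mat_decay tau p (2 * C) (M w)" if w: "w \<in> {z - 1..0}" for w
    unfolding mat_decay_def real_norm_def
  proof (intro conjI allI)
    fix k m
    let ?B = "C * ew (-tau) (k - m) * jap k powr (p / 2)"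
    have B: "\<bar>A' x k m\<bar> <= ?B" if "x \<in> {z - 1..0}" for x using C[OF that] by (simp add: mat_decay_def)
    have "norm (A w k m - A z k m) <= ?B * norm (w - z)"
    proof (rule differentiable_bound[of "{z - 1..0}" "%w. A w k m" "%x h. h *\<^sub>R A' x k m"])
      show "((%w. A w k m) has_derivative (%h. h *\<^sub>R A' x k m)) (at x within {z - 1..0})" if "x \<in> {z - 1..0}" for x
        by (rule has_derivative_subset[OF der[of x k m, unfolded has_vector_derivative_def]]) (use that in auto)
      show "onorm (%h. h *\<^sub>R A' x k m) <= ?B" if "x \<in> {z - 1..0}" for x
        using B[OF that] by (subst onorm_scaleR_left) (auto simp: onorm_id)
    qed (use w z in auto)
    then have "\<bar>(A w k m - A z k m) / (w - z)\<bar> <= ?B"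
      using C0 by (cases "w = z") (auto simp: abs_divide pos_divide_le_eq)
    then show "\<bar>M w k m\<bar> <= 2 * C * ew (-tau) (k - m) * jap k powr (p / 2)"
      using B[of z] z abs_triangle_ineq4[of "(A w k m - A z k m) / (w - z)" "A' z k m"] by (simp add: M_def)
  qed (use C0 in simp)
  have lim: "((%w. M w k m) \<longlongrightarrow> 0) (at z within {..0})" for k m
  proof -
    have "((%z. A z k m) has_field_derivative A' z k m) (at z within {..0})"
      using der[OF z] by (simp add: has_real_derivative_iff_has_vector_derivative)
    then have "((%w. (A w k m - A z k m) / (w - z)) \<longlongrightarrow> A' z k m) (at z within {..0})" by (simp add: has_field_derivative_iff)
    then show ?thesis unfolding M_def by (rule LIM_zero)
  qed
  have "((%w. hnorm (s - p) (matop (M w) u)) \<longlongrightarrow> 0) (at z within {..0})"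
    by (rule matop_tendsto_0[OF tau u _ eventually_mono[OF nb M] lim]) (use C0 in simp)
  then show "((%w. hnorm (s - p) (%k. (matop (A w) u k - matop (A z) u k) / of_real (w - z) - matop (A' z) u k)) \<longlongrightarrow> 0) (at z within {..0})"
  proof (rule Lim_transform_eventually)
    show "\<forall>\<^sub>F w in at z within {..0}. hnorm (s - p) (matop (M w) u) =
       hnorm (s - p) (%k. (matop (A w) u k - matop (A z) u k) / of_real (w - z) - matop (A' z) u k)"
      using nb
    proof eventually_elim
      case (elim w)
      have "matop (M w) u k = (matop (A w) u k - matop (A z) u k) / of_real (w - z) - matop (A' z) u k" for k
      proof -
        have h: "((%m. of_real (X k m) * u m) has_sum matop X u k) UNIV" if "mat_decay tau p C X" for X
          unfolding matop_def by (intro has_sum_infsum matop_estimate(1)[OF tau that u])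
        have "((%m. (of_real (A w k m) * u m - of_real (A z k m) * u m) * (1 / of_real (w - z)) - of_real (A' z k m) * u m) has_sum
            (matop (A w) u k - matop (A z) u k) * (1 / of_real (w - z)) - matop (A' z) u k) UNIV"
          by (intro has_sum_diff has_sum_cmult_left h) (use C[OF elim] Cz in auto)
        from infsumI[OF this] show ?thesis
          by (simp add: matop_def M_def algebra_simps diff_divide_distrib)
      qed
      then have "matop (M w) u = (%k. (matop (A w) u k - matop (A z) u k) / of_real (w - z) - matop (A' z) u k)" by (rule ext)
      then show ?case by (rule arg_cong)
    qed
  qed
qed

text \<open>The fixed point only bounds solutions by exp(-z/4). For a true nonnegative frequency the
  equation improves this: the homogeneous part exp(w z) and the source exp(3/4 z) are both dominated
  by exp(c z), and 3/4 - c >= 1/2 produces the factor 2.\<close>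

lemma solves_decay:
  assumes s: "solves w f th" and c: "0 <= c" "c <= 1/4" "c <= w" and f: "!!z. z <= 0 ==> \<bar>f z\<bar> <= G * exp (3/4 * z)" and z: "z <= 0"
  shows "\<bar>th z\<bar> <= (\<bar>th 0\<bar> + 2 * G) * exp (c * z :: real)"
proof -
  have G: "G >= 0" using order_trans[OF abs_ge_zero f[of 0]] by simp
  let ?\<phi> = "%s. G * exp (c * z) / (3/4 - c) * exp ((3/4 - c) * s)"
  have "norm (exp ((z - 0) *\<^sub>R w) * th 0 - exp ((z - z) *\<^sub>R w) * th z) <= ?\<phi> 0 - ?\<phi> z"
  proof (rule solves_gronwall[OF s z, where \<phi>'="%s. G * exp (c * z) * exp ((3/4 - c) * s)"])
    show "(?\<phi> has_vector_derivative G * exp (c * z) * exp ((3/4 - c) * s)) (at s)" for s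
      using c by (auto intro!: derivative_eq_intros simp: has_real_derivative_iff_has_vector_derivative[symmetric])
    fix s assume s: "z <= s" "s <= 0"
    have "(z - s) * w <= (z - s) * c" using s c by (intro mult_left_mono_neg) auto
    then have "norm (exp ((z - s) *\<^sub>R w) * f s) <= exp ((z - s) * c) * (G * exp (3/4 * s))"
      unfolding norm_mult by (intro mult_mono) (use f[OF s(2)] G in auto)
    also have "... = G * exp (c * z) * exp ((3/4 - c) * s)" by (simp add: exp_add[symmetric] mult_exp_exp algebra_simps)
    finally show "norm (exp ((z - s) *\<^sub>R w) * f s) <= G * exp (c * z) * exp ((3/4 - c) * s)" .
  qed simp
  then have "\<bar>exp (z * w) * th 0 - th z\<bar> <= ?\<phi> 0 - ?\<phi> z" by simp
  also have "... <= ?\<phi> 0" using G c by simp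
  also have "... <= 2 * G * exp (c * z)"
  proof -
    have "1 / (3/4 - c) <= 2" using c by (simp add: divide_simps)
    from mult_left_mono[OF this, of "G * exp (c * z)"] show ?thesis using G by simp
  qed
  finally have 1: "\<bar>exp (z * w) * th 0 - th z\<bar> <= 2 * G * exp (c * z)" .
  have "z * w <= c * z" using mult_left_mono_neg[OF c(3) z] by (simp add: mult.commute)
  then have "\<bar>exp (z * w) * th 0\<bar> <= exp (c * z) * \<bar>th 0\<bar>" unfolding abs_mult by (intro mult_right_mono) auto
  with 1 show ?thesis by (simp add: algebra_simps)
qed

context dcoef
begin

text \<open>The columns of the fundamental matrix are superposed with the modes of u as
  coefficients. Two derivatives in z cost two orders, whence decay of order 2 for the matrices A0,
  A1, A2 and values in the space of exponent s - 2.\<close>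

lemma fiber_sol_exists:
  assumes sym: "d_symbol d (%kap z. eps * dt eps kap z)" and eps: "abs eps <= 2 * e0" and u: "u \<in> Hspace s"
  shows "\<exists>T T'. fiber_sol d al mu u T T' & T' 0 = matop (Gmat True al mu eps) u"
proof -
  let ?w = "freq (al^2) mu" and ?b = "al^2 * eps"
  note tau0 = tau
  note adm = admissible_real[OF eps, of al mu]
  interpret fiber_system ?w ?b "dt eps" DD ?w tau "16 * e0" by (rule admissible_system[OF adm])
  obtain Th U where fund: "fundamental ?w ?b (dt eps) tau Th U"
    and b0: "!!k m z. z <= 0 ==> norm (Th k m z) <= 2 * ew (-tau) (k - m) * exp (- z / 4)"
    and b1: "!!k m z. z <= 0 ==> norm (U k m z) <= 2 * NN / (?w k + 3/4) * ew (-tau) (k - m) * exp (3/4 * z)"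
    using fundamental_ex[OF adm] by blast
  have sU: "solves (- ?w k) (lconv (dt eps) (%j. Th j m) k) (U k m)" and sT: "solves (?w k) (%z. ?b * U k m z) (Th k m)"
    and T0: "Th k m 0 = (if k = m then 1 else 0)" for k m using fund by (auto simp: fundamental_def)
  let ?e = "%k m::int. ew (-tau) (k - m) :: real"
  define L where "L z k m = lconv (dt eps) (%j. Th j m) k z" for z k m
  define A0 where "A0 z k m = Th k m z" for z k m
  define A1 where "A1 z k m = ?w k * Th k m z + ?b * U k m z" for z k m
  define A2 where "A2 z k m = ?w k * ?w k * Th k m z + ?b * L z k m" for z k m
  have d0: "((%z. A0 z k m) has_vector_derivative A1 z k m) (at z within {..0})" if "z <= 0" for z k m
    unfolding A0_def A1_def using sT[of k m] that by (simp add: solves_def)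
  have d1: "((%z. A1 z k m) has_vector_derivative A2 z k m) (at z within {..0})" if "z <= 0" for z k m
  proof -
    have "((%z. A1 z k m) has_vector_derivative ?w k * A1 z k m + ?b * (- ?w k * U k m z + L z k m)) (at z within {..0})"
      unfolding A1_def using sT[of k m] sU[of k m] that
      by (intro has_vector_derivative_add has_vector_derivative_mult_right) (auto simp: solves_def L_def)
    then show ?thesis by (simp add: A1_def A2_def algebra_simps)
  qed
  let ?K = "1 + abs mu + abs al"
  have K: "?K >= 1" by simp
  have jh: "jap k powr (1/2) <= jap k" "jap k powr (1/2) * jap k powr (1/2) = jap k" for k
    using jap_ge1[of k] powr_mono[of "1/2" 1 "jap k"] by (auto simp: powr_add[symmetric])
  have w1: "?w k <= ?K * jap k" for k
    using freq_le_jap[of al mu k] mult_left_mono[OF jh(1)[of k], of ?K] by linarith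
  have w2: "?w k * ?w k <= ?K * ?K * jap k" for k
    using mult_mono[OF freq_le_jap[of al mu k] freq_le_jap[of al mu k]] freq_nonneg[of al mu k] jh(2)[of k] by (simp add: mult_ac)
  have w0: "?w k >= 0" for k by (rule freq_nonneg)
  have bU: "\<bar>?b * U k m z\<bar> <= \<bar>?b\<bar> * (4 * NN) * ?e k m * exp (3/4 * z)" if "z <= 0" for k m z
  proof -
    have "2 * NN / (?w k + 3/4) <= 2 * NN / (1/2)" using w0[of k] NN_nonneg by (intro divide_left_mono) auto
    then have "2 * NN / (?w k + 3/4) * ?e k m * exp (3/4 * z) <= 4 * NN * ?e k m * exp (3/4 * z)"
      by (intro mult_right_mono) auto
    with b1[OF that, of k m] have "\<bar>U k m z\<bar> <= 4 * NN * ?e k m * exp (3/4 * z)" by simp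
    from mult_left_mono[OF this, of "\<bar>?b\<bar>"] show ?thesis by (simp add: abs_mult mult_ac)
  qed
  have bL: "\<bar>L z k m\<bar> <= 2 * NN * ?e k m" if "z <= 0" for z k m
  proof -
    have "norm (lconv (dt eps) (%j. Th j m) k z) <= N * 2 * ?e k m * exp (3/4 * z)"
      by (rule lconv_summable(2)[where th="%j. Th j m" and W="%k. ?e k m", OF weight_diff that b0[OF that]]) simp
    also have "... <= N * 2 * ?e k m * 1" using that N_nonneg by (intro mult_left_mono) auto
    finally show ?thesis by (simp add: L_def NN_def mult_ac)
  qed
  let ?G = "\<bar>?b\<bar> * (4 * NN)"
  have G: "?G >= 0" using NN_nonneg by simp
  have decay: "\<bar>Th k m z\<bar> <= (1 + 2 * ?G) * ?e k m * exp (c * z)" if c: "0 <= c" "c <= 1/4" "c <= ?w k" and z: "z <= 0" for k m z c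
  proof -
    have "\<bar>Th k m z\<bar> <= (\<bar>Th k m 0\<bar> + 2 * (?G * ?e k m)) * exp (c * z)"
      by (rule solves_decay[OF sT c bU z])
    also have "... <= (?e k m + 2 * (?G * ?e k m)) * exp (c * z)" by (intro mult_right_mono add_mono) (use NN_nonneg in \<open>auto simp: T0\<close>)
    finally show ?thesis by (simp add: algebra_simps)
  qed
  have e3: "exp (3/4 * z) <= 1" if "z <= 0" for z :: real using that by simp
  \<comment> \<open>\<open>decay\<close> with c = 0 gives a bound without growth in z, as the
    passage to minus infinity under the sum requires.\<close>
  have bA1: "\<bar>A1 z k m\<bar> <= (?K * (1 + 2 * ?G) + ?G) * ?e k m * jap k powr (2/2)" if z: "z <= 0" for z k m
  proof -
    have "\<bar>A1 z k m\<bar> <= ?w k * \<bar>Th k m z\<bar> + \<bar>?b * U k m z\<bar>" unfolding A1_def using w0[of k] by (intro order_trans[OF abs_triangle_ineq]) (simp add: abs_mult)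
    also have "?w k * \<bar>Th k m z\<bar> <= (?K * jap k) * ((1 + 2 * ?G) * ?e k m * exp (0 * z))"
      by (intro mult_mono w1 decay z w0) (use jap_pos[of k] in auto)
    also have "\<bar>?b * U k m z\<bar> <= ?G * ?e k m * jap k"
    proof (rule order_trans[OF bU[OF z] mult_left_mono])
      show "exp (3/4 * z) <= jap k" using e3[OF z] jap_ge1[of k] by linarith
    qed (use NN_nonneg in simp)
    finally show ?thesis using jap_pos[of k] by (simp add: algebra_simps)
  qed
  have ln: "\<exists>C. \<forall>z\<in>{z0..0}. mat_decay tau 2 C (A0 z) & mat_decay tau 2 C (A1 z) & mat_decay tau 2 C (A2 z)" for z0
  proof -
    let ?C0 = "2 * exp (- z0 / 4)" and ?C1 = "?K * (1 + 2 * ?G) + ?G" and ?C2 = "?K * ?K * (2 * exp (- z0 / 4)) + \<bar>?b\<bar> * (2 * NN)"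
    have nn: "?C0 >= 0" "?C1 >= 0" "?C2 >= 0" using G NN_nonneg by (auto intro!: add_nonneg_nonneg mult_nonneg_nonneg)
    have ej: "0 <= ?e k m * jap k" for k m using jap_pos[of k] by simp
    have up: "c * ?e k m * jap k <= (?C0 + ?C1 + ?C2) * ?e k m * jap k" if "c <= ?C0 + ?C1 + ?C2" for c k m
      using mult_right_mono[OF that ej[of k m]] by (simp add: mult.assoc)
    have t: "\<bar>Th k m z\<bar> <= ?C0 * ?e k m" if "z \<in> {z0..0}" for z k m
    proof -
      have "2 * ?e k m * exp (- z / 4) <= 2 * ?e k m * exp (- z0 / 4)" using that by (intro mult_left_mono) auto
      also have "... = ?C0 * ?e k m" by (simp only: mult_ac)
      finally have le: "2 * ?e k m * exp (- z / 4) <= ?C0 * ?e k m" .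
      have "norm (Th k m z) <= 2 * ?e k m * exp (- z / 4)" by (rule b0) (use that in simp)
      from order_trans[OF this le] show ?thesis by (simp only: real_norm_def)
    qed
    have "mat_decay tau 2 (?C0 + ?C1 + ?C2) (A0 z) & mat_decay tau 2 (?C0 + ?C1 + ?C2) (A1 z) & mat_decay tau 2 (?C0 + ?C1 + ?C2) (A2 z)" if z: "z \<in> {z0..0}" for z
      unfolding mat_decay_def real_norm_def
    proof (intro conjI allI)
      fix k m
      have j: "jap k powr (2/2) = jap k" using jap_pos[of k] by simp
      have "\<bar>A0 z k m\<bar> <= ?C0 * ?e k m * 1" using t[OF z] by (simp add: A0_def)
      also have "... <= ?C0 * ?e k m * jap k" using jap_ge1[of k] by (intro mult_left_mono) auto
      also have "... <= (?C0 + ?C1 + ?C2) * ?e k m * jap k" by (rule up) (use nn in linarith)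
      finally show "\<bar>A0 z k m\<bar> <= (?C0 + ?C1 + ?C2) * ?e k m * jap k powr (2/2)" unfolding j .
      have "\<bar>A1 z k m\<bar> <= ?C1 * ?e k m * jap k" using bA1[of z k m] z j by simp
      also have "... <= (?C0 + ?C1 + ?C2) * ?e k m * jap k" by (rule up) (use nn in linarith)
      finally show "\<bar>A1 z k m\<bar> <= (?C0 + ?C1 + ?C2) * ?e k m * jap k powr (2/2)" unfolding j .
      have "\<bar>A2 z k m\<bar> <= (?w k * ?w k) * \<bar>Th k m z\<bar> + \<bar>?b\<bar> * \<bar>L z k m\<bar>"
        unfolding A2_def by (intro order_trans[OF abs_triangle_ineq]) (simp add: abs_mult)
      also have "... <= (?K * ?K * jap k) * (?C0 * ?e k m) + \<bar>?b\<bar> * (2 * NN * ?e k m)"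
        by (intro add_mono mult_mono w2 t z bL) (use z jap_pos[of k] in auto)
      also have "\<bar>?b\<bar> * (2 * NN * ?e k m) <= (\<bar>?b\<bar> * (2 * NN * ?e k m)) * jap k"
        using mult_left_mono[OF jap_ge1[of k], of "\<bar>?b\<bar> * (2 * NN * ?e k m)"] NN_nonneg by simp
      finally have "\<bar>A2 z k m\<bar> <= ?C2 * ?e k m * jap k" by (simp add: algebra_simps)
      also have "... <= (?C0 + ?C1 + ?C2) * ?e k m * jap k" by (rule up) (use nn in linarith)
      finally show "\<bar>A2 z k m\<bar> <= (?C0 + ?C1 + ?C2) * ?e k m * jap k powr (2/2)" unfolding j .
    qed (use nn in linarith)+
    then show ?thesis by blast
  qed
  define T where "T z = matop (A0 z) u" for z
  define T' where "T' z = matop (A1 z) u" for z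
  define T'' where "T'' z = matop (A2 z) u" for z
  have D1: "H_deriv (s - 2) T T'"
    unfolding T_def T'_def
  proof (rule H_deriv_matop[OF tau0 u d0])
    fix z0 :: real
    obtain C where "\<forall>z\<in>{z0..0}. mat_decay tau 2 C (A0 z) & mat_decay tau 2 C (A1 z) & mat_decay tau 2 C (A2 z)" using ln by (rule exE)
    then show "\<exists>C. \<forall>z\<in>{z0..0}. mat_decay tau 2 C (A0 z) & mat_decay tau 2 C (A1 z)" by (intro exI[of _ C]) simp
  qed
  have D2: "H_deriv (s - 2) T' T''"
    unfolding T'_def T''_def
  proof (rule H_deriv_matop[OF tau0 u d1])
    fix z0 :: real
    obtain C where "\<forall>z\<in>{z0..0}. mat_decay tau 2 C (A0 z) & mat_decay tau 2 C (A1 z) & mat_decay tau 2 C (A2 z)" using ln by (rule exE)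
    then show "\<exists>C. \<forall>z\<in>{z0..0}. mat_decay tau 2 C (A1 z) & mat_decay tau 2 C (A2 z)" by (intro exI[of _ C]) simp
  qed
  have lim: "((%z. hnorm (s - 2) (T' z)) \<longlongrightarrow> 0) at_bot"
    unfolding T'_def
  proof (rule matop_tendsto_0[OF tau0 u])
    show C: "?K * (1 + 2 * ?G) + ?G >= 0" using G by (auto intro!: add_nonneg_nonneg mult_nonneg_nonneg)
    show "\<forall>\<^sub>F z in at_bot. mat_decay tau 2 (?K * (1 + 2 * ?G) + ?G) (A1 z)"
      by (rule eventually_mono[OF eventually_le_at_bot[of 0]]) (use bA1 C in \<open>auto simp: mat_decay_def\<close>)
    fix k m
    have null: "((%z. f z) \<longlongrightarrow> 0) at_bot" if f: "!!z. z <= 0 ==> \<bar>f z\<bar> <= B * exp (c * z)" and c: "c > 0" for f :: "real => real" and B c :: real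
    proof (rule Lim_null_comparison)
      show "\<forall>\<^sub>F z in at_bot. norm (f z) <= B * exp (c * z)"
        by (rule eventually_mono[OF eventually_le_at_bot[of 0]]) (simp add: f)
      show "((%z. B * exp (c * z)) \<longlongrightarrow> 0) at_bot"
        using tendsto_mult_left[OF tendsto_exp_mult_at_bot[OF c], of B] by simp
    qed
    have l1: "((%z. ?b * U k m z) \<longlongrightarrow> 0) at_bot"
      by (rule null[OF bU]) simp_all
    \<comment> \<open>At frequency zero the term is absent; otherwise the smaller of the frequency
      and 1/4 is a positive rate of decay.\<close>
    have l2: "((%z. ?w k * Th k m z) \<longlongrightarrow> 0) at_bot"
    proof (cases "?w k = 0")
      case False
      define c where "c = min (?w k) (1/4)"
      have c: "0 < c" "c <= 1/4" "c <= ?w k" using False w0[of k] by (auto simp: c_def)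
      have "((%z. Th k m z) \<longlongrightarrow> 0) at_bot"
        by (rule null[OF decay[OF less_imp_le[OF c(1)] c(2,3)] c(1)])
      from tendsto_mult_left[OF this, of "?w k"] show ?thesis by simp
    qed simp
    show "((%z. A1 z k m) \<longlongrightarrow> 0) at_bot" unfolding A1_def using tendsto_add[OF l2 l1] by simp
  qed
  have eq: "T'' z k - of_real ((of_int k + mu)^2) * T z k - of_real (al^2) * mult_fun (%x. 1 + d x z) (T z) k = 0" if z: "z <= 0" for z k
  proof -
    \<comment> \<open>Absolute convergence over the pairs (kap, m) justifies exchanging the
      convolution with d and the superposition of columns.\<close>
    let ?f = "%kap m. of_real (dt eps kap z) * (of_real (Th (k - kap) m z) * u m) :: complex"
    have "mat_decay tau 0 1 (%k m. ?e k m)" by (simp add: mat_decay_def less_imp_neq[OF jap_pos, symmetric])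
    from summable_on_bounded_linear[OF bounded_linear_Re matop_estimate(1)[OF tau0 this, of "%m. of_real (cmod (u m))" s k]]
    have se: "(%m. ?e k m * cmod (u m)) summable_on UNIV"
      using u by (simp add: Hspace_def)
    have "(%(kap, m). (DD kap * ew tau kap) * (?e k m * cmod (u m))) summable_on UNIV \<times> UNIV"
      by (rule summable_on_product_nonneg[OF DD_summable se]) (use DD_nonneg in auto)
    from summable_on_cmult_right[OF this, of "2 * exp (- z / 4)"]
    have sp: "(%(kap, m). 2 * exp (- z / 4) * ((DD kap * ew tau kap) * (?e k m * cmod (u m)))) summable_on UNIV \<times> UNIV"
      by (simp add: case_prod_unfold)
    have fb: "norm (?f kap m) <= 2 * exp (- z / 4) * ((DD kap * ew tau kap) * (?e k m * cmod (u m)))" for kap m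
    proof -
      have "\<bar>dt eps kap z\<bar> <= DD kap" using d_bound[OF z, of kap] z DD_nonneg[of kap] mult_left_mono[of "exp z" 1 "DD kap"] by simp
      moreover have "\<bar>Th (k - kap) m z\<bar> <= 2 * (ew tau kap * ?e k m) * exp (- z / 4)"
      proof (rule order_trans[OF b0[OF z, of "k - kap" m, unfolded real_norm_def]])
        have "?e (k - kap) m <= ew tau kap * ?e k m" using weight_diff[of m] by (simp add: weight_def)
        then show "2 * ?e (k - kap) m * exp (- z / 4) <= 2 * (ew tau kap * ?e k m) * exp (- z / 4)"
          by (intro mult_right_mono mult_left_mono) simp_all
      qed
      ultimately have "\<bar>dt eps kap z\<bar> * (\<bar>Th (k - kap) m z\<bar> * cmod (u m)) <= DD kap * ((2 * (ew tau kap * ?e k m) * exp (- z / 4)) * cmod (u m))"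
        by (intro mult_mono) (use DD_nonneg in auto)
      then show ?thesis by (simp add: norm_mult mult_ac)
    qed
    have "(%(kap, m). norm (?f kap m)) summable_on UNIV \<times> UNIV"
    proof (rule summable_on_comparison_test[OF sp])
      show "(case q of (kap, m) => norm (?f kap m)) <= (case q of (kap, m) => 2 * exp (- z / 4) * ((DD kap * ew tau kap) * (?e k m * cmod (u m))))" for q
        unfolding case_prod_unfold by (rule fb)
      show "0 <= (case q of (kap, m) => norm (?f kap m))" for q unfolding case_prod_unfold by (rule norm_ge_zero)
    qed
    then have sf: "(%(kap, m). ?f kap m) summable_on UNIV \<times> UNIV"
      unfolding case_prod_unfold by (rule abs_summable_summable)
    have inner: "(\<Sum>\<^sub>\<infinity>m. ?f kap m) = of_real (dt eps kap z) * T z (k - kap)" for kap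
      unfolding T_def matop_def A0_def by (rule infsum_cmult_right')
    have s1: "(%kap. of_real (dt eps kap z) * T z (k - kap)) summable_on UNIV"
      using summable_on_Sigma_banach[OF sf] unfolding inner .
    have Lm: "(\<Sum>\<^sub>\<infinity>kap. ?f kap m) = of_real (L z k m) * u m" for m
    proof -
      have "(%kap. dt eps kap z * Th (k - kap) m z) summable_on UNIV"
        by (rule lconv_summable(1)[where th="%j. Th j m" and W="%k. ?e k m", OF weight_diff z b0[OF z]]) simp
      then have "((%kap. dt eps kap z * Th (k - kap) m z) has_sum L z k m) UNIV" unfolding L_def lconv_def by (rule has_sum_infsum)
      then have "((%kap. of_real (dt eps kap z * Th (k - kap) m z) * u m) has_sum of_real (L z k m) * u m) UNIV"
        by (intro has_sum_cmult_left has_sum_of_real)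
      from infsumI[OF this] show ?thesis by (simp add: mult.assoc)
    qed
    have "(\<Sum>\<^sub>\<infinity>kap. of_real (dt eps kap z) * T z (k - kap)) = (\<Sum>\<^sub>\<infinity>m. of_real (L z k m) * u m)"
      using infsum_swap_banach[OF sf] by (simp add: inner Lm)
    then have mf: "mult_fun (%x. 1 + d x z) (T z) k = T z k + of_real eps * (\<Sum>\<^sub>\<infinity>m. of_real (L z k m) * u m)"
      using mult_fun_symbol[OF sym z s1] by simp
    obtain C where "\<forall>x\<in>{z..0}. mat_decay tau 2 C (A0 x) & mat_decay tau 2 C (A1 x) & mat_decay tau 2 C (A2 x)" using ln by (rule exE)
    then have C: "mat_decay tau 2 C (A0 z)" "mat_decay tau 2 C (A2 z)" using z by simp_all
    have dL: "mat_decay tau 0 (2 * NN) (L z)" using bL[OF z] NN_nonneg by (simp add: mat_decay_def less_imp_neq[OF jap_pos, symmetric])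
    have "((%m. of_real (?w k * ?w k) * (of_real (A0 z k m) * u m) + of_real ?b * (of_real (L z k m) * u m)) has_sum
        of_real (?w k * ?w k) * T z k + of_real ?b * (\<Sum>\<^sub>\<infinity>m. of_real (L z k m) * u m)) UNIV"
      unfolding T_def matop_def
      by (intro has_sum_add has_sum_cmult_right has_sum_infsum matop_estimate(1)[OF tau0 C(1) u] matop_estimate(1)[OF tau0 dL u])
    from infsumI[OF this]
    have "T'' z k = of_real (?w k * ?w k) * T z k + of_real ?b * (\<Sum>\<^sub>\<infinity>m. of_real (L z k m) * u m)"
      by (simp add: T''_def matop_def A2_def A0_def algebra_simps)
    then show ?thesis unfolding mf freq_sq by (simp add: algebra_simps)
  qed
  have "T 0 = u"
    unfolding T_def A0_def matop_def T0
  proof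
    fix k
    have "((%m. of_real (if k = m then 1 else 0) * u m) has_sum u k) UNIV"
      by (rule has_sum_finite_neutralI[of "{k}"]) auto
    then show "(\<Sum>\<^sub>\<infinity>m. of_real (if k = m then 1 else 0) * u m) = u k" by (rule infsumI)
  qed
  then have "fiber_sol d al mu u T T'"
    unfolding fiber_sol_def using D1 D2 eq lim by blast
  moreover have "A1 0 = Gmat True al mu eps"
    by (intro ext) (simp add: A1_def T0 Gmat_def asm_def Rmat_def RR_eq[OF adm fund])
  ultimately have "fiber_sol d al mu u T T' & T' 0 = matop (Gmat True al mu eps) u" by (simp add: T'_def)
  then show ?thesis by (intro exI)
qed

lemma fiber_DN_eq:
  assumes "d_symbol (flat_d (p eps)) (%kap z. eps * dt eps kap z)" "abs eps <= 2 * e0" "u \<in> Hspace s"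
  shows "fiber_DN p al mu eps u = matop (Gmat True al mu eps) u"
proof -
  obtain T T' where T: "fiber_sol (flat_d (p eps)) al mu u T T'" "T' 0 = matop (Gmat True al mu eps) u"
    using fiber_sol_exists[OF assms, of al mu] by (elim exE conjE)
  show ?thesis unfolding fiber_DN_def
  proof (rule the_equality)
    show "\<exists>T T'. fiber_sol (flat_d (p eps)) al mu u T T' & matop (Gmat True al mu eps) u = T' 0"
      by (intro exI conjI) (rule T, rule T(2)[symmetric])
    fix f assume "\<exists>T T'. fiber_sol (flat_d (p eps)) al mu u T T' & f = T' 0"
    then obtain S S' where S: "fiber_sol (flat_d (p eps)) al mu u S S'" and f: "f = S' 0" by (elim exE conjE)
    show "f = matop (Gmat True al mu eps) u"
      unfolding f T(2)[symmetric] by (rule fiber_sol_unique[OF assms(1,2) S T(1)])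
  qed
qed

end

section \<open>Absolutely convergent Fourier series\<close>

text \<open>Membership in the Wiener algebra together with the coefficients and an upper bound M for
  the norm; a bound in place of the norm lets estimates be combined without computing norms.\<close>

definition wiener :: "real => (int => complex) => (real => complex) => bool" where
  "wiener M b u \<longleftrightarrow> (%k. cmod (b k)) summable_on UNIV & (\<Sum>\<^sub>\<infinity>k. cmod (b k)) <= M &
     (\<forall>x. ((%k. b k * cis (of_int k * x)) has_sum u x) UNIV)"

lemma wienerI:
  assumes s: "B summable_on UNIV" and le: "!!k. cmod (b k) <= B k" "(\<Sum>\<^sub>\<infinity>k. B k) <= M"
    and u: "!!x. ((%k. b k * cis (of_int k * x)) has_sum u x) UNIV"
  shows "wiener M b u"
proof -
  have sb: "(%k. cmod (b k)) summable_on UNIV" by (rule summable_on_comparison_test[OF s]) (use le in auto)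
  have "(\<Sum>\<^sub>\<infinity>k. cmod (b k)) <= (\<Sum>\<^sub>\<infinity>k. B k)" by (rule infsum_mono[OF sb s]) (rule le)
  then show ?thesis unfolding wiener_def using sb le(2) u by simp
qed

lemma wiener_has_sum: "wiener M b u ==> ((%k. b k * cis (of_int k * x)) has_sum u x) UNIV"
  by (simp add: wiener_def)

lemma has_integral_cis:
  "((%x. cis (of_int n * x)) has_integral (if n = 0 then of_real (2 * pi) else 0)) {0..2 * pi}"
proof (cases "n = 0")
  case True
  then show ?thesis using has_integral_const_real[of "1 :: complex" 0 "2 * pi"] by (simp add: scaleR_conv_of_real)
next
  case False
  have "((%x. cis (of_int n * x)) has_integral (cis (of_int n * (2 * pi)) / (\<i> * of_int n) - cis (of_int n * 0) / (\<i> * of_int n))) {0..2 * pi}"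
  proof (rule fundamental_theorem_of_calculus)
    fix x
    have "((%x. cis (of_int n * x)) has_vector_derivative (of_int n) *\<^sub>R (\<i> * cis (of_int n * x))) (at x within {0..2 * pi})"
      by (auto intro!: derivative_eq_intros simp: has_vector_derivative_def scaleR_conv_of_real mult_ac)
    from has_vector_derivative_divide[OF this, of "\<i> * of_int n"]
    show "((%x. cis (of_int n * x) / (\<i> * of_int n)) has_vector_derivative cis (of_int n * x)) (at x within {0..2 * pi})"
      using False by (simp add: scaleR_conv_of_real)
  qed simp
  moreover have "cis (of_int n * (2 * pi)) = 1" using cis_multiple_2pi[of "of_int n"] by (simp add: mult_ac)
  ultimately show ?thesis using False by simp
qed

text \<open>The convergence is uniform in x, so the series may be integrated term by term against an
  exponential. Any absolutely convergent expansion thus identifies Fourier coefficients.\<close>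

lemma wiener_fcoeff:
  assumes "wiener M b (%x. of_real (f x))" shows "fcoeff f k = b k"
proof -
  let ?S = "%X x. \<Sum>j\<in>X. b j * cis (of_int (j - k) * x)"
  have eq: "b j * cis (of_int j * x) * cis (- (of_int k * x)) = b j * cis (of_int (j - k) * x)" for j x
    by (simp add: mult.assoc cis_mult left_diff_distrib)
  have ul: "uniform_limit {0..2 * pi} ?S (%x. of_real (f x) * cis (- (of_int k * x))) (finite_subsets_at_top UNIV)"
  proof (rule Weierstrass_m_test_general'[where M="%j. cmod (b j)"])
    show "((%j. b j * cis (of_int (j - k) * x)) has_sum of_real (f x) * cis (- (of_int k * x))) UNIV" for x
      using has_sum_cmult_left[OF wiener_has_sum[OF assms, of x], of "cis (- (of_int k * x))"] unfolding eq .
  qed (use assms in \<open>auto simp: wiener_def norm_mult\<close>)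
  obtain I J where I: "!!X. (?S X has_integral I X) {0..2 * pi}" and J: "((%x. of_real (f x) * cis (- (of_int k * x))) has_integral J) {0..2 * pi}"
    and lim: "(I \<longlongrightarrow> J) (finite_subsets_at_top UNIV)"
    by (rule uniform_limit_integral[OF ul]) (auto intro!: continuous_intros)
  have IX: "I X = (if k \<in> X then b k * of_real (2 * pi) else 0)" if "finite X" for X
  proof -
    have "(?S X has_integral (\<Sum>j\<in>X. b j * (if j - k = 0 then of_real (2 * pi) else 0))) {0..2 * pi}"
      by (intro has_integral_sum that has_integral_mult_right has_integral_cis)
    also have "(\<Sum>j\<in>X. b j * (if j - k = 0 then of_real (2 * pi) else 0)) = (if k \<in> X then b k * of_real (2 * pi) else 0)"
      using that by (simp add: if_distrib[of "%x. _ * x"] eq_commute[of _ k] sum.delta cong: if_cong)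
    finally show ?thesis using I has_integral_unique by blast
  qed
  have "(I \<longlongrightarrow> b k * of_real (2 * pi)) (finite_subsets_at_top UNIV)"
  proof (rule tendsto_eventually)
    show "\<forall>\<^sub>F X in finite_subsets_at_top UNIV. I X = b k * of_real (2 * pi)"
      unfolding eventually_finite_subsets_at_top by (intro exI[of _ "{k}"]) (auto simp: IX)
  qed
  then have "J = b k * of_real (2 * pi)" using lim by (intro tendsto_unique) auto
  then show ?thesis unfolding fcoeff_def using integral_unique[OF J] by simp
qed

lemma has_sum_product:
  fixes f :: "'i => complex" and g :: "'j => complex"
  assumes "(%i. norm (f i)) summable_on A" "(%j. norm (g j)) summable_on B" "(f has_sum a) A" "(g has_sum b) B"
  shows "((%(i, j). f i * g j) has_sum a * b) (A \<times> B)"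
proof -
  have "(%(i, j). norm (f i) * norm (g j)) summable_on A \<times> B"
    by (rule summable_on_product_nonneg[OF assms(1,2)]) auto
  then have "(%q. norm (case q of (i, j) => f i * g j)) summable_on A \<times> B"
    by (simp add: case_prod_unfold norm_mult)
  then have s: "(%(i, j). f i * g j) summable_on A \<times> B" by (rule abs_summable_summable)
  have "((%i. f i * b) has_sum infsum (%(i, j). f i * g j) (A \<times> B)) A"
    by (rule has_sum_SigmaD[OF has_sum_infsum[OF s]]) (use has_sum_cmult_right[OF assms(4)] in simp)
  from has_sum_unique[OF this has_sum_cmult_left[OF assms(3)]] show ?thesis using has_sum_infsum[OF s] by simp
qed

lemma wiener_mult:
  assumes u: "wiener M a u" and v: "wiener N b v"
  shows "wiener (M * N) (%k. \<Sum>\<^sub>\<infinity>j. a j * b (k - j)) (%x. u x * v x)"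
proof -
  have sa: "(%k. cmod (a k)) summable_on UNIV" and sb: "(%k. cmod (b k)) summable_on UNIV"
    and le: "(\<Sum>\<^sub>\<infinity>k. cmod (a k)) <= M" "(\<Sum>\<^sub>\<infinity>k. cmod (b k)) <= N" using u v by (auto simp: wiener_def)
  let ?h = "%(k, j). (j, k - j) :: int \<times> int"
  have bij: "bij_betw ?h UNIV UNIV" by (rule bij_betw_byWitness[of _ "%(i, j). (i + j, i)"]) auto
  have re: "((%q. g (?h q)) has_sum y) UNIV \<longleftrightarrow> (g has_sum y) UNIV" for g :: "int \<times> int => 'a::{topological_comm_monoid_add,t2_space}" and y
    by (rule has_sum_reindex_bij_betw[OF bij])
  let ?P = "(\<Sum>\<^sub>\<infinity>k. cmod (a k)) * (\<Sum>\<^sub>\<infinity>k. cmod (b k))"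
  have "((%(i, j). complex_of_real (cmod (a i)) * complex_of_real (cmod (b j))) has_sum of_real (\<Sum>\<^sub>\<infinity>k. cmod (a k)) * of_real (\<Sum>\<^sub>\<infinity>k. cmod (b k))) (UNIV \<times> UNIV)"
    by (rule has_sum_product) (use sa sb in \<open>auto intro!: has_sum_of_real has_sum_infsum\<close>)
  from has_sum_Re[OF this] have "((%(i, j). cmod (a i) * cmod (b j)) has_sum ?P) UNIV" by (simp add: case_prod_unfold)
  then have "((%(k, j). cmod (a j) * cmod (b (k - j))) has_sum ?P) UNIV" using re[of "%(i, j). cmod (a i) * cmod (b j)"] by (simp add: case_prod_unfold)
  then have hs: "((%(k, j). cmod (a j) * cmod (b (k - j))) has_sum ?P) (UNIV \<times> UNIV)" by simp
  have sp: "(%(k, j). cmod (a j) * cmod (b (k - j))) summable_on UNIV \<times> UNIV" using hs by (rule has_sum_imp_summable)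
  have sk: "(%j. cmod (a j) * cmod (b (k - j))) summable_on UNIV" for k
    using summable_on_SigmaD1[OF sp, of k] by simp
  have hk: "((%k. \<Sum>\<^sub>\<infinity>j. cmod (a j) * cmod (b (k - j))) has_sum ?P) UNIV"
    by (rule has_sum_SigmaD[OF hs]) (use sk in simp)
  have sc: "(%j. a j * b (k - j)) summable_on UNIV" for k
    by (rule abs_summable_summable) (use sk in \<open>simp add: norm_mult\<close>)
  show ?thesis
  proof (rule wienerI[where B="%k. \<Sum>\<^sub>\<infinity>j. cmod (a j) * cmod (b (k - j))"])
    show "(%k. \<Sum>\<^sub>\<infinity>j. cmod (a j) * cmod (b (k - j))) summable_on UNIV" using hk by (rule has_sum_imp_summable)
    show "cmod (\<Sum>\<^sub>\<infinity>j. a j * b (k - j)) <= (\<Sum>\<^sub>\<infinity>j. cmod (a j) * cmod (b (k - j)))" for k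
      using norm_infsum_bound[of "%j. a j * b (k - j)" UNIV] sk by (simp add: norm_mult)
    have "?P <= M * N" by (intro mult_mono le infsum_nonneg order_trans[OF infsum_nonneg le(1)]) auto
    then show "(\<Sum>\<^sub>\<infinity>k. \<Sum>\<^sub>\<infinity>j. cmod (a j) * cmod (b (k - j))) <= M * N" using infsumI[OF hk] by simp
    fix x
    have "((%(i, j). (a i * cis (of_int i * x)) * (b j * cis (of_int j * x))) has_sum u x * v x) (UNIV \<times> UNIV)"
      by (rule has_sum_product) (use sa sb wiener_has_sum[OF u] wiener_has_sum[OF v] in \<open>auto simp: norm_mult\<close>)
    then have "((%(k, j). (a j * cis (of_int j * x)) * (b (k - j) * cis (of_int (k - j) * x))) has_sum u x * v x) UNIV"
      using re[of "%(i, j). (a i * cis (of_int i * x)) * (b j * cis (of_int j * x))"] by (simp add: case_prod_unfold)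
    moreover have eq: "(a j * cis (of_int j * x)) * (b (k - j) * cis (of_int (k - j) * x)) = a j * b (k - j) * cis (of_int k * x)" for k j
    proof -
      have "cis (of_int j * x) * cis (of_int (k - j) * x) = cis (of_int k * x)" unfolding cis_mult by (simp add: left_diff_distrib)
      then show ?thesis by (metis mult.assoc mult.commute)
    qed
    ultimately have "((%(k, j). a j * b (k - j) * cis (of_int k * x)) has_sum u x * v x) (UNIV \<times> UNIV)"
      by (simp only: eq UNIV_Times_UNIV)
    then show "((%k. (\<Sum>\<^sub>\<infinity>j. a j * b (k - j)) * cis (of_int k * x)) has_sum u x * v x) UNIV"
      by (rule has_sum_SigmaD) (use has_sum_cmult_left[OF has_sum_infsum[OF sc]] in simp)
  qed
qed

lemma wiener_sum:
  assumes w: "!!i. wiener (M i) (b i) (u i)" and M: "M summable_on UNIV" and U: "!!x. ((%i. u i x) has_sum U x) UNIV"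
  shows "wiener (\<Sum>\<^sub>\<infinity>i. M i) (%k. \<Sum>\<^sub>\<infinity>i. b i k) U"
proof -
  have sb: "(%k. cmod (b i k)) summable_on UNIV" and le: "(\<Sum>\<^sub>\<infinity>k. cmod (b i k)) <= M i" for i using w[of i] by (auto simp: wiener_def)
  have sN: "(%i. \<Sum>\<^sub>\<infinity>k. cmod (b i k)) summable_on UNIV"
    by (rule summable_on_comparison_test[OF M]) (use le in \<open>auto intro: infsum_nonneg\<close>)
  have s1: "(%(i, k). cmod (b i k)) summable_on UNIV \<times> UNIV"
    by (rule summable_on_SigmaI[where g="%i. \<Sum>\<^sub>\<infinity>k. cmod (b i k)"]) (use sb sN in auto)
  then have s2: "(%(k, i). cmod (b i k)) summable_on UNIV \<times> UNIV"
    using summable_on_swap[of "%(i, k). cmod (b i k)" UNIV UNIV] by simp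
  have sk: "(%i. cmod (b i k)) summable_on UNIV" for k using summable_on_SigmaD1[OF s2, of k] by simp
  have eq: "(\<Sum>\<^sub>\<infinity>k. \<Sum>\<^sub>\<infinity>i. cmod (b i k)) = (\<Sum>\<^sub>\<infinity>i. \<Sum>\<^sub>\<infinity>k. cmod (b i k))"
    by (rule infsum_swap_banach[OF s2])
  show ?thesis
  proof (rule wienerI[where B="%k. \<Sum>\<^sub>\<infinity>i. cmod (b i k)"])
    show "(%k. \<Sum>\<^sub>\<infinity>i. cmod (b i k)) summable_on UNIV" using summable_on_Sigma_banach[OF s2] by simp
    show "cmod (\<Sum>\<^sub>\<infinity>i. b i k) <= (\<Sum>\<^sub>\<infinity>i. cmod (b i k))" for k by (rule norm_infsum_bound[OF sk])
    show "(\<Sum>\<^sub>\<infinity>k. \<Sum>\<^sub>\<infinity>i. cmod (b i k)) <= (\<Sum>\<^sub>\<infinity>i. M i)"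
      unfolding eq by (rule infsum_mono[OF sN M]) (rule le)
    fix x
    have "(%q. norm (case q of (k, i) => b i k * cis (of_int k * x))) summable_on UNIV \<times> UNIV"
      using s2 by (simp add: case_prod_unfold norm_mult)
    then have s3: "(%(k, i). b i k * cis (of_int k * x)) summable_on UNIV \<times> UNIV" by (rule abs_summable_summable)
    let ?S = "infsum (%(k, i). b i k * cis (of_int k * x)) (UNIV \<times> UNIV)"
    have hs: "((%(k, i). b i k * cis (of_int k * x)) has_sum ?S) (UNIV \<times> UNIV)" by (rule has_sum_infsum[OF s3])
    then have "((%(i, k). b i k * cis (of_int k * x)) has_sum ?S) (UNIV \<times> UNIV)"
      using has_sum_swap[of "%(k, i). b i k * cis (of_int k * x)" UNIV UNIV ?S] by simp
    then have "((%i. u i x) has_sum ?S) UNIV"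
      by (rule has_sum_SigmaD) (use wiener_has_sum[OF w] in simp)
    then have S: "?S = U x" using U has_sum_unique by blast
    from hs have "((%k. (\<Sum>\<^sub>\<infinity>i. b i k) * cis (of_int k * x)) has_sum ?S) UNIV"
      by (rule has_sum_SigmaD) (use has_sum_cmult_left[OF has_sum_infsum[OF abs_summable_summable[OF sk]]] in simp)
    then show "((%k. (\<Sum>\<^sub>\<infinity>i. b i k) * cis (of_int k * x)) has_sum U x) UNIV" unfolding S .
  qed
qed

lemma wiener_mono: "wiener M b u ==> M <= M' ==> wiener M' b u"
  by (auto simp: wiener_def)

lemma wiener_cmult: "wiener M b u ==> wiener (cmod c * M) (%k. c * b k) (%x. c * u x)"
  unfolding wiener_def by (auto simp: norm_mult infsum_cmult_right' mult.assoc intro!: summable_on_cmult_right mult_left_mono has_sum_cmult_right)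

lemma wiener_cis: "wiener 1 (%k. if k = n then 1 else 0) (%x. cis (of_int n * x))"
proof (rule wienerI[where B="%k. if k = n then 1 else 0"])
  have h: "((%k. if k = n then 1 else 0 :: real) has_sum 1) UNIV" by (rule has_sum_finite_neutralI[of "{n}"]) auto
  show "(%k. if k = n then 1 else 0 :: real) summable_on UNIV" "(\<Sum>\<^sub>\<infinity>k. if k = n then 1 else 0 :: real) <= 1"
    using h by (auto simp: infsumI has_sum_imp_summable)
  show "((%k. (if k = n then 1 else 0) * cis (of_int k * x)) has_sum cis (of_int n * x)) UNIV" for x
    by (rule has_sum_finite_neutralI[of "{n}"]) auto
qed auto

lemma wiener_power: "wiener M b u ==> \<exists>b'. wiener (M ^ j) b' (%x. u x ^ j)"
proof (induction j)
  case 0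
  then show ?case using wiener_cis[of 0] by auto
next
  case (Suc j)
  then obtain b' where "wiener (M ^ j) b' (%x. u x ^ j)" by blast
  from wiener_mult[OF Suc.prems this] show ?case by auto
qed

lemma wiener_exp:
  assumes u: "wiener M b u" shows "\<exists>b'. wiener (exp M) b' (%x. exp (u x))"
proof -
  obtain b' where b': "!!j. wiener (M ^ j) (b' j) (%x. u x ^ j)" using wiener_power[OF u] by metis
  have M: "M >= 0" using u infsum_nonneg[of UNIV "%k. cmod (b k)"] by (auto simp: wiener_def)
  have 1: "((%j. inverse (fact j) * M ^ j) has_sum exp M) UNIV"
    by (rule sums_nonneg_imp_has_sum) (use M exp_converges[of M] in auto)
  have "wiener (\<Sum>\<^sub>\<infinity>j. inverse (fact j) * M ^ j) (%k. \<Sum>\<^sub>\<infinity>j. inverse (fact j) * b' j k) (%x. exp (u x))"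
  proof (rule wiener_sum)
    show "wiener (inverse (fact j) * M ^ j) (%k. inverse (fact j) * b' j k) (%x. inverse (fact j) * u x ^ j)" for j
      using wiener_cmult[OF b'[of j], of "inverse (fact j)"] by (simp add: norm_inverse)
    show "(%j. inverse (fact j) * M ^ j) summable_on UNIV" using 1 by (rule has_sum_imp_summable)
    show "((%j. inverse (fact j) * u x ^ j) has_sum exp (u x)) UNIV" for x
    proof (rule norm_summable_imp_has_sum)
      show "summable (%n. norm (inverse (fact n) * u x ^ n))" using summable_norm_exp[of "u x"] by (simp add: scaleR_conv_of_real)
      show "(%n. inverse (fact n) * u x ^ n) sums exp (u x)" using exp_converges[of "u x"] by (simp add: scaleR_conv_of_real)
    qed
  qed
  then show ?thesis using infsumI[OF 1] by auto
qed

text \<open>If p has norm at most si, then the exponential of i k (x + p x) has norm at most exp(|k|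
  si). The exponential weight on the coefficients of \<eta> pays exactly for this.\<close>

lemma wiener_compose:
  assumes h: "!!x. ((%k. b k * cis (of_int k * x)) has_sum of_real (\<eta> x)) UNIV"
    and s: "(%k. cmod (b k) * ew si k) summable_on UNIV"
    and p: "wiener si bp (%x. of_real (p x))"
  shows "\<exists>b'. wiener (\<Sum>\<^sub>\<infinity>k. cmod (b k) * ew si k) b' (%x. of_real (\<eta> (x + p x)))"
proof -
  have "\<exists>b'. wiener (cmod (b k) * ew si k) b' (%x. b k * cis (of_int k * (x + p x)))" for k
  proof -
    have "wiener (cmod (\<i> * of_int k) * si) (%j. \<i> * of_int k * bp j) (%x. \<i> * of_int k * of_real (p x))" by (rule wiener_cmult[OF p])
    from wiener_exp[OF this] obtain b1 where b1: "wiener (exp (cmod (\<i> * of_int k) * si)) b1 (%x. exp (\<i> * of_int k * of_real (p x)))" by blast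
    from wiener_cmult[OF wiener_mult[OF wiener_cis[of k] this], of "b k"]
    have "wiener (cmod (b k) * (1 * exp (cmod (\<i> * of_int k) * si))) (%n. b k * (\<Sum>\<^sub>\<infinity>j. (if j = k then 1 else 0) * b1 (n - j))) (%x. b k * (cis (of_int k * x) * exp (\<i> * of_int k * of_real (p x))))" .
    moreover have "cis (of_int k * x) * exp (\<i> * of_int k * of_real (p x)) = cis (of_int k * (x + p x))" for x
      by (simp add: cis_conv_exp mult_exp_exp distrib_left mult_ac)
    ultimately show ?thesis by (auto simp: norm_mult mult.commute)
  qed
  then obtain b' where b': "!!k. wiener (cmod (b k) * ew si k) (b' k) (%x. b k * cis (of_int k * (x + p x)))" by metis
  from wiener_sum[OF this s h] show ?thesis by blast
qed

lemma has_vector_derivative_quotient: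
  fixes f :: "real => 'a::real_normed_vector"
  shows "(f has_vector_derivative D) (at x within S) \<longleftrightarrow> ((%y. norm ((1 / (y - x)) *\<^sub>R (f y - f x) - D)) \<longlongrightarrow> 0) (at x within S)"
proof -
  have "norm ((1 / (y - x)) *\<^sub>R (f y - f x) - D) = norm (f y - f x - (y - x) *\<^sub>R D) / norm (y - x)" if "y ~= x" for y
  proof -
    have "(1 / (y - x)) *\<^sub>R (f y - f x) - D = (1 / (y - x)) *\<^sub>R (f y - f x - (y - x) *\<^sub>R D)"
      using that by (simp add: scaleR_diff_right)
    then show ?thesis by (simp add: divide_inverse mult.commute)
  qed
  then have "((%y. norm ((1 / (y - x)) *\<^sub>R (f y - f x) - D)) \<longlongrightarrow> 0) (at x within S) \<longleftrightarrow>
      ((%y. norm (f y - f x - (y - x) *\<^sub>R D) / norm (y - x)) \<longlongrightarrow> 0) (at x within S)"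
    by (intro tendsto_cong) (auto simp: eventually_at_filter)
  then show ?thesis unfolding has_vector_derivative_def has_derivative_iff_norm by (simp add: bounded_linear_scaleR_left)
qed

text \<open>Dominated convergence for the difference quotients: by the Lipschitz bound of the k-th
  exponential the deviation in the k-th term is at most 2 |k| |b k|.\<close>

lemma wiener_derivative:
  assumes u: "wiener M b u" and s: "(%k. \<bar>of_int k\<bar> * cmod (b k)) summable_on UNIV"
  shows "(u has_vector_derivative (\<Sum>\<^sub>\<infinity>k. \<i> * of_int k * b k * cis (of_int k * x))) (at x)"
proof -
  let ?c = "%k x. cis (of_int k * x)"
  have sd: "(%k. \<i> * of_int k * b k * ?c k x) summable_on UNIV"
    by (rule abs_summable_summable) (use s in \<open>simp add: norm_mult\<close>)
  define f where "f k y = cmod (b k) * cmod (of_real (1 / (y - x)) * (?c k y - ?c k x) - \<i> * of_int k * ?c k x)" for k y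
  have dc: "(?c k has_vector_derivative \<i> * of_int k * ?c k y) (at y)" for k y
    by (auto intro!: derivative_eq_intros simp: has_vector_derivative_def scaleR_conv_of_real mult_ac)
  have lip: "cmod (?c k y - ?c k x) <= \<bar>of_int k\<bar> * \<bar>y - x\<bar>" for k y
  proof -
    have "norm (?c k y - ?c k x) <= \<bar>of_int k\<bar> * norm (y - x)"
    proof (rule differentiable_bound[of UNIV "?c k" "%y h. h *\<^sub>R (\<i> * of_int k * ?c k y)"])
      show "onorm (%h. h *\<^sub>R (\<i> * of_int k * ?c k y)) <= \<bar>of_int k\<bar>" for y
        by (subst onorm_scaleR_left) (auto simp: onorm_id norm_mult)
    qed (use dc in \<open>auto simp: has_vector_derivative_def\<close>)
    then show ?thesis by simp
  qed
  have fb: "f k y <= 2 * (\<bar>of_int k\<bar> * cmod (b k))" if y: "y ~= x" for y k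
  proof -
    have "cmod (of_real (1 / (y - x)) * (?c k y - ?c k x)) <= \<bar>of_int k\<bar>"
      using lip[of k y] y by (simp add: norm_mult norm_divide divide_simps mult.commute del: of_real_diff)
    then have "cmod (of_real (1 / (y - x)) * (?c k y - ?c k x) - \<i> * of_int k * ?c k x) <= 2 * \<bar>of_int k\<bar>"
      using norm_triangle_ineq4[of "of_real (1 / (y - x)) * (?c k y - ?c k x)" "\<i> * of_int k * ?c k x"] by (simp add: norm_mult)
    from mult_left_mono[OF this, of "cmod (b k)"] show ?thesis by (simp add: f_def mult_ac)
  qed
  have "((%y. \<Sum>\<^sub>\<infinity>k. f k y) \<longlongrightarrow> 0) (at x)"
  proof (rule dominated_infsum_tendsto_0)
    show "(%k. 2 * (\<bar>of_int k\<bar> * cmod (b k))) summable_on UNIV" by (rule summable_on_cmult_right[OF s])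
    show "(f k \<longlongrightarrow> 0) (at x)" for k
    proof -
      have "((%y. cmod (of_real (1 / (y - x)) * (?c k y - ?c k x) - \<i> * of_int k * ?c k x)) \<longlongrightarrow> 0) (at x)"
        using dc[of k x] unfolding has_vector_derivative_quotient scaleR_conv_of_real .
      from tendsto_mult_left[OF this, of "cmod (b k)"] show ?thesis unfolding f_def by simp
    qed
    show "\<forall>\<^sub>F y in at x. \<forall>k. 0 <= f k y & f k y <= 2 * (\<bar>of_int k\<bar> * cmod (b k))"
      unfolding eventually_at_filter by (intro always_eventually allI impI conjI fb) (simp_all add: f_def)
  qed
  then have lim: "((%y. \<Sum>\<^sub>\<infinity>k. f k y) \<longlongrightarrow> 0) (at x)" .
  have le: "norm ((1 / (y - x)) *\<^sub>R (u y - u x) - (\<Sum>\<^sub>\<infinity>k. \<i> * of_int k * b k * ?c k x)) <= (\<Sum>\<^sub>\<infinity>k. f k y)" if y: "y ~= x" for y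
  proof (rule norm_infsum_le)
    show "((%k. of_real (1 / (y - x)) * (b k * ?c k y - b k * ?c k x) - \<i> * of_int k * b k * ?c k x) has_sum
        (1 / (y - x)) *\<^sub>R (u y - u x) - (\<Sum>\<^sub>\<infinity>k. \<i> * of_int k * b k * ?c k x)) UNIV"
      unfolding scaleR_conv_of_real
      by (intro has_sum_diff has_sum_cmult_right wiener_has_sum[OF u] has_sum_infsum sd)
    show "((%k. f k y) has_sum (\<Sum>\<^sub>\<infinity>k. f k y)) UNIV"
    proof (rule has_sum_infsum, rule summable_on_comparison_test)
      show "(%k. 2 * (\<bar>of_int k\<bar> * cmod (b k))) summable_on UNIV" by (rule summable_on_cmult_right[OF s])
    qed (use fb[OF y] in \<open>simp_all add: f_def\<close>)
    show "norm (of_real (1 / (y - x)) * (b k * ?c k y - b k * ?c k x) - \<i> * of_int k * b k * ?c k x) <= f k y" for k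
      unfolding f_def norm_mult[symmetric] by (rule eq_refl, rule arg_cong[where f=norm]) (simp add: algebra_simps)
  qed
  show ?thesis unfolding has_vector_derivative_quotient
    by (rule Lim_null_comparison[OF _ lim]) (use le in \<open>auto simp: eventually_at_filter\<close>)
qed

lemma wiener_derivative_bound:
  assumes "(%k. \<bar>of_int k\<bar> * cmod (b k)) summable_on UNIV"
  shows "norm (\<Sum>\<^sub>\<infinity>k. \<i> * of_int k * b k * cis (of_int k * x)) <= (\<Sum>\<^sub>\<infinity>k. \<bar>of_int k\<bar> * cmod (b k))"
  using norm_infsum_bound[of "%k. \<i> * of_int k * b k * cis (of_int k * x)" UNIV] assms by (simp add: norm_mult)

section \<open>Analytic families\<close>

definition fmode :: "(nat => int => complex) => real => int => complex" where
  "fmode a eps k = (\<Sum>\<^sub>\<infinity>l. a l k * of_real (eps ^ l))"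

context
  fixes a :: "nat => int => complex" and e1 si :: real and f :: "real => real => real"
  assumes e1: "e1 > 0" and sig: "si >= 0"
    and sum: "(%(l, k). cmod (a l k) * e1 ^ l * ew si k) summable_on UNIV"
    and rep: "!!eps x. eps \<in> cball 0 e1 ==> ((%(l, k). a l k * of_real (eps ^ l) * cis (of_int k * x)) has_sum of_real (f eps x)) UNIV"
begin

lemma fam_swapped: "(%(k, l). cmod (a l k) * e1 ^ l * ew si k) summable_on UNIV \<times> UNIV"
  using summable_on_swap[of "%(l, k). cmod (a l k) * e1 ^ l * ew si k" UNIV UNIV] sum by simp

lemma fam_weighted_summable: "(%l. cmod (a l k) * e1 ^ l * ew si k) summable_on UNIV"
  using summable_on_SigmaD1[OF fam_swapped, of k] by simp

lemma fam_row_summable: "(%l. cmod (a l k) * e1 ^ l) summable_on UNIV"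
proof (rule summable_on_comparison_test[OF fam_weighted_summable[of k]])
  fix l
  have "1 <= ew si k" using sig by simp
  from mult_left_mono[OF this, of "cmod (a l k) * e1 ^ l"]
  show "cmod (a l k) * e1 ^ l <= cmod (a l k) * e1 ^ l * ew si k" using e1 by simp
qed (use e1 in simp)

lemma fam_term: "abs eps <= e1 ==> cmod (a l k * of_real (eps ^ l)) <= cmod (a l k) * e1 ^ l"
  by (auto simp: norm_mult norm_power intro!: mult_left_mono power_mono)

lemma fmode_has_sum:
  assumes "abs eps <= e1"
  shows "(%l. cmod (a l k * of_real (eps ^ l))) summable_on UNIV" "((%l. a l k * of_real (eps ^ l)) has_sum fmode a eps k) UNIV"
proof -
  show s: "(%l. cmod (a l k * of_real (eps ^ l))) summable_on UNIV"
    by (rule summable_on_comparison_test[OF fam_row_summable[of k]]) (use fam_term[OF assms] in simp_all)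
  show "((%l. a l k * of_real (eps ^ l)) has_sum fmode a eps k) UNIV"
    unfolding fmode_def by (rule has_sum_infsum[OF abs_summable_summable[OF s]])
qed

lemma fmode_bound:
  assumes "abs eps <= e1"
  shows "cmod (fmode a eps k) <= (\<Sum>\<^sub>\<infinity>l. cmod (a l k) * e1 ^ l)"
  by (rule norm_infsum_le[OF fmode_has_sum(2)[OF assms] has_sum_infsum[OF fam_row_summable]]) (rule fam_term[OF assms])

lemma fam_rows_summable: "(%k. (\<Sum>\<^sub>\<infinity>l. cmod (a l k) * e1 ^ l) * ew si k) summable_on UNIV"
  using summable_on_Sigma_banach[OF fam_swapped] by (simp add: infsum_cmult_left')

lemma fmode_weighted_summable:
  assumes "abs eps <= e1" shows "(%k. cmod (fmode a eps k) * ew si k) summable_on UNIV"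
  by (rule summable_on_comparison_test[OF fam_rows_summable]) (auto intro: mult_right_mono fmode_bound[OF assms])

lemma fmode_wiener:
  assumes "abs eps <= e1"
  shows "wiener (\<Sum>\<^sub>\<infinity>k. cmod (fmode a eps k) * ew si k) (fmode a eps) (%x. of_real (f eps x))"
proof (rule wienerI[OF fmode_weighted_summable[OF assms]])
  show "cmod (fmode a eps k) <= cmod (fmode a eps k) * ew si k" for k
    using mult_left_mono[of 1 "ew si k" "cmod (fmode a eps k)"] sig by simp
  fix x
  have "((%(l, k). a l k * of_real (eps ^ l) * cis (of_int k * x)) has_sum of_real (f eps x)) (UNIV \<times> UNIV)"
    using rep[of eps x] assms by simp
  then have "((%(k, l). a l k * of_real (eps ^ l) * cis (of_int k * x)) has_sum of_real (f eps x)) (UNIV \<times> UNIV)"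
    using has_sum_swap[of "%(l, k). a l k * of_real (eps ^ l) * cis (of_int k * x)" UNIV UNIV "of_real (f eps x)"] by simp
  then show "((%k. fmode a eps k * cis (of_int k * x)) has_sum of_real (f eps x)) UNIV"
    by (rule has_sum_SigmaD) (use has_sum_cmult_left[OF fmode_has_sum(2)[OF assms]] in simp)
qed simp

lemma fmode_fcoeff: "abs eps <= e1 ==> fcoeff (f eps) k = fmode a eps k"
  by (rule wiener_fcoeff[OF fmode_wiener])

lemma fmode_zero: "fmode a 0 k = a 0 k"
proof -
  have "((%l. a l k * of_real (0 ^ l)) has_sum a 0 k) UNIV"
    by (rule has_sum_finite_neutralI[of "{0}"]) auto
  then show ?thesis unfolding fmode_def by (rule infsumI)
qed

lemma fam_zero_coeff:
  assumes "!!x. f 0 x = 0" shows "a 0 k = 0"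
  using fmode_fcoeff[of 0 k] e1 assms by (simp add: fmode_zero fcoeff_def)

text \<open>The coefficient of order zero vanishes, so each remaining term yields a factor |eps| /
  e1. This is how all norms become small with the amplitude.\<close>

lemma fmode_small:
  assumes z: "!!x. f 0 x = 0" and eps: "abs eps <= e1"
  shows "cmod (fmode a eps k) <= abs eps / e1 * (\<Sum>\<^sub>\<infinity>l. cmod (a l k) * e1 ^ l)"
    and "(\<Sum>\<^sub>\<infinity>k. cmod (fmode a eps k) * ew si k) <= abs eps / e1 * (\<Sum>\<^sub>\<infinity>k. (\<Sum>\<^sub>\<infinity>l. cmod (a l k) * e1 ^ l) * ew si k)"
proof -
  show 1: "cmod (fmode a eps k) <= abs eps / e1 * (\<Sum>\<^sub>\<infinity>l. cmod (a l k) * e1 ^ l)" for k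
  proof (rule norm_infsum_le[OF fmode_has_sum(2)[OF eps] has_sum_cmult_right[OF has_sum_infsum[OF fam_row_summable]]])
    fix l
    show "cmod (a l k * of_real (eps ^ l)) <= abs eps / e1 * (cmod (a l k) * e1 ^ l)"
    proof (cases l)
      case 0
      then show ?thesis using fam_zero_coeff[OF z] e1 by simp
    next
      case (Suc n)
      have "abs eps ^ n <= e1 ^ n" using eps by (intro power_mono) auto
      then have "cmod (a l k) * (abs eps * abs eps ^ n) <= cmod (a l k) * (abs eps * e1 ^ n)" by (intro mult_left_mono) auto
      then show ?thesis using e1 by (simp add: Suc norm_mult norm_power mult_ac)
    qed
  qed
  have "(\<Sum>\<^sub>\<infinity>k. cmod (fmode a eps k) * ew si k) <= (\<Sum>\<^sub>\<infinity>k. abs eps / e1 * ((\<Sum>\<^sub>\<infinity>l. cmod (a l k) * e1 ^ l) * ew si k))"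
    by (rule infsum_mono[OF fmode_weighted_summable[OF eps] summable_on_cmult_right[OF fam_rows_summable]])
      (use mult_right_mono[OF 1] in \<open>simp add: mult.assoc\<close>)
  then show "(\<Sum>\<^sub>\<infinity>k. cmod (fmode a eps k) * ew si k) <= abs eps / e1 * (\<Sum>\<^sub>\<infinity>k. (\<Sum>\<^sub>\<infinity>l. cmod (a l k) * e1 ^ l) * ew si k)"
    by (simp only: infsum_cmult_right')
qed

end

section \<open>A single Stokes wave in conformal coordinates\<close>

text \<open>The q n are the Taylor coefficients of the derivative of the conformal map, in the
  variable exp(- \<i> w). In the series with q n / n the term n = 0 is zero by the convention for
  division by zero; the mean value Y0 is kept apart. R > 1 means that the map is holomorphic across
  the surface.\<close>

locale conformal_wave =
  fixes q :: "nat => real" and R Y0 :: real and \<eta> p :: "real => real"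
  assumes q0: "q 0 = 1" and R: "R > 1" and q_summable: "summable (%n. \<bar>q n\<bar> * R ^ n)"
    and q_small: "(\<Sum>n. \<bar>q (Suc n)\<bar>) <= 1/4"
    and p_eq: "!!x. p x = - Im (\<Sum>n. of_real (q n / n) * cis (- x) ^ n)"
    and y_eq: "!!x. \<eta> (x + p x) = Y0 + Re (\<Sum>n. of_real (q n / n) * cis (- x) ^ n)"
    and eta_lip: "!!x y. \<bar>\<eta> x - \<eta> y\<bar> <= \<bar>x - y\<bar>"
begin

definition hh :: "complex => complex" where "hh ze = (\<Sum>n. of_real (q n / n) * ze ^ n)"
definition gg :: "complex => complex" where "gg ze = (\<Sum>n. of_real (q n) * ze ^ n)"
text \<open>The conformal map of the lower half-plane, which exp(- \<i> w) sends to the unit disc.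
  On the real axis it is the surface, parametrised by x + p x; its derivative is \<open>gg\<close>
  at exp(- \<i> w).\<close>

definition conf :: "complex => complex" where "conf w = w + \<i> * of_real Y0 + \<i> * hh (exp (- \<i> * w))"

lemma q_summable_at:
  assumes "norm ze <= R" shows "summable (%n. norm (of_real (q n) * ze ^ n))" "summable (%n. norm (of_real (q n / n) * ze ^ n :: complex))"
proof -
  have z: "norm (ze ^ n) <= R ^ n" for n using assms by (simp add: norm_power power_mono)
  show "summable (%n. norm (of_real (q n) * ze ^ n))"
    by (rule summable_comparison_test'[OF q_summable, of 0]) (use z in \<open>simp add: norm_mult mult_left_mono\<close>)
  have le: "\<bar>q n / n\<bar> <= \<bar>q n\<bar>" for n
  proof (cases n)
    case (Suc k)
    have "\<bar>q n\<bar> * 1 <= \<bar>q n\<bar> * real n" by (intro mult_left_mono) (auto simp: Suc)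
    then show ?thesis using Suc by (simp add: abs_divide divide_le_eq del: of_nat_Suc)
  qed simp
  show "summable (%n. norm (of_real (q n / n) * ze ^ n :: complex))"
  proof (rule summable_comparison_test'[OF q_summable, of 0])
    fix n
    have "norm (of_real (q n / n) * ze ^ n :: complex) = \<bar>q n / n\<bar> * norm (ze ^ n)" by (simp only: norm_mult norm_of_real)
    also have "... <= \<bar>q n\<bar> * R ^ n" by (intro mult_mono le z) auto
    finally show "norm (norm (of_real (q n / n) * ze ^ n :: complex)) <= \<bar>q n\<bar> * R ^ n" by simp
  qed
qed

lemma gg_split:
  assumes "norm ze <= R" shows "gg ze = 1 + (\<Sum>n. of_real (q (Suc n)) * ze ^ n) * ze"
  using powser_split_head(1)[OF summable_norm_cancel[OF q_summable_at(1)[OF assms]]] by (simp add: gg_def q0)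

lemma gg_near_one:
  assumes "norm ze <= 1" shows "norm (gg ze - 1) <= 1/4"
proof -
  have "summable (%n. \<bar>q n\<bar>)"
    using q_summable_at(1)[of 1] R by simp
  then have s: "summable (%n. \<bar>q (Suc n)\<bar>)" by (subst summable_Suc_iff)
  have t: "norm (of_real (q (Suc n)) * ze ^ n) <= \<bar>q (Suc n)\<bar>" for n
    using mult_left_mono[OF power_le_one[OF norm_ge_zero assms, of n], of "\<bar>q (Suc n)\<bar>"] by (simp add: norm_mult norm_power)
  have "norm (\<Sum>n. of_real (q (Suc n)) * ze ^ n) <= (\<Sum>n. \<bar>q (Suc n)\<bar>)"
    by (rule norm_suminf_le[OF t s])
  then have "norm ((\<Sum>n. of_real (q (Suc n)) * ze ^ n) * ze) <= (1/4) * 1"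
    unfolding norm_mult using q_small assms by (intro mult_mono) auto
  then show ?thesis using gg_split[of ze] assms R by simp
qed

lemma hh_deriv:
  assumes "norm ze < R" shows "(hh has_field_derivative (\<Sum>n. of_real (q (Suc n)) * ze ^ n)) (at ze)"
proof -
  have "norm (complex_of_real R) = R" using R by simp
  then have "summable (%n. of_real (q n / n) * (of_real R :: complex) ^ n)" "norm ze < norm (complex_of_real R)"
    using summable_norm_cancel[OF q_summable_at(2)[of "of_real R"]] assms by auto
  from termdiffs_strong[OF this]
  have "(hh has_field_derivative (\<Sum>n. diffs (%n. of_real (q n / n)) n * ze ^ n)) (at ze)" unfolding hh_def .
  moreover have "diffs (%n. of_real (q n / n)) n = (of_real (q (Suc n)) :: complex)" for n
    by (simp add: diffs_def del: of_nat_Suc)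
  ultimately show ?thesis by simp
qed

lemma norm_exp_lower: "Im w <= 0 ==> norm (exp (- \<i> * w)) <= 1"
  by simp

lemma exp_lower_less:
  assumes "Im w <= 0" shows "norm (exp (- \<i> * w)) < norm (complex_of_real R)"
proof -
  have "norm (complex_of_real R) = R" using R by simp
  then show ?thesis using order_le_less_trans[OF norm_exp_lower[OF assms] R] by simp
qed

lemma exp_shift: "exp (- \<i> * (w + of_real (2 * pi))) = exp (- \<i> * w)"
proof -
  have "exp (- \<i> * (w + of_real (2 * pi))) = exp (- \<i> * w) * exp (- (\<i> * of_real (2 * pi)))"
    by (simp add: exp_add[symmetric] algebra_simps)
  also have "exp (- (\<i> * of_real (2 * pi))) = 1" by (simp add: exp_minus mult_ac)
  finally show ?thesis by simp
qed

lemma conf_deriv: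
  assumes "Im w <= 0" shows "(conf has_field_derivative gg (exp (- \<i> * w))) (at w)"
proof -
  let ?z = "exp (- \<i> * w)"
  have z: "norm ?z <= 1" by (rule norm_exp_lower[OF assms])
  then have "norm ?z < R" using R by linarith
  note d = hh_deriv[OF this]
  have e: "((%w. exp (- \<i> * w)) has_field_derivative ?z * (- \<i>)) (at w)" by (auto intro!: derivative_eq_intros)
  have "(conf has_field_derivative 1 + 0 + \<i> * ((\<Sum>n. of_real (q (Suc n)) * ?z ^ n) * (?z * (- \<i>)))) (at w)"
    unfolding conf_def[abs_def] by (intro DERIV_add DERIV_ident DERIV_const DERIV_cmult DERIV_chain2[OF d e])
  moreover have "1 + 0 + \<i> * ((\<Sum>n. of_real (q (Suc n)) * ?z ^ n) * (?z * (- \<i>))) = gg ?z"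
    using gg_split[OF order_trans[OF z less_imp_le[OF R]]] by (simp add: algebra_simps)
  ultimately show ?thesis by simp
qed

lemma conf_real: "conf (of_real x) = Complex (x + p x) (\<eta> (x + p x))"
proof -
  have e: "exp (- \<i> * of_real x) = cis (- x)" by (simp add: cis_conv_exp)
  have p: "p x = - Im (hh (cis (- x)))" and y: "\<eta> (x + p x) = Y0 + Re (hh (cis (- x)))"
    unfolding hh_def by (fact p_eq, fact y_eq)
  show ?thesis
  proof (rule complex_eqI)
    show "Re (conf (of_real x)) = Re (Complex (x + p x) (\<eta> (x + p x)))" unfolding conf_def e by (simp add: p)
    show "Im (conf (of_real x)) = Im (Complex (x + p x) (\<eta> (x + p x)))" unfolding conf_def e by (simp add: y)
  qed
qed

lemma conf_near:
  assumes "Im w <= 0" "Im v <= 0" shows "norm ((conf w - w) - (conf v - v)) <= 1/4 * norm (w - v)"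
proof (rule field_differentiable_bound[of "{w. Im w <= 0}" _ "%w. gg (exp (- \<i> * w)) - 1"])
  show "convex {w. Im w <= 0}" by (rule convex_halfspace_Im_le)
  fix z assume z: "z \<in> {w. Im w <= 0}"
  then show "((%w. conf w - w) has_field_derivative gg (exp (- \<i> * z)) - 1) (at z within {w. Im w <= 0})"
    by (intro DERIV_diff DERIV_ident DERIV_subset[OF conf_deriv]) auto
  show "norm (gg (exp (- \<i> * z)) - 1) <= 1/4" using z by (intro gg_near_one norm_exp_lower) simp
qed (use assms in auto)

text \<open>Compare w with its projection to the real axis. The images differ by w minus the
  projection up to a quarter of the distance, and the slope of \<eta>, at most 1, costs another
  quarter. So the open half-plane goes into the fluid.\<close>

lemma conf_below_top:
  assumes "Im w <= 0"
  shows "Im (conf w) <= \<eta> (Re w + p (Re w)) + 3/4 * Im w" "Im (conf w) <= \<eta> (Re (conf w)) + 1/2 * Im w"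
proof -
  let ?v = "complex_of_real (Re w)" and ?X = "Re w + p (Re w)"
  have v: "conf ?v = Complex ?X (\<eta> ?X)" by (rule conf_real)
  have nv: "norm (w - ?v) = - Im w"
  proof -
    have "w - ?v = \<i> * of_real (Im w)" by (simp add: complex_eq_iff)
    then show ?thesis using assms by (simp add: norm_mult)
  qed
  have n: "norm ((conf w - w) - (conf ?v - ?v)) <= 1/4 * (- Im w)" using conf_near[OF assms, of ?v] nv by simp
  have "\<bar>Im ((conf w - w) - (conf ?v - ?v))\<bar> <= 1/4 * (- Im w)" "\<bar>Re ((conf w - w) - (conf ?v - ?v))\<bar> <= 1/4 * (- Im w)"
    using order_trans[OF abs_Im_le_cmod n] order_trans[OF abs_Re_le_cmod n] .
  then have 1: "\<bar>Im (conf w) - Im w - \<eta> ?X\<bar> <= 1/4 * (- Im w)" and 2: "\<bar>Re (conf w) - ?X\<bar> <= 1/4 * (- Im w)" by (simp_all add: v)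
  show "Im (conf w) <= \<eta> ?X + 3/4 * Im w" using 1 by linarith
  show "Im (conf w) <= \<eta> (Re (conf w)) + 1/2 * Im w" using 1 2 eta_lip[of ?X "Re (conf w)"] by linarith
qed

lemma conf_shift: "conf (w + of_real (2 * pi)) = conf w + of_real (2 * pi)"
  unfolding conf_def exp_shift by simp

lemma boundary_derivs:
  defines "A \<equiv> %x. Re (gg (cis (- x)))" and "B \<equiv> %x. Im (gg (cis (- x)))"
  shows "((%x. x + p x) has_real_derivative A x) (at x)" "((%x. \<eta> (x + p x)) has_real_derivative B x) (at x)" "A x >= 3/4"
proof -
  have e: "exp (- \<i> * of_real x) = cis (- x)" by (simp add: cis_conv_exp)
  have "(conf has_field_derivative gg (cis (- x))) (at (of_real x))"
    using conf_deriv[of "of_real x"] by (simp add: e[symmetric] del: of_real_minus)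
  then have "((%x. conf (of_real x)) has_vector_derivative gg (cis (- x))) (at x)"
    by (rule has_vector_derivative_real_field)
  then have d: "((%x. Complex (x + p x) (\<eta> (x + p x))) has_vector_derivative gg (cis (- x))) (at x)" by (simp add: conf_real)
  show "((%x. x + p x) has_real_derivative A x) (at x)"
    using bounded_linear.has_vector_derivative[OF bounded_linear_Re d] by (simp add: A_def has_real_derivative_iff_has_vector_derivative)
  show "((%x. \<eta> (x + p x)) has_real_derivative B x) (at x)"
    using bounded_linear.has_vector_derivative[OF bounded_linear_Im d] by (simp add: B_def has_real_derivative_iff_has_vector_derivative)
  have "\<bar>Re (gg (cis (- x)) - 1)\<bar> <= 1/4" by (rule order_trans[OF abs_Re_le_cmod gg_near_one]) simp
  then have "\<bar>Re (gg (cis (- x))) - 1\<bar> <= 1/4" by simp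
  then show "A x >= 3/4" unfolding A_def by linarith
qed

end

section \<open>The complex velocity in conformal coordinates\<close>

locale fluid_wave = conformal_wave +
  fixes c By :: real and \<psi> G :: "real => real" and Phi Phix Phiz Phixx Phixz Phizz :: "real \<times> real => real"
  assumes eta_bound: "!!x. \<bar>\<eta> x\<bar> <= By" and eta_diff: "!!x. (\<eta> has_real_derivative deriv \<eta> x) (at x)"
    and eta_per: "!!x. \<eta> (x + 2 * pi) = \<eta> x" and psi_per: "!!x. \<psi> (x + 2 * pi) = \<psi> x"
    and zero: "\<psi> 0 = 0" "p 0 = 0"
    and cont: "continuous_on {(x, z). z <= \<eta> x} Phi" "continuous_on {(x, z). z <= \<eta> x} Phix" "continuous_on {(x, z). z <= \<eta> x} Phiz"
    and der: "!!x z. z < \<eta> x ==> (Phi has_derivative (%(h, k). Phix (x, z) * h + Phiz (x, z) * k)) (at (x, z))"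
      "!!x z. z < \<eta> x ==> (Phix has_derivative (%(h, k). Phixx (x, z) * h + Phixz (x, z) * k)) (at (x, z))"
      "!!x z. z < \<eta> x ==> (Phiz has_derivative (%(h, k). Phixz (x, z) * h + Phizz (x, z) * k)) (at (x, z))"
    and harm: "!!x z. z < \<eta> x ==> Phixx (x, z) + Phizz (x, z) = 0"
    and phi_per: "!!x z. z <= \<eta> x ==> Phi (x + 2 * pi, z) = Phi (x, z)"
    and surf: "!!x. Phi (x, \<eta> x) = \<psi> x"
    and decay: "uniform_limit UNIV (%z x. Phiz (x, z)) (%_. 0) at_bot"
    and DN: "!!x. G x = Phiz (x, \<eta> x) - deriv \<eta> x * Phix (x, \<eta> x)"
    and kin: "!!x. c * deriv \<eta> x + G x = 0"
begin

text \<open>The complex velocity of the potential flow, holomorphic in the fluid because the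
  potential is harmonic.\<close>

definition V :: "complex => complex" where
  "V ze = of_real (Phix (Re ze, Im ze)) - \<i> * of_real (Phiz (Re ze, Im ze))"

text \<open>The derivative in w of the complex potential of the flow relative to the wave, pulled
  back by the conformal map.\<close>

definition W :: "complex => complex" where "W w = (V (conf w) - of_real c) * gg (exp (- \<i> * w))"

lemma coord_deriv: "((%ze. (Re ze, Im ze)) has_derivative (%h. (Re h, Im h))) (at ze within S)"
  by (intro has_derivative_Pair bounded_linear_imp_has_derivative bounded_linear_Re bounded_linear_Im)

lemma V_deriv:
  assumes "Im ze < \<eta> (Re ze)"
  shows "(V has_field_derivative of_real (Phixx (Re ze, Im ze)) - \<i> * of_real (Phixz (Re ze, Im ze))) (at ze)"
proof -
  have "((%ze. Phix (Re ze, Im ze)) has_derivative (%h. Phixx (Re ze, Im ze) * Re h + Phixz (Re ze, Im ze) * Im h)) (at ze)"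
    using has_derivative_compose[OF coord_deriv der(2)[OF assms]] by simp
  moreover have "((%ze. Phiz (Re ze, Im ze)) has_derivative (%h. Phixz (Re ze, Im ze) * Re h + Phizz (Re ze, Im ze) * Im h)) (at ze)"
    using has_derivative_compose[OF coord_deriv der(3)[OF assms]] by simp
  ultimately have "(V has_derivative (%h. of_real (Phixx (Re ze, Im ze) * Re h + Phixz (Re ze, Im ze) * Im h)
      - \<i> * of_real (Phixz (Re ze, Im ze) * Re h + Phizz (Re ze, Im ze) * Im h))) (at ze)"
    unfolding V_def[abs_def] by (intro has_derivative_diff has_derivative_mult_right has_derivative_of_real)
  moreover have "(%h. of_real (Phixx (Re ze, Im ze) * Re h + Phixz (Re ze, Im ze) * Im h)
      - \<i> * of_real (Phixz (Re ze, Im ze) * Re h + Phizz (Re ze, Im ze) * Im h)) = (*) (of_real (Phixx (Re ze, Im ze)) - \<i> * of_real (Phixz (Re ze, Im ze)))"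
  proof -
    have "Phizz (Re ze, Im ze) = - Phixx (Re ze, Im ze)" using harm[OF assms] by simp
    then show ?thesis by (intro ext) (simp add: complex_eq_iff)
  qed
  ultimately show ?thesis by (simp add: has_field_derivative_def)
qed

lemma conf_fluid: "Im w < 0 ==> Im (conf w) < \<eta> (Re (conf w))" "Im w <= 0 ==> Im (conf w) <= \<eta> (Re (conf w))"
  using conf_below_top(2)[of w] by auto

lemma W_holomorphic: "W holomorphic_on {w. Im w < 0}"
proof -
  have "W field_differentiable at w" if w: "Im w < 0" for w
  proof -
    have e: "((%w. exp (- \<i> * w)) has_field_derivative exp (- \<i> * w) * (- \<i>)) (at w)" by (auto intro!: derivative_eq_intros)
    have "conf field_differentiable at w" using conf_deriv[of w] w by (auto simp: field_differentiable_def)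
    moreover have "V field_differentiable at (conf w)" using V_deriv[OF conf_fluid(1)[OF w]] by (auto simp: field_differentiable_def)
    ultimately have 1: "(V \<circ> conf) field_differentiable at w" by (rule field_differentiable_compose)
    have n: "norm (exp (- \<i> * w)) < norm (complex_of_real R)" by (rule exp_lower_less) (use w in simp)
    have sm: "summable (%n. of_real (q n) * complex_of_real R ^ n)" using summable_norm_cancel[OF q_summable_at(1)[of "of_real R"]] R by simp
    have "gg field_differentiable at (exp (- \<i> * w))"
      using termdiffs_strong[OF sm n] unfolding gg_def[abs_def] by (auto simp: field_differentiable_def)
    moreover have "(%w. exp (- \<i> * w)) field_differentiable at w" using e by (auto simp: field_differentiable_def)
    ultimately have 2: "(gg \<circ> (%w. exp (- \<i> * w))) field_differentiable at w" by (intro field_differentiable_compose)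
    have "(%w. ((V \<circ> conf) w - of_real c) * (gg \<circ> (%w. exp (- \<i> * w))) w) field_differentiable at w"
      by (intro field_differentiable_mult field_differentiable_diff 1 2 field_differentiable_const)
    then show ?thesis by (simp add: W_def[abs_def] o_def)
  qed
  then show ?thesis by (auto simp: holomorphic_on_def intro: field_differentiable_at_within)
qed

lemma conf_continuous: "continuous_on {w. Im w <= 0} conf"
  by (rule continuous_at_imp_continuous_on) (use conf_deriv in \<open>auto intro: DERIV_isCont\<close>)

lemma W_continuous: "continuous_on {w. Im w <= 0} W"
proof -
  have m: "(%w. (Re (conf w), Im (conf w))) ` {w. Im w <= 0} \<subseteq> {(x, z). z <= \<eta> x}" using conf_fluid(2) by auto
  have c2: "continuous_on {w. Im w <= 0} (%w. (Re (conf w), Im (conf w)))" by (intro continuous_intros conf_continuous)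
  have "continuous_on {w. Im w <= 0} (%w. gg (exp (- \<i> * w)))"
  proof (rule continuous_at_imp_continuous_on, safe)
    fix w assume w: "Im w <= 0"
    have n: "norm (exp (- \<i> * w)) < norm (complex_of_real R)" by (rule exp_lower_less[OF w])
    have sm: "summable (%n. of_real (q n) * complex_of_real R ^ n)" using summable_norm_cancel[OF q_summable_at(1)[of "of_real R"]] R by simp
    have "isCont gg (exp (- \<i> * w))" unfolding gg_def[abs_def] by (rule DERIV_isCont[OF termdiffs_strong[OF sm n]])
    moreover have "isCont (%w. exp (- \<i> * w)) w" by (intro continuous_intros)
    ultimately show "isCont (%w. gg (exp (- \<i> * w))) w" by (rule isCont_o2[rotated])
  qed
  then show ?thesis unfolding W_def[abs_def] V_def
    by (intro continuous_intros continuous_on_compose2[OF cont(2) c2 m] continuous_on_compose2[OF cont(3) c2 m])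
qed

lemma slope: "Im (gg (cis (- x))) = deriv \<eta> (x + p x) * Re (gg (cis (- x)))"
  using DERIV_unique[OF boundary_derivs(2)[of x] DERIV_chain2[OF eta_diff[of "x + p x"] boundary_derivs(1)[of x]]] .

text \<open>By the kinematic condition the surface is a streamline of the relative flow, so the
  stream function has zero derivative along the real axis.\<close>

lemma W_real: "Im (W (of_real x)) = 0"
proof -
  let ?X = "x + p x"
  have e: "exp (- \<i> * of_real x) = cis (- x)" by (simp add: cis_conv_exp)
  have z: "Phiz (?X, \<eta> ?X) = deriv \<eta> ?X * (Phix (?X, \<eta> ?X) - c)" using DN[of ?X] kin[of ?X] by (simp add: algebra_simps)
  have "Im (W (of_real x)) = (Phix (?X, \<eta> ?X) - c) * Im (gg (cis (- x))) - Phiz (?X, \<eta> ?X) * Re (gg (cis (- x)))"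
    unfolding W_def V_def e conf_real by simp
  then show ?thesis unfolding slope z by (simp only: mult_ac diff_self)
qed

text \<open>Periodicity is given for the potential; its derivatives inherit it inside the open fluid
  domain, where they are unique.\<close>

lemma V_shift:
  assumes "Im ze < \<eta> (Re ze)" shows "V (ze + of_real (2 * pi)) = V ze"
proof -
  define x z where "x = Re ze" and "z = Im ze"
  have xz: "z < \<eta> x" using assms by (simp add: x_def z_def)
  have xz': "z < \<eta> (x + 2 * pi)" using xz by (simp add: eta_per)
  have cE: "continuous_on UNIV \<eta>" by (rule continuous_at_imp_continuous_on) (use eta_diff in \<open>auto intro: DERIV_isCont\<close>)
  have op: "open {q. snd q < \<eta> (fst q)}"
    by (intro open_Collect_less continuous_on_compose2[OF cE] continuous_intros) auto
  have "((%q. q + (2 * pi, 0)) has_derivative (%h. h)) (at (x, z))" by (auto intro!: derivative_eq_intros)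
  moreover have "(Phi has_derivative (%(h, k). Phix (x + 2 * pi, z) * h + Phiz (x + 2 * pi, z) * k)) (at ((x, z) + (2 * pi, 0)))"
    using der(1)[OF xz'] by simp
  ultimately have "((%q. Phi (q + (2 * pi, 0))) has_derivative (%(h, k). Phix (x + 2 * pi, z) * h + Phiz (x + 2 * pi, z) * k)) (at (x, z))"
    by (rule has_derivative_compose)
  then have "(Phi has_derivative (%(h, k). Phix (x + 2 * pi, z) * h + Phiz (x + 2 * pi, z) * k)) (at (x, z))"
    by (rule has_derivative_transform_within_open[OF _ op]) (use xz phi_per in auto)
  from has_derivative_unique[OF this der(1)[OF xz]]
  have eq: "Phix (x + 2 * pi, z) * h + Phiz (x + 2 * pi, z) * k = Phix (x, z) * h + Phiz (x, z) * k" for h k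
    by (auto simp: fun_eq_iff)
  show ?thesis using eq[of 1 0] eq[of 0 1] by (simp add: V_def x_def z_def)
qed

lemma W_shift: "Im w < 0 ==> W (w + of_real (2 * pi)) = W w"
  unfolding W_def exp_shift conf_shift by (simp only: V_shift[OF conf_fluid(1)])

lemma W_shift_nat: "Im w < 0 ==> W (w + of_real (2 * pi * real n)) = W w"
proof (induction n)
  case (Suc n)
  have "W (w + of_real (2 * pi * real (Suc n))) = W ((w + of_real (2 * pi * real n)) + of_real (2 * pi))" by (simp add: algebra_simps)
  also have "... = W w" using W_shift[of "w + of_real (2 * pi * real n)"] Suc by simp
  finally show ?case .
qed simp

text \<open>At depth only the vertical velocity is controlled. The function exp(\<i> V) has modulus
  exp(Phiz), so Cauchy's inequality on unit discs bounds V'. Since Phi is periodic, Phix vanishes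
  somewhere in each period, and the bound for Phixx carries this over the whole period.\<close>

lemma V_bounded_deep: "\<exists>K M. \<forall>ze. Im ze <= K --> norm (V ze) <= M"
proof -
  have "\<forall>\<^sub>F z in at_bot. \<forall>x\<in>UNIV. dist (Phiz (x, z)) 0 < 1" using decay by (rule uniform_limitD) simp
  then obtain K0 where K0: "!!z x. z <= K0 ==> \<bar>Phiz (x, z)\<bar> < 1" unfolding eventually_at_bot_linorder by auto
  \<comment> \<open>The distance 2 leaves room for unit discs around the points below K, inside the
    fluid and inside the region where Phiz is small.\<close>
  define K where "K = min K0 (- By) - 2"
  have KK: "K + 2 <= K0" by (simp add: K_def)
  have fl: "z < \<eta> x" if "z <= K + 1" for x z using that eta_bound[of x] by (auto simp: K_def)
  have dV: "norm (of_real (Phixx (Re ze, Im ze)) - \<i> * of_real (Phixz (Re ze, Im ze))) <= exp 2" if z: "Im ze <= K" for ze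
  proof -
    let ?D = "of_real (Phixx (Re ze, Im ze)) - \<i> * of_real (Phixz (Re ze, Im ze))"
    let ?E = "%\<xi>. exp (\<i> * V \<xi>)"
    have near: "Im \<xi> <= K + 1" if "\<xi> \<in> cball ze 1" for \<xi>
      using abs_Im_le_cmod[of "ze - \<xi>"] that z by (simp add: dist_norm)
    have dE: "(?E has_field_derivative ?E \<xi> * (\<i> * (of_real (Phixx (Re \<xi>, Im \<xi>)) - \<i> * of_real (Phixz (Re \<xi>, Im \<xi>))))) (at \<xi>)" if "\<xi> \<in> cball ze 1" for \<xi>
      by (rule DERIV_chain2[OF DERIV_exp]) (rule DERIV_cmult[OF V_deriv[OF fl[OF near[OF that]]]])
    have nE: "norm (?E \<xi>) = exp (Phiz (Re \<xi>, Im \<xi>))" for \<xi> by (simp add: V_def)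
    have "norm ((deriv ^^ 1) ?E ze) <= fact 1 * exp 1 / 1 ^ 1"
    proof (rule Cauchy_inequality)
      show "?E holomorphic_on ball ze 1"
        unfolding holomorphic_on_def field_differentiable_def
        by (auto intro!: exI has_field_derivative_at_within[OF dE])
      show "continuous_on (cball ze 1) ?E" by (rule continuous_at_imp_continuous_on) (use dE in \<open>blast intro: DERIV_isCont\<close>)
      fix \<xi> assume "norm (ze - \<xi>) = 1"
      then have "Im \<xi> <= K0" using near[of \<xi>] KK by (simp add: dist_norm)
      then show "norm (?E \<xi>) <= exp 1" unfolding nE using K0[of "Im \<xi>" "Re \<xi>"] by simp
    qed simp
    moreover have "(deriv ^^ 1) ?E ze = ?E ze * (\<i> * ?D)" using DERIV_imp_deriv[OF dE[of ze]] by simp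
    ultimately have "norm (?E ze) * norm ?D <= exp 1" by (simp add: norm_mult)
    moreover have "exp (- 1) <= norm (?E ze)" unfolding nE using K0[of "Im ze" "Re ze"] z KK by simp
    ultimately have "exp (- 1) * norm ?D <= exp 1" by (meson mult_right_mono norm_ge_zero order_trans)
    from mult_left_mono[OF this, of "exp 1"] show ?thesis by (simp add: mult.assoc[symmetric] mult_exp_exp)
  qed
  have x2: "\<bar>Phixx (x, z)\<bar> <= exp 2" if "z <= K" for x z
    using order_trans[OF abs_Re_le_cmod dV[of "Complex x z"]] that by simp
  have bx: "\<bar>Phix (x, z)\<bar> <= 2 * pi * exp 2" if z: "z <= K" for x z
  proof -
    have zf: "z < \<eta> x" for x using fl[of z x] z by simp
    have l: "((%x. (x, z)) has_derivative (%h. (h, 0))) (at x)" for x by (auto intro!: derivative_eq_intros)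
    have d1: "((%x. Phi (x, z)) has_real_derivative Phix (x, z)) (at x)" for x
      using has_derivative_compose[OF l der(1)[OF zf]] by (simp add: has_field_derivative_def)
    have d2: "((%x. Phix (x, z)) has_real_derivative Phixx (x, z)) (at x)" for x
      using has_derivative_compose[OF l der(2)[OF zf]] by (simp add: has_field_derivative_def)
    have lt: "x < x + 2 * pi" by simp
    obtain x0 where x0: "x < x0" "x0 < x + 2 * pi" "Phi (x + 2 * pi, z) - Phi (x, z) = (x + 2 * pi - x) * Phix (x0, z)"
      using MVT2[OF lt, of "%x. Phi (x, z)" "%x. Phix (x, z)"] d1 by blast
    then have 0: "Phix (x0, z) = 0" using phi_per[of z x] zf[of x] by simp
    obtain x1 where "Phix (x0, z) - Phix (x, z) = (x0 - x) * Phixx (x1, z)"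
      using MVT2[OF x0(1), of "%x. Phix (x, z)" "%x. Phixx (x, z)"] d2 by blast
    then have "Phix (x, z) = - ((x0 - x) * Phixx (x1, z))" unfolding 0 by linarith
    then have "\<bar>Phix (x, z)\<bar> = \<bar>x0 - x\<bar> * \<bar>Phixx (x1, z)\<bar>" by (simp only: abs_minus_cancel abs_mult)
    then have "\<bar>Phix (x, z)\<bar> = (x0 - x) * \<bar>Phixx (x1, z)\<bar>" using x0(1) by simp
    also have "... <= 2 * pi * exp 2" using x0 x2[OF z, of x1] by (intro mult_mono) auto
    finally show ?thesis .
  qed
  have "norm (V ze) <= 2 * pi * exp 2 + 1" if "Im ze <= K" for ze
  proof -
    have "norm (V ze) <= \<bar>Phix (Re ze, Im ze)\<bar> + \<bar>Phiz (Re ze, Im ze)\<bar>"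
      unfolding V_def by (rule order_trans[OF norm_triangle_ineq4]) (simp add: norm_mult)
    then show ?thesis using bx[OF that, of "Re ze"] K0[of "Im ze" "Re ze"] that KK by linarith
  qed
  then show ?thesis by blast
qed

text \<open>Deep points are covered by \<open>V_bounded_deep\<close>, one period of a strip by
  compactness, the rest of the strip by periodicity. Translation is available in the open half-plane
  only, so the real axis is reached as a limit.\<close>

lemma W_bounded: "\<exists>M. \<forall>w. Im w <= 0 --> norm (W w) <= M"
proof -
  obtain K M where KM: "!!ze. Im ze <= K ==> norm (V ze) <= M" using V_bounded_deep by blast
  \<comment> \<open>The image sinks at least 3/4 as fast as w, so below -K2 it lies in the deep
    region.\<close>
  define K2 where "K2 = max 0 (4/3 * (By - K))"
  have K2: "4/3 * (By - K) <= K2" by (simp add: K2_def)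
  have gb: "norm (gg (exp (- \<i> * w))) <= 2" if "Im w <= 0" for w
    using gg_near_one[OF norm_exp_lower[OF that]] norm_triangle_ineq2[of "gg (exp (- \<i> * w))" 1] by simp
  have deep: "norm (W w) <= (M + abs c) * 2" if w: "Im w <= - K2" for w
  proof -
    have w0: "Im w <= 0" using w by (simp add: K2_def)
    have "3/4 * Im w <= K - By" using w K2 by simp
    then have "Im (conf w) <= K" using conf_below_top(1)[OF w0] abs_le_D1[OF eta_bound[of "Re w + p (Re w)"]] by linarith
    then have "norm (V (conf w) - of_real c) <= M + abs c" using KM[of "conf w"] norm_triangle_ineq4[of "V (conf w)" "of_real c"] by simp
    then show ?thesis unfolding W_def norm_mult using gb[OF w0] by (intro mult_mono) (auto intro: order_trans[OF norm_ge_zero])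
  qed
  have "compact (cbox (Complex 0 (- K2)) (Complex (2 * pi) 0))" by (rule compact_cbox)
  moreover have "continuous_on (cbox (Complex 0 (- K2)) (Complex (2 * pi) 0)) W"
    by (rule continuous_on_subset[OF W_continuous]) (auto simp: in_cbox_complex_iff)
  ultimately have "bounded (W ` cbox (Complex 0 (- K2)) (Complex (2 * pi) 0))" by (intro compact_imp_bounded compact_continuous_image)
  then obtain M2 where M2: "!!w. w \<in> cbox (Complex 0 (- K2)) (Complex (2 * pi) 0) ==> norm (W w) <= M2" unfolding bounded_iff by blast
  define B where "B = max ((M + abs c) * 2) M2"
  have neg: "norm (W w) <= B" if w: "Im w < 0" for w
  proof (cases "Im w <= - K2")
    case True
    then show ?thesis using deep[OF True] by (simp add: B_def)
  next
    case False
    define n where "n = \<lfloor>Re w / (2 * pi)\<rfloor>"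
    define v where "v = w - of_real (2 * pi * of_int n)"
    have n: "of_int n <= Re w / (2 * pi)" "Re w / (2 * pi) < of_int n + 1" unfolding n_def by linarith+
    have "of_int n * (2 * pi) <= Re w" "Re w < (of_int n + 1) * (2 * pi)"
      using n by (simp_all add: pos_le_divide_eq pos_divide_less_eq)
    then have "v \<in> cbox (Complex 0 (- K2)) (Complex (2 * pi) 0)"
      using w False by (simp add: v_def in_cbox_complex_iff algebra_simps)
    from M2[OF this] have Wv: "norm (W v) <= B" by (simp add: B_def)
    have "W w = W v"
    proof (cases "n >= 0")
      case True
      have "w = v + of_real (2 * pi * real (nat n))" using True by (simp add: v_def)
      then show ?thesis using W_shift_nat[of v "nat n"] w by (simp add: v_def)
    next
      case False
      have "v = w + of_real (2 * pi * real (nat (- n)))" using False by (simp add: v_def)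
      then show ?thesis using W_shift_nat[OF w, of "nat (- n)"] by simp
    qed
    with Wv show ?thesis by simp
  qed
  have "norm (W w) <= B" if w: "Im w <= 0" for w
  proof (rule Lim_norm_ubound[OF trivial_limit_sequentially])
    define r where "r n = inverse (real (Suc n))" for n
    have r: "r n > 0" for n by (simp add: r_def)
    have "r \<longlonglongrightarrow> 0" unfolding r_def by (rule LIMSEQ_inverse_real_of_nat)
    then have "(%n. w - \<i> * of_real (r n)) \<longlonglongrightarrow> w - \<i> * of_real 0" by (intro tendsto_intros)
    then have lim: "(%n. w - \<i> * of_real (r n)) \<longlonglongrightarrow> w" by simp
    have i: "Im (w - \<i> * of_real (r n)) < 0" for n using w r[of n] by simp
    show "(%n. W (w - \<i> * of_real (r n))) \<longlonglongrightarrow> W w"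
      by (rule continuous_on_tendsto_compose[OF W_continuous lim]) (use w less_imp_le[OF i] in \<open>auto intro!: always_eventually\<close>)
    show "\<forall>\<^sub>F n in sequentially. norm (W (w - \<i> * of_real (r n))) <= B"
      by (intro always_eventually allI neg i)
  qed
  then show ?thesis by blast
qed

text \<open>W is real on the real axis, so reflection extends it to a bounded entire function, and
  Liouville applies. The substitution of -w for w moves the domain to the upper half-plane, where
  the reflection principle is stated.\<close>

lemma W_constant: "\<exists>K. \<forall>w. Im w <= 0 --> W w = K"
proof -
  obtain M where M: "!!w. Im w <= 0 ==> norm (W w) <= M" using W_bounded by blast
  let ?g = "%w. W (- w)"
  let ?F = "%z. if 0 <= Im z then ?g z else cnj (?g (cnj z))"
  have "?F holomorphic_on UNIV"
  proof (rule Schwarz_reflection)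
    have "(W \<circ> uminus) holomorphic_on {z. 0 < Im z}"
      by (rule holomorphic_on_compose_gen[OF _ W_holomorphic]) (auto intro: holomorphic_intros)
    then show "?g holomorphic_on UNIV \<inter> {z. 0 < Im z}" by (simp add: o_def)
    have "continuous_on {z. 0 <= Im z} (%w. W (- w))"
      by (rule continuous_on_compose2[OF W_continuous]) (auto intro!: continuous_intros)
    then show "continuous_on (UNIV \<inter> {z. 0 <= Im z}) ?g" by simp
    show "?g z \<in> \<real>" if "z \<in> \<real>" for z
    proof -
      from that obtain x where "z = of_real x" by (auto elim: Reals_cases)
      then show ?thesis using W_real[of "- x"] by (simp add: complex_is_Real_iff)
    qed
  qed auto
  moreover have "bounded (range ?F)"
    unfolding bounded_iff by (rule exI[of _ M]) (auto intro!: M)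
  ultimately have "?F constant_on UNIV" by (rule Liouville_theorem)
  then obtain K where K: "!!z. ?F z = K" by (auto simp: constant_on_def)
  have "W w = K" if "Im w <= 0" for w using K[of "- w"] that by simp
  then show ?thesis by blast
qed

text \<open>Constancy of W makes Phi(conf) - c Re conf affine along horizontal lines. The
  derivatives of Phi are available in the open fluid, so this is shown for z < 0 and carried to the
  surface by continuity. Periodicity of \<psi> and of p then fixes the slope as -c.\<close>

lemma potential_on_surface: "\<psi> (x + p x) = c * p x"
proof -
  obtain K where K: "!!w. Im w <= 0 ==> W w = K" using W_constant by blast
  define P where "P w = Phi (Re (conf w), Im (conf w))" for w
  have level: "P (Complex x z) - Re K * x - c * Re (conf (Complex x z)) = P (Complex 0 z) - c * Re (conf (Complex 0 z))" if z: "z < 0" for x z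
  proof -
    have line: "((%x. conf (Complex x z)) has_vector_derivative gg (exp (- \<i> * Complex x z))) (at x)" for x
    proof -
      have "(conf has_field_derivative gg (exp (- \<i> * (of_real x + Complex 0 z)))) (at (of_real x + Complex 0 z))"
        by (rule conf_deriv) (use z in simp)
      then have "((%w. conf (w + Complex 0 z)) has_field_derivative gg (exp (- \<i> * (of_real x + Complex 0 z)))) (at (of_real x))"
        by (simp add: DERIV_shift)
      then have "((%x. conf (of_real x + Complex 0 z)) has_vector_derivative gg (exp (- \<i> * (of_real x + Complex 0 z)))) (at x)"
        by (rule has_vector_derivative_real_field)
      moreover have "of_real x + Complex 0 z = Complex x z" for x by (simp add: complex_eq_iff)
      ultimately show ?thesis by simp
    qed
    have "((%x. P (Complex x z) - Re K * x - c * Re (conf (Complex x z))) has_real_derivative 0) (at x)" for x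
    proof -
      let ?w = "Complex x z" and ?g = "gg (exp (- \<i> * Complex x z))"
      let ?q = "(Re (conf ?w), Im (conf ?w))"
      have w: "Im ?w < 0" using z by simp
      have "((%x. (Re (conf (Complex x z)), Im (conf (Complex x z)))) has_derivative (%h. (Re (h *\<^sub>R ?g), Im (h *\<^sub>R ?g)))) (at x)"
        using has_derivative_compose[OF line[of x, unfolded has_vector_derivative_def] coord_deriv] .
      from has_derivative_compose[OF this der(1)[OF conf_fluid(1)[OF w]]]
      have "((%x. P (Complex x z)) has_derivative (%h. Phix ?q * Re (h *\<^sub>R ?g) + Phiz ?q * Im (h *\<^sub>R ?g))) (at x)" by (simp add: P_def)
      moreover have "(%h. Phix ?q * Re (h *\<^sub>R ?g) + Phiz ?q * Im (h *\<^sub>R ?g)) = (*) (Phix ?q * Re ?g + Phiz ?q * Im ?g)"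
        by (intro ext) (simp add: algebra_simps)
      ultimately have d1: "((%x. P (Complex x z)) has_real_derivative Phix ?q * Re ?g + Phiz ?q * Im ?g) (at x)" by (simp add: has_field_derivative_def)
      have "Re (W ?w) = (Phix ?q - c) * Re ?g + Phiz ?q * Im ?g" by (simp add: W_def V_def)
      then have RK: "Phix ?q * Re ?g + Phiz ?q * Im ?g = Re K + c * Re ?g" using K[of ?w] w by (simp add: algebra_simps)
      have d2: "((%x. Re (conf (Complex x z))) has_real_derivative Re ?g) (at x)"
        using bounded_linear.has_vector_derivative[OF bounded_linear_Re line[of x]] by (simp add: has_real_derivative_iff_has_vector_derivative)
      have d3: "((%x. Re K * x) has_real_derivative Re K) (at x)" by (auto intro!: derivative_eq_intros)
      show ?thesis
        using DERIV_diff[OF DERIV_diff[OF d1 d3] DERIV_cmult[OF d2, of c]] RK by simp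
    qed
    from DERIV_isconst_all[OF allI[OF this], of x 0] show ?thesis by simp
  qed
  have Pc: "continuous_on {w. Im w <= 0} P"
    unfolding P_def using conf_fluid(2)
    by (intro continuous_on_compose2[OF cont(1)] continuous_intros conf_continuous) auto
  have lim: "((%z. f (Complex x z)) \<longlongrightarrow> f (of_real x)) (at_left 0)" if f: "continuous_on {w. Im w <= 0} f" for f :: "complex => real" and x
  proof (rule continuous_on_tendsto_compose[OF f])
    have "((%z. Complex x z) \<longlongrightarrow> Complex x 0) (at_left 0)" by (intro tendsto_intros)
    then show "((%z. Complex x z) \<longlongrightarrow> of_real x) (at_left 0)" by (simp add: complex_of_real_def)
    show "\<forall>\<^sub>F z in at_left 0. Complex x z \<in> {w. Im w <= 0}" by (simp add: eventually_at_filter)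
  qed simp
  have rc: "continuous_on {w. Im w <= 0} (%w. Re (conf w))" by (intro continuous_intros conf_continuous)
  have main: "P (of_real x) - Re K * x - c * Re (conf (of_real x)) = P (of_real 0) - c * Re (conf (of_real 0))" for x
  proof (rule tendsto_unique)
    show "((%z. P (Complex x z) - Re K * x - c * Re (conf (Complex x z))) \<longlongrightarrow> P (of_real x) - Re K * x - c * Re (conf (of_real x))) (at_left 0)"
      by (intro tendsto_diff tendsto_mult_left tendsto_const lim Pc rc)
    have "((%z. P (Complex 0 z) - c * Re (conf (Complex 0 z))) \<longlongrightarrow> P (of_real 0) - c * Re (conf (of_real 0))) (at_left 0)"
      by (intro tendsto_diff tendsto_mult_left lim Pc rc)
    then show "((%z. P (Complex x z) - Re K * x - c * Re (conf (Complex x z))) \<longlongrightarrow> P (of_real 0) - c * Re (conf (of_real 0))) (at_left 0)"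
      by (rule Lim_transform_eventually) (auto simp: eventually_at_filter level)
  qed simp
  have m: "\<psi> (x + p x) - Re K * x - c * (x + p x) = 0" for x
    using main[of x] zero by (simp add: P_def conf_real surf del: of_real_0)
  have "p (2 * pi) = p 0" using cis_2pi by (simp add: p_eq cis_minus_pi_half minus_cis flip: cis_inverse)
  then have "- Re K * (2 * pi) - c * (2 * pi) = 0" using m[of "2 * pi"] psi_per[of 0] zero by simp
  then have "(Re K + c) * (2 * pi) = 0" by (simp add: algebra_simps)
  then have "Re K = - c" by simp
  then show ?thesis using m[of x] by (simp add: algebra_simps)
qed

text \<open>Differentiating \<psi>(x + p) = c p expresses the derivative s of \<psi> through A, the
  derivative of x + p: s A = c (A - 1). Eliminating s from Bernoulli's law leaves \<eta> and the
  squared modulus of the derivative of the conformal map.\<close>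

lemma bernoulli:
  assumes psi_diff: "!!x. (\<psi> has_real_derivative deriv \<psi> x) (at x)"
    and bern: "!!x. c * deriv \<psi> x - \<eta> x - (deriv \<psi> x)^2 / 2 + (G x + deriv \<eta> x * deriv \<psi> x)^2 / (2 * (1 + (deriv \<eta> x)^2)) = 0"
  shows "(c^2 - 2 * \<eta> (x + p x)) * (cmod (gg (cis (- x))))^2 = c^2"
proof -
  define X A s e y where "X = x + p x" and "A = Re (gg (cis (- x)))" and "s = deriv \<psi> (x + p x)" and "e = deriv \<eta> (x + p x)" and "y = \<eta> (x + p x)"
  have A: "A >= 3/4" unfolding A_def by (rule boundary_derivs)
  have "((%x. (x + p x) - x) has_real_derivative A - 1) (at x)"
    using DERIV_diff[OF boundary_derivs(1)[of x] DERIV_ident] by (simp add: A_def)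
  then have "((%x. c * p x) has_real_derivative c * (A - 1)) (at x)" using DERIV_cmult[of "%x. (x + p x) - x" "A - 1"] by simp
  moreover have "((%x. c * p x) has_real_derivative s * A) (at x)"
    using DERIV_chain2[OF psi_diff[of "x + p x"] boundary_derivs(1)[of x]] unfolding potential_on_surface A_def s_def .
  ultimately have sA: "s * A = c * (A - 1)" using DERIV_unique by blast
  have B: "Im (gg (cis (- x))) = e * A" using slope[of x] by (simp add: e_def A_def)
  have J: "(cmod (gg (cis (- x))))^2 = A^2 * (1 + e^2)" unfolding cmod_power2 B A_def[symmetric] by (simp add: power_mult_distrib algebra_simps)
  have "G X = - c * e" using kin[of X] by (simp add: X_def e_def)
  then have b: "c * s - y - s^2 / 2 + (e * (s - c))^2 / (2 * (1 + e^2)) = 0"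
    using bern[of X] by (simp add: X_def e_def s_def y_def algebra_simps)
  have sc: "(s - c) * A = - c" using sA by (simp add: algebra_simps)
  have e1: "1 + e^2 > 0" by (simp add: add_pos_nonneg)
  have "(2 * (1 + e^2)) * (c * s - y - s^2 / 2) + (e * (s - c))^2 = 0"
    using b e1 by (simp add: field_simps)
  then have "(1 + e^2) * (c^2 - 2 * y) = (s - c)^2" by (simp add: power2_eq_square algebra_simps)
  then have "A^2 * ((1 + e^2) * (c^2 - 2 * y)) = ((s - c) * A)^2" by (simp add: power_mult_distrib mult_ac)
  then show ?thesis unfolding J y_def[symmetric] sc by (simp add: mult_ac)
qed

end

section \<open>Fourier modes of the conformal map\<close>

lemma has_sum_int_split:
  fixes f :: "int => complex"
  assumes "(f has_sum S) UNIV"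
  shows "((%n::nat. if n = 0 then f 0 else f (int n) + f (- int n)) has_sum S) UNIV"
proof -
  have s: "f summable_on A" for A by (rule summable_on_subset_banach[OF has_sum_imp_summable[OF assms]]) simp
  have "UNIV = range int \<union> (%n. - int n) ` {1..}"
  proof safe
    fix k :: int assume "k \<notin> (%n. - int n) ` {1..}"
    then have "k >= 0" by (cases "k < 0") (auto intro: image_eqI[of _ _ "nat (- k)"])
    then show "k \<in> range int" by (auto intro: range_eqI[of _ _ "nat k"])
  qed auto
  moreover have "range int \<inter> (%n. - int n) ` {1..} = {}" by auto
  ultimately have S: "S = infsum f (range int) + infsum f ((%n. - int n) ` {1..})"
    using infsumI[OF assms] infsum_Un_disjoint[OF s s, of "range int" "(%n. - int n) ` {1..}"] by simp
  have 1: "((%n. f (int n)) has_sum infsum f (range int)) UNIV"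
    using has_sum_infsum[OF s[of "range int"]] by (subst (asm) has_sum_reindex) (auto simp: o_def)
  have "inj_on (%n. - int n) {1..}" by (auto simp: inj_on_def)
  then have "((%n. f (- int n)) has_sum infsum f ((%n. - int n) ` {1..})) {1..}"
    using has_sum_infsum[OF s[of "(%n. - int n) ` {1..}"]] by (subst (asm) has_sum_reindex) (auto simp: o_def)
  moreover have "((%n. f (- int n)) has_sum y) {1..} \<longleftrightarrow> ((%n. if n = 0 then 0 else f (- int n)) has_sum y) UNIV" for y
    by (rule has_sum_cong_neutral) auto
  ultimately have 2: "((%n. if n = 0 then 0 else f (- int n)) has_sum infsum f ((%n. - int n) ` {1..})) UNIV" by blast
  have "f (int n) + (if n = 0 then 0 else f (- int n)) = (if n = 0 then f 0 else f (int n) + f (- int n))" for n by simp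
  with has_sum_add[OF 1 2] show ?thesis unfolding S by simp
qed

lemma wiener_reflect:
  assumes "wiener M b u" shows "wiener M (%k. b (- k)) (%x. u (- x))"
proof -
  have bij: "bij_betw uminus (UNIV :: int set) UNIV" by (rule bij_betw_byWitness[of _ uminus]) auto
  have "((%k. b (- k) * cis (of_int (- k) * - x)) has_sum u (- x)) UNIV" for x
    using has_sum_reindex_bij_betw[OF bij, of "%k. b k * cis (of_int k * - x)"] wiener_has_sum[OF assms, of "- x"] by simp
  moreover have "(%k. cmod (b (- k))) summable_on UNIV" "(\<Sum>\<^sub>\<infinity>k. cmod (b (- k))) = (\<Sum>\<^sub>\<infinity>k. cmod (b k))"
    using assms summable_on_reindex_bij_betw[OF bij, of "%k. cmod (b k)"] infsum_reindex_bij_betw[OF bij, of "%k. cmod (b k)"] by (auto simp: wiener_def)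
  ultimately show ?thesis using assms by (simp add: wiener_def)
qed

lemma wiener_cnj:
  assumes "wiener M b u" shows "wiener M (%k. cnj (b (- k))) (%x. cnj (u x))"
proof -
  have "((%k. cnj (b (- k) * cis (of_int k * - x))) has_sum cnj (u x)) UNIV" for x
    using has_sum_bounded_linear[OF bounded_linear_cnj wiener_has_sum[OF wiener_reflect[OF assms], of "- x"]] by simp
  then show ?thesis using wiener_reflect[OF assms] by (simp add: wiener_def cis_cnj)
qed

text \<open>As si |k| is at most exp(si |k|), one derivative is paid for by the width of the
  strip.\<close>

lemma weighted_first_moment:
  fixes b :: "int => complex"
  assumes sig: "si > 0" and s: "(%k. cmod (b k) * ew si k) summable_on UNIV"
  shows "(%k. \<bar>of_int k\<bar> * cmod (b k)) summable_on UNIV" "(\<Sum>\<^sub>\<infinity>k. \<bar>of_int k\<bar> * cmod (b k)) <= (\<Sum>\<^sub>\<infinity>k. cmod (b k) * ew si k) / si"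
proof -
  have t: "\<bar>of_int k\<bar> * cmod (b k) <= cmod (b k) * ew si k / si" for k
  proof -
    have "si * of_int \<bar>k\<bar> <= ew si k" using exp_ge_add_one_self[of "si * of_int \<bar>k\<bar>"] by linarith
    from mult_left_mono[OF this, of "cmod (b k)"] show ?thesis using sig by (simp add: field_simps)
  qed
  have s': "(%k. cmod (b k) * ew si k / si) summable_on UNIV" using summable_on_cmult_left[OF s, of "1 / si"] by simp
  show s1: "(%k. \<bar>of_int k\<bar> * cmod (b k)) summable_on UNIV" by (rule summable_on_comparison_test[OF s']) (use t in auto)
  have "(\<Sum>\<^sub>\<infinity>k. \<bar>of_int k\<bar> * cmod (b k)) <= (\<Sum>\<^sub>\<infinity>k. cmod (b k) * ew si k / si)" by (rule infsum_mono[OF s1 s' t])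
  also have "... = (\<Sum>\<^sub>\<infinity>k. cmod (b k) * ew si k) / si" using infsum_cmult_left'[of "%k. cmod (b k) * ew si k" "1 / si" UNIV] by simp
  finally show "(\<Sum>\<^sub>\<infinity>k. \<bar>of_int k\<bar> * cmod (b k)) <= (\<Sum>\<^sub>\<infinity>k. cmod (b k) * ew si k) / si" .
qed

lemma wiener_real_facts:
  assumes w: "wiener M b (%x. of_real (f x))" and sig: "si > 0"
    and s: "(%k. cmod (b k) * ew si k) summable_on UNIV" and L: "(\<Sum>\<^sub>\<infinity>k. cmod (b k) * ew si k) <= si * L"
  shows "(f has_real_derivative deriv f x) (at x)" "\<bar>f x - f y\<bar> <= L * \<bar>x - y\<bar>" "\<bar>f x\<bar> <= M" "f (x + 2 * pi) = f x"
proof -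
  let ?D = "%x. \<Sum>\<^sub>\<infinity>k. \<i> * of_int k * b k * cis (of_int k * x)"
  note m = weighted_first_moment[OF sig s]
  have "(\<Sum>\<^sub>\<infinity>k. cmod (b k) * ew si k) / si <= L" using L sig by (simp add: pos_divide_le_eq mult.commute)
  then have DL: "norm (?D x) <= L" for x using wiener_derivative_bound[OF m(1), of x] m(2) by linarith
  have d: "(f has_real_derivative Re (?D x)) (at x)" for x
    using bounded_linear.has_vector_derivative[OF bounded_linear_Re wiener_derivative[OF w m(1), of x]]
    by (simp add: has_real_derivative_iff_has_vector_derivative)
  then show "(f has_real_derivative deriv f x) (at x)" using DERIV_imp_deriv by metis
  show "\<bar>f x - f y\<bar> <= L * \<bar>x - y\<bar>"
    using field_differentiable_bound[of UNIV f "%x. Re (?D x)" L x y] d order_trans[OF abs_Re_le_cmod DL] by simp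
  have "norm (complex_of_real (f x)) <= (\<Sum>\<^sub>\<infinity>k. cmod (b k))"
    by (rule norm_infsum_le[OF wiener_has_sum[OF w] has_sum_infsum]) (use w in \<open>auto simp: wiener_def norm_mult\<close>)
  then show "\<bar>f x\<bar> <= M" using w by (simp add: wiener_def)
  have "cis (of_int k * (x + 2 * pi)) = cis (of_int k * x)" for k :: int
    using cis_multiple_2pi[of "of_int k"] by (simp add: distrib_left cis_mult[symmetric] mult_ac)
  then have "complex_of_real (f (x + 2 * pi)) = of_real (f x)"
    using has_sum_unique[OF wiener_has_sum[OF w, of x]] wiener_has_sum[OF w, of "x + 2 * pi"] by simp
  then show "f (x + 2 * pi) = f x" by simp
qed

definition fnorm :: "real => (nat => int => complex) => real => real" where
  "fnorm si a eps = (\<Sum>\<^sub>\<infinity>k. cmod (fmode a eps k) * ew si k)"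

text \<open>The three families may live in strips of different widths. E is a reduced radius on
  which \<eta> has slope at most 1, p stays within the strip of \<eta> (for the composition) and has
  norm at most sip / 8 (for \<open>q_small\<close>), and \<psi> has slope at most 1/4 while c is
  near 1, so that p can be recovered from \<psi>.\<close>

locale stokes =
  fixes e1 E si1 sis sip :: real and \<eta> \<psi> p :: "real => real => real" and c :: "real => real" and aN aS aP :: "nat => int => complex"
  assumes e1: "e1 > 0" and E: "0 < E" "E <= e1" and sig: "si1 > 0" "sis > 0" "sip > 0"
    and sumN: "(%(l, k). cmod (aN l k) * e1 ^ l * ew si1 k) summable_on UNIV"
    and sumS: "(%(l, k). cmod (aS l k) * e1 ^ l * ew sis k) summable_on UNIV"
    and sumP: "(%(l, k). cmod (aP l k) * e1 ^ l * ew sip k) summable_on UNIV"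
    and repN: "!!eps x. eps \<in> cball 0 e1 ==> ((%(l, k). aN l k * of_real (eps ^ l) * cis (of_int k * x)) has_sum of_real (\<eta> eps x)) UNIV"
    and repS: "!!eps x. eps \<in> cball 0 e1 ==> ((%(l, k). aS l k * of_real (eps ^ l) * cis (of_int k * x)) has_sum of_real (\<psi> eps x)) UNIV"
    and repP: "!!eps x. eps \<in> cball 0 e1 ==> ((%(l, k). aP l k * of_real (eps ^ l) * cis (of_int k * x)) has_sum of_real (p eps x)) UNIV"
    and oddS: "!!eps x. eps \<in> cball 0 e1 ==> \<psi> eps (- x) = - \<psi> eps x" and oddP: "!!eps x. eps \<in> cball 0 e1 ==> p eps (- x) = - p eps x"
    and zeroP: "!!x. p 0 x = 0"
    and wave: "!!eps. eps \<in> cball 0 e1 ==> \<exists>G. is_DN (\<eta> eps) (\<psi> eps) G &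
        (\<forall>x. c eps * deriv (\<eta> eps) x + G x = 0 &
             c eps * deriv (\<psi> eps) x - \<eta> eps x - (deriv (\<psi> eps) x)^2 / 2
               + (G x + deriv (\<eta> eps) x * deriv (\<psi> eps) x)^2 / (2 * (1 + (deriv (\<eta> eps) x)^2)) = 0)"
    and sym: "!!eps x. eps \<in> cball 0 e1 ==> \<psi> (- eps) x = \<psi> eps (x + pi) & c (- eps) = c eps"
    and conj: "!!eps k. eps \<in> cball 0 e1 ==> fcoeff (p eps) k = - \<i> * of_int (sgn k) * fcoeff (%x. \<eta> eps (x + p eps x)) k"
    and smallN: "!!eps. abs eps <= E ==> fnorm si1 aN eps <= si1 * 1 & fnorm si1 aN eps <= 1/50"
    and smallS: "!!eps. abs eps <= E ==> fnorm sis aS eps <= sis * (1/4)"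
    and smallP: "!!eps. abs eps <= E ==> fnorm sip aP eps <= si1 & fnorm sip aP eps <= sip / 8"
    and smallC: "!!eps. abs eps <= E ==> \<bar>c eps - 1\<bar> <= 1/100"
begin

lemma Ee: "abs eps <= E ==> \<bar>eps\<bar> <= e1" "abs eps <= E ==> eps \<in> cball 0 e1"
  using E by auto

lemma famN:
  assumes "abs eps <= e1"
  shows "wiener (fnorm si1 aN eps) (fmode aN eps) (%x. of_real (\<eta> eps x))"
    "(%k. cmod (fmode aN eps k) * ew si1 k) summable_on UNIV"
  unfolding fnorm_def
  by (rule fmode_wiener[OF e1 less_imp_le[OF sig(1)] sumN repN assms] fmode_weighted_summable[OF e1 less_imp_le[OF sig(1)] sumN repN assms]; assumption)+

lemma famS:
  assumes "abs eps <= e1"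
  shows "wiener (fnorm sis aS eps) (fmode aS eps) (%x. of_real (\<psi> eps x))"
    "(%k. cmod (fmode aS eps k) * ew sis k) summable_on UNIV"
  unfolding fnorm_def
  by (rule fmode_wiener[OF e1 less_imp_le[OF sig(2)] sumS repS assms] fmode_weighted_summable[OF e1 less_imp_le[OF sig(2)] sumS repS assms]; assumption)+

lemma famP:
  assumes "abs eps <= e1"
  shows "wiener (fnorm sip aP eps) (fmode aP eps) (%x. of_real (p eps x))"
    "(%k. cmod (fmode aP eps k) * ew sip k) summable_on UNIV"
  unfolding fnorm_def
  by (rule fmode_wiener[OF e1 less_imp_le[OF sig(3)] sumP repP assms] fmode_weighted_summable[OF e1 less_imp_le[OF sig(3)] sumP repP assms]; assumption)+

lemma eta_facts:
  assumes "abs eps <= E"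
  shows "(\<eta> eps has_real_derivative deriv (\<eta> eps) x) (at x)" "\<bar>\<eta> eps x - \<eta> eps y\<bar> <= \<bar>x - y\<bar>" "\<bar>\<eta> eps x\<bar> <= 1/50" "\<eta> eps (x + 2 * pi) = \<eta> eps x"
proof -
  have "fnorm si1 aN eps <= si1 * 1" "fnorm si1 aN eps <= 1/50" using smallN[OF assms] by auto
  note f = wiener_real_facts[OF famN(1)[OF Ee(1)[OF assms]] sig(1) famN(2)[OF Ee(1)[OF assms]] this(1)[unfolded fnorm_def]] this(2)
  show "(\<eta> eps has_real_derivative deriv (\<eta> eps) x) (at x)" "\<eta> eps (x + 2 * pi) = \<eta> eps x" by (fact f)+
  show "\<bar>\<eta> eps x - \<eta> eps y\<bar> <= \<bar>x - y\<bar>" using f(2)[of x y] by simp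
  show "\<bar>\<eta> eps x\<bar> <= 1/50" using f(3)[of x] f(5) by linarith
qed

lemma psi_facts:
  assumes "abs eps <= E"
  shows "(\<psi> eps has_real_derivative deriv (\<psi> eps) x) (at x)" "\<bar>\<psi> eps x - \<psi> eps y\<bar> <= 1/4 * \<bar>x - y\<bar>" "\<psi> eps (x + 2 * pi) = \<psi> eps x"
  using wiener_real_facts[OF famS(1)[OF Ee(1)[OF assms]] sig(2) famS(2)[OF Ee(1)[OF assms]], of "1/4", folded fnorm_def] smallS[OF assms]
  by auto

abbreviation "P \<equiv> fmode aP"

lemma P_fcoeff: "abs eps <= e1 ==> fcoeff (p eps) k = P eps k"
  by (rule wiener_fcoeff[OF famP(1)])

text \<open>Reality of p gives conjugate symmetry of the coefficients and oddness gives
  antisymmetry; together they are purely imaginary.\<close>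

lemma P_sym:
  assumes "abs eps <= e1"
  shows "P eps (- k) = - P eps k" "P eps k = \<i> * of_real (Im (P eps k))" "P eps 0 = 0"
proof -
  note w = famP(1)[OF assms]
  have 1: "P eps (- k) = - P eps k" for k
  proof -
    have "wiener (cmod (- 1) * fnorm sip aP eps) (%k. (- 1) * P eps (- k)) (%x. (- 1) * of_real (p eps (- x)))"
      by (rule wiener_cmult[OF wiener_reflect[OF w]])
    then have "wiener (fnorm sip aP eps) (%k. - P eps (- k)) (%x. of_real (p eps x))" using oddP[of eps] assms by simp
    from wiener_fcoeff[OF this, of k] show ?thesis using P_fcoeff[OF assms, of k] by simp
  qed
  then show "P eps (- k) = - P eps k" .
  have "cnj (P eps (- k)) = P eps k"
    using wiener_fcoeff[of _ "%k. cnj (P eps (- k))" "p eps" k] wiener_cnj[OF w] P_fcoeff[OF assms, of k] by simp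
  then have "- cnj (P eps k) = P eps k" unfolding 1 by simp
  then have "cnj (P eps k) = - P eps k" by (metis minus_minus)
  then show "P eps k = \<i> * of_real (Im (P eps k))" by (simp add: complex_eq_iff)
  show "P eps 0 = 0" using 1[of 0] by (simp add: equal_neg_zero)
qed

text \<open>Normalised so that q n is the n-th coefficient of the derivative of the conformal map;
  the value 1 at n = 0 is the derivative of the identity part.\<close>

definition q :: "real => nat => real" where
  "q eps n = (if n = 0 then 1 else 2 * n * Im (P eps (- int n)))"

lemma P_q:
  assumes "abs eps <= e1" "n > 0"
  shows "P eps (- int n) = \<i> * of_real (q eps n / (2 * n))" "P eps (int n) = - (\<i> * of_real (q eps n / (2 * n)))"
proof -
  show 1: "P eps (- int n) = \<i> * of_real (q eps n / (2 * n))" using P_sym(2)[OF assms(1), of "- int n"] assms(2) by (simp add: q_def)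
  show "P eps (int n) = - (\<i> * of_real (q eps n / (2 * n)))" using P_sym(1)[OF assms(1), of "int n"] 1 by simp
qed

lemma q_bound: "abs eps <= e1 ==> n > 0 ==> \<bar>q eps n\<bar> = 2 * n * cmod (P eps (- int n))"
  by (subst P_q) (auto simp: norm_mult abs_mult norm_divide)

text \<open>The factor 2 n in the definition of \<open>q\<close> is paid for by halving the strip,
  whence the radius exp(sip / 2) later on.\<close>

lemma index_le_exp: "2 * real n * exp (sip / 2 * n) <= 4 / sip * exp (sip * n)"
proof -
  have "sip / 2 * n <= exp (sip / 2 * n)" using exp_ge_add_one_self[of "sip / 2 * n"] by linarith
  then have "2 * real n * exp (sip / 2 * n) <= 4 / sip * exp (sip / 2 * n) * exp (sip / 2 * n)"
    using sig(3) by (intro mult_right_mono) (auto simp: field_simps)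
  then show ?thesis by (simp add: mult.assoc mult_exp_exp)
qed

lemma q_summable:
  assumes eps: "abs eps <= E" shows "summable (%n. \<bar>q eps n\<bar> * exp (sip / 2) ^ n)" "(\<Sum>n. \<bar>q eps (Suc n)\<bar>) <= 1/4"
proof -
  note e = Ee(1)[OF eps]
  have inj: "inj (%n::nat. - int n)" "inj (%n::nat. - int (Suc n))" by (auto simp: inj_def)
  have "(%k. cmod (P eps k) * ew sip k) summable_on range (%n::nat. - int n)" by (rule summable_on_subset_banach[OF famP(2)[OF e]]) simp
  then have s: "summable (%n. cmod (P eps (- int n)) * exp (sip * n))"
    by (subst (asm) summable_on_reindex[OF inj(1)]) (auto simp: o_def dest: summable_on_imp_summable)
  show "summable (%n. \<bar>q eps n\<bar> * exp (sip / 2) ^ n)"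
  proof (rule summable_comparison_test'[OF summable_mult[OF s, of "4 / sip"], of 1])
    fix n :: nat assume "n >= 1"
    show "norm (\<bar>q eps n\<bar> * exp (sip / 2) ^ n) <= 4 / sip * (cmod (P eps (- int n)) * exp (sip * n))"
      using \<open>n >= 1\<close> mult_left_mono[OF index_le_exp[of n], of "cmod (P eps (- int n))"]
      by (simp add: q_bound[OF e] exp_of_nat_mult[symmetric] mult_ac)
  qed
  note m = weighted_first_moment[OF sig(3) famP(2)[OF e]]
  have t: "\<bar>q eps (Suc n)\<bar> / 2 = \<bar>of_int (- int (Suc n))\<bar> * cmod (P eps (- int (Suc n)))" for n
    by (simp add: q_bound[OF e] del: of_nat_Suc)
  have s2: "(%k. \<bar>of_int k\<bar> * cmod (P eps k)) summable_on range (%n::nat. - int (Suc n))" by (rule summable_on_subset_banach[OF m(1)]) simp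
  then have s3: "(%n. \<bar>q eps (Suc n)\<bar> / 2) summable_on UNIV"
    unfolding summable_on_reindex[OF inj(2)] o_def t .
  have "(\<Sum>n. \<bar>q eps (Suc n)\<bar> / 2) = (\<Sum>\<^sub>\<infinity>n. \<bar>q eps (Suc n)\<bar> / 2)"
    using sums_unique[OF has_sum_imp_sums[OF has_sum_infsum[OF s3]]] by simp
  also have "... = (\<Sum>\<^sub>\<infinity>k\<in>range (%n::nat. - int (Suc n)). \<bar>of_int k\<bar> * cmod (P eps k))"
    unfolding infsum_reindex[OF inj(2)] o_def t ..
  also have "... <= (\<Sum>\<^sub>\<infinity>k. \<bar>of_int k\<bar> * cmod (P eps k))" by (rule infsum_mono_neutral[OF s2 m(1)]) auto
  also have "... <= fnorm sip aP eps / sip" unfolding fnorm_def by (rule m(2))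
  also have "... <= 1/8" using smallP[OF eps] sig(3) by (simp add: pos_divide_le_eq)
  finally have "(\<Sum>n. \<bar>q eps (Suc n)\<bar> / 2) <= 1/8" .
  moreover have "(\<Sum>n. \<bar>q eps (Suc n)\<bar> / 2) = (\<Sum>n. \<bar>q eps (Suc n)\<bar>) / 2"
    using summable_on_cmult_right[OF s3, of 2] by (intro suminf_divide summable_on_imp_summable) simp
  ultimately show "(\<Sum>n. \<bar>q eps (Suc n)\<bar>) <= 1/4" by simp
qed

lemma q_series:
  fixes ze :: complex
  assumes eps: "abs eps <= E" and z: "norm ze <= 1"
  shows "((%n. of_real (q eps n / n) * ze ^ n) has_sum (\<Sum>n. of_real (q eps n / n) * ze ^ n)) UNIV"
proof (rule norm_summable_imp_has_sum)
  show s: "summable (%n. norm (of_real (q eps n / n) * ze ^ n))"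
  proof (rule summable_comparison_test'[OF q_summable(1)[OF eps], of 1])
    fix n :: nat assume n: "n >= 1"
    have "norm (of_real (q eps n / n) * ze ^ n) = \<bar>q eps n\<bar> / n * norm ze ^ n" by (simp add: norm_mult norm_power norm_divide)
    also have "... <= \<bar>q eps n\<bar> * exp (sip / 2) ^ n"
      using n z sig by (intro mult_mono order_trans[OF power_le_one one_le_power]) (auto simp: divide_le_eq mult_le_cancel_left1)
    finally show "norm (norm (of_real (q eps n / n) * ze ^ n)) <= \<bar>q eps n\<bar> * exp (sip / 2) ^ n" by simp
  qed
  show "(%n. of_real (q eps n / n) * ze ^ n) sums (\<Sum>n. of_real (q eps n / n) * ze ^ n)"
    by (rule summable_sums[OF summable_norm_cancel[OF s]])
qed

text \<open>The modes n and -n combine to the imaginary part of one analytic series. \<rho> = 1 is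
  the surface, and \<rho> = exp z the level z of the flattened domain.\<close>

lemma P_series:
  assumes eps: "abs eps <= E" and \<rho>: "0 <= \<rho>" "\<rho> <= 1"
  shows "((%k. P eps k * of_real (\<rho> ^ nat \<bar>k\<bar>) * cis (of_int k * x)) has_sum
     of_real (- Im (\<Sum>n. of_real (q eps n / n) * (of_real \<rho> * cis (- x)) ^ n))) UNIV"
proof -
  note e = Ee(1)[OF eps]
  let ?f = "%k. P eps k * of_real (\<rho> ^ nat \<bar>k\<bar>) * cis (of_int k * x)"
  have "(%k. norm (?f k)) summable_on UNIV"
  proof (rule summable_on_comparison_test)
    show "(%k. cmod (P eps k)) summable_on UNIV" using famP(1)[OF e] by (simp add: wiener_def)
    show "norm (?f k) <= cmod (P eps k)" for k
      using mult_left_mono[OF power_le_one[OF \<rho>, of "nat \<bar>k\<bar>"], of "cmod (P eps k)"] \<rho> by (simp add: norm_mult norm_power)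
  qed simp
  then have s: "?f summable_on UNIV" by (rule abs_summable_summable)
  note h1 = has_sum_int_split[OF has_sum_infsum[OF s]]
  have "norm (of_real \<rho> * cis (- x)) <= 1" using \<rho> by (simp add: norm_mult)
  from has_sum_Im[OF q_series[OF eps this]]
  have "((%n. Im (of_real (q eps n / n) * (of_real \<rho> * cis (- x)) ^ n)) has_sum Im (\<Sum>n. of_real (q eps n / n) * (of_real \<rho> * cis (- x)) ^ n)) UNIV" .
  then have h2: "((%n. complex_of_real (- Im (of_real (q eps n / n) * (of_real \<rho> * cis (- x)) ^ n))) has_sum complex_of_real (- Im (\<Sum>n. of_real (q eps n / n) * (of_real \<rho> * cis (- x)) ^ n))) UNIV"
    by (intro has_sum_of_real) (use has_sum_cmult_right[of _ _ _ "- 1 :: real"] in fastforce)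
  have t: "(if n = 0 then ?f 0 else ?f (int n) + ?f (- int n)) = of_real (- Im (of_real (q eps n / n) * (of_real \<rho> * cis (- x)) ^ n))" for n
  proof (cases "n = 0")
    case True
    then show ?thesis by (simp add: P_sym(3)[OF e])
  next
    case False
    have pw: "(of_real \<rho> * cis (- x)) ^ n = of_real (\<rho> ^ n) * cis (- (n * x))" unfolding power_mult_distrib Complex.DeMoivre by simp
    show ?thesis unfolding pw using False by (simp add: P_q[OF e] complex_eq_iff field_simps del: of_real_power)
  qed
  have "infsum ?f UNIV = of_real (- Im (\<Sum>n. of_real (q eps n / n) * (of_real \<rho> * cis (- x)) ^ n))"
    using has_sum_unique[OF h1[unfolded t] h2] .
  then show ?thesis using has_sum_infsum[OF s] by simp
qed

definition Y where "Y eps k = fcoeff (%x. \<eta> eps (x + p eps x)) k"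

lemma Y_wiener:
  assumes eps: "abs eps <= E" shows "wiener (1/50) (Y eps) (%x. of_real (\<eta> eps (x + p eps x)))"
proof -
  note e = Ee(1)[OF eps]
  have "wiener si1 (P eps) (%x. of_real (p eps x))" by (rule wiener_mono[OF famP(1)[OF e]]) (use smallP[OF eps] in simp)
  from wiener_compose[OF wiener_has_sum[OF famN(1)[OF e]] famN(2)[OF e] this]
  obtain b where b: "wiener (fnorm si1 aN eps) b (%x. of_real (\<eta> eps (x + p eps x)))" unfolding fnorm_def by blast
  have "b = Y eps" by (rule ext) (simp add: Y_def wiener_fcoeff[OF b])
  then show ?thesis using wiener_mono[OF b] smallN[OF eps] by simp
qed

text \<open>The conjugation equation ties the modes of the surface elevation to those of p, so that
  a single real sequence q describes both.\<close>

lemma Y_q: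
  assumes eps: "abs eps <= E" and n: "n > 0"
  shows "Y eps (int n) = of_real (q eps n / (2 * n))" "Y eps (- int n) = of_real (q eps n / (2 * n))"
proof -
  have c: "P eps k = - \<i> * of_int (sgn k) * Y eps k" for k using conj[OF Ee(2)[OF eps], of k] P_fcoeff[OF Ee(1)[OF eps], of k] by (simp add: Y_def)
  show "Y eps (int n) = of_real (q eps n / (2 * n))" using c[of "int n"] P_q(2)[OF Ee(1)[OF eps] n] n by (simp add: complex_eq_iff)
  show "Y eps (- int n) = of_real (q eps n / (2 * n))" using c[of "- int n"] P_q(1)[OF Ee(1)[OF eps] n] n by (simp add: complex_eq_iff)
qed

lemma Y_series:
  assumes eps: "abs eps <= E"
  shows "\<eta> eps (x + p eps x) = Re (Y eps 0) + Re (\<Sum>n. of_real (q eps n / n) * cis (- x) ^ n)" "Im (Y eps 0) = 0"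
proof -
  have h1: "((%n. if n = 0 then Y eps 0 else Y eps (int n) * cis (n * x) + Y eps (- int n) * cis (- (n * x))) has_sum of_real (\<eta> eps (x + p eps x))) UNIV" for x
    using has_sum_int_split[OF wiener_has_sum[OF Y_wiener[OF eps], of x]] by (simp cong: if_cong)
  have h2: "((%n. complex_of_real (Re (of_real (q eps n / n) * cis (- x) ^ n))) has_sum complex_of_real (Re (\<Sum>n. of_real (q eps n / n) * cis (- x) ^ n))) UNIV" for x
    by (intro has_sum_of_real has_sum_Re q_series[OF eps]) simp
  have h3: "((%n. if n = 0 then Y eps 0 else 0) has_sum Y eps 0) (UNIV :: nat set)" by (rule has_sum_finite_neutralI[of "{0}"]) auto
  have t: "(if n = 0 then Y eps 0 else 0) + of_real (Re (of_real (q eps n / n) * cis (- x) ^ n)) = (if n = 0 then Y eps 0 else Y eps (int n) * cis (n * x) + Y eps (- int n) * cis (- (n * x)))" for n x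
  proof (cases "n = 0")
    case False
    have "cis (- x) ^ n = cis (- (n * x))" unfolding Complex.DeMoivre by simp
    then show ?thesis using False by (simp add: Y_q[OF eps] complex_eq_iff field_simps)
  qed simp
  have eq: "of_real (\<eta> eps (x + p eps x)) = Y eps 0 + of_real (Re (\<Sum>n. of_real (q eps n / n) * cis (- x) ^ n))" for x
    using has_sum_unique[OF h1 has_sum_add[OF h3 h2, unfolded t]] .
  show "\<eta> eps (x + p eps x) = Re (Y eps 0) + Re (\<Sum>n. of_real (q eps n / n) * cis (- x) ^ n)"
    using arg_cong[OF eq[of x], of Re] by simp
  show "Im (Y eps 0) = 0" using arg_cong[OF eq[of 0], of Im] by simp
qed

lemma conformal:
  assumes eps: "abs eps <= E" shows "conformal_wave (q eps) (exp (sip / 2)) (Re (Y eps 0)) (\<eta> eps) (p eps)"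
proof
  show "p eps x = - Im (\<Sum>n. of_real (q eps n / n) * cis (- x) ^ n)" for x
  proof -
    have "((%k. P eps k * cis (of_int k * x)) has_sum of_real (- Im (\<Sum>n. of_real (q eps n / n) * cis (- x) ^ n))) UNIV"
      using P_series[OF eps, of 1 x] by simp
    from has_sum_unique[OF wiener_has_sum[OF famP(1)[OF Ee(1)[OF eps]]] this] show ?thesis by (simp only: of_real_eq_iff)
  qed
qed (use q_summable[OF eps] Y_series[OF eps] eta_facts(2)[OF eps] sig in \<open>auto simp: q_def\<close>)

lemma wave_facts:
  assumes eps: "abs eps <= E"
  shows "\<psi> eps (x + p eps x) = c eps * p eps x"
    "((c eps)^2 - 2 * \<eta> eps (x + p eps x)) * (cmod (\<Sum>n. of_real (q eps n) * cis (- x) ^ n))^2 = (c eps)^2"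
proof -
  note ce = Ee(2)[OF eps]
  interpret conformal_wave "q eps" "exp (sip / 2)" "Re (Y eps 0)" "\<eta> eps" "p eps" by (rule conformal[OF eps])
  obtain G where G: "is_DN (\<eta> eps) (\<psi> eps) G"
    and eqs: "!!x. c eps * deriv (\<eta> eps) x + G x = 0"
      "!!x. c eps * deriv (\<psi> eps) x - \<eta> eps x - (deriv (\<psi> eps) x)^2 / 2 + (G x + deriv (\<eta> eps) x * deriv (\<psi> eps) x)^2 / (2 * (1 + (deriv (\<eta> eps) x)^2)) = 0"
    using wave[OF ce] by blast
  obtain Phi Phix Phiz Phixx Phixz Phizz where D:
        "continuous_on {(x, z). z <= \<eta> eps x} Phi" "continuous_on {(x, z). z <= \<eta> eps x} Phix" "continuous_on {(x, z). z <= \<eta> eps x} Phiz"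
        "\<forall>q\<in>{(x, z). z < \<eta> eps x}.
           (Phi has_derivative (%(h, k). Phix q * h + Phiz q * k)) (at q) &
           (Phix has_derivative (%(h, k). Phixx q * h + Phixz q * k)) (at q) &
           (Phiz has_derivative (%(h, k). Phixz q * h + Phizz q * k)) (at q) &
           Phixx q + Phizz q = 0"
        "\<forall>x z. z <= \<eta> eps x --> Phi (x + 2 * pi, z) = Phi (x, z)"
        "\<forall>x. Phi (x, \<eta> eps x) = \<psi> eps x"
        "uniform_limit UNIV (%z x. Phiz (x, z)) (%_. 0) at_bot"
        "\<forall>x. G x = Phiz (x, \<eta> eps x) - deriv (\<eta> eps) x * Phix (x, \<eta> eps x)"
    using G unfolding is_DN_def by (elim exE conjE)
  interpret fluid_wave "q eps" "exp (sip / 2)" "Re (Y eps 0)" "\<eta> eps" "p eps" "c eps" "1/50" "\<psi> eps" G Phi Phix Phiz Phixx Phixz Phizz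
  proof
    show "\<psi> eps 0 = 0" using oddS[OF ce, of 0] by simp
    show "p eps 0 = 0" using oddP[OF ce, of 0] by simp
    show "(\<eta> eps has_real_derivative deriv (\<eta> eps) x) (at x)" "\<bar>\<eta> eps x\<bar> <= 1/50" "\<eta> eps (x + 2 * pi) = \<eta> eps x" "\<psi> eps (x + 2 * pi) = \<psi> eps x" for x
      by (fact eta_facts[OF eps] psi_facts(3)[OF eps])+
    fix x z assume z: "z < \<eta> eps x"
    then have m: "(x, z) \<in> {(x, z). z < \<eta> eps x}" by simp
    note D4 = D(4)[THEN bspec, OF m]
    show "(Phi has_derivative (%(h, k). Phix (x, z) * h + Phiz (x, z) * k)) (at (x, z))" by (rule D4[THEN conjunct1])
    show "(Phix has_derivative (%(h, k). Phixx (x, z) * h + Phixz (x, z) * k)) (at (x, z))" by (rule D4[THEN conjunct2, THEN conjunct1])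
    show "(Phiz has_derivative (%(h, k). Phixz (x, z) * h + Phizz (x, z) * k)) (at (x, z))" by (rule D4[THEN conjunct2, THEN conjunct2, THEN conjunct1])
    show "Phixx (x, z) + Phizz (x, z) = 0" by (rule D4[THEN conjunct2, THEN conjunct2, THEN conjunct2])
  next
    show "Phi (x + 2 * pi, z) = Phi (x, z)" if "z <= \<eta> eps x" for x z by (rule D(5)[rule_format, OF that])
    show "Phi (x, \<eta> eps x) = \<psi> eps x" for x by (rule D(6)[rule_format])
    show "G x = Phiz (x, \<eta> eps x) - deriv (\<eta> eps) x * Phix (x, \<eta> eps x)" for x by (rule D(8)[rule_format])
  qed (fact D(1) D(2) D(3) D(7) eqs(1))+
  show "\<psi> eps (x + p eps x) = c eps * p eps x" by (rule potential_on_surface)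
  show "((c eps)^2 - 2 * \<eta> eps (x + p eps x)) * (cmod (\<Sum>n. of_real (q eps n) * cis (- x) ^ n))^2 = (c eps)^2"
    using bernoulli[OF psi_facts(1)[OF eps] eqs(2)] by (simp add: gg_def)
qed

text \<open>\<open>flat_U\<close> is the real part of \<open>conf\<close>, so the sum of the squared
  partial derivatives is the squared modulus of the derivative by the Cauchy-Riemann equations. At z
  = 0 the one-sided derivative agrees because \<open>conf\<close> is holomorphic there.\<close>

lemma flat_d_eq:
  assumes eps: "abs eps <= E" and z: "z <= 0"
  shows "1 + flat_d (p eps) x z = (cmod (\<Sum>n. of_real (q eps n) * (of_real (exp z) * cis (- x)) ^ n))^2"
proof -
  interpret conformal_wave "q eps" "exp (sip / 2)" "Re (Y eps 0)" "\<eta> eps" "p eps" by (rule conformal[OF eps])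
  have ex: "exp (- \<i> * Complex x z) = of_real (exp z) * cis (- x)" for x z
    by (simp add: complex_eq_iff Re_exp Im_exp)
  have U: "flat_U (p eps) x z = Re (conf (Complex x z))" if z: "z <= 0" for x z
  proof -
    have "((%k. P eps k * of_real (exp z ^ nat \<bar>k\<bar>) * cis (of_int k * x)) has_sum of_real (- Im (hh (of_real (exp z) * cis (- x))))) UNIV"
      unfolding hh_def by (rule P_series[OF eps]) (use z in auto)
    moreover have "((%k. P eps k * of_real (exp z ^ nat \<bar>k\<bar>) * cis (of_int k * x)) has_sum y) UNIV \<longleftrightarrow>
        ((%k. P eps k * of_real (exp z ^ nat \<bar>k\<bar>) * cis (of_int k * x)) has_sum y) (UNIV - {0})" for y
      by (rule has_sum_cong_neutral) (auto simp: P_sym(3)[OF Ee(1)[OF eps]])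
    moreover have "exp z ^ nat \<bar>k\<bar> = exp (of_int \<bar>k\<bar> * z)" for k :: int by (simp flip: exp_of_nat_mult)
    ultimately have "(\<Sum>\<^sub>\<infinity>k\<in>UNIV - {0}. fcoeff (p eps) k * of_real (exp (of_int \<bar>k\<bar> * z)) * cis (of_int k * x)) = of_real (- Im (hh (of_real (exp z) * cis (- x))))"
      by (simp add: P_fcoeff[OF Ee(1)[OF eps]] infsumI)
    then show ?thesis unfolding flat_U_def conf_def ex by simp
  qed
  let ?g = "gg (exp (- \<i> * Complex x z))"
  have "((%y. conf (Complex x z + v * of_real (y - a))) has_vector_derivative ?g * v) (at a)" for a :: real and v
  proof -
    have "((%y. conf (Complex x z + v * (y - of_real a))) has_field_derivative ?g * v) (at (of_real a))"
      by (rule DERIV_chain2[where f=conf]) (use conf_deriv[of "Complex x z"] z in \<open>auto intro!: derivative_eq_intros\<close>)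
    from has_vector_derivative_real_field[OF this] show ?thesis by simp
  qed
  note line = this[THEN bounded_linear.has_vector_derivative[OF bounded_linear_Re]]
  have "((%y. Re (conf (Complex y z))) has_vector_derivative Re ?g) (at x)"
    using line[of 1 x] by (simp add: complex_of_real_def plus_complex.code)
  then have dx: "((%y. flat_U (p eps) y z) has_real_derivative Re ?g) (at x)"
    by (simp add: U[OF z] has_real_derivative_iff_has_vector_derivative)
  have "((%y. Re (conf (Complex x y))) has_vector_derivative - Im ?g) (at z within {..0})"
    using line[of \<i> z] by (simp add: complex_of_real_def plus_complex.code times_complex.code imaginary_unit.code has_vector_derivative_at_within)
  then have "((%y. flat_U (p eps) x y) has_vector_derivative - Im ?g) (at z within {..0})"
    by (rule has_vector_derivative_transform[rotated 2]) (use z U in auto)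
  moreover have "at z within {..0} ~= bot"
    unfolding trivial_limit_within not_not by (rule islimpt_subset[OF islimpt_greaterThanLessThan2[of "z - 1" z]]) (use z in auto)
  ultimately have dz: "vector_derivative (%y. flat_U (p eps) x y) (at z within {..0}) = - Im ?g"
    by (intro vector_derivative_within)
  show ?thesis
    unfolding flat_d_def DERIV_imp_deriv[OF dx] dz unfolding gg_def ex by (simp add: cmod_power2)
qed

end

lemma has_sum_fibers:
  fixes f :: "'x => 'a::banach"
  assumes "(f has_sum S) A"
  shows "((%k. \<Sum>\<^sub>\<infinity>x\<in>{x \<in> A. \<phi> x = k}. f x) has_sum S) UNIV"
proof -
  have s: "f summable_on {x \<in> A. \<phi> x = k}" for k by (rule summable_on_subset_banach[OF has_sum_imp_summable[OF assms]]) auto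
  have "((%(k, x). f x) has_sum S) (SIGMA k:UNIV. {x \<in> A. \<phi> x = k})"
    using has_sum_reindex_bij_witness[of A "snd" "%x. (\<phi> x, x)" "SIGMA k:UNIV. {x \<in> A. \<phi> x = k}" "%(k, x). f x" f S S] assms by auto
  from has_sum_SigmaD[OF this] show ?thesis using s by (simp add: has_sum_infsum)
qed

text \<open>The quotient f x / x^l tends to a l, as all lower coefficients vanish by induction, and
  to 0, as f is of higher order.\<close>

lemma powser_order:
  fixes a :: "nat => real"
  assumes s: "!!x. abs x < r ==> (%n. a n * x ^ n) sums f x" and r: "r > 0"
    and le: "!!x. abs x < r ==> \<bar>f x\<bar> <= M * abs x ^ k" and l: "l < k"
  shows "a l = 0"
  using l
proof (induction l rule: less_induct)
  case (less l)
  have "(%n. a (n + l) * x ^ n) sums (f x / x ^ l)" if "x ~= 0" "norm x < r" for x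
  proof -
    have "(%n. a (n + l) * x ^ (n + l)) sums (f x - (\<Sum>n<l. a n * x ^ n))"
      using sums_split_initial_segment[OF s, of x l] that by simp
    moreover have "(\<Sum>n<l. a n * x ^ n) = 0" using less by (intro sum.neutral) auto
    ultimately show ?thesis using sums_divide[of "%n. a (n + l) * x ^ (n + l)" "f x" "x ^ l"] that by (simp add: power_add)
  qed
  from powser_limit_0_strong[OF r this] have "(%x. f x / x ^ l) \<midarrow>0\<rightarrow> a l" by simp
  moreover have "(%x. f x / x ^ l) \<midarrow>0\<rightarrow> 0"
  proof (rule Lim_null_comparison)
    show "\<forall>\<^sub>F x in at 0. norm (f x / x ^ l) <= M * abs x ^ (k - l)"
      unfolding eventually_at
    proof (intro exI[of _ r] conjI ballI impI r)
      fix x :: real assume x: "x ~= 0 & dist x 0 < r"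
      have "abs x ^ k = abs x ^ (k - l) * abs x ^ l" using less.prems by (simp add: power_add[symmetric])
      then show "norm (f x / x ^ l) <= M * abs x ^ (k - l)" using le[of x] x by (simp add: divide_le_eq power_abs)
    qed
    show "((%x. M * abs x ^ (k - l)) \<longlongrightarrow> 0) (at 0)" using less.prems by (auto intro!: tendsto_eq_intros)
  qed
  ultimately show ?case by (rule LIM_unique)
qed

lemma wiener_add:
  assumes "wiener M a u" "wiener N b v" shows "wiener (M + N) (%k. a k + b k) (%x. u x + v x)"
proof (rule wienerI)
  show "(%k. cmod (a k) + cmod (b k)) summable_on UNIV" "(\<Sum>\<^sub>\<infinity>k. cmod (a k) + cmod (b k)) <= M + N"
    using assms by (auto simp: wiener_def infsum_add intro: summable_on_add)
  show "((%k. (a k + b k) * cis (of_int k * x)) has_sum u x + v x) UNIV" for x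
    using has_sum_add[OF wiener_has_sum[OF assms(1)] wiener_has_sum[OF assms(2)]] by (simp add: distrib_right)
qed (rule norm_triangle_ineq)

lemma wiener_conv_summable:
  assumes "wiener M a u" "wiener N b v" shows "(%j. a j * b (k - j)) summable_on UNIV"
proof (rule abs_summable_summable, rule summable_on_comparison_test)
  show "(%j. cmod (a j) * (\<Sum>\<^sub>\<infinity>k. cmod (b k))) summable_on UNIV"
    using assms(1) by (intro summable_on_cmult_left) (simp add: wiener_def)
  show "cmod (a j * b (k - j)) <= cmod (a j) * (\<Sum>\<^sub>\<infinity>k. cmod (b k))" for j
    using finite_sum_le_infsum[of "%k. cmod (b k)" UNIV "{k - j}"] assms(2) by (auto simp: wiener_def norm_mult intro!: mult_left_mono)
qed simp

section \<open>Support and parity of the Taylor coefficients of the conformal map\<close>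

context stokes
begin

text \<open>The Taylor coefficient of order l in eps of q n.\<close>

definition cf :: "nat => nat => real" where
  "cf l n = (if n = 0 then of_bool (l = 0) else 2 * n * Im (aP l (- int n)))"

lemma cf_zero: "n > 0 ==> cf 0 n = 0"
  using fam_zero_coeff[OF e1 less_imp_le[OF sig(3)] sumP repP zeroP] by (simp add: cf_def)

lemma q_has_sum:
  assumes "abs eps <= e1" shows "((%l. cf l n * eps ^ l) has_sum q eps n) UNIV"
proof (cases "n = 0")
  case True
  then show ?thesis using has_sum_finite_neutralI[of "{0}" UNIV "%l. cf l n * eps ^ l"] by (simp add: cf_def q_def)
next
  case False
  from fmode_has_sum(2)[OF e1 less_imp_le[OF sig(3)] sumP repP assms, of "- int n", THEN has_sum_Im, THEN has_sum_cmult_right, of "2 * n"]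
  show ?thesis using False by (simp add: cf_def q_def mult_ac del: of_real_power)
qed

lemma cf_summable: "(%(l, n). \<bar>cf l n\<bar> * E ^ l * exp (sip / 2 * n)) summable_on UNIV"
proof (rule summable_on_comparison_test)
  have "inj (%(l::nat, n). (l, - int n))" by (auto simp: inj_def)
  from summable_on_reindex[OF this, of "%(l, k). cmod (aP l k) * e1 ^ l * ew sip k"]
  have "(%(l, n). cmod (aP l (- int n)) * e1 ^ l * exp (sip * n)) summable_on UNIV"
    using summable_on_subset_banach[OF sumP] by (simp add: o_def case_prod_unfold)
  then show "(%x. 4 / sip * (case x of (l, n) => cmod (aP l (- int n)) * e1 ^ l * exp (sip * n)) + of_bool (x = (0, 0))) summable_on UNIV"
    by (rule summable_on_add[OF summable_on_cmult_right finite_nonzero_values_imp_summable_on]) auto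
  show "(case x of (l, n) => \<bar>cf l n\<bar> * E ^ l * exp (sip / 2 * n)) <= 4 / sip * (case x of (l, n) => cmod (aP l (- int n)) * e1 ^ l * exp (sip * n)) + of_bool (x = (0, 0))" for x
  proof (cases x)
    case (Pair l n)
    from mult_mono[OF index_le_exp mult_mono[OF abs_Im_le_cmod[of "aP l (- int n)"] power_mono[OF E(2)]], of l] E(1) e1 sig(3)
    show ?thesis by (auto simp: Pair cf_def abs_mult mult_ac)
  qed
qed (use E in auto)

definition Q :: "nat => real" where "Q n = (\<Sum>\<^sub>\<infinity>l. \<bar>cf l n\<bar> * E ^ l)"

lemma Q_summable: "(%l. \<bar>cf l n\<bar> * E ^ l) summable_on UNIV" "Q summable_on UNIV" "Q n >= 0"
proof -
  have *: "(%(n, l). \<bar>cf l n\<bar> * E ^ l) summable_on UNIV \<times> UNIV"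
  proof -
    have "(%(l, n). \<bar>cf l n\<bar> * E ^ l) summable_on UNIV \<times> UNIV"
      unfolding UNIV_Times_UNIV using E sig
      by (intro summable_on_comparison_test[OF cf_summable]) (auto intro: order_trans[OF _ mult_left_mono[of 1 "exp _"]])
    then show ?thesis using summable_on_swap[of "%(l, n). \<bar>cf l n\<bar> * E ^ l" UNIV UNIV] by simp
  qed
  show "(%l. \<bar>cf l n\<bar> * E ^ l) summable_on UNIV" using summable_on_SigmaD1[OF *, of n] by simp
  show "Q summable_on UNIV" using summable_on_Sigma_banach[OF *] by (simp add: Q_def[abs_def])
  show "Q n >= 0" unfolding Q_def using E by (intro infsum_nonneg) auto
qed

text \<open>Vanishing to order k in quantitative form. The constants Q n are summable in n, so that
  infinite sums of such terms can still be estimated.\<close>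

lemma q_order_bound:
  assumes z: "!!l. l < k ==> cf l n = 0" and eps: "abs eps <= E"
  shows "\<bar>q eps n\<bar> <= (abs eps / E) ^ k * Q n"
  unfolding Q_def
proof (rule norm_infsum_le[OF q_has_sum has_sum_cmult_right[OF has_sum_infsum[OF Q_summable(1)]], of eps n, unfolded real_norm_def])
  fix l
  show "\<bar>cf l n * eps ^ l\<bar> <= (abs eps / E) ^ k * (\<bar>cf l n\<bar> * E ^ l)"
  proof (cases "l < k")
    case False
    have "abs eps ^ l = (abs eps / E) ^ l * E ^ l" using E by (simp add: power_divide)
    also have "... <= (abs eps / E) ^ k * E ^ l" using False eps E by (intro mult_right_mono power_decreasing) auto
    finally show ?thesis using mult_left_mono[of _ _ "\<bar>cf l n\<bar>"] by (fastforce simp: abs_mult power_abs mult_ac)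
  qed (simp add: z)
qed (use eps Ee in auto)

lemma cf_order:
  assumes "!!eps. abs eps < E ==> \<bar>q eps n\<bar> <= M * abs eps ^ k" "l < k" shows "cf l n = 0"
  by (rule powser_order[OF _ E(1) assms]) (use has_sum_imp_sums[OF q_has_sum] E in auto)

text \<open>The wave at -eps is the wave at eps shifted by pi. That p shares the symmetry has to be
  derived: \<psi>(x + p) = c p determines p, since the slope 1/4 of \<psi> is less than |c|. On the
  n-th mode the shift is the sign (-1)^n.\<close>

lemma cf_parity:
  assumes "cf l n ~= 0" shows "even (l + n)"
proof -
  have "q (- eps) n = (-1) ^ n * q eps n" if eps: "abs eps <= E" for eps
  proof (cases "n = 0")
    case False
    have eps': "\<bar>- eps\<bar> <= E" using eps by simp
    have pp: "p (- eps) (x + pi) = p eps x" for x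
    proof -
      have "\<psi> eps (x + p (- eps) (x + pi)) = c eps * p (- eps) (x + pi)"
        using wave_facts(1)[OF eps', of "x + pi"] sym[OF Ee(2)[OF eps]] psi_facts(3)[OF eps, of "x + p (- eps) (x + pi)"]
        by (simp add: add_ac)
      then have "\<bar>c eps\<bar> * \<bar>p (- eps) (x + pi) - p eps x\<bar> <= 1/4 * \<bar>p (- eps) (x + pi) - p eps x\<bar>"
        using wave_facts(1)[OF eps, of x] psi_facts(2)[OF eps, of "x + p (- eps) (x + pi)" "x + p eps x"]
        by (simp add: abs_mult[symmetric] right_diff_distrib)
      moreover have "\<bar>c eps\<bar> > 1/4" using smallC[OF eps] by linarith
      ultimately show ?thesis using mult_strict_right_mono[of "1/4" "\<bar>c eps\<bar>" "\<bar>p (- eps) (x + pi) - p eps x\<bar>"]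
        by (cases "p (- eps) (x + pi) = p eps x") auto
    qed
    have "wiener (fnorm sip aP (- eps)) (%k. P (- eps) k * cis (of_int k * pi)) (%x. of_real (p (- eps) (x + pi)))"
      using famP(1)[OF Ee(1)[OF eps']] unfolding wiener_def
      by (auto simp: norm_mult mult.assoc cis_mult distrib_left[symmetric] add.commute[of pi])
    from wiener_fcoeff[OF this] have "P eps k = P (- eps) k * cis (of_int k * pi)" for k
      using P_fcoeff[OF Ee(1)[OF eps]] by (simp add: pp cong: if_cong)
    moreover have "cis (of_int (- int n) * pi) = (-1) ^ n" using Complex.DeMoivre[of "-pi" n] by (simp add: cis_cnj[symmetric])
    ultimately show ?thesis using False by (cases "even n") (auto simp: q_def)
  qed (simp add: q_def)
  then have *: "((%l. cf l n * (- eps) ^ l - (-1) ^ n * (cf l n * eps ^ l)) has_sum 0) UNIV" if "abs eps <= E" for eps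
    using has_sum_diff[OF q_has_sum[of "- eps" n] has_sum_cmult_right[OF q_has_sum[of eps n], of "(-1) ^ n"]] that E by simp
  have "(%l. (((-1) ^ l - (-1) ^ n) * cf l n) * eps ^ l) sums 0" if "abs eps < E" for eps
    using has_sum_imp_sums[OF *[of eps]] that by (simp add: algebra_simps power_minus[of eps])
  from powser_order[OF this E(1), of 0 "Suc l" l] show ?thesis
    using assms by (cases "even l"; cases "even n"; simp)
qed

definition qz :: "real => int => real" where "qz eps k = (if k >= 0 then q eps (nat k) else 0)"

lemma q_wiener:
  assumes eps: "abs eps <= E" and z: "z <= 0"
  obtains M where "wiener M (%k. of_real (qz eps k * exp (of_int k * z))) (%x. \<Sum>n. of_real (q eps n) * (of_real (exp z) * cis x) ^ n)"
    "wiener M (%k. of_real (qz eps (- k) * exp (- of_int k * z))) (%x. \<Sum>n. of_real (q eps n) * (of_real (exp z) * cis (- x)) ^ n)"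
proof -
  let ?b = "%k. complex_of_real (qz eps k * exp (of_int k * z))" and ?g = "%x. \<Sum>n. of_real (q eps n) * (of_real (exp z) * cis x) ^ n"
  have tr: "((%k. if k >= 0 then f (nat k) else 0) has_sum S) (UNIV :: int set) \<longleftrightarrow> (f has_sum S) UNIV" for f :: "nat => 'a::{comm_monoid_add,t2_space}" and S
  proof -
    have "bij_betw int UNIV {0..}" by (rule bij_betw_byWitness[of _ nat]) auto
    from has_sum_reindex_bij_betw[OF this, of "%k. f (nat k)" S]
    have "(f has_sum S) UNIV \<longleftrightarrow> ((%k. f (nat k)) has_sum S) {0..}" by simp
    also have "... \<longleftrightarrow> ((%k. if k >= 0 then f (nat k) else 0) has_sum S) UNIV" by (rule has_sum_cong_neutral) auto
    finally show ?thesis by simp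
  qed
  have le: "norm (of_real (q eps n) * (of_real (exp z) * cis x) ^ n) <= \<bar>q eps n\<bar> * exp (sip / 2) ^ n" for n x
  proof -
    have "exp z <= exp (sip / 2)" using z sig by simp
    from mult_left_mono[OF power_mono[OF this], of "\<bar>q eps n\<bar>" n] show ?thesis by (simp add: norm_mult norm_power)
  qed
  have s: "summable (%n. norm (of_real (q eps n) * (of_real (exp z) * cis x) ^ n))" for x
    by (rule summable_comparison_test'[OF q_summable(1)[OF eps]]) (use le in simp)
  have t: "?b k * cis (of_int k * x) = (if k >= 0 then of_real (q eps (nat k)) * (of_real (exp z) * cis x) ^ nat k else 0)" for k x
    by (auto simp: qz_def power_mult_distrib Complex.DeMoivre exp_of_nat_mult[symmetric] mult.assoc simp flip: of_real_power)
  have hs: "((%k. ?b k * cis (of_int k * x)) has_sum ?g x) UNIV" for x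
    unfolding t by (rule tr[THEN iffD2, OF norm_summable_imp_has_sum[OF s summable_sums[OF summable_norm_cancel[OF s]]]])
  have "(%k. norm (?b k * cis (of_int k * 0))) summable_on UNIV"
    using tr[THEN iffD2, OF norm_summable_imp_has_sum[OF _ summable_sums[OF s[of 0]]], THEN has_sum_imp_summable] s[of 0]
    unfolding t by (simp add: if_distrib[of norm] cong: if_cong)
  then have "wiener (\<Sum>\<^sub>\<infinity>k. cmod (?b k)) ?b ?g" unfolding wiener_def using hs by (simp add: norm_mult)
  from that[OF this] wiener_reflect[OF this] show ?thesis by (simp add: minus_mult_commute)
qed

text \<open>On the surface Bernoulli's law reads u h g = c^2, with u = c^2 - 2 \<eta>, h the series
  of q and g its reflection. It is cubic in q, but g has frequencies at most 0 and is close to 1.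
  Hence the product u h has no positive modes, and this condition is quadratic.\<close>

lemma mode_equation:
  fixes k :: nat
  assumes eps: "abs eps <= E" and k: "k > 0"
  shows "((c eps)^2 - 2 * Re (Y eps 0) - 1 / k) * q eps k = (\<Sum>\<^sub>\<infinity>j\<in>UNIV - {0, int k}. q eps (nat \<bar>j\<bar>) / \<bar>of_int j\<bar> * qz eps (int k - j))"
proof -
  let ?b = "%k. complex_of_real (qz eps k)" and ?y = "%x. \<eta> eps (x + p eps x)" and ?S = "\<Sum>n. \<bar>q eps (Suc n)\<bar>"
    and ?h = "%x. \<Sum>n. of_real (q eps n) * cis x ^ n"
  obtain M where h: "wiener M ?b ?h" and g: "wiener M (%k. ?b (- k)) (%x. ?h (- x))"
    using q_wiener[OF eps order_refl] by auto
  let ?U = "%k. complex_of_real ((c eps)^2) * (if k = 0 then 1 else 0) + (- 2) * Y eps k"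
  have "wiener (cmod (of_real ((c eps)^2)) * 1 + cmod (- 2) * (1/50)) ?U (%x. of_real ((c eps)^2) * cis (of_int 0 * x) + (- 2) * of_real (?y x))"
    by (intro wiener_add wiener_cmult wiener_cis Y_wiener eps)
  then obtain Mu u where u: "wiener Mu ?U u" and u': "u = (%x. of_real ((c eps)^2 - 2 * ?y x))" by simp
  from wiener_mult[OF u h] obtain M' where v: "wiener M' (%k. \<Sum>\<^sub>\<infinity>j. ?U j * ?b (k - j)) (%x. of_real ((c eps)^2 - 2 * ?y x) * ?h x)"
    by (simp add: u')
  let ?v = "%k. \<Sum>\<^sub>\<infinity>j. ?U j * ?b (k - j)"
  have hg: "?h x * ?h (- x) = of_real ((cmod (?h (- x)))^2)" for x
    using has_sum_unique[OF wiener_has_sum[OF h] wiener_has_sum[OF wiener_cnj[OF g], unfolded minus_minus complex_cnj_complex_of_real], of x]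
    by (simp only: complex_norm_square mult.commute)
  have vg: "wiener (M' * M) (%k. \<Sum>\<^sub>\<infinity>i. ?v i * ?b (- (k - i))) (%x. of_real ((c eps)^2))"
    using wiener_mult[OF v g] wave_facts(2)[OF eps] unfolding mult.assoc hg of_real_mult[symmetric] by simp
  have bs: "((%i. norm (?b i)) has_sum ?S) {1..}"
  proof -
    have "bij_betw (%n. int (Suc n)) UNIV {1..}" by (rule bij_betw_byWitness[of _ "%i. nat (i - 1)"]) auto
    note re = has_sum_reindex_bij_betw[OF this, of "%i. norm (?b i)"]
    have "(%i. norm (?b i)) summable_on {1..}" using h by (auto simp: wiener_def intro: summable_on_subset_banach)
    then have "((%i. norm (?b i)) has_sum infsum (%i. norm (?b i)) {1..}) {1..}" by simp
    moreover from this re have "((%n. \<bar>q eps (Suc n)\<bar>) has_sum infsum (%i. norm (?b i)) {1..}) UNIV"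
      by (simp add: qz_def nat_add_distrib)
    ultimately show ?thesis using sums_unique[OF has_sum_imp_sums] by metis
  qed
  \<comment> \<open>For i > 0 the mode i of v g = c^2 expresses v i through the v j with j > i and
    the coefficients q (j - i), whose absolute sum is at most 1/4. So the supremum of |v i| over i >
    0 is at most a quarter of itself.\<close>
  have v0: "?v i = 0" if "i > 0" for i
  proof -
    let ?B = "SUP i\<in>{0<..}. norm (?v i)"
    have vs: "(%i. norm (?v i)) summable_on UNIV" using v by (simp add: wiener_def)
    have bdd: "bdd_above ((%i. norm (?v i)) ` {0<..})"
      using finite_sum_le_infsum[OF vs, of "{_}"] by (intro bdd_aboveI2[of _ _ "\<Sum>\<^sub>\<infinity>i. norm (?v i)"]) simp
    have "norm (?v i) <= ?B * ?S" if i: "i > 0" for i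
    proof -
      have "wiener ((c eps)^2) (%k. complex_of_real ((c eps)^2) * (if k = 0 then 1 else 0)) (%x. of_real ((c eps)^2))"
        using wiener_cmult[OF wiener_cis[of 0], of "of_real ((c eps)^2)"] by (simp add: norm_power)
      from wiener_fcoeff[OF this, of i] have "fcoeff (%x. (c eps)^2) i = 0" using i by simp
      then have "(\<Sum>\<^sub>\<infinity>j. ?v j * ?b (j - i)) = 0" using wiener_fcoeff[OF vg, of i] by simp
      then have "((%j. ?v j * ?b (j - i)) has_sum 0) UNIV"
        using has_sum_infsum[OF wiener_conv_summable[OF v g, of i]] by simp
      from has_sum_Diff[OF this has_sum_finite[of "{i}"]] have "((%j. ?v j * ?b (j - i)) has_sum - ?v i) (UNIV - {i})"
        by (simp add: qz_def q_def)
      moreover have "((%j. ?v j * ?b (j - i)) has_sum y) (UNIV - {i}) \<longleftrightarrow> ((%j. ?v j * ?b (j - i)) has_sum y) {i<..}" for y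
        by (rule has_sum_cong_neutral) (auto simp: qz_def)
      ultimately have "((%j. ?v j * ?b (j - i)) has_sum - ?v i) {i<..}" by simp
      moreover have "((%j. ?B * norm (?b (j - i))) has_sum ?B * ?S) {i<..}"
      proof (rule has_sum_cmult_right)
        have "bij_betw (%j. j - i) {i<..} {1..}" by (rule bij_betw_byWitness[of _ "%j. j + i"]) auto
        from has_sum_reindex_bij_betw[OF this, of "%j. norm (?b j)"] bs
        show "((%j. norm (?b (j - i))) has_sum ?S) {i<..}" by simp
      qed
      ultimately have "norm (- ?v i) <= ?B * ?S"
      proof (rule norm_infsum_le)
        fix j assume "j \<in> {i<..}"
        then have "norm (?v j) <= ?B" using bdd i by (intro cSUP_upper) auto
        from mult_right_mono[OF this] show "norm (?v j * ?b (j - i)) <= ?B * norm (?b (j - i))" unfolding norm_mult by simp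
      qed
      then show ?thesis by (simp only: norm_minus_cancel)
    qed
    then have "?B <= ?B * ?S" by (intro cSUP_least) auto
    moreover have "?B >= norm (?v i)" "?S <= 1/4" using that bdd q_summable(2)[OF eps] by (auto intro!: cSUP_upper2)
    moreover have "norm (?v i) >= 0" by simp
    ultimately have "norm (?v i) <= 0" using mult_left_mono[of ?S "1/4" ?B] by linarith
    then show ?thesis by simp
  qed
  have "((%j. ?U j * ?b (int k - j)) has_sum 0) UNIV"
    using has_sum_infsum[OF wiener_conv_summable[OF u h, of "int k"]] v0[of "int k"] k by simp
  \<comment> \<open>The terms j = 0 and j = k contain q k once, because q 0 = 1 and 2 Y k = q k / k;
    they form the left-hand side.\<close>
  from has_sum_Diff[OF this has_sum_finite[of "{0, int k}"]]
  have "((%j. ?U j * ?b (int k - j)) has_sum - (?U 0 * ?b k + ?U k * ?b 0)) (UNIV - {0, int k})"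
    using k by simp
  from has_sum_Re[OF this, THEN has_sum_cmult_right, of "-1"]
  have 1: "((%j. - Re (?U j * ?b (int k - j))) has_sum Re (?U 0 * ?b k + ?U k * ?b 0)) (UNIV - {0, int k})"
    using k by (simp add: add.commute del: times_complex.sel)
  have Yj: "2 * Y eps j = of_real (q eps (nat \<bar>j\<bar>) / \<bar>of_int j\<bar>)" if "j ~= 0" for j
    using Y_q[OF eps, of "nat \<bar>j\<bar>"] that by (cases "j > 0") (auto simp: not_less)
  have "(\<Sum>\<^sub>\<infinity>j\<in>UNIV - {0, int k}. - Re (?U j * ?b (int k - j))) = (\<Sum>\<^sub>\<infinity>j\<in>UNIV - {0, int k}. q eps (nat \<bar>j\<bar>) / \<bar>of_int j\<bar> * qz eps (int k - j))"
    by (intro infsum_cong) (use Yj in \<open>auto simp flip: mult.assoc\<close>)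
  with infsumI[OF 1] Yj[of "int k"] k show ?thesis by (simp add: qz_def q_def algebra_simps)
qed

text \<open>Induction on the order K. If all lower orders have the claimed support and n > K, then
  each product in \<open>mode_equation\<close> is of order eps^(K + 1), while the factor on the left
  is bounded below since n >= 2; so the coefficient of order K vanishes. The resonant n = 1 occurs
  for K = 0 only, where q n vanishes at eps = 0.\<close>

lemma cf_support:
  assumes "cf l n ~= 0" shows "n <= l"
proof -
  have "cf l n = 0" if "n > 0" "l < n" "l < K" for K l n
    using that
  proof (induction K arbitrary: l n)
    case (Suc K)
    let ?Q = "%j::int. Q (nat \<bar>j\<bar>)"
    show ?case
    proof (cases "l < K \<or> K = 0")
      case True
      then show ?thesis using Suc cf_zero by auto
    next
      case False
      then have lK: "l = K" "K > 0" using Suc.prems by auto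
      have q_le: "\<bar>q eps m\<bar> <= (abs eps / E) ^ min m K * Q m" if "abs eps <= E" for eps m
        using Suc.IH by (cases "m = 0") (auto intro!: q_order_bound that simp del: power_0)
      have Qs: "?Q summable_on UNIV"
        by (rule summable_on_int_of_nat) (use Q_summable summable_on_imp_summable in auto)
      have QM: "Q m <= infsum Q UNIV" for m using finite_sum_le_infsum[OF Q_summable(2), of "{m}"] Q_summable(3) by simp
      have "\<bar>q eps n\<bar> <= (4 * (infsum ?Q UNIV * infsum Q UNIV) / E ^ Suc K) * abs eps ^ Suc K" if "abs eps < E" for eps
      proof -
        let ?t = "abs eps / E"
        have eps: "abs eps <= E" using that by simp
        have t: "0 <= ?t" "?t <= 1" using eps E by auto
        have trm: "norm (q eps (nat \<bar>j\<bar>) / \<bar>of_int j\<bar> * qz eps (int n - j)) <= ?t ^ Suc K * (?Q j * infsum Q UNIV)" if j: "j ~= 0" "j ~= int n" for j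
        proof (cases "j < int n")
          case True
          let ?i = "nat \<bar>j\<bar>" and ?m = "nat (int n - j)"
          have "\<bar>q eps ?i\<bar> / \<bar>of_int j\<bar> <= \<bar>q eps ?i\<bar>" using j(1) by (simp add: divide_le_eq mult_le_cancel_left1 int_one_le_iff_zero_less flip: of_int_abs)
          then have "\<bar>q eps ?i\<bar> / \<bar>of_int j\<bar> * \<bar>q eps ?m\<bar> <= (?t ^ min ?i K * Q ?i) * (?t ^ min ?m K * Q ?m)"
            using q_le[OF eps] t Q_summable(3) by (intro mult_mono order_trans[OF _ q_le[OF eps]]) auto
          also have "... = ?t ^ (min ?i K + min ?m K) * (Q ?i * Q ?m)" by (simp add: power_add mult_ac)
          \<comment> \<open>The capped orders add up to at least K + 1. If one of them is K, the
            other is at least 1; if neither is capped, then j is positive and they sum to n > K. For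
            negative j the second index exceeds K.\<close>
          also have "... <= ?t ^ Suc K * (Q ?i * infsum Q UNIV)"
            using True j lK Suc.prems t E(1) Q_summable(3) QM by (intro mult_mono power_decreasing) auto
          finally show ?thesis using True by (simp add: qz_def abs_mult)
        next
          case False
          then show ?thesis using j t E(1) Q_summable(3) order_trans[OF Q_summable(3) QM] by (simp add: qz_def)
        qed
        \<comment> \<open>The squared speed is at least 0.98, the mean elevation takes away at most
          0.04 and 1/n at most 1/2.\<close>
        have "1/4 <= (c eps)^2 - 2 * Re (Y eps 0) - 1 / n"
        proof -
          have "(99/100)^2 <= (c eps)^2" using smallC[OF eps] by (intro power_mono; linarith)
          moreover have "1 / real n <= 1/2" using lK Suc.prems by (simp add: divide_le_eq)
          moreover have "cmod (Y eps 0) <= 1/50"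
            using Y_wiener[OF eps] finite_sum_le_infsum[of "%k. cmod (Y eps k)" UNIV "{0}"] by (simp add: wiener_def)
          ultimately show ?thesis using complex_Re_le_cmod[of "Y eps 0"] by (simp add: power2_eq_square)
        qed
        then have "1/4 * \<bar>q eps n\<bar> <= \<bar>((c eps)^2 - 2 * Re (Y eps 0) - 1 / n) * q eps n\<bar>"
          unfolding abs_mult by (intro mult_right_mono) auto
        also have "... <= ?t ^ Suc K * (infsum ?Q UNIV * infsum Q UNIV)"
        proof -
          let ?f = "%j. q eps (nat \<bar>j\<bar>) / \<bar>of_int j\<bar> * qz eps (int n - j)" and ?A = "UNIV - {0, int n}"
          have gs: "(%j. ?t ^ Suc K * (?Q j * infsum Q UNIV)) summable_on UNIV"
            by (intro summable_on_cmult_right summable_on_cmult_left Qs)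
          have g0: "?t ^ Suc K * (?Q j * infsum Q UNIV) >= 0" for j
            using t E(1) Q_summable(3) order_trans[OF Q_summable(3) QM] by simp
          have fs: "(%j. norm (?f j)) summable_on ?A"
            by (rule summable_on_comparison_test[OF summable_on_subset_banach[OF gs]]) (use trm in auto)
          have "\<bar>infsum ?f ?A\<bar> <= (\<Sum>\<^sub>\<infinity>j\<in>?A. norm (?f j))" using norm_infsum_bound[OF fs] by simp
          also have "... <= (\<Sum>\<^sub>\<infinity>j. ?t ^ Suc K * (?Q j * infsum Q UNIV))"
            by (rule infsum_mono_neutral[OF fs gs]) (use trm g0 in auto)
          finally show ?thesis unfolding mode_equation[OF eps Suc.prems(1)] by (simp only: infsum_cmult_right' infsum_cmult_left')
        qed
        finally show ?thesis using E by (simp add: power_divide field_simps)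
      qed
      then show ?thesis unfolding lK(1) by (rule cf_order[OF _ lessI])
    qed
  qed simp
  from this[of n l "Suc l"] assms show ?thesis by (cases "l < n") auto
qed

section \<open>Expansion of the symbol of the flattened problem\<close>

definition wt :: "(nat \<times> nat) \<times> nat \<times> nat => real" where
  "wt = (%((i, n), j, m). real (n + m) * \<bar>cf i n * cf j m\<bar>)"

text \<open>One term of the expansion of |conf'|^2 - 1 at level z, stripped of its power eps^(i + j)
  and of its exponential of frequency n - m. The pair n = m = 0 contributes exactly the constant 1
  that is subtracted. The factor n + m in \<open>wt\<close> is the Lipschitz constant in z.\<close>

definition dv :: "(nat \<times> nat) \<times> nat \<times> nat => real => real" where
  "dv = (%((i, n), j, m) z. if n + m = 0 then 0 else cf i n * cf j m * exp (real (n + m) * z))"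

text \<open>One power of eps is split off, whence i + j - 1. For i + j = 0 the truncated difference
  does no harm: by \<open>cf_support\<close> the coefficients then vanish unless n = m = 0, a pair
  that \<open>dv\<close> sets to zero.\<close>

definition gr :: "(nat \<times> nat) \<times> nat \<times> nat => nat \<times> int" where
  "gr = (%((i, n), j, m). (i + j - 1, int n - int m))"

definition dc :: "nat => int => real => real" where "dc l kap z = (\<Sum>\<^sub>\<infinity>x\<in>{x. gr x = (l, kap)}. dv x z)"

definition Dc :: "nat => int => real" where "Dc l kap = (\<Sum>\<^sub>\<infinity>x\<in>{x. gr x = (l, kap)}. wt x)"

lemma dv_bounds:
  assumes z: "z <= 0" "z' <= 0"
  shows "\<bar>dv x z\<bar> <= wt x * exp z" "\<bar>dv x z - dv x z'\<bar> <= wt x * \<bar>z - z'\<bar>"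
proof -
  obtain i n j m where x: "x = ((i, n), (j, m))" by (cases x) auto
  let ?a = "real (n + m)"
  show "\<bar>dv x z\<bar> <= wt x * exp z"
  proof (cases "n + m = 0")
    case False
    then have "1 <= ?a" by linarith
    have "exp (?a * z) <= exp z" using mult_right_mono_neg[OF \<open>1 <= ?a\<close> z(1)] by simp
    also have "... <= ?a * exp z" using mult_right_mono[OF \<open>1 <= ?a\<close>, of "exp z"] by simp
    finally have "exp (?a * z) <= ?a * exp z" .
    from mult_left_mono[OF this, of "\<bar>cf i n * cf j m\<bar>"] show ?thesis using False by (simp add: x dv_def wt_def abs_mult mult_ac)
  qed (simp add: x dv_def wt_def)
  have "\<bar>exp (?a * z) - exp (?a * z')\<bar> <= ?a * \<bar>z - z'\<bar>"
  proof -
    have "((%z. exp (?a * z)) has_real_derivative ?a * exp (?a * z)) (at z within {..0})" for z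
      by (auto intro!: derivative_eq_intros)
    from field_differentiable_bound[OF _ this, of ?a z z'] z show ?thesis by (simp add: mult_left_le mult_nonneg_nonpos)
  qed
  from mult_left_mono[OF this, of "\<bar>cf i n * cf j m\<bar>"]
  show "\<bar>dv x z - dv x z'\<bar> <= wt x * \<bar>z - z'\<bar>" by (simp add: x dv_def wt_def abs_mult[symmetric] right_diff_distrib[symmetric] mult_ac)
qed

lemma cf_product_summable:
  "(%((i, n), j, m). (\<bar>cf i n\<bar> * E ^ i * exp (sip / 2 * n)) * (\<bar>cf j m\<bar> * E ^ j * exp (sip / 2 * m))) summable_on UNIV"
  using summable_on_product_nonneg[OF cf_summable cf_summable] E by (simp add: case_prod_unfold)

text \<open>By \<open>cf_support\<close> every nonzero term has i + j >= 1, so one power of E can be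
  traded for the constant 1 / E. The factor n + m and the weight in n - m use up half of the
  exponent sip / 2 in \<open>cf_summable\<close>.\<close>

lemma wt_summable: "(%x. wt x * E ^ fst (gr x) * exp (sip / 4 * of_int \<bar>snd (gr x)\<bar>)) summable_on UNIV"
proof (rule summable_on_comparison_test[OF summable_on_cmult_right[OF cf_product_summable, where c="4 / (sip * E)"]])
  fix x :: "(nat \<times> nat) \<times> nat \<times> nat"
  obtain i n j m where x: "x = ((i, n), (j, m))" by (cases x) auto
  show "wt x * E ^ fst (gr x) * exp (sip / 4 * of_int \<bar>snd (gr x)\<bar>) <= 4 / (sip * E) * (%((i, n), j, m). (\<bar>cf i n\<bar> * E ^ i * exp (sip / 2 * n)) * (\<bar>cf j m\<bar> * E ^ j * exp (sip / 2 * m))) x"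
  proof (cases "wt x = 0")
    case True
    then show ?thesis using E sig by (simp add: x)
  next
    case False
    then have "n <= i" "m <= j" "n + m > 0" using cf_support by (auto simp: x wt_def)
    then have Eq: "E ^ (i + j) = E * E ^ (i + j - 1)" by (cases "i + j") auto
    let ?e = "exp (sip / 4 * (n + m))"
    have "sip / 4 * (n + m) <= ?e" using exp_ge_add_one_self[of "sip / 4 * (n + m)"] by linarith
    then have "real (n + m) * ew (sip / 4) (int n - int m) <= 4 / sip * ?e * ?e"
      using sig mult_left_mono[of "of_int \<bar>int n - int m\<bar>" "real (n + m)" "sip / 4"] by (intro mult_mono) (auto simp: field_simps)
    also have "... = 4 / sip * (exp (sip / 2 * n) * exp (sip / 2 * m))" by (simp add: mult.assoc mult_exp_exp add_divide_distrib distrib_left)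
    finally have "\<bar>cf i n * cf j m\<bar> * E ^ (i + j - 1) * (real (n + m) * ew (sip / 4) (int n - int m)) <= \<bar>cf i n * cf j m\<bar> * E ^ (i + j - 1) * (4 / sip * (exp (sip / 2 * n) * exp (sip / 2 * m)))"
      using E by (intro mult_left_mono) auto
    also have "... = 4 / (sip * E) * (\<bar>cf i n * cf j m\<bar> * E ^ (i + j) * (exp (sip / 2 * n) * exp (sip / 2 * m)))"
      unfolding Eq using E by simp
    finally show ?thesis by (simp add: x wt_def gr_def abs_mult power_add mult_ac)
  qed
qed (use E in \<open>auto simp: wt_def\<close>)

lemma wt_fiber_summable: "wt summable_on {x. gr x = (l, kap)}"
proof -
  have "(%x. wt x * (E ^ l * ew (sip / 4) kap)) summable_on {x. gr x = (l, kap)}"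
    using summable_on_subset_banach[OF wt_summable, of "{x. gr x = (l, kap)}"]
    by (rule summable_on_cong[THEN iffD1, rotated]) auto
  then show ?thesis using E by (subst (asm) summable_on_cmult_left') auto
qed

lemma dv_fiber_summable: "z <= 0 ==> (%x. dv x z) summable_on {x. gr x = (l, kap)}"
  by (rule abs_summable_summable, rule summable_on_comparison_test[OF summable_on_cmult_left[OF wt_fiber_summable, of "exp z"]])
    (use dv_bounds(1)[of z z] in auto)

text \<open>The bounds follow termwise from \<open>dv_bounds\<close>. For the support, |n - m| <= n
  + m <= i + j by \<open>cf_support\<close>, and i + j is congruent to n - m by
  \<open>cf_parity\<close>; here i + j = l + 1.\<close>

lemma dcoef_dc: "dcoef dc Dc E (sip / 4)"
proof
  show "0 < E" "0 < sip / 4" using E sig by auto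
  show "\<bar>dc l kap z\<bar> <= Dc l kap * exp z" if "z <= 0" for l kap z
    unfolding real_norm_def[symmetric] dc_def Dc_def
    by (rule norm_infsum_le[OF has_sum_infsum[OF dv_fiber_summable[OF that]] has_sum_cmult_left[OF has_sum_infsum[OF wt_fiber_summable]]])
      (use dv_bounds(1)[OF that that] in simp)
  show "\<bar>dc l kap z - dc l kap z'\<bar> <= Dc l kap * \<bar>z - z'\<bar>" if "z <= 0" "z' <= 0" for l kap z z'
    unfolding real_norm_def[symmetric] dc_def Dc_def
    by (rule norm_infsum_le[OF has_sum_diff[OF has_sum_infsum[OF dv_fiber_summable] has_sum_infsum[OF dv_fiber_summable]] has_sum_cmult_left[OF has_sum_infsum[OF wt_fiber_summable]]])
      (use dv_bounds(2) that in simp_all)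
  have "(%k. \<Sum>\<^sub>\<infinity>x\<in>{x. gr x = k}. wt x * E ^ fst (gr x) * exp (sip / 4 * of_int \<bar>snd (gr x)\<bar>)) summable_on UNIV"
    using has_sum_fibers[OF has_sum_infsum[OF wt_summable], of gr] has_sum_imp_summable by simp
  moreover have "(\<Sum>\<^sub>\<infinity>x\<in>{x. gr x = k}. wt x * E ^ fst (gr x) * exp (sip / 4 * of_int \<bar>snd (gr x)\<bar>)) = (case k of (l, kap) => Dc l kap * E ^ l * ew (sip / 4) kap)" for k
    by (cases k) (auto simp: Dc_def mult.assoc infsum_cmult_left'[symmetric] intro!: infsum_cong)
  ultimately show "(%(l, kap). Dc l kap * E ^ l * ew (sip / 4) kap) summable_on UNIV" by simp
  fix l kap and z :: real assume "dc l kap z ~= 0"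
  then obtain x where x: "gr x = (l, kap)" "dv x z ~= 0" unfolding dc_def by (metis (mono_tags, lifting) infsum_0 mem_Collect_eq)
  obtain i n j m where x': "x = ((i, n), (j, m))" by (cases x) auto
  have cf: "cf i n ~= 0" "cf j m ~= 0" "n + m > 0" using x by (auto simp: x' dv_def split: if_splits)
  then have "even ((i + n) + (j + m))" using cf_parity by auto
  then show "abs kap <= int l + 1 & even (kap - (int l + 1))"
    using cf_support[OF cf(1)] cf_support[OF cf(2)] cf(3) x(1) by (auto simp: x' gr_def)
qed

text \<open>The squared modulus is the product of the series of \<open>gg\<close> with its
  conjugate. The resulting absolutely convergent sum is grouped by frequency to read off the Fourier
  coefficient, and within each frequency by order to obtain the power series in eps.\<close>

lemma symbol_fcoeff:
  assumes eps: "abs eps <= E" and z: "z <= 0"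
  shows "fcoeff (%x. 1 + flat_d (p eps) x z) kap = of_real ((if kap = 0 then 1 else 0) + eps * (\<Sum>l. dc l kap z * eps ^ l))"
proof -
  let ?s = "%((i, n), j, m). int n - int m"
  let ?F = "%x. dv x z * eps ^ Suc (fst (gr x))"
  have Fs: "(%x. norm (?F x)) summable_on UNIV"
  proof (rule summable_on_comparison_test[OF summable_on_cmult_right[OF wt_summable, where c=E]])
    fix x
    have "abs eps ^ Suc (fst (gr x)) <= E ^ Suc (fst (gr x)) * exp (sip / 4 * of_int \<bar>snd (gr x)\<bar>)"
      using power_mono[OF eps, of "Suc (fst (gr x))"] E sig order_trans[OF _ mult_left_mono[of 1 "exp (sip / 4 * of_int \<bar>snd (gr x)\<bar>)"]] by simp
    moreover have "\<bar>dv x z\<bar> <= wt x" using dv_bounds(1)[OF z z, of x] z mult_left_mono[of "exp z" 1 "wt x"] by (simp add: wt_def split: prod.splits)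
    ultimately have "\<bar>dv x z\<bar> * abs eps ^ Suc (fst (gr x)) <= wt x * (E ^ Suc (fst (gr x)) * exp (sip / 4 * of_int \<bar>snd (gr x)\<bar>))"
      by (intro mult_mono) auto
    then show "norm (?F x) <= E * (wt x * E ^ fst (gr x) * exp (sip / 4 * of_int \<bar>snd (gr x)\<bar>))"
      by (simp add: abs_mult power_abs mult_ac)
  qed auto
  let ?B = "%kap. \<Sum>\<^sub>\<infinity>x\<in>{x. snd (gr x) = kap}. ?F x"
  have B: "?B kap = eps * (\<Sum>l. dc l kap z * eps ^ l)" for kap
  proof -
    have "?F summable_on {x. snd (gr x) = kap}"
      by (rule summable_on_subset_banach[OF abs_summable_summable[OF Fs]]) simp
    from has_sum_fibers[OF has_sum_infsum[OF this], of "%x. fst (gr x)"]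
    have "((%l. \<Sum>\<^sub>\<infinity>x\<in>{x. gr x = (l, kap)}. ?F x) has_sum ?B kap) UNIV" by (simp add: prod_eq_iff conj_commute)
    moreover have "(\<Sum>\<^sub>\<infinity>x\<in>{x. gr x = (l, kap)}. ?F x) = dc l kap z * eps ^ l * eps" for l
      unfolding dc_def mult.assoc infsum_cmult_left'[symmetric] by (rule infsum_cong) (simp add: mult.commute)
    ultimately have 1: "(%l. dc l kap z * eps ^ l * eps) sums ?B kap" by (simp add: has_sum_imp_sums)
    have 2: "summable (%l. dc l kap z * eps ^ l)"
      using summable_norm_cancel[OF dcoef.dt_summable[OF dcoef_dc _ z, of eps kap]] eps by simp
    show ?thesis unfolding sums_unique[OF 1] suminf_mult2[OF 2, symmetric] by (rule mult.commute)
  qed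
  have Fk: "((%kap. \<Sum>\<^sub>\<infinity>x\<in>{x. snd (gr x) = kap}. norm (?F x)) has_sum (\<Sum>\<^sub>\<infinity>x. norm (?F x))) UNIV"
    using has_sum_fibers[OF has_sum_infsum[OF Fs], of "%x. snd (gr x)"] by simp
  have Fsk: "(%x. norm (?F x)) summable_on {x. snd (gr x) = kap}" for kap
    by (rule summable_on_subset_banach[OF Fs]) simp
  let ?g = "%x. \<Sum>n. of_real (q eps n) * (of_real (exp z) * cis (- x)) ^ n"
  have "wiener (\<Sum>\<^sub>\<infinity>x. norm (?F x)) (%kap. of_real (?B kap)) (%x. of_real ((cmod (?g x))^2 - 1))"
  proof (rule wienerI)
    show "(%kap. \<Sum>\<^sub>\<infinity>x\<in>{x. snd (gr x) = kap}. norm (?F x)) summable_on UNIV" using Fk by (rule has_sum_imp_summable)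
    show "(\<Sum>\<^sub>\<infinity>kap. \<Sum>\<^sub>\<infinity>x\<in>{x. snd (gr x) = kap}. norm (?F x)) <= (\<Sum>\<^sub>\<infinity>x. norm (?F x))" using infsumI[OF Fk] by simp
    show "cmod (of_real (?B kap)) <= (\<Sum>\<^sub>\<infinity>x\<in>{x. snd (gr x) = kap}. norm (?F x))" for kap
      using norm_infsum_bound[OF Fsk] by simp
    fix t
    let ?w = "of_real (exp z) * cis (- t)"
    let ?f = "%(i, n). of_real (cf i n * eps ^ i) * ?w ^ n"
    have fs: "(%x. norm (?f x)) summable_on UNIV"
    proof (rule summable_on_comparison_test[OF cf_summable])
      fix x :: "nat \<times> nat"
      obtain i n where x: "x = (i, n)" by fastforce
      have "\<bar>cf i n\<bar> * abs eps ^ i * exp z ^ n <= \<bar>cf i n\<bar> * E ^ i * exp (sip / 2 * n)"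
        using power_mono[OF eps, of i] z sig E order_trans[OF power_le_one one_le_exp_iff[THEN iffD2]] by (intro mult_mono) auto
      then show "norm (?f x) <= (case x of (l, n) => \<bar>cf l n\<bar> * E ^ l * exp (sip / 2 * n))"
        by (simp add: x norm_mult norm_power abs_mult power_abs)
    qed simp
    have "(?f has_sum infsum ?f UNIV) (UNIV \<times> UNIV)" using has_sum_infsum[OF abs_summable_summable[OF fs]] by simp
    then have "((%(n, i). ?f (i, n)) has_sum infsum ?f UNIV) (UNIV \<times> UNIV)" using has_sum_swap[of ?f UNIV UNIV] by simp
    then have "((%n. of_real (q eps n) * ?w ^ n) has_sum infsum ?f UNIV) UNIV"
      by (rule has_sum_SigmaD) (use has_sum_cmult_left[OF has_sum_of_real[OF q_has_sum[OF Ee(1)[OF eps]]]] in simp)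
    from sums_unique[OF has_sum_imp_sums[OF this]] have f: "(?f has_sum ?g t) UNIV"
      using has_sum_infsum[OF abs_summable_summable[OF fs]] by simp
    have "((%(x, y). cnj (?f x) * ?f y) has_sum cnj (?g t) * ?g t) (UNIV \<times> UNIV)"
      by (rule has_sum_product) (use fs f has_sum_bounded_linear[OF bounded_linear_cnj f] in auto)
    then have "((%(x, y). cnj (?f x) * ?f y) has_sum of_real ((cmod (?g t))^2)) UNIV"
      by (simp only: complex_norm_square mult.commute UNIV_Times_UNIV)
    \<comment> \<open>The product of the two leading coefficients is the 1 that is removed in
      d.\<close>
    moreover have "((%x. of_bool (x = ((0, 0), (0, 0)))) has_sum of_real 1) (UNIV :: ((nat \<times> nat) \<times> nat \<times> nat) set)"
      by (rule has_sum_finite_neutralI[of "{((0, 0), (0, 0))}"]) auto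
    ultimately have "((%x. (case x of (x, y) => cnj (?f x) * ?f y) - of_bool (x = ((0, 0), (0, 0)))) has_sum of_real ((cmod (?g t))^2 - 1)) UNIV"
      unfolding of_real_diff by (rule has_sum_diff)
    moreover have "(case x of (x, y) => cnj (?f x) * ?f y) - of_bool (x = ((0, 0), (0, 0))) = of_real (?F x) * cis (of_int (snd (gr x)) * t)" for x :: "(nat \<times> nat) \<times> nat \<times> nat"
    proof -
      obtain i n j m where x: "x = ((i, n), (j, m))" by (cases x) auto
      have pw: "?w ^ n = of_real (exp (n * z)) * cis (- (n * t))" for n
        by (simp add: power_mult_distrib Complex.DeMoivre exp_of_nat_mult[symmetric] flip: of_real_power)
      have w: "cnj (?w ^ n) * ?w ^ m = of_real (exp (n * z) * exp (m * z)) * (cis (n * t) * cis (- (m * t)))"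
        unfolding pw by (simp add: cis_cnj)
      then have w: "cnj (?w ^ n) * ?w ^ m = of_real (exp (real (n + m) * z)) * cis (of_int (int n - int m) * t)"
        unfolding cis_mult mult_exp_exp by (simp add: distrib_right left_diff_distrib)
      show ?thesis
      proof (cases "n + m = 0")
        case True
        then show ?thesis by (auto simp: x dv_def cf_def)
      next
        case nm: False
        have "cf i n * cf j m * eps ^ (i + j) = cf i n * cf j m * eps ^ Suc (i + j - 1)"
          using nm cf_support[of i n] cf_support[of j m] by (cases "i + j"; cases "cf i n = 0"; cases "cf j m = 0") auto
        moreover have "cnj (of_real (cf i n * eps ^ i) * ?w ^ n) * (of_real (cf j m * eps ^ j) * ?w ^ m) = of_real (cf i n * cf j m * eps ^ (i + j)) * (cnj (?w ^ n) * ?w ^ m)"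
          by (simp only: power_add of_real_mult complex_cnj_mult complex_cnj_complex_of_real mult_ac)
        ultimately have "cnj (of_real (cf i n * eps ^ i) * ?w ^ n) * (of_real (cf j m * eps ^ j) * ?w ^ m) =
            of_real (cf i n * cf j m * eps ^ Suc (i + j - 1)) * (of_real (exp (real (n + m) * z)) * cis (of_int (int n - int m) * t))"
          by (simp only: w)
        also have "... = of_real (?F x) * cis (of_int (snd (gr x)) * t)"
          using nm by (auto simp add: x dv_def gr_def mult_ac simp del: power_Suc)
        finally show ?thesis using nm by (auto simp add: x)
      qed
    qed
    ultimately have "((%x. of_real (?F x) * cis (of_int (snd (gr x)) * t)) has_sum of_real ((cmod (?g t))^2 - 1)) UNIV" by simp
    from has_sum_fibers[OF this, of "%x. snd (gr x)"]
    have "((%kap. \<Sum>\<^sub>\<infinity>x\<in>{x. snd (gr x) = kap}. of_real (?F x) * cis (of_int (snd (gr x)) * t)) has_sum of_real ((cmod (?g t))^2 - 1)) UNIV" by simp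
    moreover have "(\<Sum>\<^sub>\<infinity>x\<in>{x. snd (gr x) = kap}. of_real (?F x) * cis (of_int (snd (gr x)) * t)) = of_real (?B kap) * cis (of_int kap * t)" for kap
    proof -
      have "((%x. of_real (?F x) * cis (of_int kap * t)) has_sum of_real (?B kap) * cis (of_int kap * t)) {x. snd (gr x) = kap}"
        by (intro has_sum_cmult_left has_sum_of_real has_sum_infsum abs_summable_summable[OF Fsk])
      then have "((%x. of_real (?F x) * cis (of_int (snd (gr x)) * t)) has_sum of_real (?B kap) * cis (of_int kap * t)) {x. snd (gr x) = kap}"
        by (rule has_sum_cong[THEN iffD1, rotated]) simp
      then show ?thesis by (rule infsumI)
    qed
    ultimately show "((%kap. of_real (?B kap) * cis (of_int kap * t)) has_sum of_real ((cmod (?g t))^2 - 1)) UNIV" by simp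
  qed
  from wiener_add[OF wiener_cis[of 0] this]
  have "wiener (1 + (\<Sum>\<^sub>\<infinity>x. norm (?F x))) (%kap. (if kap = 0 then 1 else 0) + of_real (?B kap)) (%x. cis (of_int 0 * x) + of_real ((cmod (?g x))^2 - 1))" .
  moreover have "cis (of_int 0 * x) + of_real ((cmod (?g x))^2 - 1) = of_real (1 + flat_d (p eps) x z)" for x
    unfolding flat_d_eq[OF eps z] by simp
  ultimately have "wiener (1 + (\<Sum>\<^sub>\<infinity>x. norm (?F x))) (%kap. (if kap = 0 then 1 else 0) + of_real (?B kap)) (%x. of_real (1 + flat_d (p eps) x z))"
    by (simp only:)
  from wiener_fcoeff[OF this] show ?thesis unfolding B by simp
qed

end

section \<open>From the given families to the fiber operator\<close>

lemma fnorm_small: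
  assumes e1: "e1 > 0" and sig: "si > 0"
    and sum: "(%(l, k). cmod (a l k) * e1 ^ l * ew si k) summable_on UNIV"
    and rep: "!!eps x. eps \<in> cball 0 e1 ==> ((%(l, k). a l k * of_real (eps ^ l) * cis (of_int k * x)) has_sum of_real (f eps x)) UNIV"
    and zero: "!!x. f 0 x = 0" and m: "m > 0"
  shows "\<forall>\<^sub>F d in at_right 0. \<forall>eps. abs eps <= d --> fnorm si a eps <= m"
proof -
  let ?K = "\<Sum>\<^sub>\<infinity>k. (\<Sum>\<^sub>\<infinity>l. cmod (a l k) * e1 ^ l) * ew si k"
  have K: "?K >= 0" using e1 by (intro infsum_nonneg mult_nonneg_nonneg) auto
  have "\<forall>\<^sub>F d in at_right 0. d \<in> {0<..<min e1 (m * e1 / (?K + 1))}"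
    using e1 m K by (intro eventually_at_right_real) auto
  then show ?thesis
  proof eventually_elim
    case (elim d)
    have "fnorm si a eps <= m" if eps: "abs eps <= d" for eps
    proof -
      have "fnorm si a eps <= abs eps / e1 * ?K"
        unfolding fnorm_def by (rule fmode_small(2)[OF e1 less_imp_le[OF sig] sum rep zero]) (use elim eps in auto)
      also have "... <= (m * e1 / (?K + 1)) / e1 * (?K + 1)" using eps elim e1 K m by (intro mult_mono divide_right_mono) auto
      finally show ?thesis using e1 K by simp
    qed
    then show ?case by blast
  qed
qed

lemma analytic_familyE:
  assumes "analytic_family e1 f"
  obtains si a where "si > 0" "(%(l, k). cmod (a l k) * e1 ^ l * ew si k) summable_on UNIV"
    "!!eps x. eps \<in> cball 0 e1 ==> ((%(l, k). a l k * of_real (eps ^ l) * cis (of_int k * x)) has_sum of_real (f eps x)) UNIV"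
  using assms unfolding analytic_family_def by blast

lemma stokes_symbol:
  assumes e1: "e1 > 0" and S: "stokes_family e1 \<eta> \<psi> c" and P: "conformal_flattening e1 \<eta> p"
  obtains dc Dc E tau where "dcoef dc Dc E tau" "E <= e1"
    "!!eps. abs eps <= E ==> d_symbol (flat_d (p eps)) (%kap z. eps * (\<Sum>l. dc l kap z * eps ^ l))"
proof -
  have fam: "analytic_family e1 \<eta>" "analytic_family e1 \<psi>" "analytic_family e1 p"
    using S P by (auto simp: stokes_family_def conformal_flattening_def)
  obtain si1 aN where N: "si1 > 0" "(%(l, k). cmod (aN l k) * e1 ^ l * ew si1 k) summable_on UNIV"
      "!!eps x. eps \<in> cball 0 e1 ==> ((%(l, k). aN l k * of_real (eps ^ l) * cis (of_int k * x)) has_sum of_real (\<eta> eps x)) UNIV"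
    by (rule analytic_familyE[OF fam(1)]) (rule that)
  obtain sis aS where S': "sis > 0" "(%(l, k). cmod (aS l k) * e1 ^ l * ew sis k) summable_on UNIV"
      "!!eps x. eps \<in> cball 0 e1 ==> ((%(l, k). aS l k * of_real (eps ^ l) * cis (of_int k * x)) has_sum of_real (\<psi> eps x)) UNIV"
    by (rule analytic_familyE[OF fam(2)]) (rule that)
  obtain sip aP where P': "sip > 0" "(%(l, k). cmod (aP l k) * e1 ^ l * ew sip k) summable_on UNIV"
      "!!eps x. eps \<in> cball 0 e1 ==> ((%(l, k). aP l k * of_real (eps ^ l) * cis (of_int k * x)) has_sum of_real (p eps x)) UNIV"
    by (rule analytic_familyE[OF fam(3)]) (rule that)
  obtain C where C: "!!eps x. eps \<in> cball 0 e1 ==> \<bar>\<eta> eps x - (eps * cos x + eps^2 / 2 * cos (2 * x))\<bar> <= C * abs eps ^ 3"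
      "!!eps x. eps \<in> cball 0 e1 ==> \<bar>\<psi> eps x - (eps * sin x + eps^2 / 2 * sin (2 * x))\<bar> <= C * abs eps ^ 3"
      "!!eps. eps \<in> cball 0 e1 ==> \<bar>c eps - (1 + eps^2 / 2)\<bar> <= C * abs eps ^ 3"
    using S unfolding stokes_family_def by blast
  \<comment> \<open>The error terms vanish at eps = 0, so the expansions give the trivial wave
    there; this is what makes the norms small with eps.\<close>
  have z: "\<eta> 0 x = 0" "\<psi> 0 x = 0" "p 0 x = 0" for x
    using C(1,2)[of 0 x] e1 P by (auto simp: conformal_flattening_def)
  have c: "\<forall>\<^sub>F d in at_right 0. \<forall>eps. abs eps <= d --> \<bar>c eps - 1\<bar> <= 1/100"
  proof -
    have "((%d. d^2 / 2 + abs C * d ^ 3) \<longlongrightarrow> 0) (at_right (0::real))" by (auto intro!: tendsto_eq_intros)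
    then have "\<forall>\<^sub>F d in at_right 0. d^2 / 2 + abs C * d ^ 3 < 1/100" by (rule order_tendstoD) simp
    moreover have "\<forall>\<^sub>F d in at_right 0. d \<in> {0<..<e1}" using e1 by (rule eventually_at_right_real)
    ultimately show ?thesis
    proof eventually_elim
      case (elim d)
      have "\<bar>c eps - 1\<bar> <= 1/100" if eps: "abs eps <= d" for eps
      proof -
        have "abs eps^2 <= d^2" "abs C * abs eps ^ 3 <= abs C * d ^ 3" using power_mono[OF eps abs_ge_zero, of 2] mult_left_mono[OF power_mono[OF eps abs_ge_zero, of 3], of "abs C"] by auto
        moreover have "C * abs eps ^ 3 <= abs C * abs eps ^ 3" by (intro mult_right_mono) auto
        moreover have "\<bar>c eps - (1 + eps^2 / 2)\<bar> <= C * abs eps ^ 3" using C(3)[of eps] eps elim by simp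
        ultimately show ?thesis using elim(1) zero_le_power2[of eps] unfolding power2_abs by linarith
      qed
      then show ?case by blast
    qed
  qed
  \<comment> \<open>Stated with a filter, finitely many smallness conditions combine to one radius
    without explicit constants.\<close>
  have "\<forall>\<^sub>F d in at_right 0. d \<in> {0<..<e1} & (\<forall>eps. abs eps <= d --> \<bar>c eps - 1\<bar> <= 1/100) &
      (\<forall>eps. abs eps <= d --> fnorm si1 aN eps <= min (si1 * 1) (1/50)) & (\<forall>eps. abs eps <= d --> fnorm sis aS eps <= sis * (1/4)) &
      (\<forall>eps. abs eps <= d --> fnorm sip aP eps <= min si1 (sip / 8))"
    by (intro eventually_conj eventually_at_right_real[OF e1] c fnorm_small[OF e1 N z(1)] fnorm_small[OF e1 S' z(2)] fnorm_small[OF e1 P' z(3)])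
      (use N(1) S'(1) P'(1) in auto)
  from eventually_happens'[OF trivial_limit_at_right_real this] obtain E where E: "E \<in> {0<..<e1}"
    and sm: "\<forall>eps. abs eps <= E --> \<bar>c eps - 1\<bar> <= 1/100" "\<forall>eps. abs eps <= E --> fnorm si1 aN eps <= min (si1 * 1) (1/50)"
      "\<forall>eps. abs eps <= E --> fnorm sis aS eps <= sis * (1/4)" "\<forall>eps. abs eps <= E --> fnorm sip aP eps <= min si1 (sip / 8)"
    by blast
  interpret stokes e1 E si1 sis sip \<eta> \<psi> p c aN aS aP
  proof
    show "\<exists>G. is_DN (\<eta> eps) (\<psi> eps) G & (\<forall>x. c eps * deriv (\<eta> eps) x + G x = 0 &
        c eps * deriv (\<psi> eps) x - \<eta> eps x - (deriv (\<psi> eps) x)^2 / 2 + (G x + deriv (\<eta> eps) x * deriv (\<psi> eps) x)^2 / (2 * (1 + (deriv (\<eta> eps) x)^2)) = 0)"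
      if "eps \<in> cball 0 e1" for eps using S that unfolding stokes_family_def by blast
  qed (use E sm e1 N S' P' S P z in \<open>auto simp: stokes_family_def conformal_flattening_def\<close>)
  show thesis
    by (rule that[OF dcoef_dc]) (use E symbol_fcoeff in \<open>auto simp: d_symbol_def\<close>)
qed

theorem theorem2p16:
  fixes \<eta> \<psi> p :: "real \<Rightarrow> real \<Rightarrow> real" and c :: "real \<Rightarrow> real" and e1 :: real
  assumes "e1 > 0" and "stokes_family e1 \<eta> \<psi> c" and "conformal_flattening e1 \<eta> p"
  shows "\<forall>s::real. \<exists>\<epsilon>0>0. \<epsilon>0 \<le> e1 \<and>
    (\<exists>Gs :: real \<Rightarrow> real \<Rightarrow> real \<Rightarrow> pdist \<Rightarrow> pdist.
      (\<forall>\<alpha> \<mu>. \<forall>\<epsilon>\<in>cball 0 \<epsilon>0.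
         bounded_op s (s - 1) (fiber_DN p \<alpha> \<mu> \<epsilon>) \<and>
         (\<forall>u\<in>Hspace s. \<forall>k. fiber_DN p \<alpha> \<mu> \<epsilon> u k = absD \<alpha> \<mu> u k + Gs \<alpha> \<mu> \<epsilon> u k) \<and>
         bounded_op s (s - 1) (absD \<alpha> \<mu>) \<and>
         bounded_op s (s + 1) (Gs \<alpha> \<mu> \<epsilon>)) \<and>
      (\<forall>\<mu>0>0. \<exists>C. \<forall>\<alpha> \<mu>. \<forall>\<epsilon>\<in>cball 0 \<epsilon>0. \<bar>\<mu>\<bar> \<le> \<mu>0 \<longrightarrow>
         opnorm s (s + 1) (Gs \<alpha> \<mu> \<epsilon>) \<le> C * \<alpha>\<^sup>2 * \<bar>\<epsilon>\<bar> \<and>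
         opnorm s s (Gs \<alpha> \<mu> \<epsilon>) \<le> C * \<bar>\<alpha>\<bar> * \<bar>\<epsilon>\<bar>) \<and>
      (\<exists>R. classA s (s + 1) UNIV \<epsilon>0 R \<and>
         (\<forall>\<alpha> \<mu>. \<forall>\<epsilon>\<in>cball 0 \<epsilon>0. \<forall>u\<in>Hspace s. \<forall>k.
            Gs \<alpha> \<mu> \<epsilon> u k = of_real (\<alpha>\<^sup>2 * \<epsilon>) * R \<alpha> \<mu> \<epsilon> u k)) \<and>
      classA s (s - 1) UNIV \<epsilon>0 (fiber_DN p) \<and>
      (\<forall>\<alpha> \<mu>. classF s (s + 1) \<epsilon>0 (Gs \<alpha> \<mu>) \<and> classF s (s - 1) \<epsilon>0 (fiber_DN p \<alpha> \<mu>)))"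
proof
  fix s :: real
  obtain dc Dc E tau where D: "dcoef dc Dc E tau" and Ee1: "E <= e1"
    and sy: "!!eps. abs eps <= E ==> d_symbol (flat_d (p eps)) (%kap z. eps * (\<Sum>l. dc l kap z * eps ^ l))"
    by (rule stokes_symbol[OF assms]) (rule that)
  interpret dcoef dc Dc E tau by (rule D)
  let ?G = "%al mu eps. matop (Fmat False al mu eps)" and ?B = "cball 0 e0 :: real set"
  have eb: "abs eps <= 2 * e0" "abs eps <= E" if "eps \<in> ?B" for eps using that e0 by auto
  have DN: "fiber_DN p al mu eps u = matop (Gmat True al mu eps) u" if "eps \<in> ?B" "u \<in> Hspace t" for al mu eps u t
    by (rule fiber_DN_eq[OF _ eb(1)[OF that(1)] that(2)]) (use sy[OF eb(2)[OF that(1)]] in \<open>simp add: dt_def\<close>)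
  have GF: "Gmat True = Fmat True" by (intro ext) (simp add: Gmat_def Fmat_def asm_def)
  have RF: "Gmat False = Rmat" by (intro ext) (simp add: Gmat_def asm_def)
  have dec1: "mat_decay tau (-1) (al^2 * abs eps * (2 * NN * (2 + 2 * mu0))) (Fmat False al mu eps)"
    if "eps \<in> ?B" "abs mu <= mu0" for al mu mu0 eps
    using mult_left_mono[OF Rmat_bound[OF eb(1)[OF that(1)] that(2), of al], of "al^2 * abs eps"] NN_nonneg that(2)
    by (simp add: mat_decay_def Fmat_def abs_mult mult.assoc)
  \<comment> \<open>Since the frequency is at least |\<alpha>|, dividing the square of \<alpha> by
    it leaves |\<alpha>|: the smoothing is traded for one power of \<alpha>, uniformly in
    \<mu>.\<close>
  have dec0: "mat_decay tau 0 (abs al * abs eps * (2 * NN)) (Fmat False al mu eps)" if "eps \<in> ?B" for al mu eps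
  proof -
    have "al^2 * abs eps * \<bar>Rmat al mu eps k m\<bar> <= abs al * abs eps * (2 * NN) * ew (-tau) (k - m)" for k m
    proof -
      let ?f = "freq (al^2) mu k + 3/4"
      have f: "?f > 0" "abs al <= ?f" using freq_ge(2)[of al mu k] freq_nonneg[of al mu k] by auto
      have "al^2 / ?f <= abs al" using f mult_left_mono[OF f(2), of "abs al"] by (simp add: divide_le_eq power2_eq_square)
      from mult_left_mono[OF this, of "abs eps * (2 * NN) * ew (-tau) (k - m)"]
        mult_left_mono[OF RR_bound[OF admissible_real[OF eb(1)[OF that], of al mu], of k m], of "al^2 * abs eps"] NN_nonneg
      show ?thesis by (simp add: Rmat_def mult_ac)
    qed
    then show ?thesis using NN_nonneg jap_pos by (simp add: mat_decay_def Fmat_def abs_mult less_imp_neq[symmetric])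
  qed
  have bG: "bounded_op s (s + 1) (?G al mu eps)" if "eps \<in> ?B" for al mu eps
    using bounded_op_matop[OF tau dec1[OF that order_refl]] by simp
  have diag: "matop (%k m. if k = m then freq (al^2) mu k else 0) u = absD al mu u"
    and diag_sum: "(%m. of_real (if k = m then freq (al^2) mu k else 0) * u m) summable_on UNIV" for al mu u k
  proof -
    have "((%m. of_real (if k = m then freq (al^2) mu k else 0) * u m) has_sum absD al mu u k) UNIV" for k
      by (rule has_sum_finite_neutralI[of "{k}"]) (auto simp: absD_def freq_def)
    then show "matop (%k m. if k = m then freq (al^2) mu k else 0) u = absD al mu u"
      and "(%m. of_real (if k = m then freq (al^2) mu k else 0) * u m) summable_on UNIV"
      by (auto simp: matop_def infsumI intro: has_sum_imp_summable)
  qed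
  have bD: "bounded_op s (s - 1) (absD al mu)" for al mu
  proof (rule bounded_op_cong[OF diag[symmetric] bounded_op_matop[OF tau]])
    show "mat_decay tau 1 (1 + abs mu + abs al) (%k m. if k = m then freq (al^2) mu k else 0)"
      using freq_le_jap[of al mu] freq_nonneg[of al mu] by (simp add: mat_decay_def)
  qed
  have split: "matop (Gmat True al mu eps) u k = absD al mu u k + ?G al mu eps u k" if "eps \<in> ?B" "u \<in> Hspace s" for al mu eps u k
    unfolding diag[symmetric] GF matop_def
    by (subst infsum_add[symmetric, OF diag_sum matop_estimate(1)[OF tau dec0[OF that(1)] that(2)]])
      (auto intro!: infsum_cong simp: Fmat_def distrib_right)
  note A = classA_Gmat[of s "fiber_DN p" True, OF DN] classA_Gmat[of s "%al mu eps. matop (Gmat False al mu eps)" False]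
  note F = classF_Fmat[of s "fiber_DN p al mu" True al mu for al mu] classF_Fmat[of s "?G al mu" False al mu for al mu]
  show "\<exists>eps0>0. eps0 <= e1 &
    (\<exists>Gs :: real => real => real => pdist => pdist.
      (\<forall>al mu. \<forall>eps\<in>cball 0 eps0.
         bounded_op s (s - 1) (fiber_DN p al mu eps) &
         (\<forall>u\<in>Hspace s. \<forall>k. fiber_DN p al mu eps u k = absD al mu u k + Gs al mu eps u k) &
         bounded_op s (s - 1) (absD al mu) &
         bounded_op s (s + 1) (Gs al mu eps)) &
      (\<forall>mu0>0. \<exists>C. \<forall>al mu. \<forall>eps\<in>cball 0 eps0. abs mu <= mu0 -->
         opnorm s (s + 1) (Gs al mu eps) <= C * al^2 * abs eps &
         opnorm s s (Gs al mu eps) <= C * abs al * abs eps) &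
      (\<exists>R. classA s (s + 1) UNIV eps0 R &
         (\<forall>al mu. \<forall>eps\<in>cball 0 eps0. \<forall>u\<in>Hspace s. \<forall>k.
            Gs al mu eps u k = of_real (al^2 * eps) * R al mu eps u k)) &
      classA s (s - 1) UNIV eps0 (fiber_DN p) &
      (\<forall>al mu. classF s (s + 1) eps0 (Gs al mu) & classF s (s - 1) eps0 (fiber_DN p al mu)))"
  \<comment> \<open>The radius comes from the wave alone; the exponent s enters the estimates
    through \<open>sobconst\<close>.\<close>
  proof (rule exI[of _ e0], rule conjI[OF e0(1)], rule conjI[OF order_trans[OF _ Ee1]], goal_cases)
    case 1
    show ?case using e0 by simp
  next
    case 2
    show ?case
    proof (rule exI[of _ ?G], intro conjI allI ballI impI)
    fix al mu
    show "classF s (s + 1) e0 (?G al mu)" using F(2)[of al mu] by (simp add: ordr_def)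
    show "classF s (s - 1) e0 (fiber_DN p al mu)" using F(1)[of al mu] DN by (simp add: ordr_def GF)
    fix eps assume eps: "eps \<in> ?B"
    show "bounded_op s (s - 1) (fiber_DN p al mu eps)" using A(1) eps unfolding classA_def by (simp add: ordr_def)
    show "fiber_DN p al mu eps u k = absD al mu u k + ?G al mu eps u k" if "u \<in> Hspace s" for u k
      unfolding DN[OF eps that] by (rule split[OF eps that])
    show "bounded_op s (s - 1) (absD al mu)" "bounded_op s (s + 1) (?G al mu eps)" by (rule bD bG[OF eps])+
  next
    fix mu0 :: real assume m0: "mu0 > 0"
    let ?C = "sobconst tau s * (2 * NN * (2 + 2 * mu0))"
    show "\<exists>C. \<forall>al mu. \<forall>eps\<in>?B. abs mu <= mu0 -->
         opnorm s (s + 1) (?G al mu eps) <= C * al^2 * abs eps & opnorm s s (?G al mu eps) <= C * abs al * abs eps"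
    proof (intro exI[of _ ?C] allI ballI impI conjI)
      fix al mu eps :: real assume eps: "eps \<in> ?B" and mu: "abs mu <= mu0"
      show "opnorm s (s + 1) (?G al mu eps) <= ?C * al^2 * abs eps"
        by (rule opnorm_leI) (use matop_estimate(3)[OF tau dec1[OF eps mu, of al], of _ s] NN_nonneg sobconst_nonneg m0 in \<open>auto simp: mult_ac\<close>)
      have "opnorm s s (?G al mu eps) <= sobconst tau s * (abs al * abs eps * (2 * NN))"
        by (rule opnorm_leI) (use matop_estimate(3)[OF tau dec0[OF eps, of al mu], of _ s] NN_nonneg sobconst_nonneg in auto)
      also have "... <= ?C * abs al * abs eps"
        using mult_left_mono[of 1 "2 + 2 * mu0" "sobconst tau s * (abs al * abs eps * (2 * NN))"] m0 NN_nonneg sobconst_nonneg by (simp add: mult_ac)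
      finally show "opnorm s s (?G al mu eps) <= ?C * abs al * abs eps" .
    qed
  next
    show "classA s (s - 1) UNIV e0 (fiber_DN p)" using A(1) by (simp add: ordr_def)
    have "?G al mu eps u k = of_real (al^2 * eps) * matop (Gmat False al mu eps) u k" for al mu eps u k
      unfolding RF matop_def infsum_cmult_right'[symmetric] by (simp add: Fmat_def mult.assoc)
    then show "\<exists>R. classA s (s + 1) UNIV e0 R & (\<forall>al mu. \<forall>eps\<in>?B. \<forall>u\<in>Hspace s. \<forall>k. ?G al mu eps u k = of_real (al^2 * eps) * R al mu eps u k)"
      using A(2) by (intro exI[of _ "%al mu eps. matop (Gmat False al mu eps)"]) (simp add: ordr_def)
  qed
  qed
qed

end
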